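(* Let $H$ and $L$ be finite dimensional Hopf algebras over a field $\Bbbk$. Suppose $(H,L)$ is a quasi-abelian partial matched pair, with partial action $\rightharpoonup$ and partial coaction $\rho(h)=h^0\otimes h^1$, such that $$(h^0\rightharpoonup 1_L)\otimes S_L(h^1)=\varepsilon_H({1_H}^0)\,\varepsilon_L(h\rightharpoonup 1_L)\,1_L\otimes {1_H}^1$$ and $$\varepsilon_H(h^0)\,(S_H(g)\rightharpoonup h^1)=\varepsilon_L(g\rightharpoonup 1_L)\,\varepsilon_H(h)\,\varepsilon_H({1_H}^0)\,{1_H}^1$$ for all $h,g\in H$. Then $$(L\underline{\overline{\#}}H)^{\ast}\simeq H^{\ast}\underline{\overline{\#}}L^{\ast}$$ as Hopf algebras.
   Context: All vector spaces are over a fixed field $\Bbbk$; $\otimes=\otimes_{\Bbbk}$. Sweedler notation $\Delta(h)=h_1\otimes h_2$ (summation omitted) is used; $S_H,\varepsilon_H$ denote antipode and counit of $H$, and similarly for $L$. Left partial $H$-module algebra: a unital algebra $A$ with a linear map $\rightharpoonup:H\otimes A\to A$ such that $1_H\rightharpoonup a=a$; $h\rightharpoonup ab=(h_1\rightharpoonup a)(h_2\rightharpoonup b)$; $h\rightharpoonup(g\rightharpoonup a)=(h_1\rightharpoonup 1_A)(h_2g\rightharpoonup a)$, for all $h,g\in H$, $a,b\in A$. Right partial $L$-comodule coalgebra: a counital coalgebra $C$ with a linear map $\rho:C\to C\otimes L$, $\rho(c)=c^0\otimes c^1$ (summation omitted), such that $(id_C\otimes\varepsilon_L)\rho(c)=c$;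 $(\Delta_C\otimes id_L)\rho(c)={c_1}^0\otimes{c_2}^0\otimes{c_1}^1{c_2}^1$; $(\rho\otimes id_L)\rho(c)={c_1}^0\otimes({c_1}^1)_1\otimes({c_1}^1)_2\,\varepsilon_C({c_2}^0){c_2}^1$. Here ${c_i}^0\otimes{c_i}^1=\rho(c_i)$. Partial matched pair $(H,L)$: a pair of Hopf algebras such that (i) $L$ is a left partial $H$-module algebra via $\rightharpoonup$; (ii) $H$ is a right partial $L$-comodule coalgebra via $\rho(h)=h^0\otimes h^1$; (iii) for all $h,g\in H$, $x\in L$, in $H\otimes L\otimes L$, $(h_2g)^0\otimes(h_1\rightharpoonup x)_1\otimes(h_1\rightharpoonup x)_2(h_2g)^1={h_3}^0g^0\otimes({h_1}^0\rightharpoonup x_1)\otimes{h_1}^1(h_2\rightharpoonup x_2){h_3}^1(h_4\rightharpoonup g^1)$; (iv) $\varepsilon_L(h\rightharpoonup x)=\varepsilon_L(h\rightharpoonup 1_L)\varepsilon_L(x)$; (v) $\rho(1_H)=1_H\otimes\varepsilon_H({1_H}^0){1_H}^1$. It is quasi-abelian if ${h_2}^0\otimes(h_1\rightharpoonup x){h_2}^1={h_1}^0\otimes{h_1}^1(h_2\rightharpoonup x)$ for all $h\in H$, $x\in L$. The Hopf algebra $L\underline{\overline{\#}}H$ (for a quasi-abelian partial matched pair $(H,L)$ such that $(h^0\rightharpoonup 1_L)\otimes S_L(h^1)=\varepsilon_H({1_H}^0)\,\varepsilon_L(h\rightharpoonup 1_L)\,1_L\otimes {1_H}^1$ and $\varepsilon_H(h^0)\,(S_H(g)\rightharpoonup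 h^1)=\varepsilon_L(g\rightharpoonup 1_L)\,\varepsilon_H(h)\,\varepsilon_H({1_H}^0)\,{1_H}^1$ for all $h,g\in H$): let $L\#H=L\otimes H$ with product $(x\#h)(y\#g)=x(h_1\rightharpoonup y)\#h_2g$. Then $L\underline{\overline{\#}}H$ is the subspace of $L\#H$ spanned by $x\underline{\overline{\#}}h:=\varepsilon_H({h_1}^0)\,x{h_1}^1(h_2\rightharpoonup 1_L)\#h_3$, $x\in L$, $h\in H$, with multiplication $(x\underline{\overline{\#}}h)(y\underline{\overline{\#}}g)=x(h_1\rightharpoonup y)\underline{\overline{\#}}h_2g$, unit $1_L\underline{\overline{\#}}1_H$, comultiplication $\Delta(x\underline{\overline{\#}}h)=x_1\underline{\overline{\#}}{h_1}^0\otimes x_2{h_1}^1\underline{\overline{\#}}h_2$, counit $\varepsilon(x\underline{\overline{\#}}h)=\varepsilon_L(x)\varepsilon_L(h\rightharpoonup 1_L)$ and antipode $S(x\underline{\overline{\#}}h)=(1_L\underline{\overline{\#}}S_H(h^0))(S_L(h^1)S_L(x)\underline{\overline{\#}}1_H)$. The Hopf algebra $H^*\underline{\overline{\#}}L^*$: here $H^*,L^*$ are the dual Hopf algebras. $L^*$ acts on $H^*$ on the right by $(\varphi\leftharpoonup f)(h)=\varphi(h^0)f(h^1)$, and $H^*$ coacts on $L^*$ on the left by $\rho(f)=f^{-1}\otimes f^0=\sum_{i=1}^n h_i^*\otimes(f\leftharpoondown h_i)$, where $(f\leftharpoondown h)(x)=f(h\rightharpoonup x)$ and $\{h_i\}$,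 $\{h_i^*\}$ are dual bases of $H$ and $H^*$; equivalently $f^{-1}(h)f^0(x)=f(h\rightharpoonup x)$. $H^*\underline{\overline{\#}}L^*$ is the subspace of $H^*\otimes L^*$ spanned by $\varphi\underline{\overline{\#}}f:=\varepsilon_{L^*}({f_3}^0)\,(1_{H^*}\leftharpoonup f_2){f_3}^{-1}\varphi\otimes f_1$, $\varphi\in H^*$, $f\in L^*$, with multiplication $(\varphi\underline{\overline{\#}}f)(\phi\underline{\overline{\#}}g)=(\varphi\leftharpoonup g_2)\phi\underline{\overline{\#}}fg_1$, unit $1_{H^*}\underline{\overline{\#}}1_{L^*}=\varepsilon_H\underline{\overline{\#}}\varepsilon_L$, comultiplication $\Delta(\varphi\underline{\overline{\#}}f)={f_2}^{-1}\varphi_1\underline{\overline{\#}}f_1\otimes\varphi_2\underline{\overline{\#}}{f_2}^0$ and counit $\varepsilon(\varphi\underline{\overline{\#}}f)=\varepsilon_{H^*}(\varphi)\,\varepsilon_{H^*}(1_{H^*}\leftharpoonup f)$; when $H$ and $L$ are finite dimensional Hopf algebras and $(H,L)$ is a quasi-abelian partial matched pair such that $(h^0\rightharpoonup 1_L)\otimes S_L(h^1)=\varepsilon_H({1_H}^0)\,\varepsilon_L(h\rightharpoonup 1_L)\,1_L\otimes {1_H}^1$ and $\varepsilon_H(h^0)\,(S_H(g)\rightharpoonup h^1)=\varepsilon_L(g\rightharpoonup 1_L)\,\varepsilon_H(h)\,\varepsilon_H({1_H}^0)\,{1_H}^1$ for all $h,g\in H$, it is a Hopf algebra. Here $\varepsilon_{H^*}(\varphi)=\varphi(1_H)$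 and $\varepsilon_{L^*}(f)=f(1_L)$. *)

theory Defs
  imports Complex_Main "HOL-Library.Function_Algebras"
begin

section \<open>Vector spaces, linear maps, tensor products\<close>

text \<open>
  A vector space over the field \<open>'k\<close> is a subspace (the carrier) of an ambient
  vector space living on a type of class \<^class>\<open>ab_group_add\<close>.  Carriers are needed
  because duals and spans occur as vector spaces in their own right.
\<close>

record ('k, 'v) space =
  carrier :: "'v set"
  scale :: "'k \<Rightarrow> 'v \<Rightarrow> 'v"

definition is_space :: "('k::field, 'v::ab_group_add, 'z) space_scheme \<Rightarrow> bool" where
  "is_space V \<longleftrightarrow> vector_space (scale V) \<and> module.subspace (scale V) (carrier V)"

definition finite_dimensional :: "('k::field, 'v::ab_group_add, 'z) space_scheme \<Rightarrow> bool" where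
  "finite_dimensional V \<longleftrightarrow> (\<exists>B. finite B \<and> B \<subseteq> carrier V \<and> carrier V = module.span (scale V) B)"

definition linear_map ::
  "('k::field, 'v::ab_group_add, 'y) space_scheme \<Rightarrow> ('k, 'w::ab_group_add, 'z) space_scheme
    \<Rightarrow> ('v \<Rightarrow> 'w) \<Rightarrow> bool" where
  "linear_map V W f \<longleftrightarrow>
     (\<forall>x\<in>carrier V. f x \<in> carrier W) \<and>
     (\<forall>x\<in>carrier V. \<forall>y\<in>carrier V. f (x + y) = f x + f y) \<and>
     (\<forall>c. \<forall>x\<in>carrier V. f (scale V c x) = scale W c (f x))"

definition bilinear_map ::
  "('k::field, 'v::ab_group_add, 'x) space_scheme \<Rightarrow> ('k, 'w::ab_group_add, 'y) space_scheme
    \<Rightarrow> ('k, 'u::ab_group_add, 'z) space_scheme \<Rightarrow> ('v \<Rightarrow> 'w \<Rightarrow> 'u) \<Rightarrow> bool" where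
  "bilinear_map V W U \<beta> \<longleftrightarrow>
     (\<forall>v\<in>carrier V. linear_map W U (\<beta> v)) \<and>
     (\<forall>w\<in>carrier W. linear_map V U (\<lambda>v. \<beta> v w))"

definition ground_space :: "('k::field, 'k) space" where
  "ground_space = \<lparr>carrier = UNIV, scale = (*)\<rparr>"

definition fscale :: "'k::field \<Rightarrow> ('i \<Rightarrow> 'k) \<Rightarrow> 'i \<Rightarrow> 'k" where
  "fscale c f = (\<lambda>i. c * f i)"

text \<open>
  The tensor product \<open>V \<Otimes> W\<close> is realised inside the functions on bilinear forms:
  \<open>v \<otimes> w\<close> is evaluation at \<open>(v, w)\<close>, and \<open>V \<Otimes> W\<close> is the span of these.  Over a field
  this has the universal property of the tensor product, see \<open>tensor_lift_tensor\<close>,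
  \<open>tensor_lift_linear\<close> and \<open>tensor_lift_unique\<close> below.
\<close>

type_synonym ('k, 'v, 'w) tensor = "('v \<Rightarrow> 'w \<Rightarrow> 'k) \<Rightarrow> 'k"

definition tensor ::
  "('k::field, 'v::ab_group_add, 'y) space_scheme \<Rightarrow> ('k, 'w::ab_group_add, 'z) space_scheme
    \<Rightarrow> 'v \<Rightarrow> 'w \<Rightarrow> ('k, 'v, 'w) tensor" where
  "tensor V W v w = (\<lambda>\<beta>. if bilinear_map V W ground_space \<beta> then \<beta> v w else 0)"

abbreviation tensor_syntax  (\<open>(_ \<otimes>\<^bsub>_,_\<^esub> _)\<close> [71, 0, 0, 71] 70) where
  "v \<otimes>\<^bsub>V,W\<^esub> w \<equiv> tensor V W v w"

definition tensor_space ::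
  "('k::field, 'v::ab_group_add, 'y) space_scheme \<Rightarrow> ('k, 'w::ab_group_add, 'z) space_scheme
    \<Rightarrow> ('k, ('k, 'v, 'w) tensor) space" (infixl \<open>\<Otimes>\<close> 70) where
  "V \<Otimes> W = \<lparr>carrier = module.span fscale {v \<otimes>\<^bsub>V,W\<^esub> w | v w. v \<in> carrier V \<and> w \<in> carrier W},
             scale = fscale\<rparr>"

text \<open>
  Prescribing a map on generators: if every element \<open>t\<close> under consideration is a finite sum of
  generators \<open>p a b\<close> with \<open>p\<close> bilinear, then \<open>lin_extend X Y p \<beta>\<close> is the linear map sending
  \<open>p a b\<close> to \<open>\<beta> a b\<close>.  No scalars are needed in the sum, as they can be moved into \<open>a\<close>.
  The choice of the sum is immaterial precisely when such a linear map exists.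
\<close>

definition lin_extend ::
  "'a set \<Rightarrow> 'b set \<Rightarrow> ('a \<Rightarrow> 'b \<Rightarrow> 'c::comm_monoid_add)
    \<Rightarrow> ('a \<Rightarrow> 'b \<Rightarrow> 'd::comm_monoid_add) \<Rightarrow> 'c \<Rightarrow> 'd" where
  "lin_extend X Y p \<beta> t =
     (let ps = (SOME ps. set ps \<subseteq> X \<times> Y \<and> t = (\<Sum>(a, b)\<leftarrow>ps. p a b))
      in \<Sum>(a, b)\<leftarrow>ps. \<beta> a b)"

text \<open>
  For \<open>t = \<Sum> v\<^sub>i \<otimes> w\<^sub>i\<close> the value \<open>tensor_lift V W t (\<lambda>v w. \<beta> v w)\<close> is \<open>\<Sum> \<beta> v\<^sub>i w\<^sub>i\<close>.
  All uses of Sweedler notation are expressed through this.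
\<close>

definition tensor_lift ::
  "('k::field, 'v::ab_group_add, 'y) space_scheme \<Rightarrow> ('k, 'w::ab_group_add, 'z) space_scheme
    \<Rightarrow> ('k, 'v, 'w) tensor \<Rightarrow> ('v \<Rightarrow> 'w \<Rightarrow> 'u::ab_group_add) \<Rightarrow> 'u" where
  "tensor_lift V W t \<beta> = lin_extend (carrier V) (carrier W) (tensor V W) \<beta> t"

lemma vector_space_fscale: "vector_space (fscale :: 'k::field \<Rightarrow> ('i \<Rightarrow> 'k) \<Rightarrow> 'i \<Rightarrow> 'k)"
  by unfold_locales (auto simp: fscale_def fun_eq_iff algebra_simps)

lemma bilinear_map_sum_list:
  assumes "bilinear_map V W ground_space \<beta>" "set ps \<subseteq> carrier V \<times> carrier W"
  shows "(\<Sum>(v, w)\<leftarrow>ps. v \<otimes>\<^bsub>V,W\<^esub> w) \<beta> = (\<Sum>(v, w)\<leftarrow>ps. \<beta> v w)"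
  using assms(2) by (induction ps) (use assms(1) in \<open>auto simp: tensor_def\<close>)

lemma tensor_space_list:
  assumes V: "is_space V" and t: "t \<in> carrier (V \<Otimes> W)"
  shows "\<exists>ps. set ps \<subseteq> carrier V \<times> carrier W \<and> t = (\<Sum>(v, w)\<leftarrow>ps. v \<otimes>\<^bsub>V,W\<^esub> w)"
proof -
  interpret V: vector_space "scale V" using V by (simp add: is_space_def)
  have sub: "V.subspace (carrier V)" using V by (simp add: is_space_def)
  let ?S = "{v \<otimes>\<^bsub>V,W\<^esub> w | v w. v \<in> carrier V \<and> w \<in> carrier W}"
  have "t \<in> module.span fscale ?S" using t by (simp add: tensor_space_def)
  then show ?thesis
  proof (induction rule: module.span_induct_alt[OF
        vector_space_fscale[folded module_iff_vector_space], consumes 1, case_names 0 add])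
    case 0
    show ?case by (intro exI[of _ "[]"]) auto
  next
    case (add c x y)
    then obtain v w ps where vw: "x = v \<otimes>\<^bsub>V,W\<^esub> w" "v \<in> carrier V" "w \<in> carrier W"
      and ps: "set ps \<subseteq> carrier V \<times> carrier W" "y = (\<Sum>(v, w)\<leftarrow>ps. v \<otimes>\<^bsub>V,W\<^esub> w)"
      by blast
    have "fscale c x = scale V c v \<otimes>\<^bsub>V,W\<^esub> w"
      using vw by (auto simp: fscale_def tensor_def bilinear_map_def linear_map_def
          ground_space_def fun_eq_iff)
    moreover have "scale V c v \<in> carrier V" using sub vw by (simp add: V.subspace_scale)
    ultimately show ?case using vw ps by (intro exI[of _ "(scale V c v, w) # ps"]) auto
  qed
qed

lemma tensor_lift_sum_list:
  assumes U: "is_space U" and \<beta>: "bilinear_map V W U \<beta>"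
    and ps: "set ps \<subseteq> carrier V \<times> carrier W"
  shows "tensor_lift V W (\<Sum>(v, w)\<leftarrow>ps. v \<otimes>\<^bsub>V,W\<^esub> w) \<beta> = (\<Sum>(v, w)\<leftarrow>ps. \<beta> v w)"
proof -
  interpret U: vector_space "scale U" using U by (simp add: is_space_def)
  interpret K: vector_space "(*) :: 'a \<Rightarrow> 'a \<Rightarrow> 'a" by unfold_locales (auto simp: algebra_simps)
  interpret UK: vector_space_pair "scale U" "(*) :: 'a \<Rightarrow> 'a \<Rightarrow> 'a" ..
  let ?t = "\<Sum>(v, w)\<leftarrow>ps. v \<otimes>\<^bsub>V,W\<^esub> w"
  define qs where "qs = (SOME qs. set qs \<subseteq> carrier V \<times> carrier W \<and> ?t = (\<Sum>(v, w)\<leftarrow>qs. v \<otimes>\<^bsub>V,W\<^esub> w))"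
  have qs: "set qs \<subseteq> carrier V \<times> carrier W" "?t = (\<Sum>(v, w)\<leftarrow>qs. v \<otimes>\<^bsub>V,W\<^esub> w)"
    using someI_ex[of "\<lambda>qs. set qs \<subseteq> carrier V \<times> carrier W \<and> ?t = (\<Sum>(v, w)\<leftarrow>qs. v \<otimes>\<^bsub>V,W\<^esub> w)"] ps
    unfolding qs_def by blast+
  let ?b = "\<lambda>rs. \<Sum>(v, w)\<leftarrow>rs. \<beta> v w"
  have "?b qs = ?b ps"
  proof (rule ccontr)
    assume ne: "?b qs \<noteq> ?b ps"
    define u where "u = ?b qs - ?b ps"
    have "u \<noteq> 0" using ne by (simp add: u_def)
    then have "U.independent {u}" by simp
    then obtain \<phi> where \<phi>: "Vector_Spaces.linear (scale U) (*) \<phi>" "\<phi> u = 1"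
      using UK.linear_independent_extend[of "{u}" "\<lambda>_. 1"] by auto
    interpret \<phi>: Vector_Spaces.linear "scale U" "(*)" \<phi> by fact
    have form: "bilinear_map V W ground_space (\<lambda>v w. \<phi> (\<beta> v w))"
      using \<beta> by (auto simp: bilinear_map_def linear_map_def ground_space_def \<phi>.add \<phi>.scale)
    have \<phi>_sum: "\<phi> (?b rs) = (\<Sum>(v, w)\<leftarrow>rs. \<phi> (\<beta> v w))" for rs
      by (induction rs) (auto simp: \<phi>.add \<phi>.zero)
    have "\<phi> (?b qs) = \<phi> (?b ps)"
      using bilinear_map_sum_list[OF form ps] bilinear_map_sum_list[OF form qs(1)] qs(2)
      by (simp add: \<phi>_sum)
    then show False using \<phi>(2) by (simp add: u_def \<phi>.diff)
  qed
  then show ?thesis by (simp add: tensor_lift_def lin_extend_def Let_def flip: qs_def)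
qed

lemma tensor_lift_tensor:
  assumes "is_space U" "bilinear_map V W U \<beta>" "v \<in> carrier V" "w \<in> carrier W"
  shows "tensor_lift V W (v \<otimes>\<^bsub>V,W\<^esub> w) \<beta> = \<beta> v w"
  using tensor_lift_sum_list[OF assms(1,2), of "[(v, w)]"] assms(3,4) by simp

lemma tensor_lift_linear:
  assumes V: "is_space V" and U: "is_space U" and \<beta>: "bilinear_map V W U \<beta>"
  shows "linear_map (V \<Otimes> W) U (\<lambda>t. tensor_lift V W t \<beta>)"
proof -
  interpret U: vector_space "scale U" using U by (simp add: is_space_def)
  interpret V: vector_space "scale V" using V by (simp add: is_space_def)
  have sub: "V.subspace (carrier V)" "U.subspace (carrier U)" using V U by (simp_all add: is_space_def)
  let ?T = "\<lambda>ps. \<Sum>(v, w)\<leftarrow>ps. v \<otimes>\<^bsub>V,W\<^esub> w"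
  have in_U: "(\<Sum>(v, w)\<leftarrow>ps. \<beta> v w) \<in> carrier U" if "set ps \<subseteq> carrier V \<times> carrier W" for ps
    using that by (induction ps)
      (use \<beta> sub(2) in \<open>auto simp: bilinear_map_def linear_map_def U.subspace_0 U.subspace_add\<close>)
  show ?thesis
    unfolding linear_map_def
  proof (intro conjI ballI allI)
    fix t assume "t \<in> carrier (V \<Otimes> W)"
    then obtain ps where ps: "set ps \<subseteq> carrier V \<times> carrier W" "t = ?T ps"
      using tensor_space_list[OF V] by blast
    show "tensor_lift V W t \<beta> \<in> carrier U"
      using in_U[OF ps(1)] tensor_lift_sum_list[OF U \<beta> ps(1)] ps(2) by simp
    fix c
    let ?qs = "map (\<lambda>(v, w). (scale V c v, w)) ps"
    have qs: "set ?qs \<subseteq> carrier V \<times> carrier W"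
      using ps(1) sub(1) by (auto simp: V.subspace_scale)
    have "fscale c (?T ps) = ?T ?qs"
      using ps(1) by (induction ps)
       (auto simp: fscale_def tensor_def bilinear_map_def linear_map_def ground_space_def
          fun_eq_iff algebra_simps)
    moreover have "scale U c (\<Sum>(v, w)\<leftarrow>ps. \<beta> v w) = (\<Sum>(v, w)\<leftarrow>?qs. \<beta> v w)"
      using ps(1) by (induction ps)
        (use \<beta> in \<open>auto simp: bilinear_map_def linear_map_def U.scale_right_distrib\<close>)
    ultimately show "tensor_lift V W (scale (V \<Otimes> W) c t) \<beta> = scale U c (tensor_lift V W t \<beta>)"
      using tensor_lift_sum_list[OF U \<beta> ps(1)] tensor_lift_sum_list[OF U \<beta> qs] ps(2)
      by (simp add: tensor_space_def)
  next
    fix s t assume "s \<in> carrier (V \<Otimes> W)" "t \<in> carrier (V \<Otimes> W)"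
    then obtain ps qs where ps: "set ps \<subseteq> carrier V \<times> carrier W" "s = ?T ps"
      and qs: "set qs \<subseteq> carrier V \<times> carrier W" "t = ?T qs"
      using tensor_space_list[OF V, of s W] tensor_space_list[OF V, of t W] by blast
    show "tensor_lift V W (s + t) \<beta> = tensor_lift V W s \<beta> + tensor_lift V W t \<beta>"
      using tensor_lift_sum_list[OF U \<beta>, of "ps @ qs"] tensor_lift_sum_list[OF U \<beta> ps(1)]
        tensor_lift_sum_list[OF U \<beta> qs(1)] ps qs by simp
  qed
qed

lemma tensor_lift_unique:
  assumes V: "is_space V" and U: "is_space U" and \<beta>: "bilinear_map V W U \<beta>"
    and g: "linear_map (V \<Otimes> W) U g"
    and g\<beta>: "\<And>v w. v \<in> carrier V \<Longrightarrow> w \<in> carrier W \<Longrightarrow> g (v \<otimes>\<^bsub>V,W\<^esub> w) = \<beta> v w"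
    and t: "t \<in> carrier (V \<Otimes> W)"
  shows "g t = tensor_lift V W t \<beta>"
proof -
  interpret U: vector_space "scale U" using U by (simp add: is_space_def)
  note m = vector_space_fscale[folded module_iff_vector_space]
  have sp: "module.subspace fscale (carrier (V \<Otimes> W))"
    unfolding tensor_space_def by (simp add: module.subspace_span[OF m])
  have gen: "v \<otimes>\<^bsub>V,W\<^esub> w \<in> carrier (V \<Otimes> W)" if "v \<in> carrier V" "w \<in> carrier W" for v w
    using that unfolding tensor_space_def by (auto intro!: module.span_base[OF m])
  have z: "0 \<in> carrier (V \<Otimes> W)" by (rule module.subspace_0[OF m sp])
  have g0: "g 0 = 0"
  proof -
    have "g (0 + 0) = g 0 + g 0" using g z unfolding linear_map_def by blast
    then show ?thesis by simp
  qed
  obtain ps where ps: "set ps \<subseteq> carrier V \<times> carrier W" "t = (\<Sum>(v, w)\<leftarrow>ps. v \<otimes>\<^bsub>V,W\<^esub> w)"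
    using tensor_space_list[OF V t] by blast
  have "(\<Sum>(v, w)\<leftarrow>ps. v \<otimes>\<^bsub>V,W\<^esub> w) \<in> carrier (V \<Otimes> W) \<and>
        g (\<Sum>(v, w)\<leftarrow>ps. v \<otimes>\<^bsub>V,W\<^esub> w) = (\<Sum>(v, w)\<leftarrow>ps. \<beta> v w)"
    using ps(1)
  proof (induction ps)
    case Nil
    show ?case using z g0 by (simp add: zero_fun_def)
  next
    case (Cons p ps)
    obtain v w where p: "p = (v, w)" "v \<in> carrier V" "w \<in> carrier W" using Cons.prems by auto
    let ?s = "\<Sum>(v, w)\<leftarrow>ps. v \<otimes>\<^bsub>V,W\<^esub> w"
    have s: "?s \<in> carrier (V \<Otimes> W)" "g ?s = (\<Sum>(v, w)\<leftarrow>ps. \<beta> v w)"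
      using Cons by auto
    have "v \<otimes>\<^bsub>V,W\<^esub> w + ?s \<in> carrier (V \<Otimes> W)"
      by (rule module.subspace_add[OF m sp gen[OF p(2,3)] s(1)])
    moreover have "g (v \<otimes>\<^bsub>V,W\<^esub> w + ?s) = g (v \<otimes>\<^bsub>V,W\<^esub> w) + g ?s"
      using g gen[OF p(2,3)] s(1) unfolding linear_map_def by blast
    ultimately show ?case
      unfolding p(1) list.map sum_list.Cons prod.case g\<beta>[OF p(2,3)] s(2) by (rule conjI)
  qed
  then show ?thesis using tensor_lift_sum_list[OF U \<beta> ps(1)] ps(2) by simp
qed


section \<open>Hopf algebras\<close>

record ('k, 'a) bialg = "('k, 'a) space" +
  mult :: "'a \<Rightarrow> 'a \<Rightarrow> 'a" (infixl \<open>\<cdot>\<index>\<close> 73)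
  one_el :: "'a" (\<open>\<one>\<index>\<close>)
  comult :: "'a \<Rightarrow> ('k, 'a, 'a) tensor"
  counit :: "'a \<Rightarrow> 'k"

record ('k, 'a) hopf = "('k, 'a) bialg" +
  antipode :: "'a \<Rightarrow> 'a"

text \<open>
  Sweedler notation: \<open>sw A a (\<lambda>a1 a2. \<dots>)\<close> for \<open>\<Delta>(a) = a\<^sub>1 \<otimes> a\<^sub>2\<close>, with iterated versions.
\<close>

definition sw ::
  "('k::field, 'a::ab_group_add, 'z) bialg_scheme \<Rightarrow> 'a \<Rightarrow> ('a \<Rightarrow> 'a \<Rightarrow> 'u::ab_group_add) \<Rightarrow> 'u" where
  "sw A a \<beta> = tensor_lift A A (comult A a) \<beta>"

definition sw3 ::
  "('k::field, 'a::ab_group_add, 'z) bialg_scheme \<Rightarrow> 'a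
    \<Rightarrow> ('a \<Rightarrow> 'a \<Rightarrow> 'a \<Rightarrow> 'u::ab_group_add) \<Rightarrow> 'u" where
  "sw3 A a \<beta> = sw A a (\<lambda>b a3. sw A b (\<lambda>a1 a2. \<beta> a1 a2 a3))"

definition sw4 ::
  "('k::field, 'a::ab_group_add, 'z) bialg_scheme \<Rightarrow> 'a
    \<Rightarrow> ('a \<Rightarrow> 'a \<Rightarrow> 'a \<Rightarrow> 'a \<Rightarrow> 'u::ab_group_add) \<Rightarrow> 'u" where
  "sw4 A a \<beta> = sw A a (\<lambda>b a4. sw3 A b (\<lambda>a1 a2 a3. \<beta> a1 a2 a3 a4))"

definition is_algebra :: "('k::field, 'a::ab_group_add, 'z) bialg_scheme \<Rightarrow> bool" where
  "is_algebra A \<longleftrightarrow>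
     is_space A \<and> bilinear_map A A A (mult A) \<and> \<one>\<^bsub>A\<^esub> \<in> carrier A \<and>
     (\<forall>a\<in>carrier A. \<forall>b\<in>carrier A. \<forall>c\<in>carrier A. (a \<cdot>\<^bsub>A\<^esub> b) \<cdot>\<^bsub>A\<^esub> c = a \<cdot>\<^bsub>A\<^esub> (b \<cdot>\<^bsub>A\<^esub> c)) \<and>
     (\<forall>a\<in>carrier A. \<one>\<^bsub>A\<^esub> \<cdot>\<^bsub>A\<^esub> a = a \<and> a \<cdot>\<^bsub>A\<^esub> \<one>\<^bsub>A\<^esub> = a)"

definition is_coalgebra :: "('k::field, 'c::ab_group_add, 'z) bialg_scheme \<Rightarrow> bool" where
  "is_coalgebra C \<longleftrightarrow>
     is_space C \<and> linear_map C (C \<Otimes> C) (comult C) \<and> linear_map C ground_space (counit C) \<and>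
     (\<forall>c\<in>carrier C.
        sw C c (\<lambda>x c3. sw C x (\<lambda>c1 c2. (c1 \<otimes>\<^bsub>C,C\<^esub> c2) \<otimes>\<^bsub>C \<Otimes> C,C\<^esub> c3)) =
        sw C c (\<lambda>c1 x. sw C x (\<lambda>c2 c3. (c1 \<otimes>\<^bsub>C,C\<^esub> c2) \<otimes>\<^bsub>C \<Otimes> C,C\<^esub> c3))) \<and>
     (\<forall>c\<in>carrier C. sw C c (\<lambda>c1 c2. scale C (counit C c1) c2) = c \<and>
                    sw C c (\<lambda>c1 c2. scale C (counit C c2) c1) = c)"

definition is_bialgebra :: "('k::field, 'a::ab_group_add, 'z) bialg_scheme \<Rightarrow> bool" where
  "is_bialgebra A \<longleftrightarrow>
     is_algebra A \<and> is_coalgebra A \<and>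
     (\<forall>a\<in>carrier A. \<forall>b\<in>carrier A.
        comult A (a \<cdot>\<^bsub>A\<^esub> b) =
        sw A a (\<lambda>a1 a2. sw A b (\<lambda>b1 b2. (a1 \<cdot>\<^bsub>A\<^esub> b1) \<otimes>\<^bsub>A,A\<^esub> (a2 \<cdot>\<^bsub>A\<^esub> b2)))) \<and>
     comult A \<one>\<^bsub>A\<^esub> = \<one>\<^bsub>A\<^esub> \<otimes>\<^bsub>A,A\<^esub> \<one>\<^bsub>A\<^esub> \<and>
     (\<forall>a\<in>carrier A. \<forall>b\<in>carrier A. counit A (a \<cdot>\<^bsub>A\<^esub> b) = counit A a * counit A b) \<and>
     counit A \<one>\<^bsub>A\<^esub> = 1"

definition is_antipode ::
  "('k::field, 'a::ab_group_add, 'z) bialg_scheme \<Rightarrow> ('a \<Rightarrow> 'a) \<Rightarrow> bool" where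
  "is_antipode A S \<longleftrightarrow>
     linear_map A A S \<and>
     (\<forall>a\<in>carrier A. sw A a (\<lambda>a1 a2. S a1 \<cdot>\<^bsub>A\<^esub> a2) = scale A (counit A a) \<one>\<^bsub>A\<^esub> \<and>
                    sw A a (\<lambda>a1 a2. a1 \<cdot>\<^bsub>A\<^esub> S a2) = scale A (counit A a) \<one>\<^bsub>A\<^esub>)"

definition is_hopf_algebra :: "('k::field, 'a::ab_group_add, 'z) hopf_scheme \<Rightarrow> bool" where
  "is_hopf_algebra A \<longleftrightarrow> is_bialgebra A \<and> is_antipode A (antipode A)"

definition hopf_iso ::
  "('k::field, 'a::ab_group_add, 'y) hopf_scheme \<Rightarrow> ('k, 'b::ab_group_add, 'z) hopf_scheme
    \<Rightarrow> ('a \<Rightarrow> 'b) \<Rightarrow> bool" where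
  "hopf_iso A B f \<longleftrightarrow>
     linear_map A B f \<and> bij_betw f (carrier A) (carrier B) \<and>
     (\<forall>a\<in>carrier A. \<forall>b\<in>carrier A. f (a \<cdot>\<^bsub>A\<^esub> b) = f a \<cdot>\<^bsub>B\<^esub> f b) \<and>
     f \<one>\<^bsub>A\<^esub> = \<one>\<^bsub>B\<^esub> \<and>
     (\<forall>a\<in>carrier A. comult B (f a) = sw A a (\<lambda>a1 a2. f a1 \<otimes>\<^bsub>B,B\<^esub> f a2)) \<and>
     (\<forall>a\<in>carrier A. counit B (f a) = counit A a) \<and>
     (\<forall>a\<in>carrier A. f (antipode A a) = antipode B (f a))"

definition hopf_isomorphic ::
  "('k::field, 'a::ab_group_add, 'y) hopf_scheme \<Rightarrow> ('k, 'b::ab_group_add, 'z) hopf_scheme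
    \<Rightarrow> bool" (infix \<open>\<simeq>\<^sub>H\<close> 50) where
  "A \<simeq>\<^sub>H B \<longleftrightarrow> is_hopf_algebra A \<and> is_hopf_algebra B \<and> (\<exists>f. hopf_iso A B f)"


section \<open>Dual Hopf algebras\<close>

text \<open>Functionals on the carrier are made unique by letting them vanish outside of it.\<close>

definition restrict0 ::
  "('k::field, 'v::ab_group_add, 'z) space_scheme \<Rightarrow> ('v \<Rightarrow> 'k) \<Rightarrow> 'v \<Rightarrow> 'k" where
  "restrict0 V f = (\<lambda>v. if v \<in> carrier V then f v else 0)"

definition dual_space ::
  "('k::field, 'v::ab_group_add, 'z) space_scheme \<Rightarrow> ('k, 'v \<Rightarrow> 'k) space" where
  "dual_space V = \<lparr>carrier = {f. linear_map V ground_space f \<and> (\<forall>v. v \<notin> carrier V \<longrightarrow> f v = 0)},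
                   scale = fscale\<rparr>"

text \<open>
  For finite dimensional \<open>A\<close> the comultiplication \<open>f \<mapsto> f\<^sub>1 \<otimes> f\<^sub>2\<close> of the dual is determined by
  \<open>f\<^sub>1(x) f\<^sub>2(y) = f(xy)\<close>, i.e. it is the transpose of the multiplication composed with
  \<open>(A \<otimes> A)\<^sup>* \<cong> A\<^sup>* \<otimes> A\<^sup>*\<close>.
\<close>

definition dual :: "('k::field, 'a::ab_group_add, 'z) hopf_scheme \<Rightarrow> ('k, 'a \<Rightarrow> 'k) hopf" where
  "dual A = \<lparr>
     carrier = carrier (dual_space A),
     scale = scale (dual_space A),
     mult = (\<lambda>f g. restrict0 A (\<lambda>a. sw A a (\<lambda>a1 a2. f a1 * g a2))),
     one_el = restrict0 A (counit A),
     comult = (\<lambda>f. THE t. t \<in> carrier (dual_space A \<Otimes> dual_space A) \<and>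
        (\<forall>x\<in>carrier A. \<forall>y\<in>carrier A.
           tensor_lift (dual_space A) (dual_space A) t (\<lambda>f1 f2. f1 x * f2 y) = f (x \<cdot>\<^bsub>A\<^esub> y))),
     counit = (\<lambda>f. f \<one>\<^bsub>A\<^esub>),
     antipode = (\<lambda>f. restrict0 A (\<lambda>a. f (antipode A a)))\<rparr>"


section \<open>Partial matched pairs\<close>

text \<open>
  A linear map \<open>H \<otimes> A \<rightarrow> A\<close> is given by the bilinear map \<open>act\<close>, with \<open>act h a\<close> for
  \<open>h \<rightharpoonup> a\<close>; \<open>tensor_lift C L (\<rho> c) (\<lambda>c0 c1. \<dots>)\<close> is the notation \<open>\<rho>(c) = c\<^sup>0 \<otimes> c\<^sup>1\<close>.
\<close>

definition partial_module_algebra ::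
  "('k::field, 'h::ab_group_add, 'y) hopf_scheme \<Rightarrow> ('k, 'a::ab_group_add, 'z) bialg_scheme
    \<Rightarrow> ('h \<Rightarrow> 'a \<Rightarrow> 'a) \<Rightarrow> bool" where
  "partial_module_algebra H A act \<longleftrightarrow>
     is_hopf_algebra H \<and> is_algebra A \<and> bilinear_map H A A act \<and>
     (\<forall>a\<in>carrier A. act \<one>\<^bsub>H\<^esub> a = a) \<and>
     (\<forall>h\<in>carrier H. \<forall>a\<in>carrier A. \<forall>b\<in>carrier A.
        act h (a \<cdot>\<^bsub>A\<^esub> b) = sw H h (\<lambda>h1 h2. act h1 a \<cdot>\<^bsub>A\<^esub> act h2 b)) \<and>
     (\<forall>h\<in>carrier H. \<forall>g\<in>carrier H. \<forall>a\<in>carrier A.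
        act h (act g a) = sw H h (\<lambda>h1 h2. act h1 \<one>\<^bsub>A\<^esub> \<cdot>\<^bsub>A\<^esub> act (h2 \<cdot>\<^bsub>H\<^esub> g) a))"

definition partial_comodule_coalgebra ::
  "('k::field, 'l::ab_group_add, 'y) hopf_scheme \<Rightarrow> ('k, 'c::ab_group_add, 'z) bialg_scheme
    \<Rightarrow> ('c \<Rightarrow> ('k, 'c, 'l) tensor) \<Rightarrow> bool" where
  "partial_comodule_coalgebra L C \<rho> \<longleftrightarrow>
     is_hopf_algebra L \<and> is_coalgebra C \<and> linear_map C (C \<Otimes> L) \<rho> \<and>
     (\<forall>c\<in>carrier C. tensor_lift C L (\<rho> c) (\<lambda>c0 c1. scale C (counit L c1) c0) = c) \<and>
     (\<forall>c\<in>carrier C.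
        tensor_lift C L (\<rho> c) (\<lambda>c0 c1. comult C c0 \<otimes>\<^bsub>C \<Otimes> C,L\<^esub> c1) =
        sw C c (\<lambda>c1 c2.
          tensor_lift C L (\<rho> c1) (\<lambda>c10 c11.
          tensor_lift C L (\<rho> c2) (\<lambda>c20 c21.
            (c10 \<otimes>\<^bsub>C,C\<^esub> c20) \<otimes>\<^bsub>C \<Otimes> C,L\<^esub> (c11 \<cdot>\<^bsub>L\<^esub> c21))))) \<and>
     (\<forall>c\<in>carrier C.
        tensor_lift C L (\<rho> c) (\<lambda>c0 c1. \<rho> c0 \<otimes>\<^bsub>C \<Otimes> L,L\<^esub> c1) =
        sw C c (\<lambda>c1 c2.
          tensor_lift C L (\<rho> c1) (\<lambda>c10 c11.
          tensor_lift C L (\<rho> c2) (\<lambda>c20 c21.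
          sw L c11 (\<lambda>c11_1 c11_2.
            (c10 \<otimes>\<^bsub>C,L\<^esub> c11_1) \<otimes>\<^bsub>C \<Otimes> L,L\<^esub> scale L (counit C c20) (c11_2 \<cdot>\<^bsub>L\<^esub> c21))))))"

definition partial_matched_pair ::
  "('k::field, 'h::ab_group_add, 'y) hopf_scheme \<Rightarrow> ('k, 'l::ab_group_add, 'z) hopf_scheme
    \<Rightarrow> ('h \<Rightarrow> 'l \<Rightarrow> 'l) \<Rightarrow> ('h \<Rightarrow> ('k, 'h, 'l) tensor) \<Rightarrow> bool" where
  "partial_matched_pair H L act \<rho> \<longleftrightarrow>
     is_hopf_algebra H \<and> is_hopf_algebra L \<and>
     partial_module_algebra H L act \<and> partial_comodule_coalgebra L H \<rho> \<and>
     (\<forall>h\<in>carrier H. \<forall>g\<in>carrier H. \<forall>x\<in>carrier L.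
        sw H h (\<lambda>h1 h2.
          tensor_lift H L (\<rho> (h2 \<cdot>\<^bsub>H\<^esub> g)) (\<lambda>u0 u1.
          sw L (act h1 x) (\<lambda>y1 y2.
            (u0 \<otimes>\<^bsub>H,L\<^esub> y1) \<otimes>\<^bsub>H \<Otimes> L,L\<^esub> (y2 \<cdot>\<^bsub>L\<^esub> u1)))) =
        sw4 H h (\<lambda>h1 h2 h3 h4.
          tensor_lift H L (\<rho> h1) (\<lambda>h10 h11.
          tensor_lift H L (\<rho> h3) (\<lambda>h30 h31.
          tensor_lift H L (\<rho> g) (\<lambda>g0 g1.
          sw L x (\<lambda>x1 x2.
            ((h30 \<cdot>\<^bsub>H\<^esub> g0) \<otimes>\<^bsub>H,L\<^esub> act h10 x1) \<otimes>\<^bsub>H \<Otimes> L,L\<^esub>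
              (h11 \<cdot>\<^bsub>L\<^esub> act h2 x2 \<cdot>\<^bsub>L\<^esub> h31 \<cdot>\<^bsub>L\<^esub> act h4 g1))))))) \<and>
     (\<forall>h\<in>carrier H. \<forall>x\<in>carrier L. counit L (act h x) = counit L (act h \<one>\<^bsub>L\<^esub>) * counit L x) \<and>
     \<rho> \<one>\<^bsub>H\<^esub> = tensor_lift H L (\<rho> \<one>\<^bsub>H\<^esub>) (\<lambda>u0 u1. \<one>\<^bsub>H\<^esub> \<otimes>\<^bsub>H,L\<^esub> scale L (counit H u0) u1)"

definition quasi_abelian ::
  "('k::field, 'h::ab_group_add, 'y) hopf_scheme \<Rightarrow> ('k, 'l::ab_group_add, 'z) hopf_scheme
    \<Rightarrow> ('h \<Rightarrow> 'l \<Rightarrow> 'l) \<Rightarrow> ('h \<Rightarrow> ('k, 'h, 'l) tensor) \<Rightarrow> bool" where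
  "quasi_abelian H L act \<rho> \<longleftrightarrow>
     (\<forall>h\<in>carrier H. \<forall>x\<in>carrier L.
        sw H h (\<lambda>h1 h2. tensor_lift H L (\<rho> h2) (\<lambda>h20 h21. h20 \<otimes>\<^bsub>H,L\<^esub> (act h1 x \<cdot>\<^bsub>L\<^esub> h21))) =
        sw H h (\<lambda>h1 h2. tensor_lift H L (\<rho> h1) (\<lambda>h10 h11. h10 \<otimes>\<^bsub>H,L\<^esub> (h11 \<cdot>\<^bsub>L\<^esub> act h2 x))))"


section \<open>The Hopf algebra on the subspace of \<open>L \<otimes> H\<close>\<close>

text \<open>
  \<open>smash_el H L act \<rho> x h\<close> is the generator
  \<open>\<epsilon>\<^sub>H(h\<^sub>1\<^sup>0) x h\<^sub>1\<^sup>1 (h\<^sub>2 \<rightharpoonup> 1) # h\<^sub>3\<close> of the partial smash product.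
\<close>

definition smash_el ::
  "('k::field, 'h::ab_group_add, 'y) hopf_scheme \<Rightarrow> ('k, 'l::ab_group_add, 'z) hopf_scheme
    \<Rightarrow> ('h \<Rightarrow> 'l \<Rightarrow> 'l) \<Rightarrow> ('h \<Rightarrow> ('k, 'h, 'l) tensor) \<Rightarrow> 'l \<Rightarrow> 'h \<Rightarrow> ('k, 'l, 'h) tensor" where
  "smash_el H L act \<rho> x h =
     sw3 H h (\<lambda>h1 h2 h3.
       tensor_lift H L (\<rho> h1) (\<lambda>h10 h11.
         scale L (counit H h10) (x \<cdot>\<^bsub>L\<^esub> h11 \<cdot>\<^bsub>L\<^esub> act h2 \<one>\<^bsub>L\<^esub>) \<otimes>\<^bsub>L,H\<^esub> h3))"

definition smash_space ::
  "('k::field, 'h::ab_group_add, 'y) hopf_scheme \<Rightarrow> ('k, 'l::ab_group_add, 'z) hopf_scheme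
    \<Rightarrow> ('h \<Rightarrow> 'l \<Rightarrow> 'l) \<Rightarrow> ('h \<Rightarrow> ('k, 'h, 'l) tensor) \<Rightarrow> ('k, ('k, 'l, 'h) tensor) space" where
  "smash_space H L act \<rho> =
     \<lparr>carrier = module.span fscale {smash_el H L act \<rho> x h | x h. x \<in> carrier L \<and> h \<in> carrier H},
      scale = fscale\<rparr>"

definition smash_extend ::
  "('k::field, 'h::ab_group_add, 'y) hopf_scheme \<Rightarrow> ('k, 'l::ab_group_add, 'z) hopf_scheme
    \<Rightarrow> ('h \<Rightarrow> 'l \<Rightarrow> 'l) \<Rightarrow> ('h \<Rightarrow> ('k, 'h, 'l) tensor)
    \<Rightarrow> ('k, 'l, 'h) tensor \<Rightarrow> ('l \<Rightarrow> 'h \<Rightarrow> 'u::ab_group_add) \<Rightarrow> 'u" where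
  "smash_extend H L act \<rho> z \<beta> = lin_extend (carrier L) (carrier H) (smash_el H L act \<rho>) \<beta> z"

definition smash_mult ::
  "('k::field, 'h::ab_group_add, 'y) hopf_scheme \<Rightarrow> ('k, 'l::ab_group_add, 'z) hopf_scheme
    \<Rightarrow> ('h \<Rightarrow> 'l \<Rightarrow> 'l) \<Rightarrow> ('h \<Rightarrow> ('k, 'h, 'l) tensor)
    \<Rightarrow> ('k, 'l, 'h) tensor \<Rightarrow> ('k, 'l, 'h) tensor \<Rightarrow> ('k, 'l, 'h) tensor" where
  "smash_mult H L act \<rho> z w =
     smash_extend H L act \<rho> z (\<lambda>x h. smash_extend H L act \<rho> w (\<lambda>y g.
       sw H h (\<lambda>h1 h2. smash_el H L act \<rho> (x \<cdot>\<^bsub>L\<^esub> act h1 y) (h2 \<cdot>\<^bsub>H\<^esub> g))))"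

definition smash ::
  "('k::field, 'h::ab_group_add, 'y) hopf_scheme \<Rightarrow> ('k, 'l::ab_group_add, 'z) hopf_scheme
    \<Rightarrow> ('h \<Rightarrow> 'l \<Rightarrow> 'l) \<Rightarrow> ('h \<Rightarrow> ('k, 'h, 'l) tensor) \<Rightarrow> ('k, ('k, 'l, 'h) tensor) hopf" where
  "smash H L act \<rho> =
     (let E = smash_el H L act \<rho>; Sp = smash_space H L act \<rho> in
      \<lparr>carrier = carrier Sp,
       scale = scale Sp,
       mult = smash_mult H L act \<rho>,
       one_el = E \<one>\<^bsub>L\<^esub> \<one>\<^bsub>H\<^esub>,
       comult = (\<lambda>z. smash_extend H L act \<rho> z (\<lambda>x h.
         sw L x (\<lambda>x1 x2. sw H h (\<lambda>h1 h2. tensor_lift H L (\<rho> h1) (\<lambda>h10 h11.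
           E x1 h10 \<otimes>\<^bsub>Sp,Sp\<^esub> E (x2 \<cdot>\<^bsub>L\<^esub> h11) h2))))),
       counit = (\<lambda>z. smash_extend H L act \<rho> z (\<lambda>x h. counit L x * counit L (act h \<one>\<^bsub>L\<^esub>))),
       antipode = (\<lambda>z. smash_extend H L act \<rho> z (\<lambda>x h.
         tensor_lift H L (\<rho> h) (\<lambda>h0 h1.
           smash_mult H L act \<rho> (E \<one>\<^bsub>L\<^esub> (antipode H h0))
                                (E (antipode L h1 \<cdot>\<^bsub>L\<^esub> antipode L x) \<one>\<^bsub>H\<^esub>))))\<rparr>)"


section \<open>The Hopf algebra on the subspace of the tensor product of the duals\<close>

text \<open>The right action of \<open>L\<^sup>*\<close> on \<open>H\<^sup>*\<close>: \<open>(\<phi> \<leftharpoonup> f)(h) = \<phi>(h\<^sup>0) f(h\<^sup>1)\<close>.\<close>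

definition dual_act ::
  "('k::field, 'h::ab_group_add, 'y) hopf_scheme \<Rightarrow> ('k, 'l::ab_group_add, 'z) hopf_scheme
    \<Rightarrow> ('h \<Rightarrow> ('k, 'h, 'l) tensor) \<Rightarrow> ('h \<Rightarrow> 'k) \<Rightarrow> ('l \<Rightarrow> 'k) \<Rightarrow> 'h \<Rightarrow> 'k" where
  "dual_act H L \<rho> \<phi> f = restrict0 H (\<lambda>h. tensor_lift H L (\<rho> h) (\<lambda>h0 h1. \<phi> h0 * f h1))"

text \<open>
  The left coaction of \<open>H\<^sup>*\<close> on \<open>L\<^sup>*\<close>: \<open>f \<mapsto> \<Sum> h\<^sub>i\<^sup>* \<otimes> (x \<mapsto> f(h\<^sub>i \<rightharpoonup> x))\<close>.  It does not depend on
  the chosen basis.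
\<close>

definition some_basis :: "('k::field, 'v::ab_group_add, 'z) space_scheme \<Rightarrow> 'v set" where
  "some_basis V = (SOME B. B \<subseteq> carrier V \<and> \<not> module.dependent (scale V) B \<and>
                           module.span (scale V) B = carrier V)"

definition dual_coact ::
  "('k::field, 'h::ab_group_add, 'y) hopf_scheme \<Rightarrow> ('k, 'l::ab_group_add, 'z) hopf_scheme
    \<Rightarrow> ('h \<Rightarrow> 'l \<Rightarrow> 'l) \<Rightarrow> ('l \<Rightarrow> 'k) \<Rightarrow> ('k, 'h \<Rightarrow> 'k, 'l \<Rightarrow> 'k) tensor" where
  "dual_coact H L act f =
     (let B = some_basis H in
      \<Sum>b\<in>B. restrict0 H (\<lambda>h. module.representation (scale H) B h b)
        \<otimes>\<^bsub>dual H,dual L\<^esub> restrict0 L (\<lambda>x. f (act b x)))"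

text \<open>
  \<open>dual_smash_el H L act \<rho> \<phi> f\<close> is the generator
  \<open>\<epsilon>(f\<^sub>3\<^sup>0) (1 \<leftharpoonup> f\<^sub>2) f\<^sub>3\<^sup>-\<^sup>1 \<phi> \<otimes> f\<^sub>1\<close>.  In the bound variables below, \<open>m\<close> and \<open>z\<close> stand
  for the components \<open>-1\<close> and \<open>0\<close> of the left coaction.
\<close>

definition dual_smash_el ::
  "('k::field, 'h::ab_group_add, 'y) hopf_scheme \<Rightarrow> ('k, 'l::ab_group_add, 'z) hopf_scheme
    \<Rightarrow> ('h \<Rightarrow> 'l \<Rightarrow> 'l) \<Rightarrow> ('h \<Rightarrow> ('k, 'h, 'l) tensor)
    \<Rightarrow> ('h \<Rightarrow> 'k) \<Rightarrow> ('l \<Rightarrow> 'k) \<Rightarrow> ('k, 'h \<Rightarrow> 'k, 'l \<Rightarrow> 'k) tensor" where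
  "dual_smash_el H L act \<rho> \<phi> f =
     sw3 (dual L) f (\<lambda>f1 f2 f3.
       tensor_lift (dual H) (dual L) (dual_coact H L act f3) (\<lambda>f3m f3z.
         scale (dual H) (counit (dual L) f3z)
           (dual_act H L \<rho> \<one>\<^bsub>dual H\<^esub> f2 \<cdot>\<^bsub>dual H\<^esub> f3m \<cdot>\<^bsub>dual H\<^esub> \<phi>) \<otimes>\<^bsub>dual H,dual L\<^esub> f1))"

definition dual_smash_space ::
  "('k::field, 'h::ab_group_add, 'y) hopf_scheme \<Rightarrow> ('k, 'l::ab_group_add, 'z) hopf_scheme
    \<Rightarrow> ('h \<Rightarrow> 'l \<Rightarrow> 'l) \<Rightarrow> ('h \<Rightarrow> ('k, 'h, 'l) tensor)
    \<Rightarrow> ('k, ('k, 'h \<Rightarrow> 'k, 'l \<Rightarrow> 'k) tensor) space" where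
  "dual_smash_space H L act \<rho> =
     \<lparr>carrier = module.span fscale
        {dual_smash_el H L act \<rho> \<phi> f | \<phi> f. \<phi> \<in> carrier (dual H) \<and> f \<in> carrier (dual L)},
      scale = fscale\<rparr>"

definition dual_smash_extend ::
  "('k::field, 'h::ab_group_add, 'y) hopf_scheme \<Rightarrow> ('k, 'l::ab_group_add, 'z) hopf_scheme
    \<Rightarrow> ('h \<Rightarrow> 'l \<Rightarrow> 'l) \<Rightarrow> ('h \<Rightarrow> ('k, 'h, 'l) tensor)
    \<Rightarrow> ('k, 'h \<Rightarrow> 'k, 'l \<Rightarrow> 'k) tensor
    \<Rightarrow> (('h \<Rightarrow> 'k) \<Rightarrow> ('l \<Rightarrow> 'k) \<Rightarrow> 'u::ab_group_add) \<Rightarrow> 'u" where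
  "dual_smash_extend H L act \<rho> z \<beta> =
     lin_extend (carrier (dual H)) (carrier (dual L)) (dual_smash_el H L act \<rho>) \<beta> z"

definition dual_smash_bialg ::
  "('k::field, 'h::ab_group_add, 'y) hopf_scheme \<Rightarrow> ('k, 'l::ab_group_add, 'z) hopf_scheme
    \<Rightarrow> ('h \<Rightarrow> 'l \<Rightarrow> 'l) \<Rightarrow> ('h \<Rightarrow> ('k, 'h, 'l) tensor)
    \<Rightarrow> ('k, ('k, 'h \<Rightarrow> 'k, 'l \<Rightarrow> 'k) tensor) bialg" where
  "dual_smash_bialg H L act \<rho> =
     (let E = dual_smash_el H L act \<rho>; Sp = dual_smash_space H L act \<rho> in
      \<lparr>carrier = carrier Sp,
       scale = scale Sp,
       mult = (\<lambda>z w. dual_smash_extend H L act \<rho> z (\<lambda>\<phi> f. dual_smash_extend H L act \<rho> w (\<lambda>\<psi> g.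
         sw (dual L) g (\<lambda>g1 g2.
           E (dual_act H L \<rho> \<phi> g2 \<cdot>\<^bsub>dual H\<^esub> \<psi>) (f \<cdot>\<^bsub>dual L\<^esub> g1))))),
       one_el = E \<one>\<^bsub>dual H\<^esub> \<one>\<^bsub>dual L\<^esub>,
       comult = (\<lambda>z. dual_smash_extend H L act \<rho> z (\<lambda>\<phi> f.
         sw (dual L) f (\<lambda>f1 f2. sw (dual H) \<phi> (\<lambda>\<phi>1 \<phi>2.
         tensor_lift (dual H) (dual L) (dual_coact H L act f2) (\<lambda>f2m f2z.
           E (f2m \<cdot>\<^bsub>dual H\<^esub> \<phi>1) f1 \<otimes>\<^bsub>Sp,Sp\<^esub> E \<phi>2 f2z))))),
       counit = (\<lambda>z. dual_smash_extend H L act \<rho> z (\<lambda>\<phi> f.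
         counit (dual H) \<phi> * counit (dual H) (dual_act H L \<rho> \<one>\<^bsub>dual H\<^esub> f)))\<rparr>)"

text \<open>
  No formula is prescribed for the antipode; an antipode of a bialgebra is unique on the
  carrier, so any choice is the antipode.
\<close>

definition dual_smash ::
  "('k::field, 'h::ab_group_add, 'y) hopf_scheme \<Rightarrow> ('k, 'l::ab_group_add, 'z) hopf_scheme
    \<Rightarrow> ('h \<Rightarrow> 'l \<Rightarrow> 'l) \<Rightarrow> ('h \<Rightarrow> ('k, 'h, 'l) tensor)
    \<Rightarrow> ('k, ('k, 'h \<Rightarrow> 'k, 'l \<Rightarrow> 'k) tensor) hopf" where
  "dual_smash H L act \<rho> =
     (let B = dual_smash_bialg H L act \<rho>
      in bialg.extend B (hopf.fields (SOME S. is_antipode B S)))"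

end

theory Submission
  imports Defs
begin

text \<open>Put \<open>\<lambda>(h) = \<epsilon>(h \<rightharpoonup> 1)\<close> and \<open>u = \<epsilon>(1\<^sup>0) 1\<^sup>1\<close>.  The two conditions involving antipodes give
  \<open>h \<rightharpoonup> 1 = \<lambda>(h) 1\<close> (\<open>act_one_right\<close>) and \<open>\<epsilon>(h\<^sup>0) h\<^sup>1 = \<epsilon>(h) u\<close> (\<open>rho_counit_left\<close>).  Together with the
  axioms of a quasi-abelian partial matched pair it follows that \<open>u\<close> is a central idempotent of
  \<open>L\<close> with \<open>\<Delta>(u)(1 \<otimes> u) = u \<otimes> u\<close>, that \<open>\<lambda>\<close> is a central idempotent of \<open>H\<^sup>*\<close> with the dual
  property (\<open>lam_mult\<close>), and that \<open>h \<rightharpoonup> u = \<lambda>(h) u\<close> and \<open>\<lambda>(h\<^sup>0) h\<^sup>1 = \<lambda>(h) u\<close> (\<open>act_u\<close>, \<open>lam_rho\<close>).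

  Write \<open>proj h = \<lambda>(h\<^sub>1) h\<^sub>2\<close>.  The generator of the smash product given by \<open>x\<close> and \<open>h\<close> is
  \<open>xu \<otimes> proj h\<close> (\<open>E_eq\<close>).  Hence linear maps on the smash product are the bilinear maps on
  \<open>L \<times> H\<close> that do not change under \<open>x \<mapsto> xu\<close> and \<open>h \<mapsto> proj h\<close> (\<open>smash_extend\<close>).  In this way all
  operations are well defined, and the axioms of a Hopf algebra become identities between
  Sweedler sums in which superfluous factors \<open>u\<close> and \<open>\<lambda>\<close> are absorbed (\<open>smash_is_hopf\<close>).

  On the other side, the generator given by \<open>\<phi>\<close> and \<open>f\<close> takes the value \<open>\<phi>(proj h) f(xu)\<close> at
  \<open>(h, x)\<close> (\<open>ev_F\<close>).  So the elements of the dual smash product, seen as functions of \<open>(h, x)\<close>, are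
  the invariant bilinear forms, that is, the functionals on the smash product.  This is the
  isomorphism \<open>Theta\<close> (\<open>ev_Theta\<close>, \<open>bij_Theta\<close>).  In these terms the multiplication and the
  comultiplication of the dual smash product are the transposes of the comultiplication and the
  multiplication of the smash product (\<open>Theta_mult\<close>, \<open>Theta_comult\<close>).  The dual of a finite
  dimensional Hopf algebra is a Hopf algebra (\<open>dual_is_hopf\<close>), its structure is transported
  along \<open>Theta\<close> (\<open>transport\<close>), and the antipodes correspond because a bialgebra has at most one
  (\<open>antipode_unique\<close>).

  Identities between tensors are verified after application of an arbitrary multilinear form;
  these separate the points (\<open>eq_by_forms\<close>, \<open>tensor_eqI\<close>).  Every axiom then becomes a rewrite rule
  for Sweedler sums with an arbitrary multilinear continuation.  A Sweedler sum is a sum over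
  a list that depends on the tensor only (\<open>tl_reps\<close>), so that nested sums can be interchanged.\<close>

section \<open>Linear maps and linear functionals\<close>

abbreviation form :: "('k::field, 'v::ab_group_add, 'z) space_scheme \<Rightarrow> ('v \<Rightarrow> 'k) \<Rightarrow> bool" where
  "form V \<equiv> linear_map V (ground_space :: ('k, 'k) space)"

text \<open>Multilinearity of an expression is decided by resolution with \<open>lin\<close>: one rule for every
  operation and every argument position, in the form of a composition with a linear map.  The same
  collection proves membership in carriers; \<open>sp\<close> collects facts of the form \<open>is_space V\<close>.  Fixed forms are added locally by \<open>note [lin]\<close>.\<close>

named_theorems lin
named_theorems sp

lemma is_space_ground [sp]: "is_space (ground_space :: ('k::field, 'k) space)"
proof -
  interpret K: vector_space "(*) :: 'k \<Rightarrow> 'k \<Rightarrow> 'k" by unfold_locales (auto simp: algebra_simps)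
  show ?thesis by (simp add: is_space_def ground_space_def K.vector_space_axioms)
qed

lemma carrier_ground [simp, lin]: "x \<in> carrier ground_space"
  by (simp add: ground_space_def)

lemma carrier_0: "is_space V \<Longrightarrow> 0 \<in> carrier V"
  unfolding is_space_def by (meson module.subspace_0 module_iff_vector_space)

lemma carrier_add: "is_space V \<Longrightarrow> x \<in> carrier V \<Longrightarrow> y \<in> carrier V \<Longrightarrow> x + y \<in> carrier V"
  unfolding is_space_def by (meson module.subspace_add module_iff_vector_space)

lemma carrier_scale [lin]: "is_space V \<Longrightarrow> x \<in> carrier V \<Longrightarrow> scale V c x \<in> carrier V"
  unfolding is_space_def by (meson module.subspace_scale module_iff_vector_space)

lemma linear_map_in: "linear_map V W f \<Longrightarrow> x \<in> carrier V \<Longrightarrow> f x \<in> carrier W"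
  by (simp add: linear_map_def)

lemma linear_map_add: "linear_map V W f \<Longrightarrow> x \<in> carrier V \<Longrightarrow> y \<in> carrier V \<Longrightarrow> f (x + y) = f x + f y"
  by (simp add: linear_map_def)

lemma linear_map_scale: "linear_map V W f \<Longrightarrow> x \<in> carrier V \<Longrightarrow> f (scale V c x) = scale W c (f x)"
  by (simp add: linear_map_def)

lemma form_scale: "form V f \<Longrightarrow> x \<in> carrier V \<Longrightarrow> f (scale V c x) = c * f x"
  by (simp add: linear_map_def ground_space_def)

lemma linear_map_0: "is_space V \<Longrightarrow> linear_map V W f \<Longrightarrow> f 0 = 0"
  using linear_map_add[of V W f 0 0] carrier_0[of V] by simp

lemma linear_map_sum_list:
  assumes "is_space V" "linear_map V W f" "\<And>p. p \<in> set ps \<Longrightarrow> g p \<in> carrier V"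
  shows "f (\<Sum>p\<leftarrow>ps. g p) = (\<Sum>p\<leftarrow>ps. f (g p)) \<and> (\<Sum>p\<leftarrow>ps. g p) \<in> carrier V"
  using assms(3)
  by (induction ps) (use assms(1,2) in \<open>auto simp: linear_map_0 linear_map_add carrier_0 carrier_add\<close>)

lemma linear_map_sum:
  assumes "is_space V" "linear_map V W f" "\<And>p. p \<in> I \<Longrightarrow> g p \<in> carrier V"
  shows "f (\<Sum>p\<in>I. g p) = (\<Sum>p\<in>I. f (g p))" "(\<Sum>p\<in>I. g p) \<in> carrier V"
proof -
  have "f (\<Sum>p\<in>I. g p) = (\<Sum>p\<in>I. f (g p)) \<and> (\<Sum>p\<in>I. g p) \<in> carrier V"
    using assms(3)
    by (induction I rule: infinite_finite_induct)
      (use assms(1,2) in \<open>auto simp: linear_map_0 linear_map_add carrier_0 carrier_add\<close>)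
  then show "f (\<Sum>p\<in>I. g p) = (\<Sum>p\<in>I. f (g p))" "(\<Sum>p\<in>I. g p) \<in> carrier V" by auto
qed

lemma bilinear_mapI:
  assumes "\<And>v. v \<in> carrier V \<Longrightarrow> linear_map W U (\<lambda>w. \<beta> v w)"
    "\<And>w. w \<in> carrier W \<Longrightarrow> linear_map V U (\<lambda>v. \<beta> v w)"
  shows "bilinear_map V W U \<beta>"
  using assms by (simp add: bilinear_map_def)

lemma bilinear_map_left: "bilinear_map V W U \<beta> \<Longrightarrow> w \<in> carrier W \<Longrightarrow> linear_map V U (\<lambda>v. \<beta> v w)"
  by (simp add: bilinear_map_def)

lemma bilinear_map_right: "bilinear_map V W U \<beta> \<Longrightarrow> v \<in> carrier V \<Longrightarrow> linear_map W U (\<lambda>w. \<beta> v w)"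
  by (simp add: bilinear_map_def)

lemma linear_map_comp: "linear_map W U g \<Longrightarrow> linear_map V W f \<Longrightarrow> linear_map V U (\<lambda>x. g (f x))"
  by (auto simp: linear_map_def)

lemma linear_map_comp_left:
  "bilinear_map V W U \<beta> \<Longrightarrow> w \<in> carrier W \<Longrightarrow> linear_map X V f \<Longrightarrow> linear_map X U (\<lambda>x. \<beta> (f x) w)"
  by (rule linear_map_comp[OF bilinear_map_left])

lemma linear_map_comp_right:
  "bilinear_map V W U \<beta> \<Longrightarrow> v \<in> carrier V \<Longrightarrow> linear_map X W f \<Longrightarrow> linear_map X U (\<lambda>x. \<beta> v (f x))"
  by (rule linear_map_comp[OF bilinear_map_right])

lemma linear_map_cong:
  "(\<And>x. x \<in> carrier V \<Longrightarrow> f x = g x) \<Longrightarrow> is_space V \<Longrightarrow> linear_map V U f = linear_map V U g"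
  by (auto simp: linear_map_def carrier_add carrier_scale)

lemma lin_id [lin]: "linear_map V V (\<lambda>x. x)"
  by (simp add: linear_map_def)

lemma lin_times_left [lin]: "form V f \<Longrightarrow> form V (\<lambda>x. f x * c)"
  by (auto simp: linear_map_def ground_space_def algebra_simps)

lemma lin_times_right [lin]: "form V f \<Longrightarrow> form V (\<lambda>x. c * f x)"
  by (auto simp: linear_map_def ground_space_def algebra_simps)

lemma vector_space_of: "is_space V \<Longrightarrow> vector_space (scale V)"
  by (simp add: is_space_def)

lemma lin_scale_left [lin]:
  assumes "form V f" "is_space W" "w \<in> carrier W"
  shows "linear_map V W (\<lambda>x. scale W (f x) w)"
proof -
  interpret vector_space "scale W" using assms vector_space_of by blast
  show ?thesis using assms by (auto simp: linear_map_def ground_space_def algebra_simps carrier_scale)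
qed

lemma lin_scale_right [lin]:
  assumes "linear_map V W f" "is_space W"
  shows "linear_map V W (\<lambda>x. scale W c (f x))"
proof -
  interpret vector_space "scale W" using assms vector_space_of by blast
  show ?thesis using assms by (auto simp: linear_map_def ground_space_def algebra_simps carrier_scale)
qed

lemma linear_map_sum_fun:
  assumes "is_space U" "\<And>i. i \<in> I \<Longrightarrow> linear_map V U (\<lambda>x. f x i)"
  shows "linear_map V U (\<lambda>x. \<Sum>i\<in>I. f x i)"
proof -
  interpret vector_space "scale U" using assms vector_space_of by blast
  show ?thesis using assms(2)
    by (induction I rule: infinite_finite_induct)
      (use assms(1) in \<open>auto simp: linear_map_def carrier_0 carrier_add scale_right_distrib algebra_simps\<close>)
qed

lemma linear_map_sum_list_fun:
  assumes "is_space U" "\<And>i. i \<in> set I \<Longrightarrow> linear_map V U (\<lambda>x. f x i)"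
  shows "linear_map V U (\<lambda>x. \<Sum>i\<leftarrow>I. f x i)"
proof -
  interpret vector_space "scale U" using assms vector_space_of by blast
  show ?thesis using assms(2)
    by (induction I)
      (use assms(1) in \<open>auto simp: linear_map_def carrier_0 carrier_add scale_right_distrib algebra_simps\<close>)
qed

text \<open>A nonzero vector is linearly independent, so some functional takes the value 1 at it.
  Testing on functionals replaces vectors by scalars, which commute.\<close>

lemma eq_by_forms:
  assumes V: "is_space (V :: ('k::field, 'v::ab_group_add, 'z) space_scheme)"
    and xy: "x \<in> carrier V" "y \<in> carrier V"
    and eq: "\<And>\<phi>. form V \<phi> \<Longrightarrow> \<phi> x = \<phi> y"
  shows "x = y"
proof (rule ccontr)
  interpret U: vector_space "scale V" using V by (simp add: is_space_def)
  interpret K: vector_space "(*) :: 'k \<Rightarrow> 'k \<Rightarrow> 'k" by unfold_locales (auto simp: algebra_simps)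
  interpret UK: vector_space_pair "scale V" "(*) :: 'k \<Rightarrow> 'k \<Rightarrow> 'k" ..
  assume "x \<noteq> y"
  then have "U.independent {x - y}" by simp
  then obtain \<phi> where \<phi>: "Vector_Spaces.linear (scale V) (*) \<phi>" "\<phi> (x - y) = 1"
    using UK.linear_independent_extend[of "{x - y}" "\<lambda>_. 1"] by auto
  interpret \<phi>: Vector_Spaces.linear "scale V" "(*)" \<phi> by fact
  have "form V \<phi>" by (simp add: linear_map_def ground_space_def \<phi>.add \<phi>.scale)
  then show False using eq[of \<phi>] \<phi>(2) by (simp add: \<phi>.diff)
qed

section \<open>Tensor products\<close>

lemma is_space_tensor [sp]: "is_space (V \<Otimes> W)"
  unfolding is_space_def tensor_space_def
  by (simp add: vector_space_fscale module.subspace_span[OF vector_space_fscale[folded module_iff_vector_space]])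

lemma scale_tensor_space: "scale (V \<Otimes> W) = fscale"
  by (simp add: tensor_space_def)

lemma tensor_in [lin]: "v \<in> carrier V \<Longrightarrow> w \<in> carrier W \<Longrightarrow> tensor V W v w \<in> carrier (V \<Otimes> W)"
  unfolding tensor_space_def
  by (auto intro!: module.span_base[OF vector_space_fscale[folded module_iff_vector_space]])

lemma bilinear_tensor: "bilinear_map V W (V \<Otimes> W) (tensor V W)"
  by (auto simp: bilinear_map_def linear_map_def tensor_in scale_tensor_space)
    (auto simp: tensor_def bilinear_map_def linear_map_def ground_space_def fscale_def fun_eq_iff)

lemmas lin_tensor_left [lin] = linear_map_comp_left[OF bilinear_tensor]
lemmas lin_tensor_right [lin] = linear_map_comp_right[OF bilinear_tensor]

lemma tensor_apply: "bilinear_map V W ground_space \<gamma> \<Longrightarrow> tensor V W v w \<gamma> = \<gamma> v w"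
  by (simp add: tensor_def)

lemma tensor_not_bilinear: "\<not> bilinear_map V W ground_space \<gamma> \<Longrightarrow> tensor V W v w \<gamma> = 0"
  by (simp add: tensor_def)

text \<open>The list chosen in the definition of \<^const>\<open>lin_extend\<close>.  It does not depend on the map that is
  extended; hence Sweedler sums commute with each other, even if the summands are not bilinear.\<close>

definition reps where
  "reps V W t = (SOME ps. set ps \<subseteq> carrier V \<times> carrier W \<and> t = (\<Sum>(a, b)\<leftarrow>ps. tensor V W a b))"

lemma tl_reps: "tensor_lift V W t \<beta> = (\<Sum>p\<leftarrow>reps V W t. \<beta> (fst p) (snd p))"
  by (simp add: tensor_lift_def lin_extend_def reps_def split_def)

lemma reps:
  assumes "is_space V" "t \<in> carrier (V \<Otimes> W)"
  shows "set (reps V W t) \<subseteq> carrier V \<times> carrier W" "t = (\<Sum>p\<leftarrow>reps V W t. tensor V W (fst p) (snd p))"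
  using someI_ex[OF tensor_space_list[OF assms]] unfolding reps_def split_def by auto

lemma tl_cong:
  assumes "is_space V" "t \<in> carrier (V \<Otimes> W)"
    "\<And>a b. a \<in> carrier V \<Longrightarrow> b \<in> carrier W \<Longrightarrow> \<beta> a b = \<beta>' a b"
  shows "tensor_lift V W t \<beta> = tensor_lift V W t \<beta>'"
  unfolding tl_reps using reps(1)[OF assms(1,2)] assms(3)
  by (intro arg_cong[where f = sum_list] map_cong) auto

lemma sum_list_swap:
  "(\<Sum>x\<leftarrow>xs. \<Sum>y\<leftarrow>ys. f x y) = (\<Sum>y\<leftarrow>ys. \<Sum>x\<leftarrow>xs. (f x y :: 'u::comm_monoid_add))"
  by (induction xs) (simp_all add: sum_list_addf)

lemma tl_swap:
  "tensor_lift V W t (\<lambda>a b. tensor_lift X Y s (\<lambda>c d. \<beta> a b c d)) =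
   tensor_lift X Y s (\<lambda>c d. tensor_lift V W t (\<lambda>a b. \<beta> a b c d))"
  unfolding tl_reps by (rule sum_list_swap)

lemma tl_sum:
  "tensor_lift V W t (\<lambda>a b. \<Sum>i\<in>I. \<beta> a b i) = (\<Sum>i\<in>I. tensor_lift V W t (\<lambda>a b. \<beta> a b i))"
proof -
  have "(\<Sum>p\<leftarrow>ps. \<Sum>i\<in>I. f p i) = (\<Sum>i\<in>I. \<Sum>p\<leftarrow>ps. f p i)"
    for ps :: "('x \<times> 'y) list" and f :: "_ \<Rightarrow> _ \<Rightarrow> 'z::comm_monoid_add"
    by (induction ps) (simp_all add: sum.distrib)
  then show ?thesis unfolding tl_reps by simp
qed

lemma tl_sum_list:
  "tensor_lift V W t (\<lambda>a b. \<Sum>p\<leftarrow>ps. \<beta> a b p) = (\<Sum>p\<leftarrow>ps. tensor_lift V W t (\<lambda>a b. \<beta> a b p))"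
  unfolding tl_reps by (rule sum_list_swap)

lemma tl_times_left: "tensor_lift V W t (\<lambda>a b. c * \<beta> a b) = c * tensor_lift V W t \<beta>"
  for c :: "'k::field"
  unfolding tl_reps by (simp add: sum_list_const_mult)

lemma tl_times_right: "tensor_lift V W t (\<lambda>a b. \<beta> a b * c) = tensor_lift V W t \<beta> * c"
  for c :: "'k::field"
  unfolding tl_reps by (simp add: sum_list_mult_const)

lemma sum_list_apply: "(\<Sum>p\<leftarrow>ps. f p) x = (\<Sum>p\<leftarrow>ps. f p x :: 'u::monoid_add)"
  by (induction ps) auto

lemma tl_apply:
  fixes \<beta> :: "'v::ab_group_add \<Rightarrow> 'w::ab_group_add \<Rightarrow> 'i \<Rightarrow> 'u::ab_group_add"
  shows "tensor_lift V W t \<beta> x = tensor_lift V W t (\<lambda>a b. \<beta> a b x)"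
  unfolding tl_reps by (rule sum_list_apply)

text \<open>A linear map can be moved under a Sweedler sum of elements of its domain.\<close>

lemma tl_push:
  assumes "is_space V" "t \<in> carrier (V \<Otimes> W)" "is_space U" "linear_map U X f"
    "\<And>a b. a \<in> carrier V \<Longrightarrow> b \<in> carrier W \<Longrightarrow> \<beta> a b \<in> carrier U"
  shows "f (tensor_lift V W t \<beta>) = tensor_lift V W t (\<lambda>a b. f (\<beta> a b))"
    and "tensor_lift V W t \<beta> \<in> carrier U"
  using linear_map_sum_list[OF assms(3,4), of "reps V W t" "\<lambda>p. \<beta> (fst p) (snd p)"]
    reps(1)[OF assms(1,2)] assms(5)
  unfolding tl_reps by (auto simp: split_def subset_iff)

text \<open>Tensors are functions on bilinear forms, and their values are Sweedler sums.  This links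
  equations between tensors with equations between sums.\<close>

lemma tl_tensor_eval:
  assumes "is_space V" "t \<in> carrier (V \<Otimes> W)" "bilinear_map V W ground_space \<gamma>"
  shows "t \<gamma> = tensor_lift V W t \<gamma>"
  using bilinear_map_sum_list[OF assms(3) reps(1)[OF assms(1,2)]] reps(2)[OF assms(1,2)]
  by (simp add: tl_reps split_def)

lemma tl_tensor:
  "is_space U \<Longrightarrow> bilinear_map V W U \<beta> \<Longrightarrow> v \<in> carrier V \<Longrightarrow> w \<in> carrier W \<Longrightarrow>
   tensor_lift V W (tensor V W v w) \<beta> = \<beta> v w"
  by (rule tensor_lift_tensor)

lemma tl_self:
  assumes "is_space V" "t \<in> carrier (V \<Otimes> W)"
  shows "tensor_lift V W t (tensor V W) = t"
  using reps(2)[OF assms] by (simp add: tl_reps)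

lemma lin_tl_arg [lin]:
  assumes "is_space V" "is_space U" "linear_map X (V \<Otimes> W) f" "bilinear_map V W U \<beta>"
  shows "linear_map X U (\<lambda>x. tensor_lift V W (f x) \<beta>)"
  by (rule linear_map_comp[OF tensor_lift_linear[OF assms(1,2,4)] assms(3)])

lemma lin_tl_body [lin]:
  assumes "is_space V" "t \<in> carrier (V \<Otimes> W)" "is_space U"
    "\<And>a b. a \<in> carrier V \<Longrightarrow> b \<in> carrier W \<Longrightarrow> linear_map X U (\<lambda>x. \<beta> x a b)"
  shows "linear_map X U (\<lambda>x. tensor_lift V W t (\<beta> x))"
  unfolding tl_reps using reps(1)[OF assms(1,2)] assms(4)
  by (intro linear_map_sum_list_fun assms(3)) (auto simp: subset_iff)

declare bilinear_mapI [lin]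

lemma tl_in [lin]:
  assumes "is_space V" "t \<in> carrier (V \<Otimes> W)" "is_space U"
    "\<And>a b. a \<in> carrier V \<Longrightarrow> b \<in> carrier W \<Longrightarrow> \<beta> a b \<in> carrier U"
  shows "tensor_lift V W t \<beta> \<in> carrier U"
  by (rule tl_push(2)[OF assms(1-3) lin_id assms(4)])

text \<open>Elementary tensors vanish, by definition, at everything that is not a bilinear form; so only the values at
  bilinear forms matter.\<close>

lemma tensor_eqI:
  assumes "is_space V" "s \<in> carrier (V \<Otimes> W)" "t \<in> carrier (V \<Otimes> W)"
    "\<And>\<gamma>. bilinear_map V W ground_space \<gamma> \<Longrightarrow> tensor_lift V W s \<gamma> = tensor_lift V W t \<gamma>"
  shows "s = t"
proof
  fix \<gamma>
  have z: "r \<gamma> = 0" if "\<not> bilinear_map V W ground_space \<gamma>" "r \<in> carrier (V \<Otimes> W)" for r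
  proof -
    have "r \<gamma> = tensor_lift V W r (\<lambda>a b. tensor V W a b \<gamma>)"
      by (subst tl_self[OF assms(1) that(2), symmetric]) (rule tl_apply)
    then show ?thesis using that(1) by (simp add: tensor_not_bilinear tl_reps split_def)
  qed
  show "s \<gamma> = t \<gamma>"
    by (cases "bilinear_map V W ground_space \<gamma>")
     (use assms(1-4) z[of s] z[of t] in \<open>simp_all add: tl_tensor_eval\<close>)
qed

text \<open>Evaluates an equation in \<open>(V \<Otimes> W) \<Otimes> X\<close> at the bilinear form on \<open>(V \<Otimes> W) \<times> X\<close> that
  corresponds to the trilinear form \<open>\<beta>\<close>.\<close>

lemma tensor3_apply:
  assumes V: "is_space V" and W: "is_space W"
    and l: "\<And>b c. b \<in> carrier W \<Longrightarrow> c \<in> carrier X \<Longrightarrow> form V (\<lambda>a. \<beta> a b c)"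
      "\<And>a c. a \<in> carrier V \<Longrightarrow> c \<in> carrier X \<Longrightarrow> form W (\<lambda>b. \<beta> a b c)"
      "\<And>a b. a \<in> carrier V \<Longrightarrow> b \<in> carrier W \<Longrightarrow> form X (\<lambda>c. \<beta> a b c)"
    and t: "t \<in> carrier (V \<Otimes> W)"
  shows "tensor (V \<Otimes> W) X t c (\<lambda>t c. tensor_lift V W t (\<lambda>a b. \<beta> a b c)) = tensor_lift V W t (\<lambda>a b. \<beta> a b c)"
  by (rule tensor_apply) (assumption | rule lin sp V W l)+

section \<open>Hopf algebras in Sweedler notation\<close>

abbreviation sm ::
  "('k::field, 'a::ab_group_add, 'z) bialg_scheme \<Rightarrow> 'a \<Rightarrow> ('a \<Rightarrow> 'a \<Rightarrow> 'u::ab_group_add) \<Rightarrow> 'u" where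
  "sm A a \<beta> \<equiv> tensor_lift A A (comult A a) \<beta>"

lemma sm_sw: "sw A a \<beta> = sm A a \<beta>"
  by (simp add: sw_def)

lemma tl_tl:
  assumes "is_space V" "is_space W" "is_space X" "t \<in> carrier (X \<Otimes> Y)" "is_space U" "bilinear_map V W U \<beta>"
    "\<And>a b. a \<in> carrier X \<Longrightarrow> b \<in> carrier Y \<Longrightarrow> F a b \<in> carrier (V \<Otimes> W)"
  shows "tensor_lift V W (tensor_lift X Y t F) \<beta> = tensor_lift X Y t (\<lambda>a b. tensor_lift V W (F a b) \<beta>)"
  by (rule tl_push(1)[OF assms(3,4) is_space_tensor tensor_lift_linear[OF assms(1,5,6)] assms(7)])

locale hopf_alg =
  fixes A :: "('k::field, 'a::ab_group_add, 'z) hopf_scheme" (structure)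
  assumes hopf: "is_hopf_algebra A"
begin

lemmas hopf_unfold = hopf[unfolded is_hopf_algebra_def is_bialgebra_def is_algebra_def is_coalgebra_def
    is_antipode_def sm_sw]

lemma space [sp, lin]: "is_space A" using hopf_unfold by blast
lemma bilinear_mult: "bilinear_map A A A (mult A)" using hopf_unfold by blast
lemma one_in [lin, simp]: "\<one> \<in> carrier A" using hopf_unfold by blast
lemma linear_comult: "linear_map A (A \<Otimes> A) (comult A)" using hopf_unfold by blast
lemma linear_counit: "form A (counit A)" using hopf_unfold by blast
lemma linear_antipode: "linear_map A A (antipode A)" using hopf_unfold by blast

lemma mult_in [lin, simp]: "a \<in> carrier A \<Longrightarrow> b \<in> carrier A \<Longrightarrow> a \<cdot> b \<in> carrier A"
  using bilinear_mult by (auto simp: bilinear_map_def linear_map_def)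
lemma comult_in [lin, simp]: "a \<in> carrier A \<Longrightarrow> comult A a \<in> carrier (A \<Otimes> A)"
  by (rule linear_map_in[OF linear_comult])
lemma antipode_in [lin, simp]: "a \<in> carrier A \<Longrightarrow> antipode A a \<in> carrier A"
  by (rule linear_map_in[OF linear_antipode])

lemmas lin_mult_left [lin] = linear_map_comp_left[OF bilinear_mult]
lemmas lin_mult_right [lin] = linear_map_comp_right[OF bilinear_mult]
lemmas lin_comult [lin] = linear_map_comp[OF linear_comult]
lemmas lin_counit [lin] = linear_map_comp[OF linear_counit]
lemmas lin_antipode [lin] = linear_map_comp[OF linear_antipode]

lemma mult_assoc: "a \<in> carrier A \<Longrightarrow> b \<in> carrier A \<Longrightarrow> c \<in> carrier A \<Longrightarrow>
    a \<cdot> b \<cdot> c = a \<cdot> (b \<cdot> c)"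
  using hopf_unfold by blast
lemma one_mult [simp]: "a \<in> carrier A \<Longrightarrow> \<one> \<cdot> a = a"
  and mult_one [simp]: "a \<in> carrier A \<Longrightarrow> a \<cdot> \<one> = a"
  using hopf_unfold by blast+
lemma counit_mult: "a \<in> carrier A \<Longrightarrow> b \<in> carrier A \<Longrightarrow> counit A (a \<cdot> b) = counit A a * counit A b"
  and counit_one [simp]: "counit A \<one> = 1"
  using hopf_unfold by blast+

lemma sm_cong:
  assumes "c \<in> carrier A" "\<And>a b. a \<in> carrier A \<Longrightarrow> b \<in> carrier A \<Longrightarrow> \<beta> a b = \<beta>' a b"
  shows "sm A c \<beta> = sm A c \<beta>'"
  by (rule tl_cong[OF space comult_in[OF assms(1)] assms(2)])

lemma coassoc:
  assumes c: "c \<in> carrier A"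
    and l: "\<And>b c. b \<in> carrier A \<Longrightarrow> c \<in> carrier A \<Longrightarrow> form A (\<lambda>a. \<beta> a b c)"
      "\<And>a c. a \<in> carrier A \<Longrightarrow> c \<in> carrier A \<Longrightarrow> form A (\<lambda>b. \<beta> a b c)"
      "\<And>a b. a \<in> carrier A \<Longrightarrow> b \<in> carrier A \<Longrightarrow> form A (\<lambda>c. \<beta> a b c)"
  shows "sm A c (\<lambda>x c3. sm A x (\<lambda>c1 c2. \<beta> c1 c2 c3)) = sm A c (\<lambda>c1 x. sm A x (\<lambda>c2 c3. \<beta> c1 c2 c3))"
proof -
  note [lin] = l
  let ?\<gamma> = "\<lambda>t c. tensor_lift A A t (\<lambda>a b. \<beta> a b c)"
  have g: "tensor (A \<Otimes> A) A (tensor A A a b) c ?\<gamma> = \<beta> a b c"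
    if "a \<in> carrier A" "b \<in> carrier A" "c \<in> carrier A" for a b c
    by (subst tensor3_apply; (assumption | rule lin that tl_tensor[OF is_space_ground])+)
  have "sm A c (\<lambda>x c3. sm A x (\<lambda>c1 c2. tensor (A \<Otimes> A) A (tensor A A c1 c2) c3 ?\<gamma>)) =
    sm A c (\<lambda>c1 x. sm A x (\<lambda>c2 c3. tensor (A \<Otimes> A) A (tensor A A c1 c2) c3 ?\<gamma>))"
  proof -
    have "sm A c (\<lambda>x c3. sm A x (\<lambda>c1 c2. tensor (A \<Otimes> A) A (tensor A A c1 c2) c3)) =
      sm A c (\<lambda>c1 x. sm A x (\<lambda>c2 c3. tensor (A \<Otimes> A) A (tensor A A c1 c2) c3))"
      using hopf_unfold c by blast
    from arg_cong[where f = "\<lambda>t. t ?\<gamma>", OF this] show ?thesis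
      by (simp only: tl_apply)
  qed
  then show ?thesis
    by (simp add: c g space cong: sm_cong)
qed

lemma counit_left: "c \<in> carrier A \<Longrightarrow> form A \<beta> \<Longrightarrow> sm A c (\<lambda>a b. counit A a * \<beta> b) = \<beta> c"
proof -
  assume c: "c \<in> carrier A" and b: "form A \<beta>"
  have "\<beta> c = \<beta> (sm A c (\<lambda>a b. scale A (counit A a) b))" using hopf_unfold c by simp
  also have "\<dots> = sm A c (\<lambda>x y. \<beta> (scale A (counit A x) y))"
    by (rule tl_push) (assumption | rule lin c b)+
  also have "\<dots> = sm A c (\<lambda>x y. counit A x * \<beta> y)"
    using form_scale[OF b] by (simp add: c cong: sm_cong)
  finally show ?thesis by simp
qed

lemma counit_right: "c \<in> carrier A \<Longrightarrow> form A \<beta> \<Longrightarrow> sm A c (\<lambda>a b. counit A b * \<beta> a) = \<beta> c"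
proof -
  assume c: "c \<in> carrier A" and b: "form A \<beta>"
  have "\<beta> c = \<beta> (sm A c (\<lambda>a b. scale A (counit A b) a))" using hopf_unfold c by simp
  also have "\<dots> = sm A c (\<lambda>x y. \<beta> (scale A (counit A y) x))"
    by (rule tl_push) (assumption | rule lin c b)+
  also have "\<dots> = sm A c (\<lambda>x y. counit A y * \<beta> x)"
    using form_scale[OF b] by (simp add: c cong: sm_cong)
  finally show ?thesis by simp
qed

lemma comult_mult:
  assumes "a \<in> carrier A" "b \<in> carrier A" "is_space U" "bilinear_map A A U \<beta>"
  shows "sm A (a \<cdot> b) \<beta> =
    sm A a (\<lambda>a1 a2. sm A b (\<lambda>b1 b2. \<beta> (a1 \<cdot> b1) (a2 \<cdot> b2)))"
proof -
  have "comult A (a \<cdot> b) = sm A a (\<lambda>a1 a2. sm A b (\<lambda>b1 b2. tensor A A (a1 \<cdot> b1) (a2 \<cdot> b2)))"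
    using hopf_unfold assms by blast
  then have "sm A (a \<cdot> b) \<beta> = sm A a (\<lambda>a1 a2. tensor_lift A A (sm A b (\<lambda>b1 b2.
      tensor A A (a1 \<cdot> b1) (a2 \<cdot> b2))) \<beta>)"
    by (simp only:) (rule tl_tl; (assumption | rule assms lin sp)+)
  also have "\<dots> = sm A a (\<lambda>a1 a2. sm A b (\<lambda>b1 b2. tensor_lift A A (
      tensor A A (a1 \<cdot> b1) (a2 \<cdot> b2)) \<beta>))"
    by (intro sm_cong assms tl_tl; (assumption | rule assms lin sp)+)
  also have "\<dots> = sm A a (\<lambda>a1 a2. sm A b (\<lambda>b1 b2. \<beta> (a1 \<cdot> b1) (a2 \<cdot> b2)))"
    by (intro sm_cong assms tl_tensor; (assumption | rule assms lin sp)+)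
  finally show ?thesis .
qed

lemma comult_one:
  assumes "is_space U" "bilinear_map A A U \<beta>"
  shows "sm A \<one> \<beta> = \<beta> \<one> \<one>"
proof -
  have "comult A \<one> = tensor A A \<one> \<one>" using hopf_unfold by blast
  then show ?thesis by (simp add: tl_tensor[OF assms])
qed

lemma antipode_left:
  assumes "c \<in> carrier A" "form A \<beta>"
  shows "sm A c (\<lambda>a b. \<beta> (antipode A a \<cdot> b)) = counit A c * \<beta> \<one>"
proof -
  have "sm A c (\<lambda>a b. \<beta> (antipode A a \<cdot> b)) = \<beta> (sm A c (\<lambda>a b. antipode A a \<cdot> b))"
    by (rule tl_push(1)[symmetric]) (assumption | rule lin assms)+
  then show ?thesis using hopf_unfold assms by (simp add: form_scale)
qed

lemma antipode_right:
  assumes "c \<in> carrier A" "form A \<beta>"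
  shows "sm A c (\<lambda>a b. \<beta> (a \<cdot> antipode A b)) = counit A c * \<beta> \<one>"
proof -
  have "sm A c (\<lambda>a b. \<beta> (a \<cdot> antipode A b)) = \<beta> (sm A c (\<lambda>a b. a \<cdot> antipode A b))"
    by (rule tl_push(1)[symmetric]) (assumption | rule lin assms)+
  then show ?thesis using hopf_unfold assms by (simp add: form_scale)
qed

lemma antipode_one [simp]: "antipode A \<one> = \<one>"
proof (rule eq_by_forms[OF space])
  fix \<phi> assume f: "form A \<phi>"
  note [lin] = linear_map_comp[OF f]
  have "sm A \<one> (\<lambda>a b. \<phi> (antipode A a \<cdot> b)) = \<phi> (antipode A \<one> \<cdot> \<one>)"
    by (rule comult_one) (assumption | rule lin sp)+
  then show "\<phi> (antipode A \<one>) = \<phi> \<one>"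
    using antipode_left[OF one_in f] by simp
qed auto

lemma counit_antipode:
  assumes x: "x \<in> carrier A" shows "counit A (antipode A x) = counit A x"
proof -
  have "counit A (antipode A x) = sm A x (\<lambda>a b. counit A b * counit A (antipode A a))"
    by (rule counit_right[symmetric]) (assumption | rule lin x)+
  also have "\<dots> = sm A x (\<lambda>a b. counit A (antipode A a \<cdot> b))"
    by (intro sm_cong x) (simp add: counit_mult)
  also have "\<dots> = counit A x"
    using antipode_left[OF x linear_counit] by simp
  finally show ?thesis .
qed

text \<open>The product \<open>S(y) S(x)\<close> is expanded to \<open>S(x\<^sub>1 y\<^sub>1) (x\<^sub>2 y\<^sub>2) S(y\<^sub>3) S(x\<^sub>3)\<close> by inserting
  \<open>\<epsilon>(x\<^sub>1 y\<^sub>1)\<close>, and then contracted from the inside.\<close>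

lemma antipode_mult:
  assumes x: "x \<in> carrier A" and y: "y \<in> carrier A"
  shows "antipode A (x \<cdot> y) = antipode A y \<cdot> antipode A x"
proof (rule eq_by_forms[OF space])
  fix \<phi> assume f: "form A \<phi>"
  note [lin] = linear_map_comp[OF f]
  let ?S = "antipode A"
  have "\<phi> (?S y \<cdot> ?S x) = sm A x (\<lambda>x1 x2. counit A x1 * \<phi> (?S y \<cdot> ?S x2))"
    by (rule counit_left[symmetric]) (assumption | rule lin x y)+
  also have "\<dots> = sm A x (\<lambda>x1 x2. sm A y (\<lambda>y1 y2. counit A y1 * (counit A x1 * \<phi> (?S y2 \<cdot> ?S x2))))"
    by (intro sm_cong x counit_left[symmetric]; (assumption | rule lin x y)+)
  also have "\<dots> = sm A x (\<lambda>x1 x2. sm A y (\<lambda>y1 y2.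
      counit A (x1 \<cdot> y1) * \<phi> (\<one> \<cdot> (?S y2 \<cdot> ?S x2))))"
    by (intro sm_cong x y) (simp add: counit_mult)
  also have "\<dots> = sm A x (\<lambda>x1 x2. sm A y (\<lambda>y1 y2.
      sm A (x1 \<cdot> y1) (\<lambda>a b. \<phi> (?S a \<cdot> b \<cdot> (?S y2 \<cdot> ?S x2)))))"
    by (intro sm_cong x y antipode_left[symmetric]; (assumption | rule lin x y)+)
  also have "\<dots> = sm A x (\<lambda>x1 x2. sm A y (\<lambda>y1 y2. sm A x1 (\<lambda>a b. sm A y1 (\<lambda>c d.
      \<phi> (?S (a \<cdot> c) \<cdot> (b \<cdot> d) \<cdot> (?S y2 \<cdot> ?S x2))))))"
    by (intro sm_cong x y comult_mult; (assumption | rule lin sp x y)+)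
  also have "\<dots> = sm A x (\<lambda>x1 x2. sm A x1 (\<lambda>a b. sm A y (\<lambda>y1 y2. sm A y1 (\<lambda>c d.
      \<phi> (?S (a \<cdot> c) \<cdot> (b \<cdot> (d \<cdot> ?S y2 \<cdot> ?S x2)))))))"
    by (subst tl_swap[where V = A and t = "comult A y"], intro sm_cong x y) (simp_all add: mult_assoc)
  also have "\<dots> = sm A x (\<lambda>x1 x2. sm A x1 (\<lambda>a b. sm A y (\<lambda>c v. sm A v (\<lambda>d y2.
      \<phi> (?S (a \<cdot> c) \<cdot> (b \<cdot> (d \<cdot> ?S y2 \<cdot> ?S x2)))))))"
    by (intro sm_cong x y coassoc; (assumption | rule lin sp x y)+)
  also have "\<dots> = sm A x (\<lambda>x1 x2. sm A x1 (\<lambda>a b. sm A y (\<lambda>c v. counit A v *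
      \<phi> (?S (a \<cdot> c) \<cdot> (b \<cdot> (\<one> \<cdot> ?S x2))))))"
    by (intro sm_cong x y antipode_right; (assumption | rule lin sp x y)+)
  also have "\<dots> = sm A x (\<lambda>x1 x2. sm A x1 (\<lambda>a b.
      \<phi> (?S (a \<cdot> y) \<cdot> (b \<cdot> (\<one> \<cdot> ?S x2)))))"
    by (intro sm_cong x y counit_right; (assumption | rule lin sp x y)+)
  also have "\<dots> = sm A x (\<lambda>x1 x2. sm A x1 (\<lambda>a b.
      \<phi> (?S (a \<cdot> y) \<cdot> (b \<cdot> ?S x2))))"
    by (intro sm_cong x y) simp_all
  also have "\<dots> = sm A x (\<lambda>a v. sm A v (\<lambda>b x2.
      \<phi> (?S (a \<cdot> y) \<cdot> (b \<cdot> ?S x2))))"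
    by (intro sm_cong x y coassoc; (assumption | rule lin sp x y)+)
  also have "\<dots> = sm A x (\<lambda>a v. counit A v * \<phi> (?S (a \<cdot> y) \<cdot> \<one>))"
    by (intro sm_cong x y antipode_right; (assumption | rule lin sp x y)+)
  also have "\<dots> = \<phi> (?S (x \<cdot> y) \<cdot> \<one>)"
    by (rule counit_right) (assumption | rule lin sp x y)+
  finally show "\<phi> (?S (x \<cdot> y)) = \<phi> (?S y \<cdot> ?S x)" using x y by simp
qed (use x y in auto)

end

section \<open>Dual spaces\<close>

lemma restrict0_apply [simp]: "v \<in> carrier V \<Longrightarrow> restrict0 V f v = f v"
  by (simp add: restrict0_def)

lemma restrict0_outside [simp]: "v \<notin> carrier V \<Longrightarrow> restrict0 V f v = 0"
  by (simp add: restrict0_def)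

lemma dual_space_carrier:
  "f \<in> carrier (dual_space V) \<longleftrightarrow> form V f \<and> (\<forall>v. v \<notin> carrier V \<longrightarrow> f v = 0)"
  by (simp add: dual_space_def)

lemma dual_sel [simp]:
  "carrier (dual A) = carrier (dual_space A)" "scale (dual A) = fscale" "scale (dual_space V) = fscale"
  "one_el (dual A) = restrict0 A (counit A)" "counit (dual A) f = f \<one>\<^bsub>A\<^esub>"
  "antipode (dual A) f = restrict0 A (\<lambda>a. f (antipode A a))"
  by (simp_all add: dual_def dual_space_def)

lemma dual_form: "f \<in> carrier (dual_space V) \<Longrightarrow> form V f"
  by (simp add: dual_space_carrier)

lemma dual_eqI:
  assumes "f \<in> carrier (dual_space V)" "g \<in> carrier (dual_space V)"
    "\<And>v. v \<in> carrier V \<Longrightarrow> f v = g v"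
  shows "f = g"
proof
  fix v show "f v = g v" using assms by (cases "v \<in> carrier V") (auto simp: dual_space_carrier)
qed

lemma is_space_dual_space [sp]: "is_space (dual_space V)"
proof -
  have "module.subspace fscale (carrier (dual_space V))"
    unfolding module.subspace_def[OF vector_space_fscale[folded module_iff_vector_space]]
    by (auto simp: dual_space_carrier linear_map_def ground_space_def fscale_def algebra_simps)
  then show ?thesis by (simp add: is_space_def vector_space_fscale)
qed

lemma is_space_dual [sp]: "is_space (dual A)"
  using is_space_dual_space[of A] by (simp add: is_space_def)

lemma restrict0_in_dual [lin]: "is_space V \<Longrightarrow> form V (\<lambda>v. f v) \<Longrightarrow> restrict0 V (\<lambda>v. f v) \<in> carrier (dual_space V)"
  unfolding dual_space_carrier by (subst linear_map_cong[of V "restrict0 V f" f]) auto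

lemma lin_eval [lin]: "form (dual_space A) (\<lambda>f. f a)" "form (dual A) (\<lambda>f. f a)"
  by (simp_all add: linear_map_def ground_space_def fscale_def)

text \<open>Linearity of a map into a dual space can be checked pointwise.\<close>

lemma linear_map_dualI:
  assumes "\<And>v. v \<in> carrier V \<Longrightarrow> F v \<in> carrier (dual_space A)"
    "\<And>a. a \<in> carrier A \<Longrightarrow> form V (\<lambda>v. F v a)" "is_space V"
  shows "linear_map V (dual_space A) F" "linear_map V (dual A) F"
proof -
  have "\<forall>a. form V (\<lambda>v. F v a)"
  proof
    fix a show "form V (\<lambda>v. F v a)"
      using assms by (cases "a \<in> carrier A")
        (auto simp: dual_space_carrier linear_map_def ground_space_def carrier_add carrier_scale)
  qed
  then show "linear_map V (dual_space A) F" "linear_map V (dual A) F"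
    using assms(1) by (auto simp: linear_map_def ground_space_def fscale_def fun_eq_iff)
qed

lemma bilinear_map_cong_space:
  assumes "carrier V = carrier V'" "scale V = scale V'" "carrier W = carrier W'" "scale W = scale W'"
    "carrier U = carrier U'" "scale U = scale U'"
  shows "bilinear_map V W U = bilinear_map V' W' U'"
  by (intro ext) (simp add: bilinear_map_def linear_map_def assms)

text \<open>Tensor products see only the carrier and the scalar multiplication.  This identifies tensors over records
  that extend the same space, such as a dual Hopf algebra and the dual space.\<close>

lemma tensor_cong_space:
  fixes V :: "('k::field, 'v::ab_group_add, 'y) space_scheme" and V' :: "('k, 'v, 'y2) space_scheme"
    and W :: "('k, 'w::ab_group_add, 'z) space_scheme" and W' :: "('k, 'w, 'z2) space_scheme"
  assumes "carrier V = carrier V'" "scale V = scale V'" "carrier W = carrier W'" "scale W = scale W'"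
  shows "tensor V W = tensor V' W'" "V \<Otimes> W = V' \<Otimes> W'" "tensor_lift V W = tensor_lift V' W'"
proof -
  have b: "bilinear_map V W (ground_space :: ('k,'k) space) = bilinear_map V' W' ground_space"
    by (rule bilinear_map_cong_space) (simp_all add: assms)
  then show t: "tensor V W = tensor V' W'" by (simp add: tensor_def fun_eq_iff)
  show "V \<Otimes> W = V' \<Otimes> W'" by (simp add: tensor_space_def t assms)
  show "tensor_lift V W = tensor_lift V' W'"
    by (simp add: tensor_lift_def fun_eq_iff t assms)
qed

lemma dual_tensor:
  "tensor (dual A) (dual B) = tensor (dual_space A) (dual_space B)"
  "dual A \<Otimes> dual B = dual_space A \<Otimes> dual_space B"
  "tensor_lift (dual A) (dual B) = tensor_lift (dual_space A) (dual_space B)"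
  by (rule tensor_cong_space; simp)+

section \<open>Dual bases\<close>

text \<open>The functionals dual to the chosen basis.\<close>

definition coord :: "('k::field, 'v::ab_group_add, 'z) space_scheme \<Rightarrow> 'v \<Rightarrow> 'v \<Rightarrow> 'k" where
  "coord V b = restrict0 V (\<lambda>v. module.representation (scale V) (some_basis V) v b)"

lemma some_basis:
  assumes V: "is_space V" and fin: "finite_dimensional V"
  shows "finite (some_basis V)" "some_basis V \<subseteq> carrier V"
    "v \<in> carrier V \<Longrightarrow> (\<Sum>b\<in>some_basis V. scale V (coord V b v) b) = v"
    "coord V b \<in> carrier (dual_space V)"
proof -
  interpret V: vector_space "scale V" using V by (simp add: is_space_def)
  have sub: "V.subspace (carrier V)" using V by (simp add: is_space_def)
  obtain B where "B \<subseteq> carrier V" "V.independent B" "carrier V \<subseteq> V.span B"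
    using V.maximal_independent_subset[of "carrier V"] by blast
  then have "B \<subseteq> carrier V \<and> \<not> V.dependent B \<and> V.span B = carrier V"
    using V.span_minimal[OF _ sub] by blast
  then have B: "some_basis V \<subseteq> carrier V \<and> \<not> V.dependent (some_basis V) \<and> V.span (some_basis V) = carrier V"
    unfolding some_basis_def by (rule someI)
  obtain B' where "finite B'" "carrier V = V.span B'" using fin by (auto simp: finite_dimensional_def)
  then show f: "finite (some_basis V)" using V.independent_span_bound[of B' "some_basis V"] B by blast
  show "some_basis V \<subseteq> carrier V" using B by blast
  show "(\<Sum>b\<in>some_basis V. scale V (coord V b v) b) = v" if "v \<in> carrier V"
    using V.sum_representation_eq[of "some_basis V" v "some_basis V"] B f that by (simp add: coord_def)
  show "coord V b \<in> carrier (dual_space V)" unfolding coord_def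
    by (rule restrict0_in_dual[OF V])
      (use B in \<open>simp add: linear_map_def ground_space_def V.representation_add V.representation_scale\<close>)
qed

lemma form_expand:
  assumes V: "is_space V" and \<phi>: "form V \<phi>" and x: "x = (\<Sum>i\<in>I. scale V (e i) (v i))"
    and v: "\<And>i. i \<in> I \<Longrightarrow> v i \<in> carrier V"
  shows "\<phi> x = (\<Sum>i\<in>I. e i * \<phi> (v i))"
  unfolding x by (subst linear_map_sum(1)[OF V \<phi>]) (auto simp: carrier_scale V v form_scale[OF \<phi>])

lemma biform_expand:
  assumes V: "is_space V" and W: "is_space W"
    and \<gamma>: "bilinear_map V W ground_space \<gamma>"
    and ev: "x = (\<Sum>i\<in>I. scale V (e i) (v i))" "\<And>i. i \<in> I \<Longrightarrow> v i \<in> carrier V"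
    and ew: "y = (\<Sum>j\<in>J. scale W (f j) (w j))" "\<And>j. j \<in> J \<Longrightarrow> w j \<in> carrier W"
    and x: "x \<in> carrier V" and y: "y \<in> carrier W"
  shows "\<gamma> x y = (\<Sum>i\<in>I. \<Sum>j\<in>J. \<gamma> (v i) (w j) * (e i * f j))"
proof -
  have "\<gamma> x y = (\<Sum>i\<in>I. e i * \<gamma> (v i) y)"
    by (rule form_expand[OF V bilinear_map_left[OF \<gamma> y] ev])
  also have "\<dots> = (\<Sum>i\<in>I. e i * (\<Sum>j\<in>J. f j * \<gamma> (v i) (w j)))"
    by (intro sum.cong arg_cong2[where f = "(*)"] refl form_expand[OF W bilinear_map_right[OF \<gamma>] ew] ev)
  also have "\<dots> = (\<Sum>i\<in>I. \<Sum>j\<in>J. \<gamma> (v i) (w j) * (e i * f j))"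
    unfolding sum_distrib_left by (intro sum.cong refl) (simp add: ac_simps)
  finally show ?thesis .
qed

text \<open>Bilinear forms are combinations of the products of coordinate functions, so it suffices to test
  two tensors on these.\<close>

lemma tensor_eq_by_coordinates:
  assumes V: "is_space V" and W: "is_space W"
    and ev: "\<And>x. x \<in> carrier V \<Longrightarrow> x = (\<Sum>i\<in>I. scale V (e i x) (v i))" "\<And>i. i \<in> I \<Longrightarrow> v i \<in> carrier V"
    and ew: "\<And>y. y \<in> carrier W \<Longrightarrow> y = (\<Sum>j\<in>J. scale W (f j y) (w j))" "\<And>j. j \<in> J \<Longrightarrow> w j \<in> carrier W"
    and st: "s \<in> carrier (V \<Otimes> W)" "t \<in> carrier (V \<Otimes> W)"
    and eq: "\<And>i j. i \<in> I \<Longrightarrow> j \<in> J \<Longrightarrow>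
      tensor_lift V W s (\<lambda>x y. e i x * f j y) = tensor_lift V W t (\<lambda>x y. e i x * f j y)"
  shows "s = t"
proof (rule tensor_eqI[OF V st])
  fix \<gamma> assume \<gamma>: "bilinear_map V W ground_space \<gamma>"
  have "tensor_lift V W r \<gamma> = (\<Sum>i\<in>I. \<Sum>j\<in>J. \<gamma> (v i) (w j) * tensor_lift V W r (\<lambda>x y. e i x * f j y))"
    if r: "r \<in> carrier (V \<Otimes> W)" for r
  proof -
    have "tensor_lift V W r \<gamma> = tensor_lift V W r (\<lambda>x y. \<Sum>i\<in>I. \<Sum>j\<in>J. \<gamma> (v i) (w j) * (e i x * f j y))"
      by (rule tl_cong[OF V r], rule biform_expand[OF V W \<gamma>]) (auto intro: ev ew)
    then show ?thesis by (simp add: tl_sum tl_times_left)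
  qed
  then show "tensor_lift V W s \<gamma> = tensor_lift V W t \<gamma>" using st eq by simp
qed

lemma dual_expand:
  assumes V: "is_space V" and fin: "finite_dimensional V" and f: "f \<in> carrier (dual_space V)"
  shows "f = (\<Sum>b\<in>some_basis V. scale (dual_space V) (f b) (coord V b))"
proof (rule dual_eqI[OF f])
  note B = some_basis[OF V fin]
  show "(\<Sum>b\<in>some_basis V. scale (dual_space V) (f b) (coord V b)) \<in> carrier (dual_space V)"
    by (rule linear_map_sum(2)[OF _ lin_id]) (auto simp: is_space_dual_space intro!: carrier_scale B simp del: dual_sel)
  fix v assume v: "v \<in> carrier V"
  have "f v = (\<Sum>b\<in>some_basis V. coord V b v * f b)"
    by (rule form_expand[OF V dual_form[OF f]]) (use B v in auto)
  also have "\<dots> = (\<Sum>b\<in>some_basis V. scale (dual_space V) (f b) (coord V b)) v"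
    using B(1) by (induction rule: finite_induct) (auto simp: fscale_def)
  finally show "f v = (\<Sum>b\<in>some_basis V. scale (dual_space V) (f b) (coord V b)) v" .
qed

text \<open>The coordinates of a functional in the dual basis are its values at basis vectors; therefore the
  evaluations at pairs of vectors include all products of coordinates.\<close>

lemma dual_tensor_eqI:
  assumes "is_space V" "finite_dimensional V" "is_space W" "finite_dimensional W"
    and "s \<in> carrier (dual_space V \<Otimes> dual_space W)" "t \<in> carrier (dual_space V \<Otimes> dual_space W)"
    and eq: "\<And>x y. x \<in> carrier V \<Longrightarrow> y \<in> carrier W \<Longrightarrow>
      tensor_lift (dual_space V) (dual_space W) s (\<lambda>f g. f x * g y) =
      tensor_lift (dual_space V) (dual_space W) t (\<lambda>f g. f x * g y)"
  shows "s = t"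
proof (rule tensor_eq_by_coordinates[where e = "\<lambda>b f. f b" and v = "coord V" and I = "some_basis V"
      and f = "\<lambda>b f. f b" and w = "coord W" and J = "some_basis W", OF is_space_dual_space is_space_dual_space])
  fix i j assume "i \<in> some_basis V" "j \<in> some_basis W"
  then have "i \<in> carrier V" "j \<in> carrier W"
    using some_basis(2)[OF assms(1,2)] some_basis(2)[OF assms(3,4)] by auto
  then show "tensor_lift (dual_space V) (dual_space W) s (\<lambda>f g. f i * g j) =
      tensor_lift (dual_space V) (dual_space W) t (\<lambda>f g. f i * g j)" by (rule eq)
qed (rule assms dual_expand some_basis(4); assumption?)+

section \<open>Bialgebras and antipodes from multilinear forms\<close>

text \<open>Restriction along \<open>(a, b, c) \<mapsto> (a \<otimes> b, c)\<close> turns bilinear forms on \<open>(C \<Otimes> C) \<times> C\<close> into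
  trilinear ones; at anything that is not bilinear both sides are 0.\<close>

lemma coassocI:
  assumes C: "is_space C" "linear_map C (C \<Otimes> C) (comult C)" and c: "c \<in> carrier C"
    and eq: "\<And>\<beta>. (\<And>b c. b \<in> carrier C \<Longrightarrow> c \<in> carrier C \<Longrightarrow> form C (\<lambda>a. \<beta> a b c)) \<Longrightarrow>
      (\<And>a c. a \<in> carrier C \<Longrightarrow> c \<in> carrier C \<Longrightarrow> form C (\<lambda>b. \<beta> a b c)) \<Longrightarrow>
      (\<And>a b. a \<in> carrier C \<Longrightarrow> b \<in> carrier C \<Longrightarrow> form C (\<lambda>c. \<beta> a b c)) \<Longrightarrow>
      sm C c (\<lambda>x c3. sm C x (\<lambda>c1 c2. \<beta> c1 c2 c3)) = sm C c (\<lambda>c1 x. sm C x (\<lambda>c2 c3. \<beta> c1 c2 c3))"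
  shows "sm C c (\<lambda>x c3. sm C x (\<lambda>c1 c2. tensor (C \<Otimes> C) C (tensor C C c1 c2) c3)) =
         sm C c (\<lambda>c1 x. sm C x (\<lambda>c2 c3. tensor (C \<Otimes> C) C (tensor C C c1 c2) c3))"
proof
  fix \<gamma>
  show "sm C c (\<lambda>x c3. sm C x (\<lambda>c1 c2. tensor (C \<Otimes> C) C (tensor C C c1 c2) c3)) \<gamma> =
        sm C c (\<lambda>c1 x. sm C x (\<lambda>c2 c3. tensor (C \<Otimes> C) C (tensor C C c1 c2) c3)) \<gamma>"
  proof (cases "bilinear_map (C \<Otimes> C) C ground_space \<gamma>")
    case True
    note [lin] = linear_map_comp_left[OF True] linear_map_comp_right[OF True]
    show ?thesis unfolding tl_apply tensor_apply[OF True]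
      by (rule eq) (assumption | rule lin sp C)+
  next
    case False
    then show ?thesis unfolding tl_apply by (simp add: tensor_not_bilinear tl_reps)
  qed
qed

text \<open>The axioms in the form in which they can be verified by Sweedler computations with scalar values.\<close>

lemma bialgebraI:
  fixes B :: "('k::field, 'b::ab_group_add, 'w) bialg_scheme"
  assumes B: "is_space B" and mult: "bilinear_map B B B (mult B)" and one: "\<one>\<^bsub>B\<^esub> \<in> carrier B"
    and assoc: "\<And>a b c. a \<in> carrier B \<Longrightarrow> b \<in> carrier B \<Longrightarrow> c \<in> carrier B \<Longrightarrow>
      a \<cdot>\<^bsub>B\<^esub> b \<cdot>\<^bsub>B\<^esub> c = a \<cdot>\<^bsub>B\<^esub> (b \<cdot>\<^bsub>B\<^esub> c)"
    and unit: "\<And>a. a \<in> carrier B \<Longrightarrow> \<one>\<^bsub>B\<^esub> \<cdot>\<^bsub>B\<^esub> a = a" "\<And>a. a \<in> carrier B \<Longrightarrow> a \<cdot>\<^bsub>B\<^esub> \<one>\<^bsub>B\<^esub> = a"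
    and comult: "linear_map B (B \<Otimes> B) (comult B)" and counit: "form B (counit B)"
    and coassoc: "\<And>\<beta> c. c \<in> carrier B \<Longrightarrow>
      (\<And>b c. b \<in> carrier B \<Longrightarrow> c \<in> carrier B \<Longrightarrow> form B (\<lambda>a. \<beta> a b c)) \<Longrightarrow>
      (\<And>a c. a \<in> carrier B \<Longrightarrow> c \<in> carrier B \<Longrightarrow> form B (\<lambda>b. \<beta> a b c)) \<Longrightarrow>
      (\<And>a b. a \<in> carrier B \<Longrightarrow> b \<in> carrier B \<Longrightarrow> form B (\<lambda>c. \<beta> a b c)) \<Longrightarrow>
      sm B c (\<lambda>x c3. sm B x (\<lambda>c1 c2. \<beta> c1 c2 c3)) = sm B c (\<lambda>c1 x. sm B x (\<lambda>c2 c3. \<beta> c1 c2 c3))"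
    and counit_left: "\<And>\<phi> c. c \<in> carrier B \<Longrightarrow> form B \<phi> \<Longrightarrow> sm B c (\<lambda>a b. counit B a * \<phi> b) = \<phi> c"
    and counit_right: "\<And>\<phi> c. c \<in> carrier B \<Longrightarrow> form B \<phi> \<Longrightarrow> sm B c (\<lambda>a b. counit B b * \<phi> a) = \<phi> c"
    and comult_mult: "\<And>\<gamma> a b. a \<in> carrier B \<Longrightarrow> b \<in> carrier B \<Longrightarrow> bilinear_map B B ground_space \<gamma> \<Longrightarrow>
      sm B (a \<cdot>\<^bsub>B\<^esub> b) \<gamma> = sm B a (\<lambda>a1 a2. sm B b (\<lambda>b1 b2. \<gamma> (a1 \<cdot>\<^bsub>B\<^esub> b1) (a2 \<cdot>\<^bsub>B\<^esub> b2)))"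
    and comult_one: "\<And>\<gamma>. bilinear_map B B ground_space \<gamma> \<Longrightarrow> sm B \<one>\<^bsub>B\<^esub> \<gamma> = \<gamma> \<one>\<^bsub>B\<^esub> \<one>\<^bsub>B\<^esub>"
    and counit_mult: "\<And>a b. a \<in> carrier B \<Longrightarrow> b \<in> carrier B \<Longrightarrow> counit B (a \<cdot>\<^bsub>B\<^esub> b) = counit B a * counit B b"
    and counit_one: "counit B \<one>\<^bsub>B\<^esub> = 1"
  shows "is_bialgebra B"
proof -
  note [lin, sp] = B
  note [lin] = one linear_map_comp_left[OF mult] linear_map_comp_right[OF mult]
    linear_map_in[OF comult] linear_map_comp[OF counit]
  have [lin]: "a \<cdot>\<^bsub>B\<^esub> b \<in> carrier B" if "a \<in> carrier B" "b \<in> carrier B" for a b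
    using mult that by (auto simp: bilinear_map_def linear_map_def)
  have coalg: "is_coalgebra B"
    unfolding is_coalgebra_def sm_sw
  proof (intro conjI ballI B comult counit coassocI coassoc; assumption?)
    fix c assume c: "c \<in> carrier B"
    show "sm B c (\<lambda>a b. scale B (counit B a) b) = c"
    proof (rule eq_by_forms[OF B])
      fix \<phi> assume f: "form B \<phi>"
      have "\<phi> (sm B c (\<lambda>a b. scale B (counit B a) b)) = sm B c (\<lambda>a b. \<phi> (scale B (counit B a) b))"
        by (rule tl_push(1)[OF _ _ _ f]) (assumption | rule lin c)+
      also have "\<dots> = sm B c (\<lambda>a b. counit B a * \<phi> b)"
        by (intro tl_cong[OF B linear_map_in[OF comult c]] form_scale[OF f])
      finally show "\<phi> (sm B c (\<lambda>a b. scale B (counit B a) b)) = \<phi> c" by (simp add: counit_left c f)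
    qed (assumption | rule lin c)+
    show "sm B c (\<lambda>a b. scale B (counit B b) a) = c"
    proof (rule eq_by_forms[OF B])
      fix \<phi> assume f: "form B \<phi>"
      have "\<phi> (sm B c (\<lambda>a b. scale B (counit B b) a)) = sm B c (\<lambda>a b. \<phi> (scale B (counit B b) a))"
        by (rule tl_push(1)[OF _ _ _ f]) (assumption | rule lin c)+
      also have "\<dots> = sm B c (\<lambda>a b. counit B b * \<phi> a)"
        by (intro tl_cong[OF B linear_map_in[OF comult c]] form_scale[OF f])
      finally show "\<phi> (sm B c (\<lambda>a b. scale B (counit B b) a)) = \<phi> c" by (simp add: counit_right c f)
    qed (assumption | rule lin c)+
  qed
  have 1: "comult B (a \<cdot>\<^bsub>B\<^esub> b) = sm B a (\<lambda>a1 a2. sm B b (\<lambda>b1 b2. tensor B B (a1 \<cdot>\<^bsub>B\<^esub> b1) (a2 \<cdot>\<^bsub>B\<^esub> b2)))" (is "_ = ?t")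
    if ab: "a \<in> carrier B" "b \<in> carrier B" for a b
  proof (rule tensor_eqI[OF B])
    show t: "?t \<in> carrier (B \<Otimes> B)" by (assumption | rule lin sp ab)+
    fix \<gamma> assume g: "bilinear_map B B ground_space \<gamma>"
    have "sm B (a \<cdot>\<^bsub>B\<^esub> b) \<gamma> = ?t \<gamma>"
      unfolding tl_apply tensor_apply[OF g] by (rule comult_mult[OF ab g])
    then show "sm B (a \<cdot>\<^bsub>B\<^esub> b) \<gamma> = tensor_lift B B ?t \<gamma>" by (simp add: tl_tensor_eval[OF B t g])
  qed (rule lin ab)+
  have 2: "comult B \<one>\<^bsub>B\<^esub> = tensor B B \<one>\<^bsub>B\<^esub> \<one>\<^bsub>B\<^esub>"
    by (rule tensor_eqI[OF B], (rule lin)+) (simp add: comult_one tl_tensor[OF is_space_ground] one)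
  show ?thesis
    unfolding is_bialgebra_def is_algebra_def sm_sw using 1 2
    by (auto simp: coalg B mult one assoc unit counit_mult counit_one)
qed

lemma antipodeI:
  fixes B :: "('k::field, 'b::ab_group_add, 'w) bialg_scheme"
  assumes B: "is_bialgebra B" and S: "linear_map B B S"
    and left: "\<And>\<phi> c. c \<in> carrier B \<Longrightarrow> form B \<phi> \<Longrightarrow> sm B c (\<lambda>a b. \<phi> (S a \<cdot>\<^bsub>B\<^esub> b)) = counit B c * \<phi> \<one>\<^bsub>B\<^esub>"
    and right: "\<And>\<phi> c. c \<in> carrier B \<Longrightarrow> form B \<phi> \<Longrightarrow> sm B c (\<lambda>a b. \<phi> (a \<cdot>\<^bsub>B\<^esub> S b)) = counit B c * \<phi> \<one>\<^bsub>B\<^esub>"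
  shows "is_antipode B S"
  unfolding is_antipode_def sm_sw
proof (intro conjI ballI S)
  have sp: "is_space B" and mult: "bilinear_map B B B (mult B)" and one: "\<one>\<^bsub>B\<^esub> \<in> carrier B"
    and comult: "linear_map B (B \<Otimes> B) (comult B)"
    using B by (simp_all add: is_bialgebra_def is_algebra_def is_coalgebra_def)
  have mult_in: "a \<cdot>\<^bsub>B\<^esub> b \<in> carrier B" if "a \<in> carrier B" "b \<in> carrier B" for a b
    using mult that by (auto simp: bilinear_map_def linear_map_def)
  note [lin] = sp one linear_map_in[OF comult] linear_map_in[OF S] mult_in
  fix c assume c: "c \<in> carrier B"
  show "sm B c (\<lambda>a b. S a \<cdot>\<^bsub>B\<^esub> b) = scale B (counit B c) \<one>\<^bsub>B\<^esub>"
  proof (rule eq_by_forms[OF sp])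
    fix \<phi> assume f: "form B \<phi>"
    have "\<phi> (sm B c (\<lambda>a b. S a \<cdot>\<^bsub>B\<^esub> b)) = sm B c (\<lambda>a b. \<phi> (S a \<cdot>\<^bsub>B\<^esub> b))"
      by (rule tl_push(1)[OF _ _ _ f]) (assumption | rule lin c)+
    then show "\<phi> (sm B c (\<lambda>a b. S a \<cdot>\<^bsub>B\<^esub> b)) = \<phi> (scale B (counit B c) \<one>\<^bsub>B\<^esub>)"
      by (simp add: left[OF c f] form_scale[OF f one])
  qed (assumption | rule lin c)+
  show "sm B c (\<lambda>a b. a \<cdot>\<^bsub>B\<^esub> S b) = scale B (counit B c) \<one>\<^bsub>B\<^esub>"
  proof (rule eq_by_forms[OF sp])
    fix \<phi> assume f: "form B \<phi>"
    have "\<phi> (sm B c (\<lambda>a b. a \<cdot>\<^bsub>B\<^esub> S b)) = sm B c (\<lambda>a b. \<phi> (a \<cdot>\<^bsub>B\<^esub> S b))"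
      by (rule tl_push(1)[OF _ _ _ f]) (assumption | rule lin c)+
    then show "\<phi> (sm B c (\<lambda>a b. a \<cdot>\<^bsub>B\<^esub> S b)) = \<phi> (scale B (counit B c) \<one>\<^bsub>B\<^esub>)"
      by (simp add: right[OF c f] form_scale[OF f one])
  qed (assumption | rule lin c)+
qed

text \<open>Needed because a Hopf algebra record and the bialgebra record that it extends are of different types.\<close>

lemma is_antipode_cong:
  fixes A :: "('k::field, 'a::ab_group_add, 'y) bialg_scheme" and B :: "('k, 'a, 'z) bialg_scheme"
  assumes "carrier A = carrier B" "scale A = scale B" "mult A = mult B" "one_el A = one_el B"
    "comult A = comult B" "counit A = counit B"
  shows "is_antipode A S \<longleftrightarrow> is_antipode B S"
proof -
  have l: "linear_map A A S = linear_map B B S" by (simp add: linear_map_def assms)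
  have t: "tensor_lift A A = (tensor_lift B B :: ('k, 'a, 'a) tensor \<Rightarrow> ('a \<Rightarrow> 'a \<Rightarrow> 'a) \<Rightarrow> 'a)"
    by (rule tensor_cong_space(3)) (simp_all add: assms)
  show ?thesis by (simp add: is_antipode_def sm_sw l t assms)
qed

context hopf_alg
begin

text \<open>The two antipodes are left and right convolution inverses of the identity:
  \<open>S(a) = S(a\<^sub>1) a\<^sub>2 T(a\<^sub>3) = T(a)\<close>.\<close>

lemma antipode_unique:
  assumes S: "is_antipode A S" and a: "a \<in> carrier A"
  shows "S a = antipode A a"
proof (rule eq_by_forms[OF space])
  have S_lin: "linear_map A A S" using S by (simp add: is_antipode_def)
  note [lin] = linear_map_comp[OF S_lin] linear_map_in[OF S_lin]
  show "S a \<in> carrier A" by (rule lin a)+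
  fix \<phi> assume f: "form A \<phi>"
  note [lin] = linear_map_comp[OF f]
  let ?T = "antipode A"
  have S_left: "sm A c (\<lambda>x y. \<psi> (S x \<cdot> y)) = counit A c * \<psi> \<one>" if c: "c \<in> carrier A" and p: "form A \<psi>" for c \<psi>
  proof -
    have "sm A c (\<lambda>x y. \<psi> (S x \<cdot> y)) = \<psi> (sm A c (\<lambda>x y. S x \<cdot> y))"
      by (rule tl_push(1)[symmetric]) (assumption | rule lin c p)+
    then show ?thesis using S c p by (simp add: is_antipode_def sm_sw form_scale)
  qed
  have "\<phi> (S a) = sm A a (\<lambda>x y. counit A y * \<phi> (S x \<cdot> \<one>))"
    by (subst counit_right, rule a, (assumption | rule lin)+) (simp add: a linear_map_in[OF S_lin])
  also have "\<dots> = sm A a (\<lambda>x y. sm A y (\<lambda>b c. \<phi> (S x \<cdot> (b \<cdot> ?T c))))"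
    by (intro sm_cong a antipode_right[symmetric]) (assumption | rule lin)+
  also have "\<dots> = sm A a (\<lambda>y c. sm A y (\<lambda>x b. \<phi> (S x \<cdot> (b \<cdot> ?T c))))"
    by (rule coassoc[symmetric]) (assumption | rule lin a)+
  also have "\<dots> = sm A a (\<lambda>y c. sm A y (\<lambda>x b. \<phi> (S x \<cdot> b \<cdot> ?T c)))"
    by (intro sm_cong a) (simp_all add: mult_assoc linear_map_in[OF S_lin])
  also have "\<dots> = sm A a (\<lambda>y c. counit A y * \<phi> (\<one> \<cdot> ?T c))"
    by (intro sm_cong a S_left) (assumption | rule lin)+
  also have "\<dots> = \<phi> (\<one> \<cdot> ?T a)"
    by (rule counit_left) (assumption | rule lin a)+
  finally show "\<phi> (S a) = \<phi> (?T a)" using a by simp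
qed (simp add: a)

text \<open>Everything in \<open>B\<close> is of the form \<open>f a\<close>, so maps out of \<open>B\<close> are linear if they are linear after
  composition with \<open>f\<close>, and each axiom for \<open>B\<close> is the image of the one for \<open>A\<close>.\<close>

lemma transport:
  fixes B :: "('k, 'b::ab_group_add, 'w) bialg_scheme"
  assumes B: "is_space B" and f: "linear_map A B f" and bij: "bij_betw f (carrier A) (carrier B)"
    and mult: "\<And>a b. a \<in> carrier A \<Longrightarrow> b \<in> carrier A \<Longrightarrow> f a \<cdot>\<^bsub>B\<^esub> f b = f (a \<cdot> b)"
    and one: "\<one>\<^bsub>B\<^esub> = f \<one>"
    and comult: "\<And>a. a \<in> carrier A \<Longrightarrow> comult B (f a) = sm A a (\<lambda>a1 a2. tensor B B (f a1) (f a2))"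
    and counit: "\<And>a. a \<in> carrier A \<Longrightarrow> counit B (f a) = counit A a"
  shows "is_bialgebra B" "is_antipode B (\<lambda>b. f (antipode A (inv_into (carrier A) f b)))"
proof -
  note [lin, sp] = B
  note [lin] = linear_map_comp[OF f] linear_map_in[OF f]
  have f_in [simp]: "f a \<in> carrier B" if "a \<in> carrier A" for a using f that by (rule linear_map_in)
  have B_ex: "\<exists>a\<in>carrier A. b = f a" if "b \<in> carrier B" for b
    using bij that by (auto simp: bij_betw_def)
  have inj: "a = a'" if "f a = f a'" "a \<in> carrier A" "a' \<in> carrier A" for a a'
    using bij that by (auto simp: bij_betw_def inj_on_def)
  let ?g = "inv_into (carrier A) f"
  have gf [simp]: "?g (f a) = a" if "a \<in> carrier A" for a
    using bij that by (simp add: bij_betw_def)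
  have linB: "linear_map B U F" if F: "linear_map A U (\<lambda>a. F (f a))"
    for U :: "('k, 'u::ab_group_add, 'y) space_scheme" and F
    unfolding linear_map_def
  proof (intro conjI ballI allI)
    fix x assume "x \<in> carrier B"
    then obtain a where a: "x = f a" "a \<in> carrier A" using B_ex by blast
    show "F x \<in> carrier U" using F a by (simp add: linear_map_def)
    show "F (scale B c x) = scale U c (F x)" for c
      using linear_map_scale[OF f a(2), of c] linear_map_scale[OF F a(2), of c] a by simp
    fix y assume "y \<in> carrier B"
    then obtain b where b: "y = f b" "b \<in> carrier A" using B_ex by blast
    show "F (x + y) = F x + F y"
      using linear_map_add[OF f a(2) b(2)] linear_map_add[OF F a(2) b(2)] a b by simp
  qed
  have mult_lin: "bilinear_map B B B (mult B)"
  proof (rule bilinear_mapI)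
    fix b assume "b \<in> carrier B"
    then obtain a where a: "b = f a" "a \<in> carrier A" using B_ex by blast
    have "linear_map A B (\<lambda>x. f (a \<cdot> x))" "linear_map A B (\<lambda>x. f (x \<cdot> a))" by (assumption | rule lin a)+
    then show "linear_map B B (\<lambda>x. b \<cdot>\<^bsub>B\<^esub> x)" "linear_map B B (\<lambda>x. x \<cdot>\<^bsub>B\<^esub> b)"
      using linear_map_cong[of A "\<lambda>x. f a \<cdot>\<^bsub>B\<^esub> f x" "\<lambda>x. f (a \<cdot> x)" B]
        linear_map_cong[of A "\<lambda>x. f x \<cdot>\<^bsub>B\<^esub> f a" "\<lambda>x. f (x \<cdot> a)" B]
      by (auto intro!: linB simp: a mult space)
  qed
  have linc: "linear_map B (B \<Otimes> B) (comult B)"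
    by (rule linB, subst linear_map_cong[OF comult]) (assumption | rule lin sp)+
  have smB: "sm B (f a) \<beta> = sm A a (\<lambda>a1 a2. \<beta> (f a1) (f a2))"
    if a: "a \<in> carrier A" and b: "bilinear_map B B ground_space \<beta>" for a \<beta>
  proof -
    have "sm B (f a) \<beta> = sm A a (\<lambda>a1 a2. tensor_lift B B (tensor B B (f a1) (f a2)) \<beta>)"
      unfolding comult[OF a] by (rule tl_tl) (assumption | rule lin sp a b)+
    also have "\<dots> = sm A a (\<lambda>a1 a2. \<beta> (f a1) (f a2))"
      by (intro sm_cong a tl_tensor[OF is_space_ground b]) (assumption | rule lin)+
    finally show ?thesis .
  qed
  have linS: "linear_map B B (\<lambda>b. f (antipode A (inv_into (carrier A) f b)))"
  proof (rule linB)
    have "linear_map A B (\<lambda>a. f (antipode A a))" by (assumption | rule lin)+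
    then show "linear_map A B (\<lambda>a. f (antipode A (inv_into (carrier A) f (f a))))"
      by (subst linear_map_cong[where g = "\<lambda>a. f (antipode A a)"]) (simp_all add: space)
  qed
  have mult_inB: "x \<cdot>\<^bsub>B\<^esub> y \<in> carrier B" if "x \<in> carrier B" "y \<in> carrier B" for x y
    using mult_lin that by (auto simp: bilinear_map_def linear_map_def)
  have lin_counitB: "form B (counit B)"
    by (rule linB, subst linear_map_cong[OF counit]) (assumption | rule lin sp)+
  note [lin] = linear_map_comp_left[OF mult_lin] linear_map_comp_right[OF mult_lin] mult_inB linear_map_comp[OF linc]
    linear_map_in[OF linc] linear_map_comp[OF lin_counitB] linear_map_comp[OF linS] linear_map_in[OF linS]
  show bialg: "is_bialgebra B"
  proof (rule bialgebraI[OF B mult_lin _ _ _ _ linc lin_counitB])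
    fix x assume "x \<in> carrier B"
    then obtain a where a: "x = f a" "a \<in> carrier A" using B_ex by blast
    show "\<one>\<^bsub>B\<^esub> \<cdot>\<^bsub>B\<^esub> x = x" "x \<cdot>\<^bsub>B\<^esub> \<one>\<^bsub>B\<^esub> = x" by (simp_all add: a one mult)
    { fix y z assume "y \<in> carrier B" "z \<in> carrier B"
      then obtain b c where b: "y = f b" "b \<in> carrier A" "z = f c" "c \<in> carrier A" using B_ex by blast
      show "(x \<cdot>\<^bsub>B\<^esub> y) \<cdot>\<^bsub>B\<^esub> z = x \<cdot>\<^bsub>B\<^esub> (y \<cdot>\<^bsub>B\<^esub> z)" using a b by (simp add: mult mult_assoc) }
    { fix \<beta> :: "'b \<Rightarrow> 'b \<Rightarrow> 'b \<Rightarrow> 'k"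
      assume l: "\<And>b c. b \<in> carrier B \<Longrightarrow> c \<in> carrier B \<Longrightarrow> form B (\<lambda>a. \<beta> a b c)"
        "\<And>a c. a \<in> carrier B \<Longrightarrow> c \<in> carrier B \<Longrightarrow> form B (\<lambda>b. \<beta> a b c)"
        "\<And>a b. a \<in> carrier B \<Longrightarrow> b \<in> carrier B \<Longrightarrow> form B (\<lambda>c. \<beta> a b c)"
      note [lin] = l[THEN linear_map_comp]
      have "sm B x (\<lambda>x c3. sm B x (\<lambda>c1 c2. \<beta> c1 c2 c3)) = sm A a (\<lambda>y a3. sm B (f y) (\<lambda>c1 c2. \<beta> c1 c2 (f a3)))"
        unfolding a(1) by (rule smB[OF a(2)]) (assumption | rule lin sp)+
      also have "\<dots> = sm A a (\<lambda>y a3. sm A y (\<lambda>a1 a2. \<beta> (f a1) (f a2) (f a3)))"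
        by (intro sm_cong a smB) (assumption | rule lin sp)+
      also have "\<dots> = sm A a (\<lambda>a1 y. sm A y (\<lambda>a2 a3. \<beta> (f a1) (f a2) (f a3)))"
        by (rule coassoc) (assumption | rule lin a)+
      also have "\<dots> = sm A a (\<lambda>a1 y. sm B (f y) (\<lambda>c2 c3. \<beta> (f a1) c2 c3))"
        by (intro sm_cong a smB[symmetric]) (assumption | rule lin sp)+
      also have "\<dots> = sm B x (\<lambda>c1 x. sm B x (\<lambda>c2 c3. \<beta> c1 c2 c3))"
        unfolding a(1) by (rule smB[OF a(2), symmetric]) (assumption | rule lin sp)+
      finally show "sm B x (\<lambda>x c3. sm B x (\<lambda>c1 c2. \<beta> c1 c2 c3)) = sm B x (\<lambda>c1 x. sm B x (\<lambda>c2 c3. \<beta> c1 c2 c3))" . }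
    { fix \<phi> assume p: "form B \<phi>"
      note [lin] = linear_map_comp[OF p]
      have "sm B x (\<lambda>a b. counit B a * \<phi> b) = sm A a (\<lambda>a b. counit A a * \<phi> (f b))"
        unfolding a(1) by (subst smB[OF a(2)], ((assumption | rule lin sp)+)[1]) (simp add: counit a cong: sm_cong)
      also have "\<dots> = \<phi> (f a)" by (rule counit_left) (assumption | rule lin a)+
      finally show "sm B x (\<lambda>a b. counit B a * \<phi> b) = \<phi> x" by (simp add: a)
      have "sm B x (\<lambda>a b. counit B b * \<phi> a) = sm A a (\<lambda>a b. counit A b * \<phi> (f a))"
        unfolding a(1) by (subst smB[OF a(2)], ((assumption | rule lin sp)+)[1]) (simp add: counit a cong: sm_cong)
      also have "\<dots> = \<phi> (f a)" by (rule counit_right) (assumption | rule lin a)+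
      finally show "sm B x (\<lambda>a b. counit B b * \<phi> a) = \<phi> x" by (simp add: a) }
    fix y assume "y \<in> carrier B"
    then obtain b where b: "y = f b" "b \<in> carrier A" using B_ex by blast
    show "counit B (x \<cdot>\<^bsub>B\<^esub> y) = counit B x * counit B y" using a b by (simp add: mult counit counit_mult)
    fix \<gamma> assume g: "bilinear_map B B ground_space \<gamma>"
    note [lin] = linear_map_comp_left[OF g] linear_map_comp_right[OF g]
    have "sm B (x \<cdot>\<^bsub>B\<^esub> y) \<gamma> = sm A (a \<cdot> b) (\<lambda>a1 a2. \<gamma> (f a1) (f a2))"
      using a b by (simp add: mult smB g)
    also have "\<dots> = sm A a (\<lambda>a1 a2. sm A b (\<lambda>b1 b2. \<gamma> (f (a1 \<cdot> b1)) (f (a2 \<cdot> b2))))"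
      by (rule comult_mult) (assumption | rule lin sp a b)+
    also have "\<dots> = sm A a (\<lambda>a1 a2. sm A b (\<lambda>b1 b2. \<gamma> (f a1 \<cdot>\<^bsub>B\<^esub> f b1) (f a2 \<cdot>\<^bsub>B\<^esub> f b2)))"
      by (intro sm_cong a b) (simp_all add: mult)
    also have "\<dots> = sm A a (\<lambda>a1 a2. sm B y (\<lambda>b1 b2. \<gamma> (f a1 \<cdot>\<^bsub>B\<^esub> b1) (f a2 \<cdot>\<^bsub>B\<^esub> b2)))"
      unfolding b(1) by (intro sm_cong a b smB[symmetric]) (assumption | rule lin sp)+
    also have "\<dots> = sm B x (\<lambda>a1 a2. sm B y (\<lambda>b1 b2. \<gamma> (a1 \<cdot>\<^bsub>B\<^esub> b1) (a2 \<cdot>\<^bsub>B\<^esub> b2)))"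
      unfolding a(1) by (rule smB[OF a(2), symmetric]) (assumption | rule lin sp \<open>y \<in> carrier B\<close>)+
    finally show "sm B (x \<cdot>\<^bsub>B\<^esub> y) \<gamma> = sm B x (\<lambda>a1 a2. sm B y (\<lambda>b1 b2. \<gamma> (a1 \<cdot>\<^bsub>B\<^esub> b1) (a2 \<cdot>\<^bsub>B\<^esub> b2)))" .
  next
    fix \<gamma> assume g: "bilinear_map B B ground_space \<gamma>"
    note [lin] = linear_map_comp_left[OF g] linear_map_comp_right[OF g]
    have "sm A \<one> (\<lambda>a b. \<gamma> (f a) (f b)) = \<gamma> (f \<one>) (f \<one>)"
      by (rule comult_one) (assumption | rule lin sp)+
    then show "sm B \<one>\<^bsub>B\<^esub> \<gamma> = \<gamma> \<one>\<^bsub>B\<^esub> \<one>\<^bsub>B\<^esub>" by (simp add: one smB g)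
  qed (simp_all add: one counit)
  show "is_antipode B (\<lambda>b. f (antipode A (inv_into (carrier A) f b)))"
  proof (rule antipodeI[OF bialg linS])
    fix x \<phi> assume "x \<in> carrier B" and p: "form B \<phi>"
    then obtain a where a: "x = f a" "a \<in> carrier A" using B_ex by blast
    note [lin] = linear_map_comp[OF p]
    have f\<phi>: "form A (\<lambda>a. \<phi> (f a))" by (rule lin)+
    show "sm B x (\<lambda>a b. \<phi> (f (antipode A (?g a)) \<cdot>\<^bsub>B\<^esub> b)) = counit B x * \<phi> \<one>\<^bsub>B\<^esub>"
      unfolding a(1) by (subst smB[OF a(2)], ((assumption | rule lin sp)+)[1])
        (simp add: mult counit one a antipode_left[OF a(2) f\<phi>] cong: sm_cong)
    show "sm B x (\<lambda>a b. \<phi> (a \<cdot>\<^bsub>B\<^esub> f (antipode A (?g b)))) = counit B x * \<phi> \<one>\<^bsub>B\<^esub>"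
      unfolding a(1) by (subst smB[OF a(2)], ((assumption | rule lin sp)+)[1])
        (simp add: mult counit one a antipode_right[OF a(2) f\<phi>] cong: sm_cong)
  qed
qed

end

section \<open>The dual of a finite dimensional Hopf algebra\<close>

lemma fscale_in_dual [lin]: "f \<in> carrier (dual_space V) \<Longrightarrow> fscale c f \<in> carrier (dual_space V)"
  using carrier_scale[OF is_space_dual_space] by simp

locale fd_hopf_alg = hopf_alg A
  for A :: "('k::field, 'a::ab_group_add, 'z) hopf_scheme" (structure) +
  assumes fin: "finite_dimensional A"
begin

abbreviation D where "D \<equiv> dual_space A"

lemmas basis = some_basis[OF space fin]

lemma dual_mult: "mult (dual A) f g = restrict0 A (\<lambda>a. sm A a (\<lambda>a1 a2. f a1 * g a2))"
  by (simp add: dual_def sm_sw)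

lemma dual_mult_apply: "a \<in> carrier A \<Longrightarrow> mult (dual A) f g a = sm A a (\<lambda>a1 a2. f a1 * g a2)"
  by (simp add: dual_mult)

lemma dual_lin [lin]:
  "f \<in> carrier D \<Longrightarrow> linear_map V A g \<Longrightarrow> form V (\<lambda>x. f (g x))"
  by (rule linear_map_comp[OF dual_form])

lemma dual_one_in [lin]: "restrict0 A (counit A) \<in> carrier D"
  using restrict0_in_dual[OF space linear_counit] by simp

lemma dual_mult_in [lin]: "f \<in> carrier D \<Longrightarrow> g \<in> carrier D \<Longrightarrow> mult (dual A) f g \<in> carrier D"
  unfolding dual_mult by (assumption | rule lin sp)+

lemma bilinear_dual_mult: "bilinear_map D D D (mult (dual A))"
proof (rule bilinear_mapI)
  fix f assume f: "f \<in> carrier D"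
  show "linear_map D D (\<lambda>g. mult (dual A) f g)"
    by (rule linear_map_dualI; (simp only: dual_mult_apply)?; (assumption | rule lin sp f)+)
  show "linear_map D D (\<lambda>g. mult (dual A) g f)"
    by (rule linear_map_dualI; (simp only: dual_mult_apply)?; (assumption | rule lin sp f)+)
qed

lemmas lin_dual_mult_left [lin] = linear_map_comp_left[OF bilinear_dual_mult]
lemmas lin_dual_mult_right [lin] = linear_map_comp_right[OF bilinear_dual_mult]

text \<open>The transpose of the multiplication, in coordinates.  By \<open>comult_dual\<close> it is the comultiplication
  that is characterised in \<^const>\<open>dual\<close> by its evaluations.\<close>

definition dual_comult where
  "dual_comult f = (\<Sum>b\<in>some_basis A. \<Sum>c\<in>some_basis A.
     scale (D \<Otimes> D) (f (b \<cdot> c)) (tensor D D (coord A b) (coord A c)))"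

lemma dual_comult_in [lin]: "dual_comult f \<in> carrier (D \<Otimes> D)"
  unfolding dual_comult_def
  by (intro linear_map_sum(2)[OF _ lin_id]; (assumption | rule lin sp basis)+)

lemma dual_comult_lift:
  assumes f: "f \<in> carrier D" and \<beta>: "bilinear_map D D ground_space \<beta>"
  shows "tensor_lift D D (dual_comult f) \<beta> =
    (\<Sum>b\<in>some_basis A. \<Sum>c\<in>some_basis A. \<beta> (coord A b) (coord A c) * f (b \<cdot> c))"
proof -
  let ?F = "\<lambda>t. tensor_lift D D t \<beta>"
  have F: "form (D \<Otimes> D) ?F" by (assumption | rule lin sp \<beta>)+
  have "?F (dual_comult f) = (\<Sum>b\<in>some_basis A. \<Sum>c\<in>some_basis A.
      ?F (scale (D \<Otimes> D) (f (b \<cdot> c)) (tensor D D (coord A b) (coord A c))))"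
    unfolding dual_comult_def
    by (subst linear_map_sum(1)[OF is_space_tensor F]; (intro sum.cong refl)?;
        (subst linear_map_sum(1)[OF is_space_tensor F])?;
        (intro linear_map_sum(2)[OF _ lin_id])?; (assumption | rule lin sp basis refl)+)
  also have "\<dots> = (\<Sum>b\<in>some_basis A. \<Sum>c\<in>some_basis A. \<beta> (coord A b) (coord A c) * f (b \<cdot> c))"
    by (intro sum.cong refl)
      (simp add: form_scale[OF F] tensor_in basis tl_tensor[OF is_space_ground \<beta>])
  finally show ?thesis .
qed

lemma coord_expand2:
  assumes "f \<in> carrier D" "x \<in> carrier A" "y \<in> carrier A"
  shows "f (x \<cdot> y) = (\<Sum>b\<in>some_basis A. \<Sum>c\<in>some_basis A. f (b \<cdot> c) * (coord A b x * coord A c y))"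
proof (rule biform_expand[OF space space, where \<gamma> = "\<lambda>x y. f (x \<cdot> y)"])
  show "bilinear_map A A ground_space (\<lambda>x y. f (x \<cdot> y))"
    by (assumption | rule lin sp assms)+
qed (use basis assms in auto)

lemma dual_comult_eval:
  assumes f: "f \<in> carrier D" and xy: "x \<in> carrier A" "y \<in> carrier A"
  shows "tensor_lift D D (dual_comult f) (\<lambda>f g. f x * g y) = f (x \<cdot> y)"
proof -
  have "tensor_lift D D (dual_comult f) (\<lambda>f g. f x * g y) =
    (\<Sum>b\<in>some_basis A. \<Sum>c\<in>some_basis A. coord A b x * coord A c y * f (b \<cdot> c))"
    by (rule dual_comult_lift[OF f, where \<beta> = "\<lambda>f g. f x * g y"]) (assumption | rule lin sp)+
  then show ?thesis by (simp add: coord_expand2[OF f xy] mult.commute)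
qed

lemma comult_dual: assumes f: "f \<in> carrier D" shows "comult (dual A) f = dual_comult f"
proof -
  have "comult (dual A) f = (THE t. t \<in> carrier (D \<Otimes> D) \<and>
        (\<forall>x\<in>carrier A. \<forall>y\<in>carrier A. tensor_lift D D t (\<lambda>f1 f2. f1 x * f2 y) = f (x \<cdot> y)))"
    by (simp add: dual_def)
  also have "\<dots> = dual_comult f"
  proof (rule the_equality)
    fix t assume t: "t \<in> carrier (D \<Otimes> D) \<and>
        (\<forall>x\<in>carrier A. \<forall>y\<in>carrier A. tensor_lift D D t (\<lambda>f1 f2. f1 x * f2 y) = f (x \<cdot> y))"
    then show "t = dual_comult f"
      by (intro dual_tensor_eqI[OF space fin space fin]) (auto simp: dual_comult_in dual_comult_eval f)
  qed (use f in \<open>auto simp: dual_comult_in dual_comult_eval\<close>)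
  finally show ?thesis .
qed

lemma linear_comult_dual: "linear_map D (D \<Otimes> D) (comult (dual A))"
proof -
  have "linear_map D (D \<Otimes> D) dual_comult" unfolding dual_comult_def
    by (intro linear_map_sum_fun; (assumption | rule lin sp basis)+)
  then show ?thesis by (subst linear_map_cong[OF comult_dual]) (auto intro: sp)
qed

lemma comult_dual_in [lin]: "f \<in> carrier D \<Longrightarrow> comult (dual A) f \<in> carrier (D \<Otimes> D)"
  by (rule linear_map_in[OF linear_comult_dual])
lemmas lin_comult_dual [lin] = linear_map_comp[OF linear_comult_dual]

abbreviation dm where "dm f \<beta> \<equiv> tensor_lift D D (comult (dual A) f) \<beta>"

lemma dm_sm: "sm (dual A) f \<beta> = dm f \<beta>"
  by (simp add: dual_tensor)

text \<open>The defining property \<open>f\<^sub>1(x) f\<^sub>2(y) = f(xy)\<close> of the comultiplication of the dual.\<close>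

lemma dm_eval:
  "f \<in> carrier D \<Longrightarrow> x \<in> carrier A \<Longrightarrow> y \<in> carrier A \<Longrightarrow> dm f (\<lambda>f g. f x * g y) = f (x \<cdot> y)"
  by (simp add: comult_dual dual_comult_eval)

lemma dm_cong:
  assumes "f \<in> carrier D" "\<And>a b. a \<in> carrier D \<Longrightarrow> b \<in> carrier D \<Longrightarrow> \<beta> a b = \<beta>' a b"
  shows "dm f \<beta> = dm f \<beta>'"
  by (rule tl_cong[OF is_space_dual_space comult_dual_in[OF assms(1)] assms(2)])

text \<open>Both sides are \<open>\<Sum> f(bcd) \<beta>(b\<^sup>*, c\<^sup>*, d\<^sup>*)\<close> over a basis.\<close>

lemma dual_coassoc:
  assumes f: "f \<in> carrier D"
    and l: "\<And>b c. b \<in> carrier D \<Longrightarrow> c \<in> carrier D \<Longrightarrow> form D (\<lambda>a. \<beta> a b c)"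
      "\<And>a c. a \<in> carrier D \<Longrightarrow> c \<in> carrier D \<Longrightarrow> form D (\<lambda>b. \<beta> a b c)"
      "\<And>a b. a \<in> carrier D \<Longrightarrow> b \<in> carrier D \<Longrightarrow> form D (\<lambda>c. \<beta> a b c)"
  shows "dm f (\<lambda>x c3. dm x (\<lambda>c1 c2. \<beta> c1 c2 c3)) = dm f (\<lambda>c1 x. dm x (\<lambda>c2 c3. \<beta> c1 c2 c3))"
proof -
  note [lin] = l
  let ?B = "some_basis A" and ?c = "coord A"
  have ex: "g x = (\<Sum>b\<in>?B. ?c b x * g b)" if "g \<in> carrier D" "x \<in> carrier A" for g x
    by (rule form_expand[OF space dual_form[OF that(1)]]) (use basis that in auto)
  have exl: "f (x \<cdot> y) = (\<Sum>b\<in>?B. ?c b x * f (b \<cdot> y))" if "x \<in> carrier A" "y \<in> carrier A" for x y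
    by (rule form_expand[OF space, where \<phi> = "\<lambda>x. f (x \<cdot> y)"], ((assumption | rule lin f that)+)[1],
      insert basis that, auto)
  have exr: "f (y \<cdot> x) = (\<Sum>b\<in>?B. ?c b x * f (y \<cdot> b))" if "x \<in> carrier A" "y \<in> carrier A" for x y
    by (rule form_expand[OF space, where \<phi> = "\<lambda>x. f (y \<cdot> x)"], ((assumption | rule lin f that)+)[1],
      insert basis that, auto)
  have lift: "dm g \<gamma> = (\<Sum>b\<in>?B. \<Sum>c\<in>?B. \<gamma> (?c b) (?c c) * g (b \<cdot> c))"
    if "g \<in> carrier D" "bilinear_map D D ground_space \<gamma>" for g \<gamma>
    using that by (simp add: comult_dual dual_comult_lift)
  have in_A: "b \<in> carrier A" if "b \<in> ?B" for b using basis(2) that by auto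
  have in_D: "?c b \<in> carrier D" for b by (rule basis(4))
  have "dm f (\<lambda>x c3. dm x (\<lambda>c1 c2. \<beta> c1 c2 c3)) =
    (\<Sum>b\<in>?B. \<Sum>c\<in>?B. dm (?c b) (\<lambda>c1 c2. \<beta> c1 c2 (?c c)) * f (b \<cdot> c))"
    by (rule lift[OF f]) (assumption | rule lin sp)+
  also have "\<dots> = (\<Sum>b\<in>?B. \<Sum>c\<in>?B. (\<Sum>d\<in>?B. \<Sum>e\<in>?B. \<beta> (?c d) (?c e) (?c c) * ?c b (d \<cdot> e)) * f (b \<cdot> c))"
    by (intro sum.cong refl arg_cong2[where f = "(*)"] lift in_D) (assumption | rule lin sp in_D)+
  also have "\<dots> = (\<Sum>c\<in>?B. \<Sum>d\<in>?B. \<Sum>e\<in>?B. \<beta> (?c d) (?c e) (?c c) * (\<Sum>b\<in>?B. ?c b (d \<cdot> e) * f (b \<cdot> c)))"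
    unfolding sum_distrib_right sum_distrib_left mult.assoc
    by (rule trans[OF sum.swap], rule sum.cong[OF refl], rule trans[OF sum.swap], rule sum.cong[OF refl], rule sum.swap)
  also have "\<dots> = (\<Sum>c\<in>?B. \<Sum>d\<in>?B. \<Sum>e\<in>?B. \<beta> (?c d) (?c e) (?c c) * f (d \<cdot> e \<cdot> c))"
    by (intro sum.cong refl arg_cong2[where f = "(*)"] exl[symmetric]) (simp_all add: in_A)
  also have "\<dots> = (\<Sum>d\<in>?B. \<Sum>e\<in>?B. \<Sum>c\<in>?B. \<beta> (?c d) (?c e) (?c c) * f (d \<cdot> e \<cdot> c))"
    by (rule trans[OF sum.swap], rule sum.cong[OF refl], rule sum.swap)
  also have "\<dots> = (\<Sum>d\<in>?B. \<Sum>e\<in>?B. \<Sum>c\<in>?B. \<beta> (?c d) (?c e) (?c c) * (\<Sum>b\<in>?B. ?c b (e \<cdot> c) * f (d \<cdot> b)))"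
    by (intro sum.cong refl arg_cong2[where f = "(*)"], subst exr[symmetric]) (simp_all add: in_A mult_assoc)
  also have "\<dots> = (\<Sum>d\<in>?B. \<Sum>b\<in>?B. (\<Sum>e\<in>?B. \<Sum>c\<in>?B. \<beta> (?c d) (?c e) (?c c) * ?c b (e \<cdot> c)) * f (d \<cdot> b))"
    unfolding sum_distrib_right sum_distrib_left mult.assoc
    by (rule sum.cong[OF refl], rule trans[OF sum.cong[OF refl sum.swap]], rule sum.swap)
  also have "\<dots> = (\<Sum>d\<in>?B. \<Sum>b\<in>?B. dm (?c b) (\<lambda>c2 c3. \<beta> (?c d) c2 c3) * f (d \<cdot> b))"
    by (intro sum.cong refl arg_cong2[where f = "(*)"] lift[symmetric] in_D) (assumption | rule lin sp in_D)+
  also have "\<dots> = dm f (\<lambda>c1 x. dm x (\<lambda>c2 c3. \<beta> c1 c2 c3))"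
    by (rule lift[OF f, symmetric]) (assumption | rule lin sp)+
  finally show ?thesis .
qed

lemma dual_is_hopf: "is_hopf_algebra (dual A)"
proof -
  have cong: "linear_map (dual A) U = linear_map D U" "bilinear_map (dual A) (dual A) (dual A) = bilinear_map D D D"
    "linear_map U (dual A) = linear_map U D" for U :: "('k,'u::ab_group_add,'y) space_scheme"
    by (intro ext; simp add: linear_map_def bilinear_map_def)+
  have alg: "is_algebra (dual A)"
    unfolding is_algebra_def
  proof (intro conjI ballI)
    show "bilinear_map (dual A) (dual A) (dual A) (mult (dual A))"
      unfolding cong by (rule bilinear_dual_mult)
    fix a b c assume "a \<in> carrier (dual A)" "b \<in> carrier (dual A)" "c \<in> carrier (dual A)"
    then have abc: "a \<in> carrier D" "b \<in> carrier D" "c \<in> carrier D" by simp_all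
    show "mult (dual A) (mult (dual A) a b) c = mult (dual A) a (mult (dual A) b c)"
    proof (rule dual_eqI)
      fix v assume v: "v \<in> carrier A"
      have "mult (dual A) (mult (dual A) a b) c v = sm A v (\<lambda>x v3. sm A x (\<lambda>v1 v2. a v1 * (b v2 * c v3)))"
        by (simp add: dual_mult_apply v tl_times_right[symmetric] mult.assoc cong: sm_cong)
      also have "\<dots> = sm A v (\<lambda>v1 x. sm A x (\<lambda>v2 v3. a v1 * (b v2 * c v3)))"
        by (rule coassoc) (assumption | rule lin abc v)+
      also have "\<dots> = mult (dual A) a (mult (dual A) b c) v"
        by (simp add: dual_mult_apply v tl_times_left[symmetric] cong: sm_cong)
      finally show "mult (dual A) (mult (dual A) a b) c v = mult (dual A) a (mult (dual A) b c) v" .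
    qed (assumption | rule lin abc)+
  next
    fix a assume "a \<in> carrier (dual A)"
    then have a: "a \<in> carrier D" by simp
    show "mult (dual A) \<one>\<^bsub>dual A\<^esub> a = a"
    proof (rule dual_eqI)
      fix v assume v: "v \<in> carrier A"
      show "mult (dual A) \<one>\<^bsub>dual A\<^esub> a v = a v"
        using counit_left[OF v dual_form[OF a]] by (simp add: dual_mult_apply v cong: sm_cong)
    qed (simp | rule lin a)+
    show "mult (dual A) a \<one>\<^bsub>dual A\<^esub> = a"
    proof (rule dual_eqI)
      fix v assume v: "v \<in> carrier A"
      show "mult (dual A) a \<one>\<^bsub>dual A\<^esub> v = a v"
        using counit_right[OF v dual_form[OF a]] by (simp add: dual_mult_apply v mult.commute cong: sm_cong)
    qed (simp | rule lin a)+
  qed (simp add: sp dual_one_in)+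
  have coalg: "is_coalgebra (dual A)"
    unfolding is_coalgebra_def sm_sw
  proof (intro conjI ballI)
    show lc: "linear_map (dual A) (dual A \<Otimes> dual A) (comult (dual A))"
      unfolding cong dual_tensor by (rule linear_comult_dual)
    show "form (dual A) (counit (dual A))"
      unfolding cong dual_sel(5)[abs_def] by (rule lin)
    fix f assume "f \<in> carrier (dual A)"
    then have f: "f \<in> carrier D" by simp
    show "sm (dual A) f (\<lambda>x c3. sm (dual A) x (\<lambda>c1 c2. tensor (dual A \<Otimes> dual A) (dual A) (tensor (dual A) (dual A) c1 c2) c3)) =
         sm (dual A) f (\<lambda>c1 x. sm (dual A) x (\<lambda>c2 c3. tensor (dual A \<Otimes> dual A) (dual A) (tensor (dual A) (dual A) c1 c2) c3))"
      by (rule coassocI[OF is_space_dual lc], simp add: f, unfold cong dm_sm dual_sel(1), rule dual_coassoc[OF f])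
    have s: "scale (dual A) c g v = c * g v" for c g v by (simp add: fscale_def)
    have "dm f (\<lambda>c1 c2. fscale (c1 \<one>) c2) = f"
    proof (rule dual_eqI)
      show "dm f (\<lambda>c1 c2. fscale (c1 \<one>) c2) \<in> carrier D"
        by (assumption | rule lin sp f)+
      fix v assume "v \<in> carrier A"
      then show "dm f (\<lambda>c1 c2. fscale (c1 \<one>) c2) v = f v"
        by (simp add: tl_apply fscale_def dm_eval f)
    qed (rule f)
    then show "sm (dual A) f (\<lambda>c1 c2. scale (dual A) (counit (dual A) c1) c2) = f" by (simp add: dm_sm)
    have "dm f (\<lambda>c1 c2. fscale (c2 \<one>) c1) = f"
    proof (rule dual_eqI)
      show "dm f (\<lambda>c1 c2. fscale (c2 \<one>) c1) \<in> carrier D"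
        by (assumption | rule lin sp f)+
      fix v assume "v \<in> carrier A"
      then show "dm f (\<lambda>c1 c2. fscale (c2 \<one>) c1) v = f v"
        using dm_eval[OF f, of v "\<one>"] by (simp add: tl_apply fscale_def mult.commute)
    qed (rule f)
    then show "sm (dual A) f (\<lambda>c1 c2. scale (dual A) (counit (dual A) c2) c1) = f" by (simp add: dm_sm)
  qed (rule sp)
  have mult: "comult (dual A) (mult (dual A) f g) = sm (dual A) f (\<lambda>f1 f2. sm (dual A) g (\<lambda>g1 g2.
      tensor (dual A) (dual A) (mult (dual A) f1 g1) (mult (dual A) f2 g2)))"
    if f: "f \<in> carrier D" and g: "g \<in> carrier D" for f g
    unfolding dm_sm dual_tensor
  proof (rule dual_tensor_eqI[OF space fin space fin])
    fix x y assume xy: "x \<in> carrier A" "y \<in> carrier A"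
    have "dm (mult (dual A) f g) (\<lambda>f g. f x * g y) = mult (dual A) f g (x \<cdot> y)"
      using xy f g by (simp add: dm_eval dual_mult_in)
    also have "\<dots> = sm A (x \<cdot> y) (\<lambda>a b. f a * g b)" by (simp add: dual_mult_apply xy)
    also have "\<dots> = sm A x (\<lambda>x1 x2. sm A y (\<lambda>y1 y2. f (x1 \<cdot> y1) * g (x2 \<cdot> y2)))"
      by (rule comult_mult) (assumption | rule lin sp f g xy)+
    also have "\<dots> = sm A x (\<lambda>x1 x2. sm A y (\<lambda>y1 y2. dm f (\<lambda>f1 f2. f1 x1 * f2 y1) * dm g (\<lambda>g1 g2. g1 x2 * g2 y2)))"
      by (intro sm_cong xy) (simp add: dm_eval f g)
    also have "\<dots> = sm A x (\<lambda>x1 x2. sm A y (\<lambda>y1 y2. dm f (\<lambda>f1 f2. dm g (\<lambda>g1 g2. f1 x1 * g1 x2 * (f2 y1 * g2 y2)))))"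
      by (simp only: tl_times_right[symmetric], simp only: tl_times_left[symmetric], simp only: ac_simps)
    also have "\<dots> = dm f (\<lambda>f1 f2. dm g (\<lambda>g1 g2. sm A x (\<lambda>x1 x2. sm A y (\<lambda>y1 y2. f1 x1 * g1 x2 * (f2 y1 * g2 y2)))))"
      by (subst (2) tl_swap, subst tl_swap, subst (3) tl_swap, subst (2) tl_swap, rule refl)
    also have "\<dots> = dm f (\<lambda>f1 f2. dm g (\<lambda>g1 g2. mult (dual A) f1 g1 x * mult (dual A) f2 g2 y))"
      by (simp add: dual_mult_apply xy tl_times_left tl_times_right)
    also have "\<dots> = dm f (\<lambda>f1 f2. dm g (\<lambda>g1 g2. tensor_lift D D
       (tensor D D (mult (dual A) f1 g1) (mult (dual A) f2 g2)) (\<lambda>f g. f x * g y)))"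
      by (intro dm_cong f g tl_tensor[symmetric]; (assumption | rule lin sp)+)
    also have "\<dots> = dm f (\<lambda>f1 f2. tensor_lift D D (dm g (\<lambda>g1 g2.
       (tensor D D (mult (dual A) f1 g1) (mult (dual A) f2 g2)))) (\<lambda>f g. f x * g y))"
      by (intro dm_cong f tl_tl[symmetric]; (assumption | rule lin sp g)+)
    also have "\<dots> = tensor_lift D D (dm f (\<lambda>f1 f2. dm g (\<lambda>g1 g2.
       (tensor D D (mult (dual A) f1 g1) (mult (dual A) f2 g2))))) (\<lambda>f g. f x * g y)"
      by (intro tl_tl[symmetric]; (assumption | rule lin sp f g)+)
    finally show "dm (mult (dual A) f g) (\<lambda>f g. f x * g y) = tensor_lift D D (dm f (\<lambda>f1 f2. dm g (\<lambda>g1 g2.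
       (tensor D D (mult (dual A) f1 g1) (mult (dual A) f2 g2))))) (\<lambda>f g. f x * g y)" .
  qed (assumption | rule lin sp f g)+
  have one: "comult (dual A) \<one>\<^bsub>dual A\<^esub> = tensor (dual A) (dual A) \<one>\<^bsub>dual A\<^esub> \<one>\<^bsub>dual A\<^esub>"
    unfolding dual_tensor dual_sel
  proof (rule dual_tensor_eqI[OF space fin space fin])
    fix x y assume xy: "x \<in> carrier A" "y \<in> carrier A"
    have "tensor_lift D D (tensor D D (restrict0 A (counit A)) (restrict0 A (counit A))) (\<lambda>f g. f x * g y) =
        restrict0 A (counit A) x * restrict0 A (counit A) y"
      by (rule tl_tensor) (assumption | rule lin sp)+
    then show "dm (restrict0 A (counit A)) (\<lambda>f g. f x * g y) =
       tensor_lift D D (tensor D D (restrict0 A (counit A)) (restrict0 A (counit A))) (\<lambda>f g. f x * g y)"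
      using xy by (simp add: dm_eval dual_one_in counit_mult)
  qed (assumption | rule lin sp)+
  have bialg: "is_bialgebra (dual A)"
    unfolding is_bialgebra_def sm_sw
  proof (intro conjI ballI alg coalg one)
    fix f g assume "f \<in> carrier (dual A)" "g \<in> carrier (dual A)"
    then have fg: "f \<in> carrier D" "g \<in> carrier D" by simp_all
    show "comult (dual A) (mult (dual A) f g) = sm (dual A) f (\<lambda>f1 f2. sm (dual A) g (\<lambda>g1 g2.
      tensor (dual A) (dual A) (mult (dual A) f1 g1) (mult (dual A) f2 g2)))" by (rule mult[OF fg])
    have "sm A \<one> (\<lambda>a b. f a * g b) = f \<one> * g \<one>"
      by (rule comult_one) (assumption | rule lin sp fg)+
    then show "counit (dual A) (mult (dual A) f g) = counit (dual A) f * counit (dual A) g"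
      by (simp add: dual_mult_apply)
  qed simp
  have "is_antipode (dual A) (antipode (dual A))"
    unfolding is_antipode_def sm_sw
  proof (intro conjI ballI)
    have l: "linear_map D D (antipode (dual A))"
      unfolding dual_sel(6)[abs_def]
      by (rule linear_map_dualI; (simp only: restrict0_apply)?; (assumption | rule lin sp)+)
    then show "linear_map (dual A) (dual A) (antipode (dual A))" unfolding cong .
    note [lin] = linear_map_comp[OF l, unfolded dual_sel]
    fix f assume "f \<in> carrier (dual A)"
    then have f: "f \<in> carrier D" by simp
    let ?S = "\<lambda>f. restrict0 A (\<lambda>a. f (antipode A a))"
    have "dm f (\<lambda>f1 f2. mult (dual A) (?S f1) f2) = fscale (f \<one>) (restrict0 A (counit A))"
    proof (rule dual_eqI)
      fix a assume a: "a \<in> carrier A"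
      have "dm f (\<lambda>f1 f2. mult (dual A) (?S f1) f2) a = dm f (\<lambda>f1 f2. sm A a (\<lambda>a1 a2. f1 (antipode A a1) * f2 a2))"
        by (simp add: tl_apply dual_mult_apply a cong: sm_cong)
      also have "\<dots> = sm A a (\<lambda>a1 a2. f (antipode A a1 \<cdot> a2))"
        by (subst tl_swap) (simp add: dm_eval f a cong: sm_cong)
      also have "\<dots> = counit A a * f \<one>"
        by (rule antipode_left[OF a dual_form[OF f]])
      finally show "dm f (\<lambda>f1 f2. mult (dual A) (?S f1) f2) a = fscale (f \<one>) (restrict0 A (counit A)) a"
        by (simp add: a fscale_def)
    qed (assumption | rule lin sp f)+
    then show "sm (dual A) f (\<lambda>f1 f2. mult (dual A) (antipode (dual A) f1) f2) = scale (dual A) (counit (dual A) f) \<one>\<^bsub>dual A\<^esub>"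
      by (simp add: dm_sm)
    have "dm f (\<lambda>f1 f2. mult (dual A) f1 (?S f2)) = fscale (f \<one>) (restrict0 A (counit A))"
    proof (rule dual_eqI)
      fix a assume a: "a \<in> carrier A"
      have "dm f (\<lambda>f1 f2. mult (dual A) f1 (?S f2)) a = dm f (\<lambda>f1 f2. sm A a (\<lambda>a1 a2. f1 a1 * f2 (antipode A a2)))"
        by (simp add: tl_apply dual_mult_apply a cong: sm_cong)
      also have "\<dots> = sm A a (\<lambda>a1 a2. f (a1 \<cdot> antipode A a2))"
        by (subst tl_swap) (simp add: dm_eval f a cong: sm_cong)
      also have "\<dots> = counit A a * f \<one>"
        by (rule antipode_right[OF a dual_form[OF f]])
      finally show "dm f (\<lambda>f1 f2. mult (dual A) f1 (?S f2)) a = fscale (f \<one>) (restrict0 A (counit A)) a"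
        by (simp add: a fscale_def)
    qed (assumption | rule lin sp f)+
    then show "sm (dual A) f (\<lambda>f1 f2. mult (dual A) f1 (antipode (dual A) f2)) = scale (dual A) (counit (dual A) f) \<one>\<^bsub>dual A\<^esub>"
      by (simp add: dm_sm)
  qed
  with bialg show ?thesis by (simp add: is_hopf_algebra_def)
qed

(* The conclusion of this rule matches every goal about a linear functional, so it must not stay active. *)
declare dual_lin [lin del]

text \<open>This is \<open>antipode_mult\<close> for the dual Hopf algebra.\<close>

lemma antipode_comult:
  assumes f: "form A f" and g: "form A g" and x: "x \<in> carrier A"
  shows "sm A (antipode A x) (\<lambda>a b. f a * g b) = sm A x (\<lambda>a b. f (antipode A b) * g (antipode A a))"
proof -
  interpret dual: hopf_alg "dual A" by unfold_locales (rule dual_is_hopf)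
  let ?f = "restrict0 A f" and ?g = "restrict0 A g"
  have fg: "?f \<in> carrier D" "?g \<in> carrier D" using restrict0_in_dual[OF space] f g by blast+
  have "antipode (dual A) (mult (dual A) ?f ?g) x = mult (dual A) (antipode (dual A) ?g) (antipode (dual A) ?f) x"
    using dual.antipode_mult fg by simp
  then show ?thesis by (simp add: dual_mult_apply x mult.commute cong: sm_cong)
qed

end

section \<open>Quasi-abelian partial matched pairs\<close>

locale matched_pair = H: fd_hopf_alg H + L: fd_hopf_alg L
  for H :: "('k::field, 'h::ab_group_add) hopf" (structure) and L :: "('k, 'l::ab_group_add) hopf" +
  fixes act :: "'h \<Rightarrow> 'l \<Rightarrow> 'l" and \<rho> :: "'h \<Rightarrow> ('k, 'h, 'l) tensor"
  assumes pmp: "partial_matched_pair H L act \<rho>"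
    and qa: "quasi_abelian H L act \<rho>"
    and antipode_coaction: "\<And>h. h \<in> carrier H \<Longrightarrow>
      tensor_lift H L (\<rho> h) (\<lambda>h0 h1. act h0 \<one>\<^bsub>L\<^esub> \<otimes>\<^bsub>L,L\<^esub> antipode L h1) =
      tensor_lift H L (\<rho> \<one>\<^bsub>H\<^esub>) (\<lambda>u0 u1.
        scale L (counit H u0 * counit L (act h \<one>\<^bsub>L\<^esub>)) \<one>\<^bsub>L\<^esub> \<otimes>\<^bsub>L,L\<^esub> u1)"
    and antipode_action: "\<And>h g. h \<in> carrier H \<Longrightarrow> g \<in> carrier H \<Longrightarrow>
      tensor_lift H L (\<rho> h) (\<lambda>h0 h1. scale L (counit H h0) (act (antipode H g) h1)) =
      tensor_lift H L (\<rho> \<one>\<^bsub>H\<^esub>) (\<lambda>u0 u1.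
        scale L (counit L (act g \<one>\<^bsub>L\<^esub>) * counit H h * counit H u0) u1)"
begin

abbreviation mult_L (infixl \<open>\<star>\<close> 73) where "x \<star> y \<equiv> mult L x y"
abbreviation one_L (\<open>\<one>\<^sub>L\<close>) where "\<one>\<^sub>L \<equiv> one_el L"

declare H.space [simp] L.space [simp]

abbreviation rs where "rs h \<beta> \<equiv> tensor_lift H L (\<rho> h) \<beta>"

lemmas module_algebra_axioms = pmp[unfolded partial_matched_pair_def partial_module_algebra_def sm_sw]
lemmas comodule_coalgebra_axioms = pmp[unfolded partial_matched_pair_def partial_comodule_coalgebra_def sm_sw sw_def]

lemma bilinear_act: "bilinear_map H L L act" using module_algebra_axioms by blast
lemma act_in [lin, simp]: "h \<in> carrier H \<Longrightarrow> x \<in> carrier L \<Longrightarrow> act h x \<in> carrier L"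
  using bilinear_act by (auto simp: bilinear_map_def linear_map_def)
lemmas lin_act_left [lin] = linear_map_comp_left[OF bilinear_act]
lemmas lin_act_right [lin] = linear_map_comp_right[OF bilinear_act]

lemma act_one [simp]: "x \<in> carrier L \<Longrightarrow> act \<one> x = x" using module_algebra_axioms by blast

lemma linear_rho: "linear_map H (H \<Otimes> L) \<rho>" using comodule_coalgebra_axioms by blast
lemma rho_in [lin, simp]: "h \<in> carrier H \<Longrightarrow> \<rho> h \<in> carrier (H \<Otimes> L)"
  by (rule linear_map_in[OF linear_rho])
lemmas lin_rho [lin] = linear_map_comp[OF linear_rho]

lemma rs_cong:
  assumes "c \<in> carrier H" "\<And>a b. a \<in> carrier H \<Longrightarrow> b \<in> carrier L \<Longrightarrow> \<beta> a b = \<beta>' a b"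
  shows "rs c \<beta> = rs c \<beta>'"
  by (rule tl_cong[OF H.space rho_in[OF assms(1)] assms(2)])

text \<open>The axioms are restated for an arbitrary multilinear form applied to both sides.\<close>

lemma act_mult:
  assumes "h \<in> carrier H" "x \<in> carrier L" "y \<in> carrier L" "form L \<phi>"
  shows "\<phi> (act h (x \<star> y)) = sm H h (\<lambda>a b. \<phi> (act a x \<star> act b y))"
proof -
  have "act h (x \<star> y) = sm H h (\<lambda>a b. act a x \<star> act b y)" using module_algebra_axioms assms by blast
  moreover have "\<phi> (sm H h (\<lambda>a b. act a x \<star> act b y)) = sm H h (\<lambda>a b. \<phi> (act a x \<star> act b y))"
    by (rule tl_push(1)) (assumption | rule lin assms)+
  ultimately show ?thesis by simp
qed

lemma act_act:
  assumes "h \<in> carrier H" "g \<in> carrier H" "x \<in> carrier L" "form L \<phi>"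
  shows "\<phi> (act h (act g x)) = sm H h (\<lambda>a b. \<phi> (act a \<one>\<^sub>L \<star> act (b \<cdot> g) x))"
proof -
  have "act h (act g x) = sm H h (\<lambda>a b. act a \<one>\<^sub>L \<star> act (b \<cdot> g) x)" using module_algebra_axioms assms by blast
  moreover have "\<phi> (sm H h (\<lambda>a b. act a \<one>\<^sub>L \<star> act (b \<cdot> g) x)) =
      sm H h (\<lambda>a b. \<phi> (act a \<one>\<^sub>L \<star> act (b \<cdot> g) x))"
    by (rule tl_push(1)) (assumption | rule lin assms)+
  ultimately show ?thesis by simp
qed

lemma rho_counit:
  assumes "h \<in> carrier H" "form H \<phi>"
  shows "rs h (\<lambda>p q. counit L q * \<phi> p) = \<phi> h"
proof -
  have "rs h (\<lambda>p q. scale H (counit L q) p) = h" using comodule_coalgebra_axioms assms by blast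
  then have "\<phi> h = \<phi> (rs h (\<lambda>p q. scale H (counit L q) p))" by simp
  also have "\<dots> = rs h (\<lambda>p q. \<phi> (scale H (counit L q) p))"
    by (rule tl_push(1)) (assumption | rule lin assms)+
  also have "\<dots> = rs h (\<lambda>p q. counit L q * \<phi> p)"
    using form_scale[OF assms(2)] by (intro rs_cong assms)
  finally show ?thesis by simp
qed

lemma rho_comult:
  assumes c: "c \<in> carrier H"
    and l: "\<And>b c. b \<in> carrier H \<Longrightarrow> c \<in> carrier L \<Longrightarrow> form H (\<lambda>a. \<beta> a b c)"
      "\<And>a c. a \<in> carrier H \<Longrightarrow> c \<in> carrier L \<Longrightarrow> form H (\<lambda>b. \<beta> a b c)"
      "\<And>a b. a \<in> carrier H \<Longrightarrow> b \<in> carrier H \<Longrightarrow> form L (\<lambda>c. \<beta> a b c)"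
  shows "rs c (\<lambda>p q. sm H p (\<lambda>a b. \<beta> a b q)) =
    sm H c (\<lambda>c1 c2. rs c1 (\<lambda>p q. rs c2 (\<lambda>r s. \<beta> p r (q \<star> s))))"
proof -
  note [lin] = l[THEN linear_map_comp]
  let ?\<gamma> = "\<lambda>t c. tensor_lift H H t (\<lambda>a b. \<beta> a b c)"
  have g: "tensor (H \<Otimes> H) L t c ?\<gamma> = tensor_lift H H t (\<lambda>a b. \<beta> a b c)"
    if "t \<in> carrier (H \<Otimes> H)" "c \<in> carrier L" for t c
    by (rule tensor3_apply) (assumption | rule lin that)+
  have g2: "tensor_lift H H (tensor H H a b) (\<lambda>a b. \<beta> a b c) = \<beta> a b c"
    if "a \<in> carrier H" "b \<in> carrier H" "c \<in> carrier L" for a b c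
    by (rule tl_tensor[OF is_space_ground]) (assumption | rule lin that)+
  have "rs c (\<lambda>c0 c1. tensor (H \<Otimes> H) L (comult H c0) c1) =
    sm H c (\<lambda>c1 c2. rs c1 (\<lambda>c10 c11. rs c2 (\<lambda>c20 c21. tensor (H \<Otimes> H) L (tensor H H c10 c20) (c11 \<star> c21))))"
    using comodule_coalgebra_axioms c by blast
  from arg_cong[where f = "\<lambda>t. t ?\<gamma>", OF this]
  show ?thesis unfolding tl_apply by (simp add: c g g2 tensor_in cong: tl_cong)
qed

lemma rho_rho0:
  assumes c: "c \<in> carrier H"
    and l: "\<And>b c. b \<in> carrier L \<Longrightarrow> c \<in> carrier L \<Longrightarrow> form H (\<lambda>a. \<beta> a b c)"
      "\<And>a c. a \<in> carrier H \<Longrightarrow> c \<in> carrier L \<Longrightarrow> form L (\<lambda>b. \<beta> a b c)"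
      "\<And>a b. a \<in> carrier H \<Longrightarrow> b \<in> carrier L \<Longrightarrow> form L (\<lambda>c. \<beta> a b c)"
  shows "rs c (\<lambda>p q. rs p (\<lambda>r s. \<beta> r s q)) =
    sm H c (\<lambda>c1 c2. rs c1 (\<lambda>p q. rs c2 (\<lambda>r s. sm L q (\<lambda>q1 q2. counit H r * \<beta> p q1 (q2 \<star> s)))))"
proof -
  note [lin] = l[THEN linear_map_comp]
  let ?\<gamma> = "\<lambda>t c. tensor_lift H L t (\<lambda>a b. \<beta> a b c)"
  have g: "tensor (H \<Otimes> L) L t c ?\<gamma> = tensor_lift H L t (\<lambda>a b. \<beta> a b c)"
    if "t \<in> carrier (H \<Otimes> L)" "c \<in> carrier L" for t c
    by (rule tensor3_apply) (assumption | rule lin that)+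
  have g2: "tensor_lift H L (tensor H L a b) (\<lambda>a b. \<beta> a b c) = \<beta> a b c"
    if "a \<in> carrier H" "b \<in> carrier L" "c \<in> carrier L" for a b c
    by (rule tl_tensor[OF is_space_ground]) (assumption | rule lin that)+
  have s: "\<beta> a b (scale L k c) = k * \<beta> a b c" if "a \<in> carrier H" "b \<in> carrier L" "c \<in> carrier L" for a b c k
    by (rule form_scale[OF l(3)]) (rule that)+
  have "rs c (\<lambda>c0 c1. tensor (H \<Otimes> L) L (\<rho> c0) c1) =
    sm H c (\<lambda>c1 c2. rs c1 (\<lambda>c10 c11. rs c2 (\<lambda>c20 c21. sm L c11 (\<lambda>c11_1 c11_2.
       tensor (H \<Otimes> L) L (tensor H L c10 c11_1) (scale L (counit H c20) (c11_2 \<star> c21))))))"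
    using comodule_coalgebra_axioms c by blast
  from arg_cong[where f = "\<lambda>t. t ?\<gamma>", OF this]
  show ?thesis unfolding tl_apply by (simp add: c g g2 s tensor_in carrier_scale tl_times_left cong: tl_cong)
qed

lemma counit_act: "h \<in> carrier H \<Longrightarrow> x \<in> carrier L \<Longrightarrow>
    counit L (act h x) = counit L (act h \<one>\<^sub>L) * counit L x"
  using pmp unfolding partial_matched_pair_def by blast

lemma matched_compat:
  assumes h: "h \<in> carrier H" and g: "g \<in> carrier H" and x: "x \<in> carrier L"
    and l: "\<And>b c. b \<in> carrier L \<Longrightarrow> c \<in> carrier L \<Longrightarrow> form H (\<lambda>a. \<beta> a b c)"
      "\<And>a c. a \<in> carrier H \<Longrightarrow> c \<in> carrier L \<Longrightarrow> form L (\<lambda>b. \<beta> a b c)"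
      "\<And>a b. a \<in> carrier H \<Longrightarrow> b \<in> carrier L \<Longrightarrow> form L (\<lambda>c. \<beta> a b c)"
  shows "sm H h (\<lambda>h1 h2. rs (h2 \<cdot> g) (\<lambda>u0 u1. sm L (act h1 x) (\<lambda>y1 y2. \<beta> u0 y1 (y2 \<star> u1)))) =
    sm H h (\<lambda>d h4. sm H d (\<lambda>e h3. sm H e (\<lambda>h1 h2.
      rs h1 (\<lambda>h10 h11. rs h3 (\<lambda>h30 h31. rs g (\<lambda>g0 g1. sm L x (\<lambda>x1 x2.
        \<beta> (h30 \<cdot> g0) (act h10 x1) (h11 \<star> act h2 x2 \<star> h31 \<star> act h4 g1))))))))"
proof -
  note [lin] = l[THEN linear_map_comp]
  let ?\<gamma> = "\<lambda>t c. tensor_lift H L t (\<lambda>a b. \<beta> a b c)"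
  have g1: "tensor (H \<Otimes> L) L t c ?\<gamma> = tensor_lift H L t (\<lambda>a b. \<beta> a b c)"
    if "t \<in> carrier (H \<Otimes> L)" "c \<in> carrier L" for t c
    by (rule tensor3_apply) (assumption | rule lin that)+
  have g2: "tensor_lift H L (tensor H L a b) (\<lambda>a b. \<beta> a b c) = \<beta> a b c"
    if "a \<in> carrier H" "b \<in> carrier L" "c \<in> carrier L" for a b c
    by (rule tl_tensor[OF is_space_ground]) (assumption | rule lin that)+
  have "sm H h (\<lambda>h1 h2. rs (h2 \<cdot> g) (\<lambda>u0 u1. sm L (act h1 x) (\<lambda>y1 y2.
      tensor (H \<Otimes> L) L (tensor H L u0 y1) (y2 \<star> u1)))) =
    sm H h (\<lambda>d h4. sm H d (\<lambda>e h3. sm H e (\<lambda>h1 h2.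
      rs h1 (\<lambda>h10 h11. rs h3 (\<lambda>h30 h31. rs g (\<lambda>g0 g1. sm L x (\<lambda>x1 x2.
        tensor (H \<Otimes> L) L (tensor H L (h30 \<cdot> g0) (act h10 x1)) (h11 \<star> act h2 x2 \<star> h31 \<star> act h4 g1))))))))"
    using pmp h g x unfolding partial_matched_pair_def sw4_def sw3_def sm_sw by blast
  from arg_cong[where f = "\<lambda>t. t ?\<gamma>", OF this]
  show ?thesis unfolding tl_apply by (simp add: h g x g1 g2 tensor_in cong: tl_cong)
qed

lemma quasi_abelian:
  assumes h: "h \<in> carrier H" and x: "x \<in> carrier L" and b: "bilinear_map H L ground_space \<beta>"
  shows "sm H h (\<lambda>h1 h2. rs h2 (\<lambda>p q. \<beta> p (act h1 x \<star> q))) =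
         sm H h (\<lambda>h1 h2. rs h1 (\<lambda>p q. \<beta> p (q \<star> act h2 x)))"
proof -
  have "sm H h (\<lambda>h1 h2. rs h2 (\<lambda>p q. tensor H L p (act h1 x \<star> q))) =
         sm H h (\<lambda>h1 h2. rs h1 (\<lambda>p q. tensor H L p (q \<star> act h2 x)))"
    using qa[unfolded quasi_abelian_def sm_sw] h x by blast
  from arg_cong[where f = "\<lambda>t. t \<beta>", OF this]
  show ?thesis unfolding tl_apply tensor_apply[OF b] .
qed

section \<open>The idempotents \<open>\<lambda>\<close> and \<open>u\<close>\<close>

definition lam :: "'h \<Rightarrow> 'k" where "lam h = counit L (act h \<one>\<^sub>L)"
definition u :: 'l where "u = rs \<one> (\<lambda>p q. scale L (counit H p) q)"

lemma u_in [lin, simp]: "u \<in> carrier L"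
  unfolding u_def by (assumption | rule lin)+

lemma linear_lam: "form H lam"
  unfolding lam_def[abs_def] by (assumption | rule lin)+
lemmas lin_lam [lin] = linear_map_comp[OF linear_lam]

lemma form_u: "form L \<phi> \<Longrightarrow> \<phi> u = rs \<one> (\<lambda>p q. counit H p * \<phi> q)"
proof -
  assume f: "form L \<phi>"
  have "\<phi> u = rs \<one> (\<lambda>p q. \<phi> (scale L (counit H p) q))"
    unfolding u_def by (rule tl_push(1)) (assumption | rule lin f)+
  also have "\<dots> = rs \<one> (\<lambda>p q. counit H p * \<phi> q)"
    using form_scale[OF f] by (intro rs_cong) auto
  finally show ?thesis .
qed

text \<open>The axiom on the coaction at the unit says \<open>\<rho>(1) = 1 \<otimes> u\<close>.\<close>

lemma rho_one:
  assumes b: "bilinear_map H L ground_space \<beta>"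
  shows "rs \<one> \<beta> = \<beta> \<one> u"
proof -
  note [lin] = linear_map_comp_left[OF b] linear_map_comp_right[OF b]
  have "rs \<one> \<beta> = \<rho> \<one> \<beta>" by (rule tl_tensor_eval[symmetric]) (rule lin b)+
  also have "\<dots> = rs \<one> (\<lambda>p q. tensor H L \<one> (scale L (counit H p) q)) \<beta>"
    by (rule arg_cong[where f = "\<lambda>t. t \<beta>"]) (use pmp in \<open>unfold partial_matched_pair_def, blast\<close>)
  also have "\<dots> = rs \<one> (\<lambda>p q. \<beta> \<one> (scale L (counit H p) q))"
    unfolding tl_apply tensor_apply[OF b] ..
  also have "\<dots> = rs \<one> (\<lambda>p q. counit H p * \<beta> \<one> q)"
    using form_scale[OF bilinear_map_right[OF b H.one_in]] by (intro rs_cong) auto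
  also have "\<dots> = \<beta> \<one> u"
    by (rule form_u[symmetric]) (rule lin)+
  finally show ?thesis .
qed

lemma counit_u [simp]: "counit L u = 1"
proof -
  have "counit L u = rs \<one> (\<lambda>p q. counit L q * counit H p)"
    using form_u[OF L.linear_counit] by (simp add: mult.commute)
  then show ?thesis using rho_counit[OF H.one_in H.linear_counit] by simp
qed

lemma antipode_action_form:
  assumes h: "h \<in> carrier H" and g: "g \<in> carrier H" and f: "form L \<phi>"
  shows "rs h (\<lambda>p q. counit H p * \<phi> (act (antipode H g) q)) = lam g * counit H h * \<phi> u"
proof -
  have "\<phi> (rs h (\<lambda>h0 h1. scale L (counit H h0) (act (antipode H g) h1))) =
     rs h (\<lambda>h0 h1. \<phi> (scale L (counit H h0) (act (antipode H g) h1)))"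
    by (rule tl_push(1)) (assumption | rule lin f h g)+
  moreover have "\<phi> (rs \<one> (\<lambda>u0 u1. scale L (lam g * counit H h * counit H u0) u1)) =
     rs \<one> (\<lambda>u0 u1. \<phi> (scale L (lam g * counit H h * counit H u0) u1))"
    by (rule tl_push(1)) (assumption | rule lin f h g)+
  moreover have "\<dots> = lam g * counit H h * \<phi> u"
    by (simp add: form_u[OF f] form_scale[OF f] mult.assoc tl_times_left cong: rs_cong)
  ultimately show ?thesis using antipode_action[OF h g]
    by (simp add: lam_def form_scale[OF f] h g cong: rs_cong)
qed

lemma antipode_coaction_form:
  assumes h: "h \<in> carrier H" and b: "bilinear_map L L ground_space \<beta>"
  shows "rs h (\<lambda>p q. \<beta> (act p \<one>\<^sub>L) (antipode L q)) = lam h * \<beta> \<one>\<^sub>L u"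
proof -
  have "rs h (\<lambda>p q. \<beta> (act p \<one>\<^sub>L) (antipode L q)) =
      rs \<one> (\<lambda>p q. \<beta> (scale L (counit H p * lam h) \<one>\<^sub>L) q)"
    using arg_cong[where f = "\<lambda>t. t \<beta>", OF antipode_coaction[OF h]]
    unfolding tl_apply tensor_apply[OF b] lam_def .
  also have "\<dots> = rs \<one> (\<lambda>p q. lam h * (counit H p * \<beta> \<one>\<^sub>L q))"
    using form_scale[OF bilinear_map_left[OF b]] by (intro rs_cong) (auto simp: mult_ac)
  also have "\<dots> = lam h * \<beta> \<one>\<^sub>L u"
    unfolding tl_times_left by (subst form_u[OF bilinear_map_right[OF b]]) auto
  finally show ?thesis .
qed

lemma lam_one [simp]: "lam \<one> = 1"
  by (simp add: lam_def)

text \<open>The condition on the antipode of \<open>H\<close> at \<open>g = 1\<close>.\<close>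

lemma rho_counit_left:
  assumes "h \<in> carrier H" "form L \<phi>"
  shows "rs h (\<lambda>p q. counit H p * \<phi> q) = counit H h * \<phi> u"
  using antipode_action_form[OF assms(1) H.one_in assms(2)] by (simp add: assms(1) cong: rs_cong)

text \<open>The counit applied to the second leg of the condition on the antipode of \<open>L\<close>, as \<open>\<epsilon> \<circ> S = \<epsilon>\<close>
  and \<open>\<epsilon>(u) = 1\<close>.\<close>

lemma act_one_right:
  assumes h: "h \<in> carrier H" shows "act h \<one>\<^sub>L = scale L (lam h) \<one>\<^sub>L"
proof (rule eq_by_forms[OF L.space])
  fix \<phi> assume f: "form L \<phi>"
  note [lin] = linear_map_comp[OF f]
  have "\<phi> (act h \<one>\<^sub>L) = rs h (\<lambda>p q. counit L q * \<phi> (act p \<one>\<^sub>L))"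
    by (rule rho_counit[symmetric]) (assumption | rule lin h)+
  also have "\<dots> = rs h (\<lambda>p q. counit L (antipode L q) * \<phi> (act p \<one>\<^sub>L))"
    by (intro rs_cong h) (simp add: L.counit_antipode)
  also have "\<dots> = lam h * (counit L u * \<phi> \<one>\<^sub>L)"
    by (rule antipode_coaction_form[OF h]) (assumption | rule lin)+
  finally show "\<phi> (act h \<one>\<^sub>L) = \<phi> (scale L (lam h) \<one>\<^sub>L)"
    by (simp add: form_scale[OF f])
qed (simp_all add: h carrier_scale)

lemma form_act_one:
  assumes "h \<in> carrier H" "x \<in> carrier L" "form L \<phi>"
  shows "\<phi> (act h \<one>\<^sub>L \<star> x) = lam h * \<phi> x" "\<phi> (x \<star> act h \<one>\<^sub>L) = lam h * \<phi> x"
proof -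
  note [lin] = linear_map_comp[OF assms(3)]
  have "form L (\<lambda>y. \<phi> (y \<star> x))" "form L (\<lambda>y. \<phi> (x \<star> y))" by (assumption | rule lin assms)+
  from this[THEN form_scale, of "\<one>\<^sub>L" "lam h"]
  show "\<phi> (act h \<one>\<^sub>L \<star> x) = lam h * \<phi> x" "\<phi> (x \<star> act h \<one>\<^sub>L) = lam h * \<phi> x"
    using assms by (simp_all add: act_one_right)
qed

text \<open>The counit applied to the first leg of the condition on the antipode of \<open>L\<close>.\<close>

lemma lam_rho_antipode:
  assumes h: "h \<in> carrier H" and f: "form L \<phi>"
  shows "rs h (\<lambda>p q. lam p * \<phi> (antipode L q)) = lam h * \<phi> u"
proof -
  note [lin] = linear_map_comp[OF f]
  have "rs h (\<lambda>p q. counit L (act p \<one>\<^sub>L) * \<phi> (antipode L q)) = lam h * (counit L \<one>\<^sub>L * \<phi> u)"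
    by (rule antipode_coaction_form[OF h]) (assumption | rule lin)+
  then show ?thesis by (simp add: lam_def)
qed

lemma antipode_u [simp]: "antipode L u = u"
proof (rule eq_by_forms[OF L.space])
  fix \<phi> assume f: "form L \<phi>"
  note [lin] = linear_map_comp[OF f]
  have "rs \<one> (\<lambda>p q. lam p * \<phi> (antipode L q)) = lam \<one> * \<phi> (antipode L u)"
    by (rule rho_one) (assumption | rule lin)+
  then show "\<phi> (antipode L u) = \<phi> u"
    using lam_rho_antipode[OF H.one_in f] by simp
qed simp_all

text \<open>In the third axiom of a partial comodule coalgebra the last factor is \<open>\<epsilon>(c\<^sub>2\<^sup>0) c\<^sub>2\<^sup>1 = \<epsilon>(c\<^sub>2) u\<close>.
  So \<open>\<rho>\<close> is coassociative up to multiplication of the last leg by \<open>u\<close>.\<close>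

lemma rho_rho:
  assumes c: "c \<in> carrier H"
    and l: "\<And>b c. b \<in> carrier L \<Longrightarrow> c \<in> carrier L \<Longrightarrow> form H (\<lambda>a. \<beta> a b c)"
      "\<And>a c. a \<in> carrier H \<Longrightarrow> c \<in> carrier L \<Longrightarrow> form L (\<lambda>b. \<beta> a b c)"
      "\<And>a b. a \<in> carrier H \<Longrightarrow> b \<in> carrier L \<Longrightarrow> form L (\<lambda>c. \<beta> a b c)"
  shows "rs c (\<lambda>p q. rs p (\<lambda>r s. \<beta> r s q)) = rs c (\<lambda>p q. sm L q (\<lambda>q1 q2. \<beta> p q1 (q2 \<star> u)))"
proof -
  note [lin] = l[THEN linear_map_comp]
  have "rs c (\<lambda>p q. rs p (\<lambda>r s. \<beta> r s q)) =
    sm H c (\<lambda>c1 c2. rs c1 (\<lambda>p q. rs c2 (\<lambda>r s. sm L q (\<lambda>q1 q2. counit H r * \<beta> p q1 (q2 \<star> s)))))"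
    by (rule rho_rho0[OF c l])
  also have "\<dots> = sm H c (\<lambda>c1 c2. rs c1 (\<lambda>p q. sm L q (\<lambda>q1 q2. rs c2 (\<lambda>r s. counit H r * \<beta> p q1 (q2 \<star> s)))))"
    by (intro H.sm_cong rs_cong c tl_swap) assumption+
  also have "\<dots> = sm H c (\<lambda>c1 c2. rs c1 (\<lambda>p q. sm L q (\<lambda>q1 q2. counit H c2 * \<beta> p q1 (q2 \<star> u))))"
    by (intro H.sm_cong rs_cong L.sm_cong c rho_counit_left) (assumption | rule lin)+
  also have "\<dots> = sm H c (\<lambda>c1 c2. counit H c2 * rs c1 (\<lambda>p q. sm L q (\<lambda>q1 q2. \<beta> p q1 (q2 \<star> u))))"
    by (simp only: tl_times_left)
  also have "\<dots> = rs c (\<lambda>p q. sm L q (\<lambda>q1 q2. \<beta> p q1 (q2 \<star> u)))"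
    by (rule H.counit_right) (assumption | rule lin sp c)+
  finally show ?thesis .
qed

text \<open>The counit applied to the middle leg of \<open>rho_rho\<close>.\<close>

lemma rho_absorb_u:
  assumes c: "c \<in> carrier H" and b: "bilinear_map H L ground_space \<beta>"
  shows "rs c (\<lambda>p q. \<beta> p (q \<star> u)) = rs c \<beta>"
proof -
  note [lin] = linear_map_comp_left[OF b] linear_map_comp_right[OF b]
  have "rs c \<beta> = rs c (\<lambda>p q. rs p (\<lambda>r s. counit L s * \<beta> r q))"
    by (intro rs_cong c rho_counit[symmetric]) (assumption | rule lin)+
  also have "\<dots> = rs c (\<lambda>p q. sm L q (\<lambda>q1 q2. counit L q1 * \<beta> p (q2 \<star> u)))"
    by (rule rho_rho) (assumption | rule lin c)+
  also have "\<dots> = rs c (\<lambda>p q. \<beta> p (q \<star> u))"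
    by (intro rs_cong c L.counit_left) (assumption | rule lin)+
  finally show ?thesis ..
qed

text \<open>\<open>rho_rho\<close> at the unit, where both coactions produce \<open>u\<close>.\<close>

lemma comult_u:
  assumes b: "bilinear_map L L ground_space \<beta>"
  shows "sm L u (\<lambda>a b. \<beta> a (b \<star> u)) = \<beta> u u"
proof -
  note [lin] = linear_map_comp_left[OF b] linear_map_comp_right[OF b]
  have "\<beta> u u = rs \<one> (\<lambda>p q. rs p (\<lambda>r s. counit H r * \<beta> s q))"
    by (subst rho_one, ((assumption | rule lin sp)+)[1], subst rho_counit_left)
       (simp | rule lin)+
  also have "\<dots> = rs \<one> (\<lambda>p q. sm L q (\<lambda>q1 q2. counit H p * \<beta> q1 (q2 \<star> u)))"
    by (rule rho_rho) (assumption | rule lin)+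
  also have "\<dots> = counit H \<one> * sm L u (\<lambda>a b. \<beta> a (b \<star> u))"
    unfolding tl_times_left by (rule rho_one) (assumption | rule lin sp)+
  finally show ?thesis by simp
qed

lemma u_u [simp]: "u \<star> u = u"
proof (rule eq_by_forms[OF L.space])
  fix \<phi> assume f: "form L \<phi>"
  note [lin] = linear_map_comp[OF f]
  have "sm L u (\<lambda>a b. counit L a * \<phi> (b \<star> u)) = counit L u * \<phi> u"
    by (rule comult_u) (assumption | rule lin)+
  moreover have "sm L u (\<lambda>a b. counit L a * \<phi> (b \<star> u)) = \<phi> (u \<star> u)"
    by (rule L.counit_left) (assumption | rule lin)+
  ultimately show "\<phi> (u \<star> u) = \<phi> u" by simp
qed simp_all

text \<open>The quasi-abelian condition at \<open>h = 1\<close>, with the counit applied to the leg in \<open>H\<close>.\<close>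

lemma u_central:
  assumes x: "x \<in> carrier L" shows "u \<star> x = x \<star> u"
proof (rule eq_by_forms[OF L.space])
  fix \<phi> assume f: "form L \<phi>"
  note [lin] = linear_map_comp[OF f]
  let ?\<beta> = "\<lambda>p q. counit H p * \<phi> q"
  have 1: "sm H \<one> (\<lambda>h1 h2. rs h2 (\<lambda>p q. ?\<beta> p (act h1 x \<star> q))) =
       rs \<one> (\<lambda>p q. ?\<beta> p (act \<one> x \<star> q))"
    by (rule H.comult_one) (assumption | rule lin sp x)+
  have 2: "sm H \<one> (\<lambda>h1 h2. rs h1 (\<lambda>p q. ?\<beta> p (q \<star> act h2 x))) =
       rs \<one> (\<lambda>p q. ?\<beta> p (q \<star> act \<one> x))"
    by (rule H.comult_one) (assumption | rule lin sp x)+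
  have 3: "rs \<one> (\<lambda>p q. ?\<beta> p (act \<one> x \<star> q)) = counit H \<one> * \<phi> (act \<one> x \<star> u)"
    by (rule rho_counit_left) (assumption | rule lin sp x)+
  have 4: "rs \<one> (\<lambda>p q. ?\<beta> p (q \<star> act \<one> x)) = counit H \<one> * \<phi> (u \<star> act \<one> x)"
    by (rule rho_counit_left) (assumption | rule lin sp x)+
  have "bilinear_map H L ground_space ?\<beta>" by (assumption | rule lin)+
  from quasi_abelian[OF H.one_in x this] show "\<phi> (u \<star> x) = \<phi> (x \<star> u)"
    unfolding 1 2 3 4 using x by simp
qed (simp_all add: x)

text \<open>The quasi-abelian condition at \<open>x = 1\<close>.\<close>

lemma lam_rho_central:
  assumes h: "h \<in> carrier H" and b: "bilinear_map H L ground_space \<beta>"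
  shows "sm H h (\<lambda>a b. lam a * rs b \<beta>) = sm H h (\<lambda>a b. lam b * rs a \<beta>)"
proof -
  note r = bilinear_map_right[OF b]
  have "sm H h (\<lambda>a b. lam a * rs b \<beta>) = sm H h (\<lambda>h1 h2. rs h2 (\<lambda>p q. \<beta> p (act h1 \<one>\<^sub>L \<star> q)))"
    by (intro H.sm_cong h) (simp add: form_act_one r flip: tl_times_left cong: rs_cong)
  also have "\<dots> = sm H h (\<lambda>h1 h2. rs h1 (\<lambda>p q. \<beta> p (q \<star> act h2 \<one>\<^sub>L)))"
    by (rule quasi_abelian[OF h L.one_in b])
  also have "\<dots> = sm H h (\<lambda>a b. lam b * rs a \<beta>)"
    by (intro H.sm_cong h) (simp add: form_act_one r flip: tl_times_left cong: rs_cong)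
  finally show ?thesis .
qed

text \<open>The counit applied to the leg in \<open>L\<close> of the previous identity: \<open>\<lambda>\<close> is central in \<open>H\<^sup>*\<close>.\<close>

lemma lam_central:
  assumes h: "h \<in> carrier H" and f: "form H \<phi>"
  shows "sm H h (\<lambda>a b. lam a * \<phi> b) = sm H h (\<lambda>a b. lam b * \<phi> a)"
proof -
  note [lin] = linear_map_comp[OF f]
  have "bilinear_map H L ground_space (\<lambda>p q. counit L q * \<phi> p)" by (assumption | rule lin)+
  from lam_rho_central[OF h this] show ?thesis by (simp add: rho_counit f h cong: H.sm_cong)
qed

lemma lam_idem:
  assumes h: "h \<in> carrier H" shows "sm H h (\<lambda>a b. lam a * lam b) = lam h"
proof -
  have "lam h = counit L (act h (\<one>\<^sub>L \<star> \<one>\<^sub>L))" by (simp add: lam_def)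
  also have "\<dots> = sm H h (\<lambda>a b. counit L (act a \<one>\<^sub>L \<star> act b \<one>\<^sub>L))"
    by (rule act_mult[OF h L.one_in L.one_in L.linear_counit])
  finally show ?thesis by (simp add: L.counit_mult lam_def h cong: H.sm_cong)
qed

lemma act_act_lam:
  assumes "h \<in> carrier H" "g \<in> carrier H" "x \<in> carrier L" "form L \<phi>"
  shows "\<phi> (act h (act g x)) = sm H h (\<lambda>a b. lam a * \<phi> (act (b \<cdot> g) x))"
  using act_act[OF assms] by (simp add: form_act_one assms cong: H.sm_cong)

text \<open>The axiom for \<open>h \<rightharpoonup> (g \<rightharpoonup> x)\<close> at \<open>g = 1\<close>.\<close>

lemma act_lam:
  assumes "h \<in> carrier H" "x \<in> carrier L" "form L \<phi>"
  shows "\<phi> (act h x) = sm H h (\<lambda>a b. lam a * \<phi> (act b x))"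
  using act_act_lam[OF assms(1) H.one_in assms(2,3)] by (simp add: assms cong: H.sm_cong)

text \<open>The counit of \<open>h \<rightharpoonup> (g \<rightharpoonup> 1)\<close>, computed in two ways.  This is the counterpart of \<open>comult_u\<close> for \<open>\<lambda>\<close>.\<close>

lemma lam_mult:
  assumes "h \<in> carrier H" "g \<in> carrier H"
  shows "sm H h (\<lambda>a b. lam a * lam (b \<cdot> g)) = lam h * lam g"
  using act_act_lam[OF assms L.one_in L.linear_counit] counit_act[of h "act g \<one>\<^sub>L"] assms
  by (simp add: lam_def)

text \<open>The condition on the antipode of \<open>H\<close> at \<open>h = 1\<close> is the second claim; the first one is its counit.\<close>

lemma lam_antipode:
  assumes g: "g \<in> carrier H" shows "lam (antipode H g) = lam g" "act (antipode H g) u = scale L (lam g) u"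
proof -
  show a: "act (antipode H g) u = scale L (lam g) u"
  proof (rule eq_by_forms[OF L.space])
    fix \<phi> assume f: "form L \<phi>"
    note [lin] = linear_map_comp[OF f]
    have "rs \<one> (\<lambda>p q. counit H p * \<phi> (act (antipode H g) q)) = counit H \<one> * \<phi> (act (antipode H g) u)"
      by (rule rho_counit_left) (assumption | rule lin g)+
    then show "\<phi> (act (antipode H g) u) = \<phi> (scale L (lam g) u)"
      using antipode_action_form[OF H.one_in g f] by (simp add: form_scale[OF f])
  qed (simp_all add: g carrier_scale)
  show "lam (antipode H g) = lam g"
    using counit_act[of "antipode H g" u] a g form_scale[OF L.linear_counit, of u "lam g"] by (simp add: lam_def)
qed

text \<open>By \<open>lam_antipode\<close>, \<open>\<lambda>(h\<^sub>2) (h\<^sub>1 \<rightharpoonup> u) = h\<^sub>1 \<rightharpoonup> (S(h\<^sub>2) \<rightharpoonup> u) = \<lambda>(h\<^sub>1) (h\<^sub>2 S(h\<^sub>3) \<rightharpoonup> u) = \<lambda>(h) u\<close>,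
  while the left side is \<open>h \<rightharpoonup> u\<close> because \<open>\<lambda>\<close> is central and absorbed by the action.\<close>

lemma act_u:
  assumes h: "h \<in> carrier H" shows "act h u = scale L (lam h) u"
proof (rule eq_by_forms[OF L.space])
  fix \<phi> assume f: "form L \<phi>"
  note [lin] = linear_map_comp[OF f]
  have "\<phi> (act h u) = sm H h (\<lambda>a b. lam a * \<phi> (act b u))"
    by (rule act_lam) (assumption | rule lin h f)+
  also have "\<dots> = sm H h (\<lambda>a b. lam b * \<phi> (act a u))"
    by (rule lam_central) (assumption | rule lin h)+
  also have "\<dots> = sm H h (\<lambda>a b. \<phi> (act a (act (antipode H b) u)))"
  proof (intro H.sm_cong h)
    fix a b assume ab: "a \<in> carrier H" "b \<in> carrier H"
    have "form L (\<lambda>x. \<phi> (act a x))" by (assumption | rule lin ab)+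
    from form_scale[OF this, of u "lam b"] ab show "lam b * \<phi> (act a u) = \<phi> (act a (act (antipode H b) u))"
      by (simp add: lam_antipode)
  qed
  also have "\<dots> = sm H h (\<lambda>a b. sm H a (\<lambda>c d. lam c * \<phi> (act (d \<cdot> antipode H b) u)))"
    by (intro H.sm_cong h act_act_lam) (assumption | rule lin f)+
  also have "\<dots> = sm H h (\<lambda>c x. sm H x (\<lambda>d b. lam c * \<phi> (act (d \<cdot> antipode H b) u)))"
    by (rule H.coassoc) (assumption | rule lin h)+
  also have "\<dots> = sm H h (\<lambda>c x. counit H x * (lam c * \<phi> (act \<one> u)))"
    by (intro H.sm_cong h H.antipode_right) (assumption | rule lin)+
  also have "\<dots> = lam h * \<phi> (act \<one> u)"
    by (rule H.counit_right) (assumption | rule lin h)+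
  finally show "\<phi> (act h u) = \<phi> (scale L (lam h) u)" by (simp add: form_scale[OF f])
qed (simp_all add: h carrier_scale)

text \<open>Dual to \<open>act_u\<close>: evaluate \<open>\<lambda>(h\<^sup>0\<^sup>0) S(h\<^sup>0\<^sup>1) h\<^sup>1\<close>.  By \<open>rho_rho\<close> it is \<open>\<lambda>(h\<^sup>0) S(h\<^sup>1\<^sub>1) h\<^sup>1\<^sub>2 u = \<lambda>(h) u\<close>, and by
  \<open>lam_rho_antipode\<close> it is \<open>\<lambda>(h\<^sup>0) u h\<^sup>1 = \<lambda>(h\<^sup>0) h\<^sup>1\<close>.\<close>

lemma lam_rho:
  assumes h: "h \<in> carrier H" and f: "form L \<phi>"
  shows "rs h (\<lambda>p q. lam p * \<phi> q) = lam h * \<phi> u"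
proof -
  note [lin] = linear_map_comp[OF f]
  have "lam h * \<phi> u = rs h (\<lambda>p q. counit L q * (lam p * \<phi> (\<one>\<^sub>L \<star> u)))"
    by (subst rho_counit, rule h, (rule lin)+) simp
  also have "\<dots> = rs h (\<lambda>p q. sm L q (\<lambda>s t. lam p * \<phi> (antipode L s \<star> t \<star> u)))"
    by (intro rs_cong h L.antipode_left[symmetric]) (assumption | rule lin)+
  also have "\<dots> = rs h (\<lambda>p q. sm L q (\<lambda>s t. lam p * \<phi> (antipode L s \<star> (t \<star> u))))"
    by (intro rs_cong L.sm_cong h) (simp_all add: L.mult_assoc)
  also have "\<dots> = rs h (\<lambda>p q. rs p (\<lambda>r s. lam r * \<phi> (antipode L s \<star> q)))"
    by (rule rho_rho[symmetric]) (assumption | rule lin h)+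
  also have "\<dots> = rs h (\<lambda>p q. lam p * \<phi> (u \<star> q))"
    by (intro rs_cong h lam_rho_antipode) (assumption | rule lin)+
  also have "\<dots> = rs h (\<lambda>p q. lam p * \<phi> (q \<star> u))"
    by (intro rs_cong h) (simp add: u_central)
  also have "\<dots> = rs h (\<lambda>p q. lam p * \<phi> q)"
    by (rule rho_absorb_u[OF h]) (assumption | rule lin)+
  finally show ?thesis ..
qed

text \<open>By \<open>rho_comult\<close> the left side contains \<open>\<lambda>(h\<^sub>1\<^sup>0) h\<^sub>1\<^sup>1 = \<lambda>(h\<^sub>1) u\<close>, and the \<open>u\<close> is absorbed by the
  coaction of \<open>h\<^sub>2\<close>.\<close>

lemma lam_comult_rho:
  assumes h: "h \<in> carrier H" and b: "bilinear_map H L ground_space \<beta>"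
  shows "rs h (\<lambda>p q. sm H p (\<lambda>a b. lam a * \<beta> b q)) = sm H h (\<lambda>a b. lam a * rs b \<beta>)"
proof -
  note [lin] = linear_map_comp_left[OF b] linear_map_comp_right[OF b]
  have "rs h (\<lambda>p q. sm H p (\<lambda>a b. lam a * \<beta> b q)) =
      sm H h (\<lambda>c1 c2. rs c1 (\<lambda>p q. rs c2 (\<lambda>r s. lam p * \<beta> r (q \<star> s))))"
    by (rule rho_comult) (assumption | rule lin h)+
  also have "\<dots> = sm H h (\<lambda>c1 c2. rs c1 (\<lambda>p q. lam p * rs c2 (\<lambda>r s. \<beta> r (q \<star> s))))"
    by (simp only: tl_times_left)
  also have "\<dots> = sm H h (\<lambda>c1 c2. lam c1 * rs c2 (\<lambda>r s. \<beta> r (u \<star> s)))"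
    by (intro H.sm_cong h lam_rho) (assumption | rule lin sp)+
  also have "\<dots> = sm H h (\<lambda>c1 c2. lam c1 * rs c2 (\<lambda>r s. \<beta> r (s \<star> u)))"
    by (intro H.sm_cong h arg_cong2[where f = "(*)"] refl rs_cong) (simp_all add: u_central)
  also have "\<dots> = sm H h (\<lambda>a b. lam a * rs b \<beta>)"
    by (intro H.sm_cong h arg_cong2[where f = "(*)"] refl rho_absorb_u b)
  finally show ?thesis .
qed

lemma act_lam_right:
  assumes "h \<in> carrier H" "x \<in> carrier L" "form L \<phi>"
  shows "sm H h (\<lambda>a b. lam b * \<phi> (act a x)) = \<phi> (act h x)"
proof -
  note [lin] = linear_map_comp[OF assms(3)]
  have "sm H h (\<lambda>a b. lam a * \<phi> (act b x)) = sm H h (\<lambda>a b. lam b * \<phi> (act a x))"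
    by (rule lam_central) (assumption | rule lin assms)+
  then show ?thesis using act_lam[OF assms] by simp
qed

section \<open>The projection of \<open>H\<close>\<close>

definition proj :: "'h \<Rightarrow> 'h" where "proj h = sm H h (\<lambda>a b. scale H (lam a) b)"

lemma linear_proj: "linear_map H H proj"
  unfolding proj_def[abs_def] by (assumption | rule lin)+
lemmas lin_proj [lin] = linear_map_comp[OF linear_proj]
lemma proj_in [lin, simp]: "h \<in> carrier H \<Longrightarrow> proj h \<in> carrier H"
  by (rule linear_map_in[OF linear_proj])

lemma form_proj:
  assumes h: "h \<in> carrier H" and f: "form H \<phi>"
  shows "\<phi> (proj h) = sm H h (\<lambda>a b. lam a * \<phi> b)"
proof -
  have "\<phi> (proj h) = sm H h (\<lambda>a b. \<phi> (scale H (lam a) b))"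
    unfolding proj_def by (rule tl_push(1)) (assumption | rule lin f h)+
  also have "\<dots> = sm H h (\<lambda>a b. lam a * \<phi> b)"
    by (intro H.sm_cong h form_scale f)
  finally show ?thesis .
qed

lemma lam_proj: "h \<in> carrier H \<Longrightarrow> lam (proj h) = lam h"
  by (simp add: form_proj[OF _ linear_lam] lam_idem)

lemma proj_one [simp]: "proj \<one> = \<one>"
proof (rule eq_by_forms[OF H.space])
  fix \<phi> assume f: "form H \<phi>"
  note [lin] = linear_map_comp[OF f]
  have "sm H \<one> (\<lambda>a b. lam a * \<phi> b) = lam \<one> * \<phi> \<one>"
    by (rule H.comult_one) (assumption | rule lin sp)+
  then show "\<phi> (proj \<one>) = \<phi> \<one>" by (simp add: form_proj f)
qed simp_all

lemma proj_proj:
  assumes h: "h \<in> carrier H" shows "proj (proj h) = proj h"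
proof (rule eq_by_forms[OF H.space])
  fix \<phi> assume f: "form H \<phi>"
  note [lin] = linear_map_comp[OF f]
  have "\<phi> (proj (proj h)) = sm H h (\<lambda>a b. lam a * \<phi> (proj b))"
    by (rule form_proj[OF h]) (rule lin)+
  also have "\<dots> = sm H h (\<lambda>a b. sm H b (\<lambda>c d. lam a * (lam c * \<phi> d)))"
    unfolding tl_times_left by (intro H.sm_cong h arg_cong2[where f = "(*)"] refl form_proj f)
  also have "\<dots> = sm H h (\<lambda>b d. sm H b (\<lambda>a c. lam a * (lam c * \<phi> d)))"
    by (rule H.coassoc[symmetric]) (assumption | rule lin h)+
  also have "\<dots> = sm H h (\<lambda>b d. sm H b (\<lambda>a c. lam a * lam c) * \<phi> d)"
    by (simp only: mult.assoc tl_times_right[symmetric])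
  also have "\<dots> = sm H h (\<lambda>b d. lam b * \<phi> d)"
    by (intro H.sm_cong h) (simp add: lam_idem)
  finally show "\<phi> (proj (proj h)) = \<phi> (proj h)" by (simp add: form_proj h f)
qed (simp_all add: h)

text \<open>Both follow from coassociativity and centrality of \<open>\<lambda>\<close>.  In particular the image of \<open>proj\<close> is a
  subcoalgebra.\<close>

lemma proj_comult:
  assumes h: "h \<in> carrier H" and b: "bilinear_map H H ground_space \<beta>"
  shows "sm H (proj h) \<beta> = sm H h (\<lambda>a b. \<beta> (proj a) b)" "sm H (proj h) \<beta> = sm H h (\<lambda>a b. \<beta> a (proj b))"
proof -
  note [lin] = linear_map_comp_left[OF b] linear_map_comp_right[OF b]
  have "sm H (proj h) \<beta> = sm H h (\<lambda>a b. lam a * sm H b \<beta>)"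
    by (rule form_proj[OF h]) (assumption | rule lin sp b)+
  also have "\<dots> = sm H h (\<lambda>a b. sm H b (\<lambda>c d. lam a * \<beta> c d))"
    by (simp only: tl_times_left)
  also have "\<dots> = sm H h (\<lambda>e d. sm H e (\<lambda>a c. lam a * \<beta> c d))"
    by (rule H.coassoc[symmetric]) (assumption | rule lin h)+
  finally have 1: "sm H (proj h) \<beta> = \<dots>" .
  have "\<dots> = sm H h (\<lambda>a b. \<beta> (proj a) b)"
    by (intro H.sm_cong h form_proj[symmetric]) (assumption | rule lin)+
  with 1 show "sm H (proj h) \<beta> = sm H h (\<lambda>a b. \<beta> (proj a) b)" by simp
  note 1
  also have "sm H h (\<lambda>e d. sm H e (\<lambda>a c. lam a * \<beta> c d)) = sm H h (\<lambda>e d. sm H e (\<lambda>a c. lam c * \<beta> a d))"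
    by (intro H.sm_cong h lam_central) (assumption | rule lin)+
  also have "\<dots> = sm H h (\<lambda>a k. sm H k (\<lambda>c d. lam c * \<beta> a d))"
    by (rule H.coassoc) (assumption | rule lin h)+
  also have "\<dots> = sm H h (\<lambda>a k. \<beta> a (proj k))"
    by (intro H.sm_cong h form_proj[symmetric]) (assumption | rule lin)+
  finally show "sm H (proj h) \<beta> = sm H h (\<lambda>a b. \<beta> a (proj b))" .
qed

lemma comult_proj:
  assumes h: "h \<in> carrier H" and b: "bilinear_map H H ground_space \<beta>"
    and inv: "\<And>a b. a \<in> carrier H \<Longrightarrow> b \<in> carrier H \<Longrightarrow> \<beta> a (proj b) = \<beta> a b"
  shows "sm H (proj h) \<beta> = sm H h \<beta>"
  unfolding proj_comult(2)[OF h b] by (intro H.sm_cong h inv)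

text \<open>The \<open>\<lambda>\<close> of \<open>proj h\<close> meets the one of the outer projection in \<open>\<lambda>(h\<^sub>1) \<lambda>(h\<^sub>2 g\<^sub>1) = \<lambda>(h\<^sub>1) \<lambda>(g\<^sub>1)\<close>.
  In particular the image of \<open>proj\<close> is a subalgebra.\<close>

lemma proj_mult:
  assumes h: "h \<in> carrier H" and g: "g \<in> carrier H"
  shows "proj (proj h \<cdot> g) = proj h \<cdot> proj g"
proof (rule eq_by_forms[OF H.space])
  fix \<phi> assume f: "form H \<phi>"
  note [lin] = linear_map_comp[OF f]
  have "\<phi> (proj (proj h \<cdot> g)) = sm H h (\<lambda>a b. lam a * \<phi> (proj (b \<cdot> g)))"
    by (rule form_proj[OF h]) (assumption | rule lin g)+
  also have "\<dots> = sm H h (\<lambda>a b. lam a * sm H (b \<cdot> g) (\<lambda>p q. lam p * \<phi> q))"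
    by (intro H.sm_cong h arg_cong2[where f = "(*)"] refl form_proj f) (assumption | rule lin g)+
  also have "\<dots> = sm H h (\<lambda>a b. lam a * sm H b (\<lambda>c d. sm H g (\<lambda>p q. lam (c \<cdot> p) * \<phi> (d \<cdot> q))))"
    by (intro H.sm_cong h arg_cong2[where f = "(*)"] refl H.comult_mult) (assumption | rule lin sp g)+
  also have "\<dots> = sm H h (\<lambda>a b. sm H b (\<lambda>c d. lam a * sm H g (\<lambda>p q. lam (c \<cdot> p) * \<phi> (d \<cdot> q))))"
    by (simp only: tl_times_left)
  also have "\<dots> = sm H h (\<lambda>k d. sm H k (\<lambda>a c. lam a * sm H g (\<lambda>p q. lam (c \<cdot> p) * \<phi> (d \<cdot> q))))"
    by (rule H.coassoc[symmetric]) (assumption | rule lin sp h g)+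
  also have "\<dots> = sm H h (\<lambda>k d. sm H k (\<lambda>a c. sm H g (\<lambda>p q. lam a * lam (c \<cdot> p) * \<phi> (d \<cdot> q))))"
    by (simp only: tl_times_left mult.assoc)
  also have "\<dots> = sm H h (\<lambda>k d. sm H g (\<lambda>p q. sm H k (\<lambda>a c. lam a * lam (c \<cdot> p)) * \<phi> (d \<cdot> q)))"
    unfolding tl_times_right[symmetric] by (intro H.sm_cong h tl_swap)
  also have "\<dots> = sm H h (\<lambda>k d. sm H g (\<lambda>p q. lam k * (lam p * \<phi> (d \<cdot> q))))"
    by (intro H.sm_cong h g) (simp add: lam_mult)
  also have "\<dots> = sm H h (\<lambda>k d. lam k * \<phi> (d \<cdot> proj g))"
    unfolding tl_times_left
    by (intro H.sm_cong h arg_cong2[where f = "(*)"] refl form_proj[symmetric] g) (assumption | rule lin sp)+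
  also have "\<dots> = \<phi> (proj h \<cdot> proj g)"
    by (rule form_proj[symmetric, OF h]) (assumption | rule lin g)+
  finally show "\<phi> (proj (proj h \<cdot> g)) = \<phi> (proj h \<cdot> proj g)" .
qed (simp_all add: h g)

text \<open>The antipode reverses the comultiplication, \<open>\<lambda>\<close> is stable under it, and \<open>\<lambda>\<close> is central.\<close>

lemma antipode_proj:
  assumes h: "h \<in> carrier H" shows "antipode H (proj h) = proj (antipode H h)"
proof (rule eq_by_forms[OF H.space])
  fix \<phi> assume f: "form H \<phi>"
  note [lin] = linear_map_comp[OF f]
  have "\<phi> (proj (antipode H h)) = sm H (antipode H h) (\<lambda>a b. lam a * \<phi> b)"
    by (rule form_proj) (assumption | rule lin h f)+
  also have "\<dots> = sm H h (\<lambda>a b. lam (antipode H b) * \<phi> (antipode H a))"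
    by (rule H.antipode_comult[OF linear_lam f h])
  also have "\<dots> = sm H h (\<lambda>a b. lam b * \<phi> (antipode H a))"
    by (intro H.sm_cong h) (simp add: lam_antipode)
  also have "\<dots> = sm H h (\<lambda>a b. lam a * \<phi> (antipode H b))"
    by (rule lam_central[symmetric]) (assumption | rule lin h)+
  also have "\<dots> = \<phi> (antipode H (proj h))"
    by (rule form_proj[symmetric, OF h]) (assumption | rule lin)+
  finally show "\<phi> (antipode H (proj h)) = \<phi> (proj (antipode H h))" ..
qed (simp_all add: h)

text \<open>By hypothesis a factor \<open>u\<close> can be inserted in the second leg of \<open>\<Delta>(u)\<close>, where \<open>comult_u\<close> applies.\<close>

lemma u_comult:
  assumes x: "x \<in> carrier L" and b: "bilinear_map L L ground_space \<beta>"
    and inv: "\<And>a b. a \<in> carrier L \<Longrightarrow> b \<in> carrier L \<Longrightarrow> \<beta> a (b \<star> u) = \<beta> a b"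
  shows "sm L (x \<star> u) \<beta> = sm L x (\<lambda>a b. \<beta> (a \<star> u) b)"
proof -
  note [lin] = linear_map_comp_left[OF b] linear_map_comp_right[OF b]
  have "sm L (x \<star> u) \<beta> = sm L x (\<lambda>a b. sm L u (\<lambda>c d. \<beta> (a \<star> c) (b \<star> d)))"
    by (rule L.comult_mult) (assumption | rule lin sp x b)+
  also have "\<dots> = sm L x (\<lambda>a b. sm L u (\<lambda>c d. \<beta> (a \<star> c) (b \<star> (d \<star> u))))"
    by (intro L.sm_cong x u_in) (simp add: inv flip: L.mult_assoc)
  also have "\<dots> = sm L x (\<lambda>a b. \<beta> (a \<star> u) (b \<star> u))"
    by (intro L.sm_cong x comult_u) (assumption | rule lin)+
  also have "\<dots> = sm L x (\<lambda>a b. \<beta> (a \<star> u) b)"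
    by (intro L.sm_cong x) (simp add: inv)
  finally show ?thesis .
qed

lemma comult_absorb_u:
  assumes x: "x \<in> carrier L" and b: "bilinear_map L L ground_space \<beta>"
    and inv: "\<And>a b. a \<in> carrier L \<Longrightarrow> b \<in> carrier L \<Longrightarrow> \<beta> (a \<star> u) b = \<beta> a b"
     "\<And>a b. a \<in> carrier L \<Longrightarrow> b \<in> carrier L \<Longrightarrow> \<beta> a (b \<star> u) = \<beta> a b"
  shows "sm L (x \<star> u) \<beta> = sm L x \<beta>"
proof -
  have "sm L (x \<star> u) \<beta> = sm L x (\<lambda>a b. \<beta> (a \<star> u) b)" by (rule u_comult[OF x b]) (rule inv(2))
  also have "\<dots> = sm L x \<beta>" by (intro L.sm_cong x inv)
  finally show ?thesis .
qed

section \<open>The generators of the smash product\<close>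

abbreviation E where "E \<equiv> smash_el H L act \<rho>"
abbreviation Sp where "Sp \<equiv> smash_space H L act \<rho>"

text \<open>In \<open>\<epsilon>(h\<^sub>1\<^sup>0) x h\<^sub>1\<^sup>1 (h\<^sub>2 \<rightharpoonup> 1) \<otimes> h\<^sub>3\<close> the first coaction collapses to \<open>\<epsilon>(h\<^sub>1) u\<close> and the action to
  \<open>\<lambda>(h\<^sub>2) 1\<close>.\<close>

lemma E_eq:
  assumes x: "x \<in> carrier L" and h: "h \<in> carrier H"
  shows "E x h = tensor L H (x \<star> u) (proj h)"
proof -
  have e: "E x h = sm H h (\<lambda>b h3. sm H b (\<lambda>h1 h2. rs h1 (\<lambda>p q.
      tensor L H (scale L (counit H p) (x \<star> q \<star> act h2 \<one>\<^sub>L)) h3)))"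
    unfolding smash_el_def sw3_def sm_sw ..
  show ?thesis
  proof (rule tensor_eqI[OF L.space])
    show i: "E x h \<in> carrier (L \<Otimes> H)" unfolding e by (assumption | rule lin sp x h)+
    show "tensor L H (x \<star> u) (proj h) \<in> carrier (L \<Otimes> H)" by (rule lin x h)+
    fix \<gamma> assume g: "bilinear_map L H ground_space \<gamma>"
    note [lin] = linear_map_comp_left[OF g] linear_map_comp_right[OF g]
    have "tensor_lift L H (E x h) \<gamma> = E x h \<gamma>" by (rule tl_tensor_eval[symmetric]) (rule lin i g)+
    also have "\<dots> = sm H h (\<lambda>b h3. sm H b (\<lambda>h1 h2. rs h1 (\<lambda>p q.
      \<gamma> (scale L (counit H p) (x \<star> q \<star> act h2 \<one>\<^sub>L)) h3)))"
      unfolding e tl_apply tensor_apply[OF g] ..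
    also have "\<dots> = sm H h (\<lambda>b h3. sm H b (\<lambda>h1 h2. rs h1 (\<lambda>p q.
      counit H p * \<gamma> (x \<star> q \<star> act h2 \<one>\<^sub>L) h3)))"
      by (intro H.sm_cong rs_cong h form_scale) (assumption | rule lin x)+
    also have "\<dots> = sm H h (\<lambda>b h3. sm H b (\<lambda>h1 h2. counit H h1 * \<gamma> (x \<star> u \<star> act h2 \<one>\<^sub>L) h3))"
      by (intro H.sm_cong h rho_counit_left) (assumption | rule lin x)+
    also have "\<dots> = sm H h (\<lambda>b h3. \<gamma> (x \<star> u \<star> act b \<one>\<^sub>L) h3)"
      by (intro H.sm_cong h H.counit_left) (assumption | rule lin x)+
    also have "\<dots> = sm H h (\<lambda>b h3. lam b * \<gamma> (x \<star> u) h3)"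
      by (intro H.sm_cong h form_act_one(2)) (assumption | rule lin x)+
    also have "\<dots> = \<gamma> (x \<star> u) (proj h)"
      by (rule form_proj[symmetric, OF h]) (assumption | rule lin x)+
    also have "\<dots> = tensor_lift L H (tensor L H (x \<star> u) (proj h)) \<gamma>"
      by (rule tl_tensor[symmetric]) (rule lin sp x h g)+
    finally show "tensor_lift L H (E x h) \<gamma> = tensor_lift L H (tensor L H (x \<star> u) (proj h)) \<gamma>" .
  qed
qed

lemma Sp_sel: "carrier Sp = module.span fscale {E x h | x h. x \<in> carrier L \<and> h \<in> carrier H}"
  "scale Sp = fscale"
  by (simp_all add: smash_space_def)

lemmas fscale_module = vector_space_fscale[folded module_iff_vector_space]

lemma is_space_Sp [sp, lin, simp]: "is_space Sp"
  unfolding is_space_def Sp_sel by (simp add: vector_space_fscale module.subspace_span[OF fscale_module])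

lemma E_in [lin, simp]: "x \<in> carrier L \<Longrightarrow> h \<in> carrier H \<Longrightarrow> E x h \<in> carrier Sp"
  unfolding Sp_sel by (auto intro!: module.span_base[OF fscale_module])

lemma bilinear_E: "bilinear_map L H Sp E"
proof -
  have "bilinear_map L H (L \<Otimes> H) E"
  proof (rule bilinear_mapI)
    fix x assume x: "x \<in> carrier L"
    show "linear_map H (L \<Otimes> H) (\<lambda>h. E x h)"
      by (subst linear_map_cong[OF E_eq[OF x]]) (assumption | rule lin x)+
  next
    fix h assume h: "h \<in> carrier H"
    show "linear_map L (L \<Otimes> H) (\<lambda>x. E x h)"
      by (subst linear_map_cong[OF E_eq[OF _ h]]) (assumption | rule lin h)+
  qed
  then show ?thesis by (auto simp: bilinear_map_def linear_map_def Sp_sel(2) scale_tensor_space)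
qed

lemmas lin_E_left [lin] = linear_map_comp_left[OF bilinear_E]
lemmas lin_E_right [lin] = linear_map_comp_right[OF bilinear_E]

lemma E_u [simp]: "x \<in> carrier L \<Longrightarrow> h \<in> carrier H \<Longrightarrow> E (x \<star> u) h = E x h"
  by (simp add: E_eq L.mult_assoc)
lemma E_proj [simp]: "x \<in> carrier L \<Longrightarrow> h \<in> carrier H \<Longrightarrow> E x (proj h) = E x h"
  by (simp add: E_eq proj_proj)
lemma E_u_mult: "x \<in> carrier L \<Longrightarrow> y \<in> carrier L \<Longrightarrow> h \<in> carrier H \<Longrightarrow> E (x \<star> (u \<star> y)) h = E (x \<star> y) h"
  by (simp add: u_central flip: L.mult_assoc)

lemma E_mult_u:
  assumes "x \<in> carrier L" "y \<in> carrier L" "h \<in> carrier H"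
  shows "E (x \<star> (y \<star> u)) h = E (x \<star> y) h"
  using E_u[of "x \<star> y" h] assms by (simp add: L.mult_assoc)

lemma E_mult_u_mult:
  assumes "x \<in> carrier L" "y \<in> carrier L" "z \<in> carrier L" "h \<in> carrier H"
  shows "E (x \<star> (y \<star> (u \<star> z))) h = E (x \<star> (y \<star> z)) h"
  using E_u_mult[of "x \<star> y" z h] assms by (simp add: L.mult_assoc)

lemma Sp_linear_eq:
  assumes f: "linear_map Sp U f" and g: "linear_map Sp U g"
    and eq: "\<And>x h. x \<in> carrier L \<Longrightarrow> h \<in> carrier H \<Longrightarrow> f (E x h) = g (E x h)"
    and z: "z \<in> carrier Sp"
  shows "f z = g z"
proof -
  have "z \<in> module.span fscale {E x h | x h. x \<in> carrier L \<and> h \<in> carrier H}" using z by (simp add: Sp_sel)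
  then have "z \<in> carrier Sp \<and> f z = g z"
  proof (induction rule: module.span_induct_alt[OF fscale_module, consumes 1, case_names 0 add])
    case 0
    show ?case using carrier_0[OF is_space_Sp] linear_map_0[OF is_space_Sp f] linear_map_0[OF is_space_Sp g]
      by (simp add: zero_fun_def)
  next
    case (add c x y)
    then obtain a h where ah: "x = E a h" "a \<in> carrier L" "h \<in> carrier H" by blast
    have "fscale c x \<in> carrier Sp" using carrier_scale[OF is_space_Sp, of x c] ah by (simp add: Sp_sel(2))
    moreover have "f (fscale c x) = g (fscale c x)"
      using linear_map_scale[OF f, of x c] linear_map_scale[OF g, of x c] ah eq by (simp add: Sp_sel(2))
    ultimately show ?case
      using add carrier_add[OF is_space_Sp, of "fscale c x" y] linear_map_add[OF f, of "fscale c x" y]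
        linear_map_add[OF g, of "fscale c x" y] by (simp add: plus_fun_def)
  qed
  then show ?thesis ..
qed

lemma Sp_tensor: "z \<in> carrier Sp \<Longrightarrow> z \<in> carrier (L \<Otimes> H)"
proof -
  assume z: "z \<in> carrier Sp"
  have "{E x h | x h. x \<in> carrier L \<and> h \<in> carrier H} \<subseteq> carrier (L \<Otimes> H)"
    by (auto simp: E_eq tensor_in)
  moreover have "module.subspace fscale (carrier (L \<Otimes> H))"
    using is_space_tensor by (auto simp: is_space_def scale_tensor_space)
  ultimately show ?thesis using module.span_minimal[OF fscale_module] z unfolding Sp_sel by blast
qed

text \<open>For bilinear \<open>\<beta>\<close> this is the condition to factor through \<open>E\<close> by a linear map, see \<open>tl_E\<close>.\<close>

definition invariant where
  "invariant \<beta> \<longleftrightarrow> (\<forall>x\<in>carrier L. \<forall>h\<in>carrier H. \<beta> (x \<star> u) h = \<beta> x h \<and> \<beta> x (proj h) = \<beta> x h)"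

lemma tl_E:
  assumes "is_space U" "bilinear_map L H U \<beta>" "invariant \<beta>" "x \<in> carrier L" "h \<in> carrier H"
  shows "tensor_lift L H (E x h) \<beta> = \<beta> x h"
  using assms by (simp add: E_eq tl_tensor invariant_def)

text \<open>Maps prescribed on generators are given by an arbitrarily chosen expression in
  generators.  For an invariant \<open>\<beta>\<close> the result is the value of the linear extension of \<open>\<beta>\<close> to
  \<open>L \<Otimes> H\<close>, so the choice is immaterial.\<close>

lemma smash_extend:
  assumes U: "is_space U" and b: "bilinear_map L H U \<beta>" and inv: "invariant \<beta>" and z: "z \<in> carrier Sp"
  shows "smash_extend H L act \<rho> z \<beta> = tensor_lift L H z \<beta>"
proof -
  let ?P = "\<lambda>ps. set ps \<subseteq> carrier L \<times> carrier H \<and> z = (\<Sum>(x, h)\<leftarrow>ps. E x h)"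
  have "z \<in> module.span fscale {E x h | x h. x \<in> carrier L \<and> h \<in> carrier H}" using z by (simp add: Sp_sel)
  then have "\<exists>ps. ?P ps"
  proof (induction rule: module.span_induct_alt[OF fscale_module, consumes 1, case_names 0 add])
    case 0
    show ?case by (intro exI[of _ "[]"]) simp
  next
    case (add c x y)
    then obtain a h where ah: "x = E a h" "a \<in> carrier L" "h \<in> carrier H" by blast
    then have "fscale c x = E (scale L c a) h"
      using linear_map_scale[OF bilinear_map_left[OF bilinear_E], of h a c] by (simp add: Sp_sel(2))
    moreover from add obtain ps where "set ps \<subseteq> carrier L \<times> carrier H" "y = (\<Sum>(x, h)\<leftarrow>ps. E x h)" by blast
    ultimately show ?case using ah by (intro exI[of _ "(scale L c a, h) # ps"]) (auto simp: carrier_scale)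
  qed
  then have ps: "?P (SOME ps. ?P ps)" by (rule someI_ex)
  define ps where "ps = (SOME ps. ?P ps)"
  have P: "set ps \<subseteq> carrier L \<times> carrier H" "z = (\<Sum>p\<leftarrow>ps. E (fst p) (snd p))"
    using ps unfolding ps_def by (auto simp: split_def)
  have "smash_extend H L act \<rho> z \<beta> = (\<Sum>p\<leftarrow>ps. \<beta> (fst p) (snd p))"
    by (simp add: smash_extend_def lin_extend_def flip: ps_def) (simp add: split_def)
  also have "\<dots> = (\<Sum>p\<leftarrow>ps. tensor_lift L H (E (fst p) (snd p)) \<beta>)"
    using P(1) by (intro arg_cong[where f = sum_list] map_cong refl tl_E[OF U b inv, symmetric]) auto
  also have "\<dots> = tensor_lift L H z \<beta>"
    unfolding P(2)
    by (rule linear_map_sum_list[OF is_space_tensor tensor_lift_linear[OF L.space U b], THEN conjunct1, symmetric])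
      (use P(1) in \<open>auto intro!: Sp_tensor\<close>)
  finally show ?thesis .
qed

lemma smash_extend_E:
  assumes "is_space U" "bilinear_map L H U \<beta>" "invariant \<beta>" "x \<in> carrier L" "h \<in> carrier H"
  shows "smash_extend H L act \<rho> (E x h) \<beta> = \<beta> x h"
  using assms smash_extend[OF assms(1-3)] tl_E[OF assms] by simp

lemma linear_smash_extend:
  assumes "is_space U" "bilinear_map L H U \<beta>" "invariant \<beta>"
  shows "linear_map Sp U (\<lambda>z. smash_extend H L act \<rho> z \<beta>)"
proof -
  have "linear_map Sp U (\<lambda>z. tensor_lift L H z \<beta>)"
    using tensor_lift_linear[OF L.space assms(1,2)]
    by (auto simp: linear_map_def Sp_tensor Sp_sel(2) scale_tensor_space)
  then show ?thesis by (subst linear_map_cong[OF smash_extend[OF assms]]) auto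
qed

declare H.mult_in [simp] L.mult_in [simp]

section \<open>Multiplication\<close>

abbreviation mu where "mu \<equiv> smash_mult H L act \<rho>"
abbreviation A where "A \<equiv> smash H L act \<rho>"

definition gen_mult where
  "gen_mult x h y g = sm H h (\<lambda>h1 h2. E (x \<star> act h1 y) (h2 \<cdot> g))"

lemma gen_mult_in [lin, simp]: "x \<in> carrier L \<Longrightarrow> h \<in> carrier H \<Longrightarrow> y \<in> carrier L \<Longrightarrow> g \<in> carrier H \<Longrightarrow>
    gen_mult x h y g \<in> carrier Sp"
  unfolding gen_mult_def by (assumption | rule lin sp)+

lemma form_gen_mult:
  assumes "x \<in> carrier L" "h \<in> carrier H" "y \<in> carrier L" "g \<in> carrier H" "form Sp \<phi>"
  shows "\<phi> (gen_mult x h y g) = sm H h (\<lambda>h1 h2. \<phi> (E (x \<star> act h1 y) (h2 \<cdot> g)))"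
  unfolding gen_mult_def by (rule tl_push(1)[OF _ _ _ assms(5)]) (assumption | rule lin sp assms)+

text \<open>In order: \<open>u\<close> is central; \<open>\<lambda>\<close> is absorbed by the action (\<open>act_lam\<close>); \<open>h \<rightharpoonup> yu = (h\<^sub>1 \<rightharpoonup> y) \<lambda>(h\<^sub>2) u\<close>;
  and the factor \<open>h\<^sub>2\<close> next to \<open>g\<close> may be replaced by \<open>proj h\<^sub>2\<close>, after which \<open>proj_mult\<close> applies.\<close>

lemma gen_mult_invariant:
  assumes x: "x \<in> carrier L" and h: "h \<in> carrier H" and y: "y \<in> carrier L" and g: "g \<in> carrier H"
  shows "gen_mult (x \<star> u) h y g = gen_mult x h y g"
    "gen_mult x (proj h) y g = gen_mult x h y g"
    "gen_mult x h (y \<star> u) g = gen_mult x h y g"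
    "gen_mult x h y (proj g) = gen_mult x h y g"
proof -
  note xy = x y h g
  show "gen_mult (x \<star> u) h y g = gen_mult x h y g"
    unfolding gen_mult_def by (intro H.sm_cong h) (simp add: xy L.mult_assoc E_u_mult)
  \<comment> \<open>The action on \<open>y\<close> supplies a factor \<open>\<lambda>\<close>, which is passed to the second leg.\<close>
  have pr: "\<phi> (gen_mult x h y g) = sm H h (\<lambda>a b. \<phi> (E (x \<star> act a y) (proj b \<cdot> g)))"
    if f: "form Sp \<phi>" and g: "g \<in> carrier H" for \<phi> g
  proof -
    note [lin] = linear_map_comp[OF f]
    have "\<phi> (gen_mult x h y g) = sm H h (\<lambda>a b. \<phi> (E (x \<star> act a y) (b \<cdot> g)))"
      by (rule form_gen_mult[OF x h y g f])
    also have "\<dots> = sm H h (\<lambda>e d. sm H e (\<lambda>a c. lam c * \<phi> (E (x \<star> act a y) (d \<cdot> g))))"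
      by (intro H.sm_cong h act_lam_right[symmetric]) (assumption | rule lin sp xy g)+
    also have "\<dots> = sm H h (\<lambda>a b. sm H b (\<lambda>c d. lam c * \<phi> (E (x \<star> act a y) (d \<cdot> g))))"
      by (rule H.coassoc) (assumption | rule lin sp xy g)+
    also have "\<dots> = sm H h (\<lambda>a b. \<phi> (E (x \<star> act a y) (proj b \<cdot> g)))"
      by (intro H.sm_cong h form_proj[symmetric]) (assumption | rule lin sp xy g)+
    finally show ?thesis .
  qed
  have E_pm: "E a (proj b \<cdot> proj g) = E a (proj b \<cdot> g)" if "a \<in> carrier L" "b \<in> carrier H" for a b
    using E_proj[of a "proj b \<cdot> g"] that g by (simp add: proj_mult[symmetric])
  show "gen_mult x h y (proj g) = gen_mult x h y g"
  proof (rule eq_by_forms[OF is_space_Sp])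
    fix \<phi> assume f: "form Sp \<phi>"
    show "\<phi> (gen_mult x h y (proj g)) = \<phi> (gen_mult x h y g)"
      by (simp only: pr[OF f g] pr[OF f proj_in[OF g]], intro H.sm_cong h) (simp add: E_pm xy)
  qed (simp_all add: xy)
  show "gen_mult x (proj h) y g = gen_mult x h y g"
  proof (rule eq_by_forms[OF is_space_Sp])
    fix \<phi> assume f: "form Sp \<phi>"
    note [lin] = linear_map_comp[OF f]
    have "\<phi> (gen_mult x (proj h) y g) = sm H h (\<lambda>a b. lam a * \<phi> (gen_mult x b y g))"
      unfolding gen_mult_def by (rule form_proj[OF h]) (assumption | rule lin sp xy)+
    also have "\<dots> = sm H h (\<lambda>a b. lam a * sm H b (\<lambda>c d. \<phi> (E (x \<star> act c y) (d \<cdot> g))))"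
      by (intro H.sm_cong h arg_cong2[where f = "(*)"] refl form_gen_mult) (assumption | rule xy f)+
    also have "\<dots> = sm H h (\<lambda>a b. sm H b (\<lambda>c d. lam a * \<phi> (E (x \<star> act c y) (d \<cdot> g))))"
      by (simp only: tl_times_left)
    also have "\<dots> = sm H h (\<lambda>e d. sm H e (\<lambda>a c. lam a * \<phi> (E (x \<star> act c y) (d \<cdot> g))))"
      by (rule H.coassoc[symmetric]) (assumption | rule lin sp xy)+
    also have "\<dots> = sm H h (\<lambda>e d. \<phi> (E (x \<star> act e y) (d \<cdot> g)))"
      by (intro H.sm_cong h act_lam[symmetric]) (assumption | rule lin sp xy)+
    also have "\<dots> = \<phi> (gen_mult x h y g)" by (rule form_gen_mult[symmetric]) (assumption | rule xy f)+
    finally show "\<phi> (gen_mult x (proj h) y g) = \<phi> (gen_mult x h y g)" .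
  qed (simp_all add: xy)
  show "gen_mult x h (y \<star> u) g = gen_mult x h y g"
  proof (rule eq_by_forms[OF is_space_Sp])
    fix \<phi> assume f: "form Sp \<phi>"
    note [lin] = linear_map_comp[OF f]
    have "\<phi> (gen_mult x h (y \<star> u) g) = sm H h (\<lambda>e d. \<phi> (E (x \<star> act e (y \<star> u)) (d \<cdot> g)))"
      by (rule form_gen_mult) (assumption | rule lin xy f)+
    also have "\<dots> = sm H h (\<lambda>e d. sm H e (\<lambda>a b. \<phi> (E (x \<star> (act a y \<star> act b u)) (d \<cdot> g))))"
      by (intro H.sm_cong h act_mult) (assumption | rule lin sp xy)+
    also have "\<dots> = sm H h (\<lambda>e d. sm H e (\<lambda>a b. lam b * \<phi> (E (x \<star> (act a y \<star> u)) (d \<cdot> g))))"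
    proof (intro H.sm_cong h)
      fix e d a b assume i: "a \<in> carrier H" "b \<in> carrier H" "d \<in> carrier H"
      have "form L (\<lambda>w. \<phi> (E (x \<star> (act a y \<star> w)) (d \<cdot> g)))" by (assumption | rule lin sp xy i)+
      from form_scale[OF this u_in, of "lam b"] i
      show "\<phi> (E (x \<star> (act a y \<star> act b u)) (d \<cdot> g)) = lam b * \<phi> (E (x \<star> (act a y \<star> u)) (d \<cdot> g))"
        by (simp only: act_u)
    qed
    also have "\<dots> = sm H h (\<lambda>e d. sm H e (\<lambda>a b. lam b * \<phi> (E (x \<star> act a y) (d \<cdot> g))))"
      by (intro H.sm_cong h) (simp_all add: xy E_mult_u)
    also have "\<dots> = sm H h (\<lambda>e d. \<phi> (E (x \<star> act e y) (d \<cdot> g)))"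
      by (intro H.sm_cong h act_lam_right) (assumption | rule lin sp xy)+
    also have "\<dots> = \<phi> (gen_mult x h y g)" by (rule form_gen_mult[symmetric]) (assumption | rule xy f)+
    finally show "\<phi> (gen_mult x h (y \<star> u) g) = \<phi> (gen_mult x h y g)" .
  qed (simp_all add: xy)
qed

lemma gen_mult_bilinear:
  "x \<in> carrier L \<Longrightarrow> h \<in> carrier H \<Longrightarrow> bilinear_map L H Sp (gen_mult x h)"
  "y \<in> carrier L \<Longrightarrow> g \<in> carrier H \<Longrightarrow> bilinear_map L H Sp (\<lambda>x h. gen_mult x h y g)"
  unfolding gen_mult_def by (assumption | rule lin sp)+

lemma invariant_gen_mult:
  "x \<in> carrier L \<Longrightarrow> h \<in> carrier H \<Longrightarrow> invariant (gen_mult x h)"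
  "y \<in> carrier L \<Longrightarrow> g \<in> carrier H \<Longrightarrow> invariant (\<lambda>x h. gen_mult x h y g)"
  by (simp_all add: invariant_def gen_mult_invariant)

lemma mu_eq: "mu z w = smash_extend H L act \<rho> z (\<lambda>x h. smash_extend H L act \<rho> w (gen_mult x h))"
  by (simp add: smash_mult_def gen_mult_def[abs_def] sm_sw)

text \<open>The product of the smash product is defined by extending in two steps.  This lemma allows the
  outer one.\<close>

lemma inner_extend:
  assumes w: "w \<in> carrier Sp"
  shows "bilinear_map L H Sp (\<lambda>x h. smash_extend H L act \<rho> w (gen_mult x h))" (is "bilinear_map _ _ _ ?F")
    "invariant (\<lambda>x h. smash_extend H L act \<rho> w (gen_mult x h))"
proof -
  have eq: "?F x h = tensor_lift L H w (gen_mult x h)" if "x \<in> carrier L" "h \<in> carrier H" for x h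
    by (rule smash_extend[OF is_space_Sp gen_mult_bilinear(1) invariant_gen_mult(1) w]; rule that)
  show "bilinear_map L H Sp ?F"
  proof (rule bilinear_mapI)
    fix x assume x: "x \<in> carrier L"
    show "linear_map H Sp (\<lambda>h. ?F x h)"
      by (subst linear_map_cong[OF eq[OF x]])
        (assumption | rule lin sp w Sp_tensor bilinear_map_right[OF gen_mult_bilinear(2)] x)+
  next
    fix h assume h: "h \<in> carrier H"
    show "linear_map L Sp (\<lambda>x. ?F x h)"
      by (subst linear_map_cong[OF eq[OF _ h]])
        (assumption | rule lin sp w Sp_tensor bilinear_map_left[OF gen_mult_bilinear(2)] h)+
  qed
  show "invariant ?F"
    unfolding invariant_def
  proof (intro ballI conjI)
    fix x h assume xh: "x \<in> carrier L" "h \<in> carrier H"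
    show "?F (x \<star> u) h = ?F x h" "?F x (proj h) = ?F x h"
      using xh by (simp_all only: eq proj_in L.mult_in u_in)
        (intro tl_cong L.space Sp_tensor w; simp add: gen_mult_invariant)+
  qed
qed

lemma mu_E:
  assumes x: "x \<in> carrier L" and h: "h \<in> carrier H" and y: "y \<in> carrier L" and g: "g \<in> carrier H"
  shows "mu (E x h) (E y g) = gen_mult x h y g"
proof -
  have "mu (E x h) (E y g) = smash_extend H L act \<rho> (E y g) (gen_mult x h)"
    unfolding mu_eq by (rule smash_extend_E) (rule sp inner_extend E_in x h y g)+
  also have "\<dots> = gen_mult x h y g"
    by (rule smash_extend_E) (rule sp gen_mult_bilinear invariant_gen_mult x h y g)+
  finally show ?thesis .
qed

lemma bilinear_mu: "bilinear_map Sp Sp Sp mu"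
proof (rule bilinear_mapI)
  fix w assume w: "w \<in> carrier Sp"
  show "linear_map Sp Sp (\<lambda>z. mu z w)"
    unfolding mu_eq by (rule linear_smash_extend) (rule sp inner_extend w)+
next
  fix z assume z: "z \<in> carrier Sp"
  have "linear_map Sp Sp (\<lambda>w. tensor_lift L H z (\<lambda>x h. smash_extend H L act \<rho> w (gen_mult x h)))"
    by (assumption | rule lin sp z Sp_tensor linear_smash_extend gen_mult_bilinear(1) invariant_gen_mult(1))+
  then show "linear_map Sp Sp (\<lambda>w. mu z w)"
    unfolding mu_eq by (subst linear_map_cong[OF smash_extend[OF is_space_Sp inner_extend z]]) auto
qed

lemma mu_in [lin, simp]: "z \<in> carrier Sp \<Longrightarrow> w \<in> carrier Sp \<Longrightarrow> mu z w \<in> carrier Sp"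
  using bilinear_mu by (auto simp: bilinear_map_def linear_map_def)
lemmas lin_mu_left [lin] = linear_map_comp_left[OF bilinear_mu]
lemmas lin_mu_right [lin] = linear_map_comp_right[OF bilinear_mu]

lemma form_mu:
  assumes "x \<in> carrier L" "h \<in> carrier H" "y \<in> carrier L" "g \<in> carrier H" "form Sp \<phi>"
  shows "\<phi> (mu (E x h) (E y g)) = sm H h (\<lambda>h1 h2. \<phi> (E (x \<star> act h1 y) (h2 \<cdot> g)))"
  using form_gen_mult[OF assms] mu_E[OF assms(1-4)] by simp

text \<open>The computation for a global action, up to the factor \<open>\<lambda>\<close> coming from
  \<open>h \<rightharpoonup> (g \<rightharpoonup> z)\<close>; it is absorbed by the action on \<open>y\<close> next to it.\<close>

lemma mu_assoc_gen:
  assumes x: "x \<in> carrier L" and h: "h \<in> carrier H" and y: "y \<in> carrier L" and g: "g \<in> carrier H"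
    and z: "z \<in> carrier L" and k: "k \<in> carrier H"
  shows "mu (mu (E x h) (E y g)) (E z k) = mu (E x h) (mu (E y g) (E z k))"
proof (rule eq_by_forms[OF is_space_Sp])
  fix \<phi> assume f: "form Sp \<phi>"
  note [lin] = linear_map_comp[OF f]
  note in' = x y z h g k
  let ?M = "\<lambda>h1 c g1 h2 g2. \<phi> (E (x \<star> (act h1 y \<star> act (c \<cdot> g1) z)) (h2 \<cdot> (g2 \<cdot> k)))"
  have "\<phi> (mu (mu (E x h) (E y g)) (E z k)) =
      sm H h (\<lambda>h1 h2. \<phi> (mu (E (x \<star> act h1 y) (h2 \<cdot> g)) (E z k)))"
    by (rule form_mu) (assumption | rule lin sp in')+
  also have "\<dots> = sm H h (\<lambda>h1 h2. sm H (h2 \<cdot> g) (\<lambda>c d. \<phi> (E (x \<star> act h1 y \<star> act c z) (d \<cdot> k))))"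
    by (intro H.sm_cong h form_mu) (assumption | rule lin sp in' f)+
  also have "\<dots> = sm H h (\<lambda>h1 h2. sm H h2 (\<lambda>c d. sm H g (\<lambda>g1 g2.
       \<phi> (E (x \<star> act h1 y \<star> act (c \<cdot> g1) z) (d \<cdot> g2 \<cdot> k)))))"
    by (intro H.sm_cong h H.comult_mult) (assumption | rule lin sp in')+
  also have "\<dots> = sm H h (\<lambda>h1 h2. sm H h2 (\<lambda>c d. sm H g (\<lambda>g1 g2. ?M h1 c g1 d g2)))"
    by (intro H.sm_cong h g) (simp_all add: L.mult_assoc H.mult_assoc in')
  finally have L: "\<phi> (mu (mu (E x h) (E y g)) (E z k)) = \<dots>" .
  have "\<phi> (mu (E x h) (mu (E y g) (E z k))) =
      sm H g (\<lambda>g1 g2. \<phi> (mu (E x h) (E (y \<star> act g1 z) (g2 \<cdot> k))))"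
    by (rule form_mu) (assumption | rule lin sp in')+
  also have "\<dots> = sm H g (\<lambda>g1 g2. sm H h (\<lambda>h1 h2.
      \<phi> (E (x \<star> act h1 (y \<star> act g1 z)) (h2 \<cdot> (g2 \<cdot> k)))))"
    by (intro H.sm_cong g form_mu) (assumption | rule lin sp in' f)+
  also have "\<dots> = sm H g (\<lambda>g1 g2. sm H h (\<lambda>h1 h2. sm H h1 (\<lambda>a b.
      \<phi> (E (x \<star> (act a y \<star> act b (act g1 z))) (h2 \<cdot> (g2 \<cdot> k))))))"
    by (intro H.sm_cong g h act_mult) (assumption | rule lin sp in')+
  also have "\<dots> = sm H g (\<lambda>g1 g2. sm H h (\<lambda>h1 h2. sm H h1 (\<lambda>a b. sm H b (\<lambda>c d. lam c * ?M a d g1 h2 g2))))"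
    by (intro H.sm_cong g h act_act_lam) (assumption | rule lin sp in')+
  also have "\<dots> = sm H g (\<lambda>g1 g2. sm H h (\<lambda>h1 h2. sm H h1 (\<lambda>e d. sm H e (\<lambda>a c. lam c * ?M a d g1 h2 g2))))"
    by (intro H.sm_cong g h H.coassoc[symmetric]) (assumption | rule lin sp in')+
  also have "\<dots> = sm H g (\<lambda>g1 g2. sm H h (\<lambda>h1 h2. sm H h1 (\<lambda>e d. ?M e d g1 h2 g2)))"
    by (intro H.sm_cong g h act_lam_right) (assumption | rule lin sp in')+
  also have "\<dots> = sm H g (\<lambda>g1 g2. sm H h (\<lambda>e k. sm H k (\<lambda>d h2. ?M e d g1 h2 g2)))"
    by (intro H.sm_cong g h H.coassoc) (assumption | rule lin sp in')+
  also have "\<dots> = sm H h (\<lambda>e k. sm H g (\<lambda>g1 g2. sm H k (\<lambda>d h2. ?M e d g1 h2 g2)))"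
    by (rule tl_swap)
  also have "\<dots> = sm H h (\<lambda>e k. sm H k (\<lambda>d h2. sm H g (\<lambda>g1 g2. ?M e d g1 h2 g2)))"
    by (intro H.sm_cong h tl_swap)
  finally show "\<phi> (mu (mu (E x h) (E y g)) (E z k)) = \<phi> (mu (E x h) (mu (E y g) (E z k)))"
    using L by simp
qed (simp_all add: x y z h g k)

lemma mu_assoc:
  assumes "a \<in> carrier Sp" "b \<in> carrier Sp" "c \<in> carrier Sp"
  shows "mu (mu a b) c = mu a (mu b c)"
proof (rule Sp_linear_eq[where f = "\<lambda>a. mu (mu a b) c" and g = "\<lambda>a. mu a (mu b c)"])
  fix x h assume xh: "x \<in> carrier L" "h \<in> carrier H"
  show "mu (mu (E x h) b) c = mu (E x h) (mu b c)"
  proof (rule Sp_linear_eq[where f = "\<lambda>b. mu (mu (E x h) b) c" and g = "\<lambda>b. mu (E x h) (mu b c)"])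
    fix y g assume yg: "y \<in> carrier L" "g \<in> carrier H"
    show "mu (mu (E x h) (E y g)) c = mu (E x h) (mu (E y g) c)"
      by (rule Sp_linear_eq[where f = "\<lambda>c. mu (mu (E x h) (E y g)) c" and g = "\<lambda>c. mu (E x h) (mu (E y g) c)"])
        (assumption | rule lin assms xh yg mu_assoc_gen)+
  qed (assumption | rule lin assms xh)+
qed (assumption | rule lin assms)+

lemma mu_one:
  assumes "z \<in> carrier Sp"
  shows "mu (E \<one>\<^sub>L \<one>) z = z" "mu z (E \<one>\<^sub>L \<one>) = z"
proof -
  have 1: "mu (E \<one>\<^sub>L \<one>) (E y g) = E y g" if yg: "y \<in> carrier L" "g \<in> carrier H" for y g
  proof (rule eq_by_forms[OF is_space_Sp])
    fix \<phi> assume f: "form Sp \<phi>"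
    note [lin] = linear_map_comp[OF f]
    have "\<phi> (mu (E \<one>\<^sub>L \<one>) (E y g)) = sm H \<one> (\<lambda>h1 h2. \<phi> (E (\<one>\<^sub>L \<star> act h1 y) (h2 \<cdot> g)))"
      by (rule form_mu) (rule lin yg f)+
    also have "\<dots> = \<phi> (E (\<one>\<^sub>L \<star> act \<one> y) (\<one> \<cdot> g))"
      by (rule H.comult_one) (assumption | rule lin sp yg)+
    finally show "\<phi> (mu (E \<one>\<^sub>L \<one>) (E y g)) = \<phi> (E y g)" using yg by simp
  qed (simp_all add: yg)
  have 2: "mu (E x h) (E \<one>\<^sub>L \<one>) = E x h" if xh: "x \<in> carrier L" "h \<in> carrier H" for x h
  proof (rule eq_by_forms[OF is_space_Sp])
    fix \<phi> assume f: "form Sp \<phi>"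
    note [lin] = linear_map_comp[OF f]
    have "\<phi> (mu (E x h) (E \<one>\<^sub>L \<one>)) = sm H h (\<lambda>h1 h2. \<phi> (E (x \<star> act h1 \<one>\<^sub>L) (h2 \<cdot> \<one>)))"
      by (rule form_mu) (rule lin xh f)+
    also have "\<dots> = sm H h (\<lambda>h1 h2. lam h1 * \<phi> (E x h2))"
    proof (intro H.sm_cong xh)
      fix a b assume ab: "a \<in> carrier H" "b \<in> carrier H"
      have "form L (\<lambda>w. \<phi> (E w b))" by (assumption | rule lin ab)+
      from form_act_one(2)[OF ab(1) xh(1) this] ab
      show "\<phi> (E (x \<star> act a \<one>\<^sub>L) (b \<cdot> \<one>)) = lam a * \<phi> (E x b)" by simp
    qed
    also have "\<dots> = \<phi> (E x (proj h))"
      by (rule form_proj[symmetric]) (assumption | rule lin xh)+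
    finally show "\<phi> (mu (E x h) (E \<one>\<^sub>L \<one>)) = \<phi> (E x h)" using xh by simp
  qed (simp_all add: xh)
  show "mu (E \<one>\<^sub>L \<one>) z = z"
    by (rule Sp_linear_eq[where f = "\<lambda>z. mu (E \<one>\<^sub>L \<one>) z" and g = "\<lambda>z. z"]) (assumption | rule lin assms 1)+
  show "mu z (E \<one>\<^sub>L \<one>) = z"
    by (rule Sp_linear_eq[where f = "\<lambda>z. mu z (E \<one>\<^sub>L \<one>)" and g = "\<lambda>z. z"]) (assumption | rule lin assms 2)+
qed

section \<open>Comultiplication\<close>

definition gen_comult where
  "gen_comult x h = sm L x (\<lambda>x1 x2. sm H h (\<lambda>h1 h2. rs h1 (\<lambda>p q.
     tensor Sp Sp (E x1 p) (E (x2 \<star> q) h2))))"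

lemma bilinear_gen_comult: "bilinear_map L H (Sp \<Otimes> Sp) gen_comult"
  unfolding gen_comult_def by (assumption | rule lin sp)+

lemma gen_comult_in [lin]: "x \<in> carrier L \<Longrightarrow> h \<in> carrier H \<Longrightarrow> gen_comult x h \<in> carrier (Sp \<Otimes> Sp)"
  unfolding gen_comult_def by (assumption | rule lin sp)+

lemma form_gen_comult:
  assumes x: "x \<in> carrier L" and h: "h \<in> carrier H" and g: "bilinear_map Sp Sp ground_space \<gamma>"
  shows "tensor_lift Sp Sp (gen_comult x h) \<gamma> = sm L x (\<lambda>x1 x2. sm H h (\<lambda>h1 h2. rs h1 (\<lambda>p q.
     \<gamma> (E x1 p) (E (x2 \<star> q) h2))))"
proof -
  have "tensor_lift Sp Sp (gen_comult x h) \<gamma> = gen_comult x h \<gamma>"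
    by (rule tl_tensor_eval[symmetric]) (rule sp gen_comult_in x h g)+
  then show ?thesis unfolding gen_comult_def tl_apply tensor_apply[OF g] .
qed

lemma invariant_gen_comult: "invariant gen_comult"
  unfolding invariant_def
proof (intro ballI conjI)
  fix x h assume x: "x \<in> carrier L" and h: "h \<in> carrier H"
  show "gen_comult (x \<star> u) h = gen_comult x h"
  proof (rule tensor_eqI[OF is_space_Sp])
    fix \<gamma> assume g: "bilinear_map Sp Sp ground_space \<gamma>"
    note [lin] = linear_map_comp_left[OF g] linear_map_comp_right[OF g]
    have "tensor_lift Sp Sp (gen_comult (x \<star> u) h) \<gamma> = sm L (x \<star> u) (\<lambda>x1 x2. sm H h (\<lambda>h1 h2. rs h1 (\<lambda>p q.
       \<gamma> (E x1 p) (E (x2 \<star> q) h2))))"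
      by (rule form_gen_comult) (rule lin x h g)+
    also have "\<dots> = sm L x (\<lambda>x1 x2. sm H h (\<lambda>h1 h2. rs h1 (\<lambda>p q.
       \<gamma> (E x1 p) (E (x2 \<star> q) h2))))"
      by (rule comult_absorb_u, rule x, ((assumption | rule lin sp h)+)[1]; intro H.sm_cong rs_cong h)
        (simp_all add: L.mult_assoc E_u_mult)
    also have "\<dots> = tensor_lift Sp Sp (gen_comult x h) \<gamma>"
      by (rule form_gen_comult[symmetric]) (rule lin x h g)+
    finally show "tensor_lift Sp Sp (gen_comult (x \<star> u) h) \<gamma> = tensor_lift Sp Sp (gen_comult x h) \<gamma>" .
  qed (rule lin x h)+
  show "gen_comult x (proj h) = gen_comult x h"
  proof (rule tensor_eqI[OF is_space_Sp])
    fix \<gamma> assume g: "bilinear_map Sp Sp ground_space \<gamma>"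
    note [lin] = linear_map_comp_left[OF g] linear_map_comp_right[OF g]
    have "tensor_lift Sp Sp (gen_comult x (proj h)) \<gamma> = sm L x (\<lambda>x1 x2. sm H (proj h) (\<lambda>h1 h2. rs h1 (\<lambda>p q.
       \<gamma> (E x1 p) (E (x2 \<star> q) h2))))"
      by (rule form_gen_comult) (rule lin x h g)+
    also have "\<dots> = sm L x (\<lambda>x1 x2. sm H h (\<lambda>h1 h2. rs h1 (\<lambda>p q.
       \<gamma> (E x1 p) (E (x2 \<star> q) h2))))"
    proof (intro L.sm_cong x comult_proj h)
      fix x1 x2 a b assume i: "x1 \<in> carrier L" "x2 \<in> carrier L" "a \<in> carrier H" "b \<in> carrier H"
      show "rs a (\<lambda>p q. \<gamma> (E x1 p) (E (x2 \<star> q) (proj b))) = rs a (\<lambda>p q. \<gamma> (E x1 p) (E (x2 \<star> q) b))"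
        by (intro rs_cong i) (simp add: i)
    qed (assumption | rule lin sp)+
    also have "\<dots> = tensor_lift Sp Sp (gen_comult x h) \<gamma>"
      by (rule form_gen_comult[symmetric]) (rule lin x h g)+
    finally show "tensor_lift Sp Sp (gen_comult x (proj h)) \<gamma> = tensor_lift Sp Sp (gen_comult x h) \<gamma>" .
  qed (rule lin x h)+
qed

abbreviation Delta where "Delta z \<equiv> smash_extend H L act \<rho> z gen_comult"

lemma linear_Delta: "linear_map Sp (Sp \<Otimes> Sp) (\<lambda>z. Delta z)"
  by (rule linear_smash_extend[OF is_space_tensor bilinear_gen_comult invariant_gen_comult])
lemmas lin_Delta [lin] = linear_map_comp[OF linear_Delta]
lemma Delta_in [lin, simp]: "z \<in> carrier Sp \<Longrightarrow> Delta z \<in> carrier (Sp \<Otimes> Sp)"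
  by (rule linear_map_in[OF linear_Delta])

abbreviation ds where "ds z \<gamma> \<equiv> tensor_lift Sp Sp (Delta z) \<gamma>"

lemma ds_E:
  assumes x: "x \<in> carrier L" and h: "h \<in> carrier H" and g: "bilinear_map Sp Sp ground_space \<gamma>"
  shows "ds (E x h) \<gamma> = sm L x (\<lambda>x1 x2. sm H h (\<lambda>h1 h2. rs h1 (\<lambda>p q.
     \<gamma> (E x1 p) (E (x2 \<star> q) h2))))"
  unfolding smash_extend_E[OF is_space_tensor bilinear_gen_comult invariant_gen_comult x h]
  by (rule form_gen_comult[OF assms])

text \<open>Directed instances of \<open>tl_swap\<close>: sums over \<open>H\<close> outermost, then over \<open>L\<close>, then coactions.\<close>

lemmas pull = tl_swap[of H L _ H H] tl_swap[of L L _ H H] tl_swap[of H L _ L L]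

text \<open>Both sides are brought to the form \<open>x\<^sub>1, h\<^sub>1\<^sup>0 | x\<^sub>2 (h\<^sub>1\<^sup>1)\<^sub>1, h\<^sub>2\<^sup>0 | x\<^sub>3 (h\<^sub>1\<^sup>1)\<^sub>2 h\<^sub>2\<^sup>1, h\<^sub>3\<close>.  On the left this
  uses \<open>rho_comult\<close> and \<open>rho_rho\<close>, and the \<open>u\<close> that appears is absorbed by the generator.\<close>

lemma ds_coassoc_gen:
  assumes x: "x \<in> carrier L" and h: "h \<in> carrier H"
    and l: "\<And>b c. b \<in> carrier Sp \<Longrightarrow> c \<in> carrier Sp \<Longrightarrow> form Sp (\<lambda>a. \<beta> a b c)"
      "\<And>a c. a \<in> carrier Sp \<Longrightarrow> c \<in> carrier Sp \<Longrightarrow> form Sp (\<lambda>b. \<beta> a b c)"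
      "\<And>a b. a \<in> carrier Sp \<Longrightarrow> b \<in> carrier Sp \<Longrightarrow> form Sp (\<lambda>c. \<beta> a b c)"
  shows "ds (E x h) (\<lambda>w c3. ds w (\<lambda>c1 c2. \<beta> c1 c2 c3)) = ds (E x h) (\<lambda>c1 w. ds w (\<lambda>c2 c3. \<beta> c1 c2 c3))"
proof -
  note [lin] = l[THEN linear_map_comp]
  have "ds (E x h) (\<lambda>w c3. ds w (\<lambda>c1 c2. \<beta> c1 c2 c3)) =
    sm L x (\<lambda>x1 x2. sm H h (\<lambda>h1 h2. rs h1 (\<lambda>p q. ds (E x1 p) (\<lambda>c1 c2. \<beta> c1 c2 (E (x2 \<star> q) h2)))))"
    by (rule ds_E) (assumption | rule lin sp x h)+
  also have "\<dots> = sm L x (\<lambda>x1 x2. sm H h (\<lambda>h1 h2. rs h1 (\<lambda>p q.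
      sm L x1 (\<lambda>a b. sm H p (\<lambda>c d. rs c (\<lambda>r s. \<beta> (E a r) (E (b \<star> s) d) (E (x2 \<star> q) h2)))))))"
    by (intro L.sm_cong H.sm_cong rs_cong x h ds_E) (assumption | rule lin sp)+
  also have "\<dots> = sm L x (\<lambda>x1 x2. sm H h (\<lambda>h1 h2. sm L x1 (\<lambda>a b. rs h1 (\<lambda>p q.
      sm H p (\<lambda>c d. rs c (\<lambda>r s. \<beta> (E a r) (E (b \<star> s) d) (E (x2 \<star> q) h2)))))))"
    by (intro L.sm_cong H.sm_cong x h tl_swap)
  also have "\<dots> = sm L x (\<lambda>x1 x2. sm H h (\<lambda>h1 h2. sm L x1 (\<lambda>a b. sm H h1 (\<lambda>c1 c2. rs c1 (\<lambda>p q. rs c2 (\<lambda>p' q'.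
      rs p (\<lambda>r s. \<beta> (E a r) (E (b \<star> s) p') (E (x2 \<star> (q \<star> q')) h2))))))))"
    by (intro L.sm_cong H.sm_cong x h rho_comult) (assumption | rule lin sp)+
  also have "\<dots> = sm L x (\<lambda>x1 x2. sm H h (\<lambda>h1 h2. sm L x1 (\<lambda>a b. sm H h1 (\<lambda>c1 c2. rs c2 (\<lambda>p' q'. rs c1 (\<lambda>p q.
      rs p (\<lambda>r s. \<beta> (E a r) (E (b \<star> s) p') (E (x2 \<star> (q \<star> q')) h2))))))))"
    by (intro L.sm_cong H.sm_cong x h tl_swap; assumption)
  also have "\<dots> = sm L x (\<lambda>x1 x2. sm H h (\<lambda>h1 h2. sm L x1 (\<lambda>a b. sm H h1 (\<lambda>c1 c2. rs c2 (\<lambda>p' q'. rs c1 (\<lambda>p q.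
      sm L q (\<lambda>q1 q2. \<beta> (E a p) (E (b \<star> q1) p') (E (x2 \<star> (q2 \<star> u \<star> q')) h2))))))))"
    by (intro L.sm_cong H.sm_cong rs_cong x h rho_rho) (assumption | rule lin sp)+
  also have "\<dots> = sm L x (\<lambda>x1 x2. sm H h (\<lambda>h1 h2. sm L x1 (\<lambda>a b. sm H h1 (\<lambda>c1 c2. rs c2 (\<lambda>p' q'. rs c1 (\<lambda>p q.
      sm L q (\<lambda>q1 q2. \<beta> (E a p) (E (b \<star> q1) p') (E (x2 \<star> q2 \<star> q') h2))))))))"
    by (intro L.sm_cong H.sm_cong rs_cong x h arg_cong3[where f = \<beta>] refl; assumption?)
      (simp_all add: L.mult_assoc E_mult_u_mult)
  also have "\<dots> = sm L x (\<lambda>x1 x2. sm L x1 (\<lambda>a b. sm H h (\<lambda>h1 h2. sm H h1 (\<lambda>c1 c2. rs c2 (\<lambda>p' q'. rs c1 (\<lambda>p q.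
      sm L q (\<lambda>q1 q2. \<beta> (E a p) (E (b \<star> q1) p') (E (x2 \<star> q2 \<star> q') h2))))))))"
    by (intro L.sm_cong x tl_swap)
  also have "\<dots> = sm L x (\<lambda>a y. sm L y (\<lambda>b x2. sm H h (\<lambda>h1 h2. sm H h1 (\<lambda>c1 c2. rs c2 (\<lambda>p' q'. rs c1 (\<lambda>p q.
      sm L q (\<lambda>q1 q2. \<beta> (E a p) (E (b \<star> q1) p') (E (x2 \<star> q2 \<star> q') h2))))))))"
    by (rule L.coassoc) (assumption | rule lin sp x h)+
  also have "\<dots> = sm L x (\<lambda>a y. sm L y (\<lambda>b x2. sm H h (\<lambda>c1 k. sm H k (\<lambda>c2 h2. rs c2 (\<lambda>p' q'. rs c1 (\<lambda>p q.
      sm L q (\<lambda>q1 q2. \<beta> (E a p) (E (b \<star> q1) p') (E (x2 \<star> q2 \<star> q') h2))))))))"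
    by (intro L.sm_cong x H.coassoc) (assumption | rule lin sp h)+
  also have "\<dots> = sm L x (\<lambda>a y. sm L y (\<lambda>b x2. sm H h (\<lambda>c1 k. sm H k (\<lambda>c2 h2. rs c1 (\<lambda>p q. rs c2 (\<lambda>p' q'.
      sm L q (\<lambda>q1 q2. \<beta> (E a p) (E (b \<star> q1) p') (E (x2 \<star> q2 \<star> q') h2))))))))"
    by (intro L.sm_cong H.sm_cong x h tl_swap; assumption)
  finally have left: "ds (E x h) (\<lambda>w c3. ds w (\<lambda>c1 c2. \<beta> c1 c2 c3)) = \<dots>" .
  have "ds (E x h) (\<lambda>c1 w. ds w (\<lambda>c2 c3. \<beta> c1 c2 c3)) =
    sm L x (\<lambda>a y. sm H h (\<lambda>c1 k. rs c1 (\<lambda>p q. ds (E (y \<star> q) k) (\<lambda>c2 c3. \<beta> (E a p) c2 c3))))"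
    by (rule ds_E) (assumption | rule lin sp x h)+
  also have "\<dots> = sm L x (\<lambda>a y. sm H h (\<lambda>c1 k. rs c1 (\<lambda>p q.
     sm L (y \<star> q) (\<lambda>b d. sm H k (\<lambda>c2 h2. rs c2 (\<lambda>p' q'. \<beta> (E a p) (E b p') (E (d \<star> q') h2)))))))"
    by (intro L.sm_cong H.sm_cong rs_cong x h ds_E) (assumption | rule lin sp)+
  also have "\<dots> = sm L x (\<lambda>a y. sm H h (\<lambda>c1 k. rs c1 (\<lambda>p q. sm L y (\<lambda>b x2. sm L q (\<lambda>q1 q2.
      sm H k (\<lambda>c2 h2. rs c2 (\<lambda>p' q'. \<beta> (E a p) (E (b \<star> q1) p') (E (x2 \<star> q2 \<star> q') h2))))))))"
    by (intro L.sm_cong H.sm_cong rs_cong x h L.comult_mult) (assumption | rule lin sp)+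
  also have "\<dots> = sm H h (\<lambda>c1 k. sm H k (\<lambda>c2 h2. sm L x (\<lambda>a y. sm L y (\<lambda>b x2. rs c1 (\<lambda>p q. sm L q (\<lambda>q1 q2. rs c2 (\<lambda>p' q'.
      \<beta> (E a p) (E (b \<star> q1) p') (E (x2 \<star> q2 \<star> q') h2))))))))"
    by (simp only: pull)
  finally have right: "ds (E x h) (\<lambda>c1 w. ds w (\<lambda>c2 c3. \<beta> c1 c2 c3)) = \<dots>" .
  show ?thesis unfolding left right by (simp only: pull)
qed

text \<open>Both sides are brought to the form \<open>?W\<close>, in which the first leg is the generator of
  \<open>x\<^sub>1 (h\<^sub>1\<^sup>0 \<rightharpoonup> y\<^sub>1)\<close> and \<open>h\<^sub>2\<^sup>0 g\<^sub>1\<^sup>0\<close>, the second one that of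
  \<open>x\<^sub>2 h\<^sub>1\<^sup>1 h\<^sub>2\<^sup>1 (h\<^sub>3 \<rightharpoonup> y\<^sub>2) (h\<^sub>4 \<rightharpoonup> g\<^sub>1\<^sup>1)\<close> and \<open>h\<^sub>5 g\<^sub>2\<close>.  Most steps only permute the sums and
  rebracket the coproducts.\<close>

lemma ds_mult_gen:
  assumes x: "x \<in> carrier L" and h: "h \<in> carrier H" and y: "y \<in> carrier L" and g: "g \<in> carrier H"
    and b: "bilinear_map Sp Sp ground_space \<gamma>"
  shows "ds (mu (E x h) (E y g)) \<gamma> =
    ds (E x h) (\<lambda>a1 a2. ds (E y g) (\<lambda>b1 b2. \<gamma> (mu a1 b1) (mu a2 b2)))"
proof -
  note [lin] = linear_map_comp_left[OF b] linear_map_comp_right[OF b]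
  note i = x h y g
  let ?G = "\<lambda>a p b q. \<gamma> (E a p) (E b q)"
  let ?B1 = "\<lambda>x1 x2 y1 y2 p q d1 d2.
     ?G (x1 \<star> y1) p (x2 \<star> y2 \<star> q) (d1 \<cdot> d2)"
  let ?B2 = "\<lambda>x1 x2 y1 y2 p q d1 d2.
     ?G (x1 \<star> y1) p (x2 \<star> (y2 \<star> q)) (d1 \<cdot> d2)"
  let ?C1 = "\<lambda>x1 x2 y1 y2 g0 g1 d1 d2 p q p' q' h2 h4.
     ?G (x1 \<star> act p y1) (p' \<cdot> g0) (x2 \<star> (q \<star> (act h2 y2 \<star> q' \<star> act h4 g1))) (d1 \<cdot> d2)"
  let ?C2 = "\<lambda>x1 x2 y1 y2 g0 g1 d1 d2 p q p' q' h3 h4.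
     ?G (x1 \<star> act p y1) (p' \<cdot> g0) (x2 \<star> (q \<star> (q' \<star> act h3 y2 \<star> act h4 g1))) (d1 \<cdot> d2)"
  let ?M = "\<lambda>x1 x2 y1 y2 g0 g1 d2 h2 p q.
     \<gamma> (mu (E x1 p) (E y1 g0)) (mu (E (x2 \<star> q) h2) (E (y2 \<star> g1) d2))"
  let ?W = "\<lambda>x1 x2 y1 y2 g0 g1 d1 d2 p q p' q' c c'.
     ?G (x1 \<star> act p y1) (p' \<cdot> g0) (x2 \<star> (q \<star> q') \<star> (act c y2 \<star> act c' g1)) (d1 \<cdot> d2)"
  have QA: "sm H k (\<lambda>h2 h3. rs h3 (\<lambda>p' q'.
      ?C1 x1 x2 y1 y2 g0 g1 d1 d2 p q p' q' h2 h4)) =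
    sm H k (\<lambda>h2 h3. rs h2 (\<lambda>p' q'.
      ?C2 x1 x2 y1 y2 g0 g1 d1 d2 p q p' q' h3 h4))"
    if m: "k \<in> carrier H" "p \<in> carrier H" "g0 \<in> carrier H" "h4 \<in> carrier H" "d1 \<in> carrier H" "d2 \<in> carrier H"
      "x1 \<in> carrier L" "x2 \<in> carrier L" "y1 \<in> carrier L" "y2 \<in> carrier L" "q \<in> carrier L" "g1 \<in> carrier L"
    for k p g0 h4 d1 d2 x1 x2 y1 y2 q g1
    by (rule quasi_abelian[where \<beta> = "\<lambda>p' z. ?G (x1 \<star> act p y1) (p' \<cdot> g0)
        (x2 \<star> (q \<star> (z \<star> act h4 g1))) (d1 \<cdot> d2)"])
      (assumption | rule lin sp m)+
  have "ds (mu (E x h) (E y g)) \<gamma> = sm H h (\<lambda>h1 h2. ds (E (x \<star> act h1 y) (h2 \<cdot> g)) \<gamma>)"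
    by (rule form_mu) (assumption | rule lin sp i b)+
  also have "\<dots> = sm H h (\<lambda>h1 h2. sm L (x \<star> act h1 y) (\<lambda>a b. sm H (h2 \<cdot> g) (\<lambda>c d. rs c (\<lambda>p q.
      ?G a p (b \<star> q) d))))"
    by (intro H.sm_cong h ds_E) (assumption | rule lin sp i b)+
  also have "\<dots> = sm H h (\<lambda>h1 h2. sm L x (\<lambda>x1 x2. sm L (act h1 y) (\<lambda>y1 y2. sm H (h2 \<cdot> g) (\<lambda>c d. rs c (\<lambda>p q.
      ?G (x1 \<star> y1) p (x2 \<star> y2 \<star> q) d)))))"
    by (intro H.sm_cong h L.comult_mult) (assumption | rule lin sp i)+
  also have "\<dots> = sm H h (\<lambda>h1 h2. sm L x (\<lambda>x1 x2. sm L (act h1 y) (\<lambda>y1 y2. sm H h2 (\<lambda>c1 d1. sm H g (\<lambda>c2 d2. rs (c1 \<cdot> c2) (\<lambda>p q.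
      ?B1 x1 x2 y1 y2 p q d1 d2))))))"
    by (intro H.sm_cong L.sm_cong h x H.comult_mult) (assumption | rule lin sp i)+
  also have "\<dots> = sm H h (\<lambda>h1 h2. sm H h2 (\<lambda>c1 d1. sm H g (\<lambda>c2 d2. sm L x (\<lambda>x1 x2. sm L (act h1 y) (\<lambda>y1 y2. rs (c1 \<cdot> c2) (\<lambda>p q.
      ?B1 x1 x2 y1 y2 p q d1 d2))))))"
    by (simp only: pull)
  also have "\<dots> = sm H h (\<lambda>h1 h2. sm H h2 (\<lambda>c1 d1. sm H g (\<lambda>c2 d2. sm L x (\<lambda>x1 x2. rs (c1 \<cdot> c2) (\<lambda>p q. sm L (act h1 y) (\<lambda>y1 y2.
      ?B1 x1 x2 y1 y2 p q d1 d2))))))"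
    by (simp only: pull)
  also have "\<dots> = sm H h (\<lambda>h1 h2. sm H h2 (\<lambda>c1 d1. sm H g (\<lambda>c2 d2. sm L x (\<lambda>x1 x2. rs (c1 \<cdot> c2) (\<lambda>p q. sm L (act h1 y) (\<lambda>y1 y2.
      ?B2 x1 x2 y1 y2 p q d1 d2))))))"
    by (intro H.sm_cong L.sm_cong rs_cong i) (simp_all add: L.mult_assoc i)
  also have "\<dots> = sm H h (\<lambda>h1 h2. sm H g (\<lambda>c2 d2. sm H h2 (\<lambda>c1 d1. sm L x (\<lambda>x1 x2. rs (c1 \<cdot> c2) (\<lambda>p q. sm L (act h1 y) (\<lambda>y1 y2.
      ?B2 x1 x2 y1 y2 p q d1 d2))))))"
    by (intro H.sm_cong h tl_swap)
  also have "\<dots> = sm H g (\<lambda>c2 d2. sm H h (\<lambda>h1 h2. sm H h2 (\<lambda>c1 d1. sm L x (\<lambda>x1 x2. rs (c1 \<cdot> c2) (\<lambda>p q. sm L (act h1 y) (\<lambda>y1 y2.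
      ?B2 x1 x2 y1 y2 p q d1 d2))))))"
    by (rule tl_swap)
  also have "\<dots> = sm H g (\<lambda>c2 d2. sm H h (\<lambda>e d1. sm H e (\<lambda>h1 c1. sm L x (\<lambda>x1 x2. rs (c1 \<cdot> c2) (\<lambda>p q. sm L (act h1 y) (\<lambda>y1 y2.
      ?B2 x1 x2 y1 y2 p q d1 d2))))))"
    by (intro H.sm_cong g H.coassoc[symmetric]) (assumption | rule lin sp i)+
  also have "\<dots> = sm H g (\<lambda>c2 d2. sm H h (\<lambda>e d1. sm L x (\<lambda>x1 x2. sm H e (\<lambda>h1 c1. rs (c1 \<cdot> c2) (\<lambda>p q. sm L (act h1 y) (\<lambda>y1 y2.
      ?B2 x1 x2 y1 y2 p q d1 d2))))))"
    by (intro H.sm_cong g h tl_swap)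
  \<comment> \<open>The compatibility axiom evaluates \<open>\<Delta>(h \<rightharpoonup> y)\<close> together with \<open>\<rho>(hg)\<close>.\<close>
  also have "\<dots> = sm H g (\<lambda>c2 d2. sm H h (\<lambda>e d1. sm L x (\<lambda>x1 x2.
      sm H e (\<lambda>d h4. sm H d (\<lambda>e' h3. sm H e' (\<lambda>h1 h2. rs h1 (\<lambda>p q. rs h3 (\<lambda>p' q'. rs c2 (\<lambda>g0 g1. sm L y (\<lambda>y1 y2.
      ?G (x1 \<star> act p y1) (p' \<cdot> g0) (x2 \<star> (q \<star> act h2 y2 \<star> q' \<star> act h4 g1)) (d1 \<cdot> d2)))))))))))"
    by (intro H.sm_cong L.sm_cong g h x matched_compat) (assumption | rule lin sp i)+
  also have "\<dots> = sm H g (\<lambda>c2 d2. sm H h (\<lambda>e d1. sm L x (\<lambda>x1 x2.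
      sm H e (\<lambda>d h4. sm H d (\<lambda>e' h3. sm H e' (\<lambda>h1 h2. rs h1 (\<lambda>p q. rs h3 (\<lambda>p' q'. rs c2 (\<lambda>g0 g1. sm L y (\<lambda>y1 y2.
      ?C1 x1 x2 y1 y2 g0 g1 d1 d2 p q p' q' h2 h4))))))))))"
    by (intro H.sm_cong L.sm_cong rs_cong i) (simp_all add: L.mult_assoc i)
  also have "\<dots> = sm H g (\<lambda>c2 d2. sm H h (\<lambda>e d1. sm L x (\<lambda>x1 x2.
      sm H e (\<lambda>d h4. sm H d (\<lambda>h1 k. sm H k (\<lambda>h2 h3. rs h1 (\<lambda>p q. rs h3 (\<lambda>p' q'. rs c2 (\<lambda>g0 g1. sm L y (\<lambda>y1 y2.
      ?C1 x1 x2 y1 y2 g0 g1 d1 d2 p q p' q' h2 h4))))))))))"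
    by (intro H.sm_cong L.sm_cong g h x H.coassoc) (assumption | rule lin sp i)+
  also have "\<dots> = sm H g (\<lambda>c2 d2. sm H h (\<lambda>e d1. sm H e (\<lambda>d h4. sm H d (\<lambda>h1 k. sm H k (\<lambda>h2 h3.
      sm L x (\<lambda>x1 x2. sm L y (\<lambda>y1 y2. rs h1 (\<lambda>p q. rs h3 (\<lambda>p' q'. rs c2 (\<lambda>g0 g1.
      ?C1 x1 x2 y1 y2 g0 g1 d1 d2 p q p' q' h2 h4))))))))))"
    by (simp only: pull)
  also have "\<dots> = sm H g (\<lambda>c2 d2. sm H h (\<lambda>e d1. sm H e (\<lambda>d h4. sm H d (\<lambda>h1 k. sm H k (\<lambda>h2 h3.
      sm L x (\<lambda>x1 x2. sm L y (\<lambda>y1 y2. rs h1 (\<lambda>p q. rs c2 (\<lambda>g0 g1. rs h3 (\<lambda>p' q'.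
      ?C1 x1 x2 y1 y2 g0 g1 d1 d2 p q p' q' h2 h4))))))))))"
    by (intro H.sm_cong L.sm_cong rs_cong i tl_swap; assumption)
  also have "\<dots> = sm H g (\<lambda>c2 d2. sm H h (\<lambda>e d1. sm H e (\<lambda>d h4. sm H d (\<lambda>h1 k.
      sm L x (\<lambda>x1 x2. sm L y (\<lambda>y1 y2. rs h1 (\<lambda>p q. rs c2 (\<lambda>g0 g1. sm H k (\<lambda>h2 h3. rs h3 (\<lambda>p' q'.
      ?C1 x1 x2 y1 y2 g0 g1 d1 d2 p q p' q' h2 h4))))))))))"
    by (simp only: pull)
  \<comment> \<open>Exchange \<open>h\<^sub>2 \<rightharpoonup> y\<^sub>2\<close> with the coaction of \<open>h\<^sub>3\<close>.\<close>
  also have "\<dots> = sm H g (\<lambda>c2 d2. sm H h (\<lambda>e d1. sm H e (\<lambda>d h4. sm H d (\<lambda>h1 k.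
      sm L x (\<lambda>x1 x2. sm L y (\<lambda>y1 y2. rs h1 (\<lambda>p q. rs c2 (\<lambda>g0 g1. sm H k (\<lambda>h2 h3. rs h2 (\<lambda>p' q'.
      ?C2 x1 x2 y1 y2 g0 g1 d1 d2 p q p' q' h3 h4))))))))))"
    by (rule H.sm_cong[OF g], rule H.sm_cong[OF h], rule H.sm_cong, assumption, rule H.sm_cong, assumption,
      rule L.sm_cong[OF x], rule L.sm_cong[OF y], rule rs_cong, assumption, rule rs_cong, assumption,
      rule QA; assumption)
  also have "\<dots> = sm H g (\<lambda>c2 d2. sm H h (\<lambda>e d1. sm H e (\<lambda>d h4. sm H d (\<lambda>h1 k. sm H k (\<lambda>h2 h3.
      sm L x (\<lambda>x1 x2. sm L y (\<lambda>y1 y2. rs h1 (\<lambda>p q. rs c2 (\<lambda>g0 g1. rs h2 (\<lambda>p' q'.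
      ?C2 x1 x2 y1 y2 g0 g1 d1 d2 p q p' q' h3 h4))))))))))"
    by (simp only: pull)
  also have "\<dots> = sm H g (\<lambda>c2 d2. sm H h (\<lambda>e d1. sm H e (\<lambda>d h4. sm H d (\<lambda>h1 k. sm H k (\<lambda>h2 h3.
      sm L x (\<lambda>x1 x2. sm L y (\<lambda>y1 y2. rs h1 (\<lambda>p q. rs c2 (\<lambda>g0 g1. rs h2 (\<lambda>p' q'.
      ?W x1 x2 y1 y2 g0 g1 d1 d2 p q p' q' h3 h4))))))))))"
    by (intro H.sm_cong L.sm_cong rs_cong i) (simp_all add: L.mult_assoc i)
  also have "\<dots> = sm H g (\<lambda>c2 d2. sm H h (\<lambda>e d1. sm H e (\<lambda>d h4. sm H d (\<lambda>h1 k. sm H k (\<lambda>h2 h3.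
      sm L x (\<lambda>x1 x2. sm L y (\<lambda>y1 y2. rs c2 (\<lambda>g0 g1. rs h1 (\<lambda>p q. rs h2 (\<lambda>p' q'.
      ?W x1 x2 y1 y2 g0 g1 d1 d2 p q p' q' h3 h4))))))))))"
    by (intro H.sm_cong L.sm_cong i tl_swap; assumption)
  finally have left: "ds (mu (E x h) (E y g)) \<gamma> = \<dots>" .

  have "ds (E x h) (\<lambda>a1 a2. ds (E y g) (\<lambda>b1 b2. \<gamma> (mu a1 b1) (mu a2 b2))) =
    sm L x (\<lambda>x1 x2. sm H h (\<lambda>h1 h2. rs h1 (\<lambda>p q. ds (E y g) (\<lambda>b1 b2. \<gamma> (mu (E x1 p) b1) (mu (E (x2 \<star> q) h2) b2)))))"
    by (rule ds_E) (assumption | rule lin sp i)+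
  also have "\<dots> = sm L x (\<lambda>x1 x2. sm H h (\<lambda>h1 h2. rs h1 (\<lambda>p q. sm L y (\<lambda>y1 y2. sm H g (\<lambda>c2 d2. rs c2 (\<lambda>g0 g1.
      ?M x1 x2 y1 y2 g0 g1 d2 h2 p q))))))"
    by (intro L.sm_cong H.sm_cong rs_cong x h ds_E) (assumption | rule lin sp i)+
  also have "\<dots> = sm H h (\<lambda>h1 h2. sm H g (\<lambda>c2 d2. sm L x (\<lambda>x1 x2. sm L y (\<lambda>y1 y2. rs h1 (\<lambda>p q. rs c2 (\<lambda>g0 g1.
      ?M x1 x2 y1 y2 g0 g1 d2 h2 p q))))))"
    by (simp only: pull)
  also have "\<dots> = sm H g (\<lambda>c2 d2. sm H h (\<lambda>h1 h2. sm L x (\<lambda>x1 x2. sm L y (\<lambda>y1 y2. rs h1 (\<lambda>p q. rs c2 (\<lambda>g0 g1.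
      ?M x1 x2 y1 y2 g0 g1 d2 h2 p q))))))"
    by (rule tl_swap)
  also have "\<dots> = sm H g (\<lambda>c2 d2. sm H h (\<lambda>h1 h2. sm L x (\<lambda>x1 x2. sm L y (\<lambda>y1 y2. rs c2 (\<lambda>g0 g1. rs h1 (\<lambda>p q.
      ?M x1 x2 y1 y2 g0 g1 d2 h2 p q))))))"
    by (intro H.sm_cong L.sm_cong i tl_swap; assumption)
  also have "\<dots> = sm H g (\<lambda>c2 d2. sm H h (\<lambda>h1 h2. sm L x (\<lambda>x1 x2. sm L y (\<lambda>y1 y2. rs c2 (\<lambda>g0 g1. rs h1 (\<lambda>p q. sm H p (\<lambda>p1 p2.
      \<gamma> (E (x1 \<star> act p1 y1) (p2 \<cdot> g0)) (mu (E (x2 \<star> q) h2) (E (y2 \<star> g1) d2)))))))))"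
    by (intro H.sm_cong L.sm_cong rs_cong i form_mu) (assumption | rule lin sp i)+
  \<comment> \<open>On this side the coaction of a coproduct and the action on a product have to be expanded.\<close>
  also have "\<dots> = sm H g (\<lambda>c2 d2. sm H h (\<lambda>h1 h2. sm L x (\<lambda>x1 x2. sm L y (\<lambda>y1 y2. rs c2 (\<lambda>g0 g1.
      sm H h1 (\<lambda>a1 a2. rs a1 (\<lambda>p q. rs a2 (\<lambda>p' q'.
      \<gamma> (E (x1 \<star> act p y1) (p' \<cdot> g0)) (mu (E (x2 \<star> (q \<star> q')) h2) (E (y2 \<star> g1) d2))))))))))"
    by (intro H.sm_cong L.sm_cong rs_cong i rho_comult) (assumption | rule lin sp i)+
  also have "\<dots> = sm H g (\<lambda>c2 d2. sm H h (\<lambda>h1 h2. sm L x (\<lambda>x1 x2. sm L y (\<lambda>y1 y2. rs c2 (\<lambda>g0 g1.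
      sm H h1 (\<lambda>a1 a2. rs a1 (\<lambda>p q. rs a2 (\<lambda>p' q'. sm H h2 (\<lambda>c d1.
      ?G (x1 \<star> act p y1) (p' \<cdot> g0) (x2 \<star> (q \<star> q') \<star> act c (y2 \<star> g1)) (d1 \<cdot> d2))))))))))"
    by (intro H.sm_cong L.sm_cong rs_cong i form_mu) (assumption | rule lin sp i)+
  also have "\<dots> = sm H g (\<lambda>c2 d2. sm H h (\<lambda>h1 h2. sm L x (\<lambda>x1 x2. sm L y (\<lambda>y1 y2. rs c2 (\<lambda>g0 g1.
      sm H h1 (\<lambda>a1 a2. rs a1 (\<lambda>p q. rs a2 (\<lambda>p' q'. sm H h2 (\<lambda>c d1. sm H c (\<lambda>c' c''.
      ?W x1 x2 y1 y2 g0 g1 d1 d2 p q p' q' c' c''))))))))))"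
    by (intro H.sm_cong L.sm_cong rs_cong i act_mult) (assumption | rule lin sp i)+
  also have "\<dots> = sm H g (\<lambda>c2 d2. sm H h (\<lambda>h1 h2. sm H h1 (\<lambda>a1 a2. sm H h2 (\<lambda>c d1. sm H c (\<lambda>c' c''.
      sm L x (\<lambda>x1 x2. sm L y (\<lambda>y1 y2. rs c2 (\<lambda>g0 g1. rs a1 (\<lambda>p q. rs a2 (\<lambda>p' q'.
      ?W x1 x2 y1 y2 g0 g1 d1 d2 p q p' q' c' c''))))))))))"
    by (simp only: pull)
  also have "\<dots> = sm H g (\<lambda>c2 d2. sm H h (\<lambda>h1 h2. sm H h2 (\<lambda>c d1. sm H h1 (\<lambda>a1 a2. sm H c (\<lambda>c' c''.
      sm L x (\<lambda>x1 x2. sm L y (\<lambda>y1 y2. rs c2 (\<lambda>g0 g1. rs a1 (\<lambda>p q. rs a2 (\<lambda>p' q'.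
      ?W x1 x2 y1 y2 g0 g1 d1 d2 p q p' q' c' c''))))))))))"
    by (intro H.sm_cong i tl_swap)
  also have "\<dots> = sm H g (\<lambda>c2 d2. sm H h (\<lambda>h1 h2. sm H h2 (\<lambda>c d1. sm H c (\<lambda>c' c''. sm H h1 (\<lambda>a1 a2.
      sm L x (\<lambda>x1 x2. sm L y (\<lambda>y1 y2. rs c2 (\<lambda>g0 g1. rs a1 (\<lambda>p q. rs a2 (\<lambda>p' q'.
      ?W x1 x2 y1 y2 g0 g1 d1 d2 p q p' q' c' c''))))))))))"
    by (intro H.sm_cong i tl_swap; assumption)
  also have "\<dots> = sm H g (\<lambda>c2 d2. sm H h (\<lambda>e d1. sm H e (\<lambda>h1 c. sm H c (\<lambda>c' c''. sm H h1 (\<lambda>a1 a2.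
      sm L x (\<lambda>x1 x2. sm L y (\<lambda>y1 y2. rs c2 (\<lambda>g0 g1. rs a1 (\<lambda>p q. rs a2 (\<lambda>p' q'.
      ?W x1 x2 y1 y2 g0 g1 d1 d2 p q p' q' c' c''))))))))))"
    by (intro H.sm_cong i H.coassoc[symmetric]) (assumption | rule lin sp i)+
  also have "\<dots> = sm H g (\<lambda>c2 d2. sm H h (\<lambda>e d1. sm H e (\<lambda>k c''. sm H k (\<lambda>h1 c'. sm H h1 (\<lambda>a1 a2.
      sm L x (\<lambda>x1 x2. sm L y (\<lambda>y1 y2. rs c2 (\<lambda>g0 g1. rs a1 (\<lambda>p q. rs a2 (\<lambda>p' q'.
      ?W x1 x2 y1 y2 g0 g1 d1 d2 p q p' q' c' c''))))))))))"
    by (intro H.sm_cong i H.coassoc[symmetric]) (assumption | rule lin sp i)+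
  also have "\<dots> = sm H g (\<lambda>c2 d2. sm H h (\<lambda>e d1. sm H e (\<lambda>k c''. sm H k (\<lambda>a1 m. sm H m (\<lambda>a2 c'.
      sm L x (\<lambda>x1 x2. sm L y (\<lambda>y1 y2. rs c2 (\<lambda>g0 g1. rs a1 (\<lambda>p q. rs a2 (\<lambda>p' q'.
      ?W x1 x2 y1 y2 g0 g1 d1 d2 p q p' q' c' c''))))))))))"
    by (intro H.sm_cong i H.coassoc) (assumption | rule lin sp i)+
  finally show ?thesis using left by simp
qed

lemma ds_mult:
  assumes a: "a \<in> carrier Sp" and b: "b \<in> carrier Sp" and g: "bilinear_map Sp Sp ground_space \<gamma>"
  shows "ds (mu a b) \<gamma> = ds a (\<lambda>a1 a2. ds b (\<lambda>b1 b2. \<gamma> (mu a1 b1) (mu a2 b2)))"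
proof (rule Sp_linear_eq[where f = "\<lambda>a. ds (mu a b) \<gamma>" and
      g = "\<lambda>a. ds a (\<lambda>a1 a2. ds b (\<lambda>b1 b2. \<gamma> (mu a1 b1) (mu a2 b2)))"])
  note [lin] = linear_map_comp_left[OF g] linear_map_comp_right[OF g]
  show "form Sp (\<lambda>a. ds (mu a b) \<gamma>)" by (assumption | rule lin sp a b g)+
  show "form Sp (\<lambda>a. ds a (\<lambda>a1 a2. ds b (\<lambda>b1 b2. \<gamma> (mu a1 b1) (mu a2 b2))))" by (assumption | rule lin sp a b)+
  fix x h assume xh: "x \<in> carrier L" "h \<in> carrier H"
  show "ds (mu (E x h) b) \<gamma> = ds (E x h) (\<lambda>a1 a2. ds b (\<lambda>b1 b2. \<gamma> (mu a1 b1) (mu a2 b2)))"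
    by (rule Sp_linear_eq[where f = "\<lambda>b. ds (mu (E x h) b) \<gamma>" and
      g = "\<lambda>b. ds (E x h) (\<lambda>a1 a2. ds b (\<lambda>b1 b2. \<gamma> (mu a1 b1) (mu a2 b2)))"])
     (assumption | rule ds_mult_gen[OF xh _ _ g] | rule lin sp g xh b)+
qed (rule a)

lemma ds_one:
  assumes g: "bilinear_map Sp Sp ground_space \<gamma>"
  shows "ds (E \<one>\<^sub>L \<one>) \<gamma> = \<gamma> (E \<one>\<^sub>L \<one>) (E \<one>\<^sub>L \<one>)"
proof -
  note [lin] = linear_map_comp_left[OF g] linear_map_comp_right[OF g]
  have "ds (E \<one>\<^sub>L \<one>) \<gamma> = sm L \<one>\<^sub>L (\<lambda>x1 x2. sm H \<one> (\<lambda>h1 h2. rs h1 (\<lambda>p q. \<gamma> (E x1 p) (E (x2 \<star> q) h2))))"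
    by (rule ds_E) (rule lin g)+
  also have "\<dots> = sm H \<one> (\<lambda>h1 h2. rs h1 (\<lambda>p q. \<gamma> (E \<one>\<^sub>L p) (E (\<one>\<^sub>L \<star> q) h2)))"
    by (rule L.comult_one) (assumption | rule lin sp)+
  also have "\<dots> = rs \<one> (\<lambda>p q. \<gamma> (E \<one>\<^sub>L p) (E (\<one>\<^sub>L \<star> q) \<one>))"
    by (rule H.comult_one) (assumption | rule lin sp)+
  also have "\<dots> = \<gamma> (E \<one>\<^sub>L \<one>) (E (\<one>\<^sub>L \<star> u) \<one>)"
    by (rule rho_one) (assumption | rule lin sp)+
  finally show ?thesis using E_u[OF L.one_in H.one_in] by simp
qed

section \<open>Counit\<close>

definition gen_counit where "gen_counit x h = counit L x * lam h"

lemma bilinear_gen_counit: "bilinear_map L H ground_space gen_counit"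
  unfolding gen_counit_def by (assumption | rule lin sp)+
lemma invariant_gen_counit: "invariant gen_counit"
  by (simp add: invariant_def gen_counit_def L.counit_mult lam_proj)

abbreviation Eps where "Eps z \<equiv> smash_extend H L act \<rho> z gen_counit"

lemma linear_Eps: "form Sp (\<lambda>z. Eps z)"
  by (rule linear_smash_extend[OF is_space_ground bilinear_gen_counit invariant_gen_counit])
lemmas lin_Eps [lin] = linear_map_comp[OF linear_Eps]
lemma Eps_E: "x \<in> carrier L \<Longrightarrow> h \<in> carrier H \<Longrightarrow> Eps (E x h) = counit L x * lam h"
  using smash_extend_E[OF is_space_ground bilinear_gen_counit invariant_gen_counit] by (simp add: gen_counit_def)

text \<open>The coaction of \<open>h\<^sub>1\<close> leaves \<open>\<lambda>(h\<^sub>1) u\<close> by \<open>lam_rho\<close>, and the generator absorbs both factors.\<close>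

lemma Eps_left:
  assumes z: "z \<in> carrier Sp" and f: "form Sp \<phi>"
  shows "ds z (\<lambda>a b. Eps a * \<phi> b) = \<phi> z"
proof -
  note [lin] = linear_map_comp[OF f]
  have gen: "ds (E x h) (\<lambda>a b. Eps a * \<phi> b) = \<phi> (E x h)" if x: "x \<in> carrier L" and h: "h \<in> carrier H" for x h
  proof -
    have "ds (E x h) (\<lambda>a b. Eps a * \<phi> b) = sm L x (\<lambda>x1 x2. sm H h (\<lambda>h1 h2. rs h1 (\<lambda>p q. Eps (E x1 p) * \<phi> (E (x2 \<star> q) h2))))"
      by (rule ds_E) (assumption | rule lin sp x h)+
    also have "\<dots> = sm L x (\<lambda>x1 x2. sm H h (\<lambda>h1 h2. counit L x1 * rs h1 (\<lambda>p q. lam p * \<phi> (E (x2 \<star> q) h2))))"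
      unfolding tl_times_left[symmetric] by (intro L.sm_cong H.sm_cong rs_cong x h) (simp_all add: Eps_E)
    also have "\<dots> = sm L x (\<lambda>x1 x2. sm H h (\<lambda>h1 h2. counit L x1 * (lam h1 * \<phi> (E (x2 \<star> u) h2))))"
      by (intro L.sm_cong H.sm_cong x h arg_cong2[where f = "(*)"] refl lam_rho) (assumption | rule lin sp x h)+
    also have "\<dots> = sm L x (\<lambda>x1 x2. counit L x1 * \<phi> (E (x2 \<star> u) (proj h)))"
      unfolding tl_times_left
      by (intro L.sm_cong x h arg_cong2[where f = "(*)"] refl form_proj[symmetric]) (assumption | rule lin sp x h)+
    also have "\<dots> = \<phi> (E (x \<star> u) (proj h))"
      by (rule L.counit_left) (assumption | rule lin sp x h)+
    finally show ?thesis by (simp add: x h)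
  qed
  show ?thesis
    by (rule Sp_linear_eq[where f = "\<lambda>z. ds z (\<lambda>a b. Eps a * \<phi> b)" and g = \<phi>]) (assumption | rule lin sp z f gen)+
qed

lemma Eps_right:
  assumes z: "z \<in> carrier Sp" and f: "form Sp \<phi>"
  shows "ds z (\<lambda>a b. Eps b * \<phi> a) = \<phi> z"
proof -
  note [lin] = linear_map_comp[OF f]
  have gen: "ds (E x h) (\<lambda>a b. Eps b * \<phi> a) = \<phi> (E x h)" if x: "x \<in> carrier L" and h: "h \<in> carrier H" for x h
  proof -
    have "ds (E x h) (\<lambda>a b. Eps b * \<phi> a) = sm L x (\<lambda>x1 x2. sm H h (\<lambda>h1 h2. rs h1 (\<lambda>p q. Eps (E (x2 \<star> q) h2) * \<phi> (E x1 p))))"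
      by (rule ds_E) (assumption | rule lin sp x h)+
    also have "\<dots> = sm L x (\<lambda>x1 x2. sm H h (\<lambda>h1 h2. counit L x2 * (lam h2 * rs h1 (\<lambda>p q. counit L q * \<phi> (E x1 p)))))"
      unfolding tl_times_left[symmetric] by (intro L.sm_cong H.sm_cong rs_cong x h) (simp_all add: Eps_E L.counit_mult ac_simps)
    also have "\<dots> = sm L x (\<lambda>x1 x2. sm H h (\<lambda>h1 h2. counit L x2 * (lam h2 * \<phi> (E x1 h1))))"
      by (intro L.sm_cong H.sm_cong x h arg_cong2[where f = "(*)"] refl rho_counit) (assumption | rule lin sp x h)+
    also have "\<dots> = sm L x (\<lambda>x1 x2. counit L x2 * sm H h (\<lambda>h1 h2. lam h1 * \<phi> (E x1 h2)))"
      unfolding tl_times_left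
      by (intro L.sm_cong x h arg_cong2[where f = "(*)"] refl lam_central[symmetric]) (assumption | rule lin sp x h)+
    also have "\<dots> = sm L x (\<lambda>x1 x2. counit L x2 * \<phi> (E x1 (proj h)))"
      by (intro L.sm_cong x h arg_cong2[where f = "(*)"] refl form_proj[symmetric]) (assumption | rule lin sp x h)+
    also have "\<dots> = \<phi> (E x (proj h))"
      by (rule L.counit_right) (assumption | rule lin sp x h)+
    finally show ?thesis by (simp add: x h)
  qed
  show ?thesis
    by (rule Sp_linear_eq[where f = "\<lambda>z. ds z (\<lambda>a b. Eps b * \<phi> a)" and g = \<phi>]) (assumption | rule lin sp z f gen)+
qed

lemma Eps_mult:
  assumes a: "a \<in> carrier Sp" and b: "b \<in> carrier Sp"
  shows "Eps (mu a b) = Eps a * Eps b"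
proof -
  have gen: "Eps (mu (E x h) (E y g)) = Eps (E x h) * Eps (E y g)"
    if x: "x \<in> carrier L" and h: "h \<in> carrier H" and y: "y \<in> carrier L" and g: "g \<in> carrier H" for x h y g
  proof -
    have "Eps (mu (E x h) (E y g)) = sm H h (\<lambda>h1 h2. Eps (E (x \<star> act h1 y) (h2 \<cdot> g)))"
      by (rule form_mu) (rule lin x h y g)+
    also have "\<dots> = sm H h (\<lambda>h1 h2. counit L x * counit L y * (lam h1 * lam (h2 \<cdot> g)))"
      using counit_act[OF _ y] by (intro H.sm_cong h) (simp add: Eps_E x h y g L.counit_mult lam_def)
    finally show ?thesis by (simp add: tl_times_left lam_mult Eps_E x h y g)
  qed
  show ?thesis
  proof (rule Sp_linear_eq[where f = "\<lambda>a. Eps (mu a b)" and g = "\<lambda>a. Eps a * Eps b"])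
    fix x h assume xh: "x \<in> carrier L" "h \<in> carrier H"
    show "Eps (mu (E x h) b) = Eps (E x h) * Eps b"
      by (rule Sp_linear_eq[where f = "\<lambda>b. Eps (mu (E x h) b)" and g = "\<lambda>b. Eps (E x h) * Eps b"])
        (assumption | rule gen | rule lin sp xh b)+
  qed (assumption | rule lin sp a b)+
qed

section \<open>Antipode\<close>

definition gen_antipode where
  "gen_antipode x h = rs h (\<lambda>p q. mu (E \<one>\<^sub>L (antipode H p)) (E (antipode L q \<star> antipode L x) \<one>))"

lemma bilinear_gen_antipode: "bilinear_map L H Sp gen_antipode"
  unfolding gen_antipode_def by (assumption | rule lin sp)+

lemma gen_antipode_in [lin, simp]: "x \<in> carrier L \<Longrightarrow> h \<in> carrier H \<Longrightarrow> gen_antipode x h \<in> carrier Sp"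
  unfolding gen_antipode_def by (assumption | rule lin sp)+

lemma form_gen_antipode:
  assumes "x \<in> carrier L" "h \<in> carrier H" "form Sp \<phi>"
  shows "\<phi> (gen_antipode x h) = rs h (\<lambda>p q. \<phi> (mu (E \<one>\<^sub>L (antipode H p)) (E (antipode L q \<star> antipode L x) \<one>)))"
  unfolding gen_antipode_def by (rule tl_push(1)[OF _ _ _ assms(3)]) (assumption | rule lin sp assms)+

lemma invariant_gen_antipode: "invariant gen_antipode"
  unfolding invariant_def
proof (intro ballI conjI)
  fix x h assume x: "x \<in> carrier L" and h: "h \<in> carrier H"
  show "gen_antipode (x \<star> u) h = gen_antipode x h"
    unfolding gen_antipode_def
    by (intro rs_cong h) (simp add: L.antipode_mult x E_u_mult)
  show "gen_antipode x (proj h) = gen_antipode x h"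
  proof (rule eq_by_forms[OF is_space_Sp])
    fix \<phi> assume f: "form Sp \<phi>"
    note [lin] = linear_map_comp[OF f]
    let ?\<beta> = "\<lambda>p q. \<phi> (mu (E \<one>\<^sub>L (antipode H p)) (E (antipode L q \<star> antipode L x) \<one>))"
    have "\<phi> (gen_antipode x (proj h)) = sm H h (\<lambda>a b. lam a * \<phi> (gen_antipode x b))"
      unfolding gen_antipode_def by (rule form_proj[OF h]) (assumption | rule lin sp x)+
    also have "\<dots> = sm H h (\<lambda>a b. lam a * rs b ?\<beta>)"
      by (intro H.sm_cong h arg_cong2[where f = "(*)"] refl form_gen_antipode x f)
    also have "\<dots> = rs h (\<lambda>p q. sm H p (\<lambda>a b. lam a * ?\<beta> b q))"
      by (rule lam_comult_rho[symmetric]) (assumption | rule lin sp x h)+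
    also have "\<dots> = rs h (\<lambda>p q. ?\<beta> (proj p) q)"
      by (intro rs_cong h form_proj[symmetric]) (assumption | rule lin sp x h)+
    also have "\<dots> = rs h ?\<beta>"
      by (intro rs_cong h) (simp add: antipode_proj)
    also have "\<dots> = \<phi> (gen_antipode x h)"
      by (rule form_gen_antipode[symmetric]) (rule x h f)+
    finally show "\<phi> (gen_antipode x (proj h)) = \<phi> (gen_antipode x h)" .
  qed (simp_all add: x h)
qed

abbreviation Anti where "Anti z \<equiv> smash_extend H L act \<rho> z gen_antipode"

lemma linear_Anti: "linear_map Sp Sp (\<lambda>z. Anti z)"
  by (rule linear_smash_extend[OF is_space_Sp bilinear_gen_antipode invariant_gen_antipode])
lemmas lin_Anti [lin] = linear_map_comp[OF linear_Anti]
lemma Anti_in [lin, simp]: "z \<in> carrier Sp \<Longrightarrow> Anti z \<in> carrier Sp"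
  by (rule linear_map_in[OF linear_Anti])

lemma form_Anti:
  assumes "x \<in> carrier L" "h \<in> carrier H" "form Sp \<phi>"
  shows "\<phi> (Anti (E x h)) = rs h (\<lambda>p q. \<phi> (mu (E \<one>\<^sub>L (antipode H p)) (E (antipode L q \<star> antipode L x) \<one>)))"
  unfolding smash_extend_E[OF is_space_Sp bilinear_gen_antipode invariant_gen_antipode assms(1,2)]
  by (rule form_gen_antipode[OF assms])

lemma mu_L:
  assumes a: "a \<in> carrier L" and b: "b \<in> carrier L" and g: "g \<in> carrier H"
  shows "mu (E a \<one>) (E b g) = E (a \<star> b) g"
proof (rule eq_by_forms[OF is_space_Sp])
  fix \<phi> assume f: "form Sp \<phi>"
  note [lin] = linear_map_comp[OF f]
  have "\<phi> (mu (E a \<one>) (E b g)) = sm H \<one> (\<lambda>h1 h2. \<phi> (E (a \<star> act h1 b) (h2 \<cdot> g)))"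
    by (rule form_mu) (rule lin a b g f)+
  also have "\<dots> = \<phi> (E (a \<star> act \<one> b) (\<one> \<cdot> g))"
    by (rule H.comult_one) (assumption | rule lin sp a b g)+
  finally show "\<phi> (mu (E a \<one>) (E b g)) = \<phi> (E (a \<star> b) g)" using b g by simp
qed (simp_all add: a b g)

lemma form_mu_H:
  assumes a: "a \<in> carrier L" and h: "h \<in> carrier H" and g: "g \<in> carrier H" and f: "form Sp \<phi>"
  shows "\<phi> (mu (E a h) (E \<one>\<^sub>L g)) = sm H h (\<lambda>h1 h2. lam h1 * \<phi> (E a (h2 \<cdot> g)))"
proof -
  note [lin] = linear_map_comp[OF f]
  have "\<phi> (mu (E a h) (E \<one>\<^sub>L g)) = sm H h (\<lambda>h1 h2. \<phi> (E (a \<star> act h1 \<one>\<^sub>L) (h2 \<cdot> g)))"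
    by (rule form_mu) (rule lin a h g f)+
  also have "\<dots> = sm H h (\<lambda>h1 h2. lam h1 * \<phi> (E a (h2 \<cdot> g)))"
    by (intro H.sm_cong h form_act_one(2)) (assumption | rule lin a g)+
  finally show ?thesis .
qed

text \<open>By \<open>rho_rho\<close> the two antipodes in \<open>L\<close> cancel one after the other.  There remains
  \<open>(1, S(h\<^sub>1)) (1, h\<^sub>2)\<close>, where the product contributes \<open>\<lambda>(S(h\<^sub>1)\<^sub>1) = \<lambda>(h\<^sub>1\<^sub>2)\<close> and the antipode of \<open>H\<close>
  cancels.\<close>

lemma Anti_left_gen:
  assumes x: "x \<in> carrier L" and h: "h \<in> carrier H" and f: "form Sp \<phi>"
  shows "ds (E x h) (\<lambda>a b. \<phi> (mu (Anti a) b)) = counit L x * (lam h * \<phi> (E \<one>\<^sub>L \<one>))"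
proof -
  note [lin] = linear_map_comp[OF f]
  note i = x h
  let ?S = "antipode H" and ?T = "antipode L"
  have "ds (E x h) (\<lambda>a b. \<phi> (mu (Anti a) b)) =
      sm L x (\<lambda>x1 x2. sm H h (\<lambda>h1 h2. rs h1 (\<lambda>p q. \<phi> (mu (Anti (E x1 p)) (E (x2 \<star> q) h2)))))"
    by (rule ds_E) (assumption | rule lin sp i)+
  also have "\<dots> = sm L x (\<lambda>x1 x2. sm H h (\<lambda>h1 h2. rs h1 (\<lambda>p q. rs p (\<lambda>r s.
      \<phi> (mu (mu (E \<one>\<^sub>L (?S r)) (E (?T s \<star> ?T x1) \<one>)) (E (x2 \<star> q) h2))))))"
    by (intro L.sm_cong H.sm_cong rs_cong i form_Anti) (assumption | rule lin sp i)+
  also have "\<dots> = sm L x (\<lambda>x1 x2. sm H h (\<lambda>h1 h2. rs h1 (\<lambda>p q. rs p (\<lambda>r s.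
      \<phi> (mu (E \<one>\<^sub>L (?S r)) (E (?T s \<star> (?T x1 \<star> x2 \<star> q)) h2))))))"
    by (intro L.sm_cong H.sm_cong rs_cong i) (simp_all add: mu_assoc mu_L L.mult_assoc)
  \<comment> \<open>Replace the second coaction by the coproduct of \<open>h\<^sub>1\<^sup>1\<close>.\<close>
  also have "\<dots> = sm L x (\<lambda>x1 x2. sm H h (\<lambda>h1 h2. rs h1 (\<lambda>p q. sm L q (\<lambda>q1 q2.
      \<phi> (mu (E \<one>\<^sub>L (?S p)) (E (?T q1 \<star> (?T x1 \<star> x2 \<star> (q2 \<star> u))) h2))))))"
    by (intro L.sm_cong H.sm_cong i rho_rho) (assumption | rule lin sp i)+
  also have "\<dots> = sm L x (\<lambda>x1 x2. sm H h (\<lambda>h1 h2. rs h1 (\<lambda>p q. sm L q (\<lambda>q1 q2.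
      \<phi> (mu (E \<one>\<^sub>L (?S p)) (E (?T q1 \<star> (?T x1 \<star> x2 \<star> q2)) h2))))))"
    by (intro L.sm_cong H.sm_cong rs_cong i) (simp_all add: E_mult_u flip: L.mult_assoc)
  also have "\<dots> = sm H h (\<lambda>h1 h2. rs h1 (\<lambda>p q. sm L q (\<lambda>q1 q2. sm L x (\<lambda>x1 x2.
      \<phi> (mu (E \<one>\<^sub>L (?S p)) (E (?T q1 \<star> (?T x1 \<star> x2 \<star> q2)) h2))))))"
    by (subst tl_swap, rule H.sm_cong[OF h], subst tl_swap, rule rs_cong, assumption, rule tl_swap)
  also have "\<dots> = sm H h (\<lambda>h1 h2. rs h1 (\<lambda>p q. sm L q (\<lambda>q1 q2. counit L x *
      \<phi> (mu (E \<one>\<^sub>L (?S p)) (E (?T q1 \<star> (\<one>\<^sub>L \<star> q2)) h2)))))"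
    by (intro L.sm_cong H.sm_cong rs_cong i L.antipode_left) (assumption | rule lin sp i)+
  also have "\<dots> = counit L x * sm H h (\<lambda>h1 h2. rs h1 (\<lambda>p q. sm L q (\<lambda>q1 q2.
      \<phi> (mu (E \<one>\<^sub>L (?S p)) (E (?T q1 \<star> q2) h2)))))"
    unfolding tl_times_left by (intro arg_cong2[where f = "(*)"] refl L.sm_cong H.sm_cong rs_cong i) simp_all
  also have "\<dots> = counit L x * sm H h (\<lambda>h1 h2. rs h1 (\<lambda>p q. counit L q * \<phi> (mu (E \<one>\<^sub>L (?S p)) (E \<one>\<^sub>L h2))))"
    by (intro arg_cong2[where f = "(*)"] refl H.sm_cong rs_cong i L.antipode_left) (assumption | rule lin sp i)+
  also have "\<dots> = counit L x * sm H h (\<lambda>h1 h2. \<phi> (mu (E \<one>\<^sub>L (?S h1)) (E \<one>\<^sub>L h2)))"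
    by (intro arg_cong2[where f = "(*)"] refl H.sm_cong i rho_counit) (assumption | rule lin sp i)+
  \<comment> \<open>What is left is a product of two elements of \<open>H\<close>.\<close>
  also have "\<dots> = counit L x * sm H h (\<lambda>h1 h2. sm H (?S h1) (\<lambda>a b. lam a * \<phi> (E \<one>\<^sub>L (b \<cdot> h2))))"
    by (intro arg_cong2[where f = "(*)"] refl H.sm_cong i form_mu_H) (assumption | rule lin sp i f)+
  also have "\<dots> = counit L x * sm H h (\<lambda>h1 h2. sm H h1 (\<lambda>a b. lam (?S b) * \<phi> (E \<one>\<^sub>L (?S a \<cdot> h2))))"
    by (intro arg_cong2[where f = "(*)"] refl H.sm_cong i H.antipode_comult) (assumption | rule lin sp i linear_lam)+
  also have "\<dots> = counit L x * sm H h (\<lambda>h1 h2. sm H h1 (\<lambda>a b. lam b * \<phi> (E \<one>\<^sub>L (?S a \<cdot> h2))))"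
    by (intro arg_cong2[where f = "(*)"] refl H.sm_cong i lam_antipode)
  also have "\<dots> = counit L x * sm H h (\<lambda>h1 h2. sm H h1 (\<lambda>a b. lam a * \<phi> (E \<one>\<^sub>L (?S b \<cdot> h2))))"
    by (intro arg_cong2[where f = "(*)"] refl H.sm_cong i lam_central[symmetric]) (assumption | rule lin sp i)+
  also have "\<dots> = counit L x * sm H h (\<lambda>a k. sm H k (\<lambda>b h2. lam a * \<phi> (E \<one>\<^sub>L (?S b \<cdot> h2))))"
    by (intro arg_cong2[where f = "(*)"] refl H.coassoc) (assumption | rule lin sp i)+
  also have "\<dots> = counit L x * sm H h (\<lambda>a k. counit H k * (lam a * \<phi> (E \<one>\<^sub>L \<one>)))"
    by (intro arg_cong2[where f = "(*)"] refl H.sm_cong i H.antipode_left) (assumption | rule lin sp i)+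
  also have "\<dots> = counit L x * (lam h * \<phi> (E \<one>\<^sub>L \<one>))"
    by (intro arg_cong2[where f = "(*)"] refl H.counit_right) (assumption | rule lin sp i)+
  finally show ?thesis .
qed

text \<open>The coactions of \<open>h\<^sub>1\<close> and \<open>h\<^sub>2\<close> are combined to that of \<open>h\<close> by \<open>rho_comult\<close>; then the antipode of \<open>H\<close>
  cancels and leaves \<open>\<lambda>(h\<^sup>0) S(h\<^sup>1) = \<lambda>(h) u\<close>, after which the antipode of \<open>L\<close> cancels.\<close>

lemma Anti_right_gen:
  assumes x: "x \<in> carrier L" and h: "h \<in> carrier H" and f: "form Sp \<phi>"
  shows "ds (E x h) (\<lambda>a b. \<phi> (mu a (Anti b))) = counit L x * (lam h * \<phi> (E \<one>\<^sub>L \<one>))"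
proof -
  note [lin] = linear_map_comp[OF f]
  note i = x h
  let ?S = "antipode H" and ?T = "antipode L"
  have "ds (E x h) (\<lambda>a b. \<phi> (mu a (Anti b))) =
      sm L x (\<lambda>x1 x2. sm H h (\<lambda>h1 h2. rs h1 (\<lambda>p q. \<phi> (mu (E x1 p) (Anti (E (x2 \<star> q) h2))))))"
    by (rule ds_E) (assumption | rule lin sp i)+
  also have "\<dots> = sm L x (\<lambda>x1 x2. sm H h (\<lambda>h1 h2. rs h1 (\<lambda>p q. rs h2 (\<lambda>r s.
      \<phi> (mu (E x1 p) (mu (E \<one>\<^sub>L (?S r)) (E (?T s \<star> ?T (x2 \<star> q)) \<one>)))))))"
    by (intro L.sm_cong H.sm_cong rs_cong i form_Anti) (assumption | rule lin sp i)+
  also have "\<dots> = sm L x (\<lambda>x1 x2. sm H h (\<lambda>h1 h2. rs h1 (\<lambda>p q. rs h2 (\<lambda>r s.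
      \<phi> (mu (mu (E x1 p) (E \<one>\<^sub>L (?S r))) (E (?T (q \<star> s) \<star> ?T x2) \<one>))))))"
    by (intro L.sm_cong H.sm_cong rs_cong i) (simp_all add: mu_assoc L.antipode_mult L.mult_assoc)
  also have "\<dots> = sm L x (\<lambda>x1 x2. rs h (\<lambda>p q. sm H p (\<lambda>a b.
      \<phi> (mu (mu (E x1 a) (E \<one>\<^sub>L (?S b))) (E (?T q \<star> ?T x2) \<one>)))))"
    by (intro L.sm_cong i rho_comult[symmetric]) (assumption | rule lin sp i)+
  also have "\<dots> = sm L x (\<lambda>x1 x2. rs h (\<lambda>p q. sm H p (\<lambda>a b. sm H a (\<lambda>c d.
      lam c * \<phi> (mu (E x1 (d \<cdot> ?S b)) (E (?T q \<star> ?T x2) \<one>))))))"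
    by (intro L.sm_cong H.sm_cong rs_cong i form_mu_H) (assumption | rule lin sp i)+
  also have "\<dots> = sm L x (\<lambda>x1 x2. rs h (\<lambda>p q. sm H p (\<lambda>c k. sm H k (\<lambda>d b.
      lam c * \<phi> (mu (E x1 (d \<cdot> ?S b)) (E (?T q \<star> ?T x2) \<one>))))))"
    by (intro L.sm_cong rs_cong i H.coassoc) (assumption | rule lin sp i)+
  also have "\<dots> = sm L x (\<lambda>x1 x2. rs h (\<lambda>p q. sm H p (\<lambda>c k. counit H k *
      (lam c * \<phi> (mu (E x1 \<one>) (E (?T q \<star> ?T x2) \<one>))))))"
    by (intro L.sm_cong H.sm_cong rs_cong i H.antipode_right) (assumption | rule lin sp i)+
  also have "\<dots> = sm L x (\<lambda>x1 x2. rs h (\<lambda>p q. lam p * \<phi> (mu (E x1 \<one>) (E (?T q \<star> ?T x2) \<one>))))"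
    by (intro L.sm_cong rs_cong i H.counit_right) (assumption | rule lin sp i)+
  also have "\<dots> = sm L x (\<lambda>x1 x2. lam h * \<phi> (mu (E x1 \<one>) (E (u \<star> ?T x2) \<one>)))"
    by (intro L.sm_cong i lam_rho_antipode) (assumption | rule lin sp i)+
  also have "\<dots> = sm L x (\<lambda>x1 x2. lam h * \<phi> (E (x1 \<star> ?T x2) \<one>))"
    by (intro L.sm_cong i) (simp add: mu_L E_u_mult)
  also have "\<dots> = counit L x * (lam h * \<phi> (E \<one>\<^sub>L \<one>))"
    by (intro L.antipode_right) (assumption | rule lin sp i)+
  finally show ?thesis .
qed

section \<open>The smash product is a Hopf algebra\<close>

lemma smash_sel [simp]:
  "carrier A = carrier Sp" "scale A = fscale" "mult A = mu" "one_el A = E \<one>\<^sub>L \<one>"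
  "comult A = (\<lambda>z. Delta z)" "counit A = (\<lambda>z. Eps z)" "antipode A = (\<lambda>z. Anti z)"
  by (simp_all add: smash_def Let_def Sp_sel(2) gen_comult_def[abs_def] gen_counit_def[abs_def] gen_antipode_def[abs_def]
      sm_sw lam_def)

lemma A_space:
  "linear_map A = linear_map Sp" "linear_map U A = linear_map U Sp" "bilinear_map A A U = bilinear_map Sp Sp U"
  "bilinear_map V W A = bilinear_map V W Sp"
  for U :: "('k, 'u::ab_group_add, 'y) space_scheme" and V :: "('k, 'v::ab_group_add, 'y) space_scheme"
    and W :: "('k, 'w::ab_group_add, 'y) space_scheme"
  by (intro ext; simp add: linear_map_def bilinear_map_def Sp_sel(2))+

lemma A_tensor: "tensor A A = tensor Sp Sp" "A \<Otimes> A = Sp \<Otimes> Sp" "tensor_lift A A = tensor_lift Sp Sp"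
  by (rule tensor_cong_space; simp add: Sp_sel(2))+

lemma is_space_A: "is_space A"
  using is_space_Sp by (simp add: is_space_def Sp_sel(2))

text \<open>All axioms are linear in each argument, so they follow from those for generators.\<close>

lemma smash_is_hopf: "is_hopf_algebra A"
proof -
  have bialg: "is_bialgebra A"
  proof (rule bialgebraI[OF is_space_A], unfold A_space A_tensor smash_sel)
    fix \<beta> z assume z: "z \<in> carrier Sp"
      and l: "\<And>b c. b \<in> carrier Sp \<Longrightarrow> c \<in> carrier Sp \<Longrightarrow> form Sp (\<lambda>a. \<beta> a b c)"
        "\<And>a c. a \<in> carrier Sp \<Longrightarrow> c \<in> carrier Sp \<Longrightarrow> form Sp (\<lambda>b. \<beta> a b c)"
        "\<And>a b. a \<in> carrier Sp \<Longrightarrow> b \<in> carrier Sp \<Longrightarrow> form Sp (\<lambda>c. \<beta> a b c)"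
    note [lin] = l[THEN linear_map_comp]
    show "ds z (\<lambda>x c3. ds x (\<lambda>c1 c2. \<beta> c1 c2 c3)) = ds z (\<lambda>c1 x. ds x (\<lambda>c2 c3. \<beta> c1 c2 c3))"
      by (rule Sp_linear_eq[where f = "\<lambda>z. ds z (\<lambda>x c3. ds x (\<lambda>c1 c2. \<beta> c1 c2 c3))"
            and g = "\<lambda>z. ds z (\<lambda>c1 x. ds x (\<lambda>c2 c3. \<beta> c1 c2 c3))"])
        (rule z ds_coassoc_gen[OF _ _ l] | assumption | rule lin sp z)+
  qed (auto simp: bilinear_mu mu_assoc mu_one linear_Delta linear_Eps Eps_left Eps_right ds_mult ds_one Eps_mult Eps_E)
  have "is_antipode A (antipode A)"
  proof (rule antipodeI[OF bialg], unfold A_space A_tensor smash_sel)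
    fix z \<phi> assume z: "z \<in> carrier Sp" and f: "form Sp \<phi>"
    note [lin] = linear_map_comp[OF f]
    show "ds z (\<lambda>a b. \<phi> (mu (Anti a) b)) = Eps z * \<phi> (E \<one>\<^sub>L \<one>)"
      by (rule Sp_linear_eq[where f = "\<lambda>z. ds z (\<lambda>a b. \<phi> (mu (Anti a) b))" and g = "\<lambda>z. Eps z * \<phi> (E \<one>\<^sub>L \<one>)"],
        ((assumption | rule lin sp)+)[2]) (simp_all add: Anti_left_gen f Eps_E z)
    show "ds z (\<lambda>a b. \<phi> (mu a (Anti b))) = Eps z * \<phi> (E \<one>\<^sub>L \<one>)"
      by (rule Sp_linear_eq[where f = "\<lambda>z. ds z (\<lambda>a b. \<phi> (mu a (Anti b)))" and g = "\<lambda>z. Eps z * \<phi> (E \<one>\<^sub>L \<one>)"],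
        ((assumption | rule lin sp)+)[2]) (simp_all add: Anti_right_gen f Eps_E z)
  qed (rule linear_Anti)
  with bialg show ?thesis by (simp add: is_hopf_algebra_def)
qed

lemma E_expand:
  assumes x: "x \<in> carrier L" and h: "h \<in> carrier H"
  shows "E x h = (\<Sum>c\<in>some_basis L. \<Sum>b\<in>some_basis H. scale Sp (coord L c x * coord H b h) (E c b))"
proof (rule eq_by_forms[OF is_space_Sp])
  have bas: "c \<in> carrier L" if "c \<in> some_basis L" for c using L.basis(2) that by blast
  have bas': "b \<in> carrier H" if "b \<in> some_basis H" for b using H.basis(2) that by blast
  show "(\<Sum>c\<in>some_basis L. \<Sum>b\<in>some_basis H. scale Sp (coord L c x * coord H b h) (E c b)) \<in> carrier Sp"
    by (intro linear_map_sum(2)[OF _ lin_id]) (assumption | rule lin bas bas')+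
  fix \<phi> assume f: "form Sp \<phi>"
  note [lin] = linear_map_comp[OF f]
  have "\<phi> (\<Sum>c\<in>some_basis L. \<Sum>b\<in>some_basis H. scale Sp (coord L c x * coord H b h) (E c b)) =
    (\<Sum>c\<in>some_basis L. \<Sum>b\<in>some_basis H. \<phi> (scale Sp (coord L c x * coord H b h) (E c b)))"
    by (subst linear_map_sum(1)[OF is_space_Sp f], (intro linear_map_sum(2)[OF _ lin_id]; (assumption | rule lin bas bas')+)[1],
      intro sum.cong refl, rule linear_map_sum(1)[OF is_space_Sp f]) (assumption | rule lin bas bas')+
  also have "\<dots> = (\<Sum>c\<in>some_basis L. \<Sum>b\<in>some_basis H. \<phi> (E c b) * (coord L c x * coord H b h))"
    by (intro sum.cong refl) (simp add: form_scale[OF f] bas bas')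
  also have "\<dots> = \<phi> (E x h)"
    by (rule biform_expand[where \<gamma> = "\<lambda>x h. \<phi> (E x h)", OF L.space H.space, symmetric], ((assumption | rule lin)+)[1])
      (use L.basis H.basis x h in auto)
  finally show "\<phi> (E x h) = \<phi> (\<Sum>c\<in>some_basis L. \<Sum>b\<in>some_basis H. scale Sp (coord L c x * coord H b h) (E c b))" ..
qed (rule lin x h)+

lemma smash_finite_dimensional: "finite_dimensional A"
proof -
  let ?B = "(\<lambda>(c, b). E c b) ` (some_basis L \<times> some_basis H)"
  have B: "finite ?B" "?B \<subseteq> carrier Sp" using L.basis(1,2) H.basis(1,2) by (auto intro!: E_in)
  have s: "module.subspace fscale (carrier Sp)" using is_space_Sp by (simp add: is_space_def Sp_sel(2))
  have "carrier Sp = module.span fscale ?B"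
  proof
    show "module.span fscale ?B \<subseteq> carrier Sp" using module.span_minimal[OF fscale_module B(2) s] .
    have "E x h \<in> module.span fscale ?B" if "x \<in> carrier L" "h \<in> carrier H" for x h
      unfolding E_expand[OF that] Sp_sel(2)
      by (intro module.span_sum[OF fscale_module] module.span_scale[OF fscale_module] module.span_base[OF fscale_module]) auto
    then show "carrier Sp \<subseteq> module.span fscale ?B"
      unfolding Sp_sel(1) by (intro module.span_minimal[OF fscale_module] module.subspace_span[OF fscale_module]) auto
  qed
  with B show ?thesis by (auto simp: finite_dimensional_def)
qed

sublocale A: fd_hopf_alg A
  by unfold_locales (rule smash_is_hopf smash_finite_dimensional)+

section \<open>Evaluation of tensors of functionals\<close>

abbreviation HD where "HD \<equiv> dual_space H"
abbreviation LD where "LD \<equiv> dual_space L"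
abbreviation ev :: "('k, 'h \<Rightarrow> 'k, 'l \<Rightarrow> 'k) tensor \<Rightarrow> 'h \<Rightarrow> 'l \<Rightarrow> 'k" where
  "ev z h x \<equiv> z (\<lambda>\<phi> f. \<phi> h * f x)"

lemma bilinear_eval: "bilinear_map HD LD ground_space (\<lambda>\<phi> f. \<phi> h * f x)"
  by (assumption | rule lin)+

lemma ev_tensor [simp]: "ev (tensor HD LD \<phi> f) h x = \<phi> h * f x"
  by (rule tensor_apply[OF bilinear_eval])

lemma ev_tl: "z \<in> carrier (HD \<Otimes> LD) \<Longrightarrow> ev z h x = tensor_lift HD LD z (\<lambda>\<phi> f. \<phi> h * f x)"
  by (rule tl_tensor_eval[OF is_space_dual_space _ bilinear_eval])

lemma dual_tensor_ev_eqI: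
  assumes "z \<in> carrier (HD \<Otimes> LD)" "w \<in> carrier (HD \<Otimes> LD)"
    "\<And>h x. h \<in> carrier H \<Longrightarrow> x \<in> carrier L \<Longrightarrow> ev z h x = ev w h x"
  shows "z = w"
  by (rule dual_tensor_eqI[OF H.space H.fin L.space L.fin assms(1,2)])
    (simp add: assms(3) assms(1,2) ev_tl[symmetric])

section \<open>The action and the coaction on the duals\<close>

abbreviation da where "da \<equiv> dual_act H L \<rho>"
abbreviation dc where "dc \<equiv> dual_coact H L act"

lemma da_apply: "h \<in> carrier H \<Longrightarrow> da \<phi> f h = rs h (\<lambda>p q. \<phi> p * f q)"
  by (simp add: dual_act_def)

lemma da_in [lin]:
  assumes f: "\<phi> \<in> carrier HD" "f \<in> carrier LD" shows "da \<phi> f \<in> carrier HD"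
proof -
  note [lin] = linear_map_comp[OF dual_form[OF f(1)]] linear_map_comp[OF dual_form[OF f(2)]]
  show ?thesis unfolding dual_act_def by (assumption | rule lin sp)+
qed

lemma bilinear_da: "bilinear_map HD LD HD da"
proof (rule bilinear_mapI)
  fix \<phi> assume f: "\<phi> \<in> carrier HD"
  show "linear_map LD HD (\<lambda>f. da \<phi> f)"
    by (rule linear_map_dualI; (simp only: da_apply)?; (assumption | rule lin sp f)+)
next
  fix f assume f: "f \<in> carrier LD"
  show "linear_map HD HD (\<lambda>\<phi>. da \<phi> f)"
    by (rule linear_map_dualI; (simp only: da_apply)?; (assumption | rule lin sp f)+)
qed
lemmas lin_da_left [lin] = linear_map_comp_left[OF bilinear_da]
lemmas lin_da_right [lin] = linear_map_comp_right[OF bilinear_da]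

lemma dc_eq: "dc f = (\<Sum>b\<in>some_basis H. tensor HD LD (coord H b) (restrict0 L (\<lambda>x. f (act b x))))"
  by (simp add: dual_coact_def dual_tensor Let_def coord_def)

lemma basis_H: "b \<in> some_basis H \<Longrightarrow> b \<in> carrier H"
  using H.basis(2) by blast

lemma dc_summand_in:
  assumes f: "f \<in> carrier LD" and b: "b \<in> carrier H"
  shows "restrict0 L (\<lambda>x. f (act b x)) \<in> carrier LD"
proof -
  note [lin] = linear_map_comp[OF dual_form[OF f]]
  show ?thesis by (assumption | rule lin sp b)+
qed

lemma linear_dc: "linear_map LD (HD \<Otimes> LD) dc"
  unfolding dc_eq
proof (rule linear_map_sum_fun[OF is_space_tensor])
  fix b assume b: "b \<in> some_basis H"
  have "linear_map LD LD (\<lambda>f. restrict0 L (\<lambda>x. f (act b x)))"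
    by (rule linear_map_dualI; (simp only: restrict0_apply)?; (assumption | rule lin sp dc_summand_in basis_H b)+)
  from lin_tensor_right[OF H.basis(4) this]
  show "linear_map LD (HD \<Otimes> LD) (\<lambda>f. tensor HD LD (coord H b) (restrict0 L (\<lambda>x. f (act b x))))" .
qed
lemmas lin_dc [lin] = linear_map_comp[OF linear_dc]
lemma dc_in [lin]: "f \<in> carrier LD \<Longrightarrow> dc f \<in> carrier (HD \<Otimes> LD)"
  by (rule linear_map_in[OF linear_dc])

text \<open>The coaction on \<open>L\<^sup>*\<close> is the transpose of the action, which determines it.\<close>

lemma dc_eval:
  assumes f: "f \<in> carrier LD" and h: "h \<in> carrier H" and x: "x \<in> carrier L"
  shows "tensor_lift HD LD (dc f) (\<lambda>m z. m h * z x) = f (act h x)"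
proof -
  note [lin] = linear_map_comp[OF dual_form[OF f]]
  have "tensor_lift HD LD (dc f) (\<lambda>m z. m h * z x) = ev (dc f) h x"
    by (rule ev_tl[symmetric]) (rule lin f)+
  also have "\<dots> = (\<Sum>b\<in>some_basis H. coord H b h * f (act b x))"
  proof -
    have "(\<Sum>b\<in>I. t b) \<gamma> = (\<Sum>b\<in>I. t b \<gamma>)" for I :: "'h set" and t :: "'h \<Rightarrow> ('k, 'h \<Rightarrow> 'k, 'l \<Rightarrow> 'k) tensor" and \<gamma>
      by (induction I rule: infinite_finite_induct) auto
    then show ?thesis unfolding dc_eq using x by simp
  qed
  also have "\<dots> = f (act h x)"
    by (rule form_expand[symmetric, OF H.space], ((assumption | rule lin x)+)[1]) (use H.basis h in auto)
  finally show ?thesis .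
qed

section \<open>The generators of the dual smash product\<close>

abbreviation F where "F \<equiv> dual_smash_el H L act \<rho>"
abbreviation DS where "DS \<equiv> dual_smash_space H L act \<rho>"

lemma F_unfold: "F \<phi> f = L.dm f (\<lambda>b f3. L.dm b (\<lambda>f1 f2. tensor_lift HD LD (dc f3) (\<lambda>m z.
    tensor HD LD (fscale (z \<one>\<^sub>L) (mult (dual H) (mult (dual H) (da (restrict0 H (counit H)) f2) m) \<phi>)) f1)))"
  by (simp add: dual_smash_el_def sw3_def sm_sw dual_tensor)

lemma F_tensor: "\<phi> \<in> carrier HD \<Longrightarrow> f \<in> carrier LD \<Longrightarrow> F \<phi> f \<in> carrier (HD \<Otimes> LD)"
  unfolding F_unfold by (assumption | rule lin sp)+

text \<open>The transpose of \<open>E_eq\<close>.  The action of \<open>f\<^sub>2\<close> on the counit of \<open>H\<close> gives \<open>f\<^sub>2(u) \<epsilon>\<close> by \<open>rho_counit_left\<close>,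
  and the counit of the coaction of \<open>f\<^sub>3\<close> gives \<open>f\<^sub>3(1) \<lambda>\<close> by \<open>act_one_right\<close>.\<close>

lemma ev_F:
  assumes p: "\<phi> \<in> carrier HD" and f: "f \<in> carrier LD" and h: "h \<in> carrier H" and x: "x \<in> carrier L"
  shows "ev (F \<phi> f) h x = \<phi> (proj h) * f (x \<star> u)"
proof -
  have inner: "tensor_lift HD LD (dc f3) (\<lambda>m z.
    fscale (z \<one>\<^sub>L) (mult (dual H) (mult (dual H) (da (restrict0 H (counit H)) f2) m) \<phi>) h * f1 x) =
    f1 x * f2 u * (f3 \<one>\<^sub>L * \<phi> (proj h))"
    if f123: "f1 \<in> carrier LD" "f2 \<in> carrier LD" "f3 \<in> carrier LD" for f1 f2 f3
  proof -
    have m: "mult (dual H) (mult (dual H) (da (restrict0 H (counit H)) f2) m) \<phi> h =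
       sm H h (\<lambda>b c. f2 u * m b * \<phi> c)" if m: "m \<in> carrier HD" for m
    proof -
      have d: "da (restrict0 H (counit H)) f2 a = counit H a * f2 u" if a: "a \<in> carrier H" for a
        using rho_counit_left[OF a dual_form[OF f123(2)]] a by (simp add: da_apply cong: rs_cong)
      have "mult (dual H) (da (restrict0 H (counit H)) f2) m b = f2 u * m b" if b: "b \<in> carrier H" for b
      proof -
        have "mult (dual H) (da (restrict0 H (counit H)) f2) m b = sm H b (\<lambda>p q. f2 u * (counit H p * m q))"
          unfolding H.dual_mult_apply[OF b] by (intro H.sm_cong b) (simp add: d)
        then show ?thesis by (simp add: tl_times_left H.counit_left[OF b dual_form[OF m]])
      qed
      then show ?thesis unfolding H.dual_mult_apply[OF h] by (intro H.sm_cong h) simp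
    qed
    have "tensor_lift HD LD (dc f3) (\<lambda>m z.
       fscale (z \<one>\<^sub>L) (mult (dual H) (mult (dual H) (da (restrict0 H (counit H)) f2) m) \<phi>) h * f1 x) =
      tensor_lift HD LD (dc f3) (\<lambda>m z. sm H h (\<lambda>b c. m b * z \<one>\<^sub>L * (f1 x * f2 u * \<phi> c)))"
    proof (rule tl_cong[OF is_space_dual_space dc_in[OF f123(3)]])
      fix m z assume i: "m \<in> carrier HD" "z \<in> carrier LD"
      have "fscale (z \<one>\<^sub>L) (mult (dual H) (mult (dual H) (da (restrict0 H (counit H)) f2) m) \<phi>) h * f1 x =
        z \<one>\<^sub>L * sm H h (\<lambda>b c. f2 u * m b * \<phi> c) * f1 x" by (simp add: fscale_def m[OF i(1)])
      then show "fscale (z \<one>\<^sub>L) (mult (dual H) (mult (dual H) (da (restrict0 H (counit H)) f2) m) \<phi>) h * f1 x =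
        sm H h (\<lambda>b c. m b * z \<one>\<^sub>L * (f1 x * f2 u * \<phi> c))"
        by (simp only: tl_times_left[symmetric] tl_times_right[symmetric] ac_simps)
    qed
    also have "\<dots> = sm H h (\<lambda>b c. tensor_lift HD LD (dc f3) (\<lambda>m z. m b * z \<one>\<^sub>L) * (f1 x * f2 u * \<phi> c))"
      unfolding tl_times_right[symmetric] by (rule tl_swap)
    also have "\<dots> = sm H h (\<lambda>b c. (f1 x * f2 u * f3 \<one>\<^sub>L) * (lam b * \<phi> c))"
    proof (intro H.sm_cong h)
      fix b c assume b: "b \<in> carrier H"
      have "f3 (act b \<one>\<^sub>L) = lam b * f3 \<one>\<^sub>L"
        by (simp add: act_one_right b form_scale[OF dual_form[OF f123(3)]])
      then show "tensor_lift HD LD (dc f3) (\<lambda>m z. m b * z \<one>\<^sub>L) * (f1 x * f2 u * \<phi> c) = (f1 x * f2 u * f3 \<one>\<^sub>L) * (lam b * \<phi> c)"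
        by (simp add: dc_eval f123 b)
    qed
    also have "\<dots> = f1 x * f2 u * (f3 \<one>\<^sub>L * \<phi> (proj h))"
      unfolding tl_times_left form_proj[OF h dual_form[OF p]] by (simp add: mult.assoc)
    finally show ?thesis .
  qed
  have "ev (F \<phi> f) h x = L.dm f (\<lambda>b f3. L.dm b (\<lambda>f1 f2. tensor_lift HD LD (dc f3) (\<lambda>m z.
    fscale (z \<one>\<^sub>L) (mult (dual H) (mult (dual H) (da (restrict0 H (counit H)) f2) m) \<phi>) h * f1 x)))"
    unfolding F_unfold tl_apply ev_tensor ..
  also have "\<dots> = L.dm f (\<lambda>b f3. L.dm b (\<lambda>f1 f2. f1 x * f2 u * (f3 \<one>\<^sub>L * \<phi> (proj h))))"
    by (intro L.dm_cong f inner)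
  also have "\<dots> = L.dm f (\<lambda>b f3. b (x \<star> u) * (f3 \<one>\<^sub>L * \<phi> (proj h)))"
    unfolding tl_times_right by (intro L.dm_cong f) (simp add: L.dm_eval x)
  also have "\<dots> = L.dm f (\<lambda>b f3. b (x \<star> u) * f3 \<one>\<^sub>L) * \<phi> (proj h)"
    by (simp add: tl_times_right flip: mult.assoc)
  also have "\<dots> = \<phi> (proj h) * f (x \<star> u)"
    by (subst L.dm_eval[OF f]) (simp_all add: x L.mult_assoc)
  finally show ?thesis .
qed

lemma DS_sel: "carrier DS = module.span fscale {F \<phi> f | \<phi> f. \<phi> \<in> carrier HD \<and> f \<in> carrier LD}"
  "scale DS = fscale"
  by (simp_all add: dual_smash_space_def)

lemma is_space_DS [sp, lin]: "is_space DS"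
  unfolding is_space_def DS_sel by (simp add: vector_space_fscale module.subspace_span[OF fscale_module])

lemma F_in [lin]: "\<phi> \<in> carrier HD \<Longrightarrow> f \<in> carrier LD \<Longrightarrow> F \<phi> f \<in> carrier DS"
  unfolding DS_sel by (auto intro!: module.span_base[OF fscale_module])

lemma F_scale:
  assumes p: "\<phi> \<in> carrier HD" and f: "f \<in> carrier LD"
  shows "fscale c (F \<phi> f) = F (fscale c \<phi>) f"
proof (rule dual_tensor_ev_eqI)
  show "fscale c (F \<phi> f) \<in> carrier (HD \<Otimes> LD)"
    using carrier_scale[OF is_space_tensor F_tensor[OF p f], of c] by (simp add: scale_tensor_space)
qed (simp_all add: F_tensor p f fscale_in_dual ev_F fscale_def[of c "F \<phi> f"], simp add: fscale_def)

text \<open>The list of generators on which the operations of the dual smash product are computed.  They turn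
  out to depend on \<open>z\<close> only because they depend on the sum in \<open>ev_dreps\<close> only.\<close>

definition dreps where
  "dreps z = (SOME ps. set ps \<subseteq> carrier HD \<times> carrier LD \<and> z = (\<Sum>(\<phi>, f)\<leftarrow>ps. F \<phi> f))"

lemma dual_extend: "dual_smash_extend H L act \<rho> z \<beta> = (\<Sum>p\<leftarrow>dreps z. \<beta> (fst p) (snd p))"
  by (simp add: dual_smash_extend_def lin_extend_def dreps_def split_def)

lemma dreps:
  assumes z: "z \<in> carrier DS"
  shows "p \<in> set (dreps z) \<Longrightarrow> fst p \<in> carrier HD \<and> snd p \<in> carrier LD"
    "z = (\<Sum>p\<leftarrow>dreps z. F (fst p) (snd p))"
proof -
  let ?P = "\<lambda>ps. set ps \<subseteq> carrier HD \<times> carrier LD \<and> z = (\<Sum>(\<phi>, f)\<leftarrow>ps. F \<phi> f)"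
  have "z \<in> module.span fscale {F \<phi> f | \<phi> f. \<phi> \<in> carrier HD \<and> f \<in> carrier LD}" using z by (simp add: DS_sel)
  then have "\<exists>ps. ?P ps"
  proof (induction rule: module.span_induct_alt[OF fscale_module, consumes 1, case_names 0 add])
    case 0
    show ?case by (intro exI[of _ "[]"]) simp
  next
    case (add c x y)
    then obtain \<phi> f where pf: "x = F \<phi> f" "\<phi> \<in> carrier HD" "f \<in> carrier LD" by blast
    moreover from add obtain ps where "set ps \<subseteq> carrier HD \<times> carrier LD" "y = (\<Sum>(\<phi>, f)\<leftarrow>ps. F \<phi> f)" by blast
    ultimately show ?case by (intro exI[of _ "(fscale c \<phi>, f) # ps"]) (auto simp: F_scale fscale_in_dual)
  qed
  then have "?P (dreps z)" unfolding dreps_def by (rule someI_ex)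
  then show "p \<in> set (dreps z) \<Longrightarrow> fst p \<in> carrier HD \<and> snd p \<in> carrier LD"
    "z = (\<Sum>p\<leftarrow>dreps z. F (fst p) (snd p))" by (auto simp: split_def)
qed

lemma ev_dreps:
  assumes z: "z \<in> carrier DS" and h: "h \<in> carrier H" and x: "x \<in> carrier L"
  shows "ev z h x = (\<Sum>p\<leftarrow>dreps z. fst p (proj h) * snd p (x \<star> u))"
proof -
  have "ev z h x = (\<Sum>p\<leftarrow>dreps z. ev (F (fst p) (snd p)) h x)"
    by (subst (1) dreps(2)[OF z]) (rule sum_list_apply)
  also have "\<dots> = (\<Sum>p\<leftarrow>dreps z. fst p (proj h) * snd p (x \<star> u))"
    using dreps(1)[OF z] h x by (intro arg_cong[where f = sum_list] map_cong refl ev_F) auto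
  finally show ?thesis .
qed

lemma DS_tensor [simp]: "z \<in> carrier DS \<Longrightarrow> z \<in> carrier (HD \<Otimes> LD)"
proof -
  assume z: "z \<in> carrier DS"
  have "{F \<phi> f | \<phi> f. \<phi> \<in> carrier HD \<and> f \<in> carrier LD} \<subseteq> carrier (HD \<Otimes> LD)" by (auto intro: F_tensor)
  moreover have "module.subspace fscale (carrier (HD \<Otimes> LD))"
    using is_space_tensor[of HD LD] by (simp add: is_space_def scale_tensor_space)
  ultimately show ?thesis using module.span_minimal[OF fscale_module] z unfolding DS_sel by blast
qed

lemma ev_form:
  assumes z: "z \<in> carrier DS"
  shows "form H (\<lambda>h. ev z h x)" "form L (\<lambda>x. ev z h x)"
  unfolding ev_tl[OF DS_tensor[OF z]]
  by ((rule lin_tl_body[OF is_space_dual_space DS_tensor[OF z] is_space_ground] lin_times_left lin_times_right dual_form | assumption)+)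

lemmas lin_ev_left = linear_map_comp[OF ev_form(1)]
lemmas lin_ev_right = linear_map_comp[OF ev_form(2)]

lemma ev_inv:
  assumes "z \<in> carrier DS" "h \<in> carrier H" "x \<in> carrier L"
  shows "ev z (proj h) x = ev z h x" "ev z h (x \<star> u) = ev z h x"
  using assms by (simp_all add: ev_dreps proj_proj L.mult_assoc)

lemma lin_ev_eval [lin]: "form DS (\<lambda>z. ev z h x)"
  by (simp add: linear_map_def ground_space_def DS_sel(2) fscale_def)

lemma DS_eqI:
  assumes "z \<in> carrier DS" "w \<in> carrier DS"
    "\<And>h x. h \<in> carrier H \<Longrightarrow> x \<in> carrier L \<Longrightarrow> ev z h x = ev w h x"
  shows "z = w"
  by (rule dual_tensor_ev_eqI) (use assms in auto)

section \<open>The isomorphism\<close>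

abbreviation AD where "AD \<equiv> dual_space A"

text \<open>The coefficients are chosen such that \<open>ev (Theta G) b c = G (E c b)\<close>
  for basis vectors; \<open>ev_Theta\<close> extends this to all vectors.\<close>

definition Theta :: "(('k, 'l, 'h) tensor \<Rightarrow> 'k) \<Rightarrow> ('k, 'h \<Rightarrow> 'k, 'l \<Rightarrow> 'k) tensor" where
  "Theta G = (\<Sum>c\<in>some_basis L. \<Sum>b\<in>some_basis H. scale DS (G (E c b)) (F (coord H b) (coord L c)))"

lemma Theta_in [lin, simp]: "Theta G \<in> carrier DS"
  unfolding Theta_def
  by (intro linear_map_sum(2)[OF _ lin_id]) (assumption | rule lin H.basis L.basis)+

lemma linear_Theta: "linear_map AD DS Theta"
  unfolding Theta_def
  by (intro linear_map_sum_fun) (assumption | rule lin H.basis L.basis)+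

lemma AD_form: "G \<in> carrier AD \<Longrightarrow> form Sp G"
  using dual_form[of G A] by (simp add: A_space)

lemma ev_Theta:
  assumes G: "G \<in> carrier AD" and h: "h \<in> carrier H" and x: "x \<in> carrier L"
  shows "ev (Theta G) h x = G (E x h)"
proof -
  note [lin] = linear_map_comp[OF AD_form[OF G]]
  have s: "ev (\<Sum>i\<in>I. t i) h x = (\<Sum>i\<in>I. ev (t i) h x)" for I :: "'i set" and t
    by (induction I rule: infinite_finite_induct) auto
  have "ev (Theta G) h x = (\<Sum>c\<in>some_basis L. \<Sum>b\<in>some_basis H. G (E c b) * (coord L c (x \<star> u) * coord H b (proj h)))"
    unfolding Theta_def s DS_sel(2) fscale_def
    by (intro sum.cong refl) (simp add: ev_F H.basis L.basis h x)
  also have "\<dots> = G (E (x \<star> u) (proj h))"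
    by (rule biform_expand[where \<gamma> = "\<lambda>x h. G (E x h)", OF L.space H.space, symmetric], ((assumption | rule lin)+)[1])
      (use L.basis H.basis x h in auto)
  finally show ?thesis using x h by simp
qed

lemma AD_eqI:
  assumes "F1 \<in> carrier AD" "F2 \<in> carrier AD"
    "\<And>x h. x \<in> carrier L \<Longrightarrow> h \<in> carrier H \<Longrightarrow> F1 (E x h) = F2 (E x h)"
  shows "F1 = F2"
proof (rule dual_eqI[OF assms(1,2)])
  fix v assume "v \<in> carrier A"
  then show "F1 v = F2 v"
    using Sp_linear_eq[OF AD_form[OF assms(1)] AD_form[OF assms(2)] assms(3)] by simp
qed

text \<open>Elements of the dual smash product are determined by their evaluations, which are invariant
  bilinear forms; and every invariant bilinear form extends to a functional on the smash product.\<close>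

lemma bij_Theta: "bij_betw Theta (carrier AD) (carrier DS)"
  unfolding bij_betw_def
proof (intro conjI equalityI subsetI)
  show "inj_on Theta (carrier AD)"
  proof (rule inj_onI)
    fix F1 F2 assume i: "F1 \<in> carrier AD" "F2 \<in> carrier AD" "Theta F1 = Theta F2"
    show "F1 = F2"
      by (rule AD_eqI[OF i(1,2)]) (use ev_Theta i in metis)
  qed
  fix z assume z: "z \<in> carrier DS"
  let ?\<beta> = "\<lambda>x h. ev z h x"
  note [lin] = lin_ev_left[OF z] lin_ev_right[OF z]
  have b: "bilinear_map L H ground_space ?\<beta>" by (assumption | rule lin)+
  have inv: "invariant ?\<beta>" by (simp add: invariant_def ev_inv z)
  define G where "G = restrict0 A (\<lambda>w. smash_extend H L act \<rho> w ?\<beta>)"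
  have "form A (\<lambda>w. smash_extend H L act \<rho> w ?\<beta>)"
    unfolding A_space by (rule linear_smash_extend[OF is_space_ground b inv])
  then have G: "G \<in> carrier AD"
    unfolding G_def by (rule restrict0_in_dual[OF is_space_A])
  have "Theta G = z"
  proof (rule DS_eqI[OF Theta_in z])
    fix h x assume hx: "h \<in> carrier H" "x \<in> carrier L"
    show "ev (Theta G) h x = ev z h x"
      using hx by (simp add: ev_Theta G) (simp add: G_def smash_extend_E[OF is_space_ground b inv])
  qed
  with G show "z \<in> Theta ` carrier AD" by blast
qed auto

section \<open>Moving the idempotents around\<close>

lemma proj_comult_absorb:
  assumes h: "h \<in> carrier H" and b: "bilinear_map H H ground_space \<beta>"
  shows "sm H (proj h) (\<lambda>a b. \<beta> (proj a) (proj b)) = sm H (proj h) \<beta>"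
proof -
  note [lin] = linear_map_comp_left[OF b] linear_map_comp_right[OF b]
  have "sm H (proj h) (\<lambda>a b. \<beta> (proj a) (proj b)) = sm H h (\<lambda>a b. \<beta> (proj (proj a)) (proj b))"
    by (rule proj_comult(1)[OF h]) (assumption | rule lin)+
  also have "\<dots> = sm H h (\<lambda>a b. \<beta> (proj a) (proj b))"
    by (intro H.sm_cong h) (simp add: proj_proj)
  also have "\<dots> = sm H (proj h) (\<lambda>a b. \<beta> (proj a) b)"
    by (rule proj_comult(2)[OF h, symmetric]) (assumption | rule lin)+
  also have "\<dots> = sm H h (\<lambda>a b. \<beta> (proj (proj a)) b)"
    by (rule proj_comult(1)[OF h]) (assumption | rule lin)+
  also have "\<dots> = sm H h (\<lambda>a b. \<beta> (proj a) b)"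
    by (intro H.sm_cong h) (simp add: proj_proj)
  also have "\<dots> = sm H (proj h) \<beta>"
    by (rule proj_comult(1)[OF h b, symmetric])
  finally show ?thesis .
qed

text \<open>The coaction commutes with the projection, by \<open>lam_comult_rho\<close>.\<close>

lemma rho_proj:
  assumes h: "h \<in> carrier H" and b: "bilinear_map H L ground_space \<beta>"
  shows "rs (proj h) \<beta> = rs h (\<lambda>p q. \<beta> (proj p) q)"
proof -
  note [lin] = linear_map_comp_left[OF b] linear_map_comp_right[OF b]
  have "rs (proj h) \<beta> = sm H h (\<lambda>a b. lam a * rs b \<beta>)"
    by (rule form_proj[OF h]) (assumption | rule lin sp b)+
  also have "\<dots> = rs h (\<lambda>p q. sm H p (\<lambda>a b. lam a * \<beta> b q))"
    by (rule lam_comult_rho[symmetric, OF h b])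
  also have "\<dots> = rs h (\<lambda>p q. \<beta> (proj p) q)"
    by (intro rs_cong h form_proj[symmetric]) (assumption | rule lin)+
  finally show ?thesis .
qed

lemma u_comult_absorb:
  assumes x: "x \<in> carrier L" and b: "bilinear_map L L ground_space \<beta>"
    and inv: "\<And>a b. a \<in> carrier L \<Longrightarrow> b \<in> carrier L \<Longrightarrow> \<beta> a (b \<star> u) = \<beta> a b"
  shows "sm L (x \<star> u) (\<lambda>a b. \<beta> (a \<star> u) b) = sm L (x \<star> u) \<beta>"
proof -
  note [lin] = linear_map_comp_left[OF b] linear_map_comp_right[OF b]
  have "sm L (x \<star> u) (\<lambda>a b. \<beta> (a \<star> u) b) = sm L x (\<lambda>a b. \<beta> (a \<star> u \<star> u) b)"
    by (rule u_comult) (assumption | rule lin x inv)+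
  also have "\<dots> = sm L x (\<lambda>a b. \<beta> (a \<star> u) b)"
    by (intro L.sm_cong x) (simp add: L.mult_assoc)
  also have "\<dots> = sm L (x \<star> u) \<beta>" by (rule u_comult[OF x b, symmetric]) (rule inv)
  finally show ?thesis .
qed

text \<open>The operations of the dual smash product are computed on generators, whose evaluations contain
  \<open>proj\<close> and \<open>u\<close> in every argument.  This lemma shows that they make no difference within the
  comultiplication at \<open>xu\<close> and \<open>proj h\<close>, by commuting \<open>proj\<close> and \<open>u\<close> with the coproducts and the coaction.\<close>

lemma comult_absorb:
  assumes x: "x \<in> carrier L" and h: "h \<in> carrier H"
    and l: "\<And>b c d. b \<in> carrier H \<Longrightarrow> c \<in> carrier L \<Longrightarrow> d \<in> carrier H \<Longrightarrow> form L (\<lambda>a. Q a b c d)"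
      "\<And>a c d. a \<in> carrier L \<Longrightarrow> c \<in> carrier L \<Longrightarrow> d \<in> carrier H \<Longrightarrow> form H (\<lambda>b. Q a b c d)"
      "\<And>a b d. a \<in> carrier L \<Longrightarrow> b \<in> carrier H \<Longrightarrow> d \<in> carrier H \<Longrightarrow> form L (\<lambda>c. Q a b c d)"
      "\<And>a b c. a \<in> carrier L \<Longrightarrow> b \<in> carrier H \<Longrightarrow> c \<in> carrier L \<Longrightarrow> form H (\<lambda>d. Q a b c d)"
  shows "sm L (x \<star> u) (\<lambda>x1 x2. sm H (proj h) (\<lambda>a b. rs a (\<lambda>p q. Q x1 p (x2 \<star> q) b))) =
    sm L (x \<star> u) (\<lambda>x1 x2. sm H (proj h) (\<lambda>a b. rs a (\<lambda>p q. Q (x1 \<star> u) (proj p) (x2 \<star> q \<star> u) (proj b))))"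
proof -
  note [lin] = l[THEN linear_map_comp]
  have xu: "x \<star> u \<in> carrier L" and ph: "proj h \<in> carrier H" using x h by simp_all
  have "sm L (x \<star> u) (\<lambda>x1 x2. sm H (proj h) (\<lambda>a b. rs a (\<lambda>p q. Q (x1 \<star> u) (proj p) (x2 \<star> q \<star> u) (proj b)))) =
    sm L (x \<star> u) (\<lambda>x1 x2. sm H (proj h) (\<lambda>a b. rs a (\<lambda>p q. Q (x1 \<star> u) (proj p) (x2 \<star> (q \<star> u)) (proj b))))"
    by (intro L.sm_cong H.sm_cong rs_cong xu ph) (simp_all add: L.mult_assoc)
  also have "\<dots> = sm L (x \<star> u) (\<lambda>x1 x2. sm H (proj h) (\<lambda>a b. rs a (\<lambda>p q. Q (x1 \<star> u) (proj p) (x2 \<star> q) (proj b))))"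
    by (intro L.sm_cong H.sm_cong xu ph rho_absorb_u) (assumption | rule lin)+
  also have "\<dots> = sm L (x \<star> u) (\<lambda>x1 x2. sm H (proj h) (\<lambda>a b. rs (proj a) (\<lambda>p q. Q (x1 \<star> u) p (x2 \<star> q) (proj b))))"
    by (intro L.sm_cong H.sm_cong xu ph rho_proj[symmetric]) (assumption | rule lin)+
  also have "\<dots> = sm L (x \<star> u) (\<lambda>x1 x2. sm H (proj h) (\<lambda>a b. rs a (\<lambda>p q. Q (x1 \<star> u) p (x2 \<star> q) b)))"
    by (intro L.sm_cong xu proj_comult_absorb h) (assumption | rule lin sp)+
  also have "\<dots> = sm L (x \<star> u) (\<lambda>x1 x2. sm H (proj h) (\<lambda>a b. rs a (\<lambda>p q. Q x1 p (x2 \<star> q) b)))"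
  proof (rule u_comult_absorb[OF x])
    show "bilinear_map L L ground_space (\<lambda>x1 x2. sm H (proj h) (\<lambda>a b. rs a (\<lambda>p q. Q x1 p (x2 \<star> q) b)))"
      by (assumption | rule lin sp h)+
    fix x1 x2 assume i: "x1 \<in> carrier L" "x2 \<in> carrier L"
    have "sm H (proj h) (\<lambda>a b. rs a (\<lambda>p q. Q x1 p (x2 \<star> u \<star> q) b)) =
      sm H (proj h) (\<lambda>a b. rs a (\<lambda>p q. Q x1 p (x2 \<star> (q \<star> u)) b))"
      by (intro H.sm_cong rs_cong ph) (simp_all add: L.mult_assoc u_central i)
    also have "\<dots> = sm H (proj h) (\<lambda>a b. rs a (\<lambda>p q. Q x1 p (x2 \<star> q) b))"
      by (intro H.sm_cong ph rho_absorb_u) (assumption | rule lin i)+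
    finally show "sm H (proj h) (\<lambda>a b. rs a (\<lambda>p q. Q x1 p (x2 \<star> u \<star> q) b)) =
      sm H (proj h) (\<lambda>a b. rs a (\<lambda>p q. Q x1 p (x2 \<star> q) b))" .
  qed
  finally show ?thesis ..
qed

section \<open>The isomorphism respects the structure\<close>

abbreviation DB where "DB \<equiv> dual_smash_bialg H L act \<rho>"

lemma dual_smash_bialg_sel [simp]:
  "carrier DB = carrier DS" "scale DB = fscale"
  "one_el DB = F (restrict0 H (counit H)) (restrict0 L (counit L))"
  by (simp_all add: dual_smash_bialg_def Let_def DS_sel(2))

lemma DB_mult: "mult DB z w = (\<Sum>p\<leftarrow>dreps z. \<Sum>r\<leftarrow>dreps w. L.dm (snd r) (\<lambda>g1 g2.
    F (mult (dual H) (da (fst p) g2) (fst r)) (mult (dual L) (snd p) g1)))"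
  by (simp add: dual_smash_bialg_def Let_def dual_extend sm_sw dual_tensor)

lemma DB_comult: "comult DB z = (\<Sum>p\<leftarrow>dreps z. L.dm (snd p) (\<lambda>f1 f2. H.dm (fst p) (\<lambda>p1 p2.
    tensor_lift HD LD (dc f2) (\<lambda>m y. tensor DS DS (F (mult (dual H) m p1) f1) (F p2 y)))))"
  by (simp add: dual_smash_bialg_def Let_def dual_extend sm_sw dual_tensor)

lemma DB_counit: "counit DB z = (\<Sum>p\<leftarrow>dreps z. fst p \<one> * da (restrict0 H (counit H)) (snd p) \<one>)"
  by (simp add: dual_smash_bialg_def Let_def dual_extend)

lemma DB_mult_in:
  assumes "z \<in> carrier DS" "w \<in> carrier DS"
  shows "mult DB z w \<in> carrier DS"
proof -
  have "L.dm (snd r) (\<lambda>g1 g2. F (mult (dual H) (da (fst p) g2) (fst r)) (mult (dual L) (snd p) g1)) \<in> carrier DS"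
    if "p \<in> set (dreps z)" "r \<in> set (dreps w)" for p r
    using dreps(1)[OF assms(1) that(1)] dreps(1)[OF assms(2) that(2)]
    by (intro tl_in F_in H.dual_mult_in L.dual_mult_in da_in L.comult_dual_in sp) auto
  then show ?thesis unfolding DB_mult
    by (intro linear_map_sum_list[OF is_space_DS lin_id, THEN conjunct2])
qed

text \<open>All operations on functionals are transposes, so evaluation gives \<open>\<phi>\<close>, \<open>f\<close>, \<open>\<psi>\<close> and \<open>g\<close> at the legs of the
  comultiplication of the generator of \<open>x\<close> and \<open>h\<close>.  The factors \<open>proj\<close> and \<open>u\<close> are inserted such that
  the result can be read as a product of evaluations of generators.\<close>

lemma ev_gen_mult:
  assumes p: "\<phi> \<in> carrier HD" "f \<in> carrier LD" and r: "\<psi> \<in> carrier HD" "g \<in> carrier LD"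
    and h: "h \<in> carrier H" and x: "x \<in> carrier L"
  shows "ev (L.dm g (\<lambda>g1 g2. F (mult (dual H) (da \<phi> g2) \<psi>) (mult (dual L) f g1))) h x =
    sm L (x \<star> u) (\<lambda>x1 x2. sm H (proj h) (\<lambda>a b. rs a (\<lambda>p q.
      (\<phi> (proj p) * f (x1 \<star> u)) * (\<psi> (proj b) * g (x2 \<star> q \<star> u)))))"
proof -
  note [lin] = linear_map_comp[OF dual_form[OF p(1)]] linear_map_comp[OF dual_form[OF p(2)]]
    linear_map_comp[OF dual_form[OF r(1)]] linear_map_comp[OF dual_form[OF r(2)]]
  have xu: "x \<star> u \<in> carrier L" and ph: "proj h \<in> carrier H" using x h by simp_all
  have "ev (L.dm g (\<lambda>g1 g2. F (mult (dual H) (da \<phi> g2) \<psi>) (mult (dual L) f g1))) h x =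
     L.dm g (\<lambda>g1 g2. mult (dual H) (da \<phi> g2) \<psi> (proj h) * mult (dual L) f g1 (x \<star> u))"
    unfolding tl_apply
    by (intro L.dm_cong r ev_F H.dual_mult_in L.dual_mult_in da_in p h x)
  also have "\<dots> = L.dm g (\<lambda>g1 g2. sm H (proj h) (\<lambda>a b. rs a (\<lambda>p q. \<phi> p * g2 q) * \<psi> b) *
      sm L (x \<star> u) (\<lambda>x1 x2. f x1 * g1 x2))"
    unfolding H.dual_mult_apply[OF ph] L.dual_mult_apply[OF xu]
    by (intro L.dm_cong r arg_cong2[where f = "(*)"] refl H.sm_cong ph) (simp add: da_apply)
  also have "\<dots> = L.dm g (\<lambda>g1 g2. sm L (x \<star> u) (\<lambda>x1 x2. sm H (proj h) (\<lambda>a b. rs a (\<lambda>p q.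
      (\<phi> p * f x1) * (\<psi> b * (g1 x2 * g2 q))))))"
    by (simp only: tl_times_left[symmetric], simp only: tl_times_right[symmetric], simp only: ac_simps)
  also have "\<dots> = sm L (x \<star> u) (\<lambda>x1 x2. L.dm g (\<lambda>g1 g2. sm H (proj h) (\<lambda>a b. rs a (\<lambda>p q.
      (\<phi> p * f x1) * (\<psi> b * (g1 x2 * g2 q))))))"
    by (rule tl_swap)
  also have "\<dots> = sm L (x \<star> u) (\<lambda>x1 x2. sm H (proj h) (\<lambda>a b. L.dm g (\<lambda>g1 g2. rs a (\<lambda>p q.
      (\<phi> p * f x1) * (\<psi> b * (g1 x2 * g2 q))))))"
    by (intro L.sm_cong xu tl_swap)
  also have "\<dots> = sm L (x \<star> u) (\<lambda>x1 x2. sm H (proj h) (\<lambda>a b. rs a (\<lambda>p q. L.dm g (\<lambda>g1 g2.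
      (\<phi> p * f x1) * (\<psi> b * (g1 x2 * g2 q))))))"
    by (intro L.sm_cong H.sm_cong xu ph tl_swap)
  also have "\<dots> = sm L (x \<star> u) (\<lambda>x1 x2. sm H (proj h) (\<lambda>a b. rs a (\<lambda>p q. (\<phi> p * f x1) * (\<psi> b * g (x2 \<star> q)))))"
    unfolding tl_times_left by (intro L.sm_cong H.sm_cong rs_cong xu ph) (simp_all add: L.dm_eval r)
  also have "\<dots> = sm L (x \<star> u) (\<lambda>x1 x2. sm H (proj h) (\<lambda>a b. rs a (\<lambda>p q.
      (\<phi> (proj p) * f (x1 \<star> u)) * (\<psi> (proj b) * g (x2 \<star> q \<star> u)))))"
    by (rule comult_absorb[where Q = "\<lambda>x1 p y b. (\<phi> p * f x1) * (\<psi> b * g y)", OF x h]) (assumption | rule lin)+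
  finally show ?thesis .
qed

lemma ev_DB_mult:
  assumes z: "z \<in> carrier DS" and w: "w \<in> carrier DS" and h: "h \<in> carrier H" and x: "x \<in> carrier L"
  shows "ev (mult DB z w) h x = sm L (x \<star> u) (\<lambda>x1 x2. sm H (proj h) (\<lambda>a b. rs a (\<lambda>p q.
    ev z p x1 * ev w b (x2 \<star> q))))"
proof -
  have xu: "x \<star> u \<in> carrier L" and ph: "proj h \<in> carrier H" using x h by simp_all
  have "ev (mult DB z w) h x = (\<Sum>p\<leftarrow>dreps z. \<Sum>r\<leftarrow>dreps w. ev (L.dm (snd r) (\<lambda>g1 g2.
    F (mult (dual H) (da (fst p) g2) (fst r)) (mult (dual L) (snd p) g1))) h x)"
    unfolding DB_mult sum_list_apply ..
  also have "\<dots> = (\<Sum>s\<leftarrow>dreps z. \<Sum>r\<leftarrow>dreps w. sm L (x \<star> u) (\<lambda>x1 x2. sm H (proj h) (\<lambda>a b. rs a (\<lambda>p q.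
      (fst s (proj p) * snd s (x1 \<star> u)) * (fst r (proj b) * snd r (x2 \<star> q \<star> u))))))"
    using dreps(1)[OF z] dreps(1)[OF w]
    by (intro arg_cong[where f = sum_list] map_cong refl ev_gen_mult h x) auto
  also have "\<dots> = sm L (x \<star> u) (\<lambda>x1 x2. sm H (proj h) (\<lambda>a b. rs a (\<lambda>p q. \<Sum>s\<leftarrow>dreps z. \<Sum>r\<leftarrow>dreps w.
      (fst s (proj p) * snd s (x1 \<star> u)) * (fst r (proj b) * snd r (x2 \<star> q \<star> u)))))"
    by (simp only: tl_sum_list)
  also have "\<dots> = sm L (x \<star> u) (\<lambda>x1 x2. sm H (proj h) (\<lambda>a b. rs a (\<lambda>p q. ev z p x1 * ev w b (x2 \<star> q))))"
    by (intro L.sm_cong H.sm_cong rs_cong xu ph)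
      (simp_all add: ev_dreps z w sum_list_const_mult sum_list_mult_const)
  finally show ?thesis .
qed

lemma Theta_mult:
  assumes G: "G \<in> carrier AD" and K: "K \<in> carrier AD"
  shows "mult DB (Theta G) (Theta K) = Theta (mult (dual A) G K)"
proof (rule DS_eqI)
  show "mult DB (Theta G) (Theta K) \<in> carrier DS" by (intro DB_mult_in Theta_in)
  fix h x assume h: "h \<in> carrier H" and x: "x \<in> carrier L"
  have xu: "x \<star> u \<in> carrier L" and ph: "proj h \<in> carrier H" using x h by simp_all
  note [lin] = linear_map_comp[OF AD_form[OF G]] linear_map_comp[OF AD_form[OF K]]
  have "ev (mult DB (Theta G) (Theta K)) h x = sm L (x \<star> u) (\<lambda>x1 x2. sm H (proj h) (\<lambda>a b. rs a (\<lambda>p q.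
    ev (Theta G) p x1 * ev (Theta K) b (x2 \<star> q))))"
    by (intro ev_DB_mult Theta_in h x)
  also have "\<dots> = sm L (x \<star> u) (\<lambda>x1 x2. sm H (proj h) (\<lambda>a b. rs a (\<lambda>p q.
    G (E x1 p) * K (E (x2 \<star> q) b))))"
    by (intro L.sm_cong H.sm_cong rs_cong xu ph) (simp_all add: ev_Theta G K)
  also have "\<dots> = ds (E (x \<star> u) (proj h)) (\<lambda>a b. G a * K b)"
    by (rule ds_E[symmetric]) (assumption | rule lin xu ph)+
  also have "\<dots> = mult (dual A) G K (E x h)"
    using x h by (simp add: A.dual_mult_apply A_tensor)
  also have "\<dots> = ev (Theta (mult (dual A) G K)) h x"
    by (rule ev_Theta[symmetric]) (intro A.dual_mult_in G K h x)+
  finally show "ev (mult DB (Theta G) (Theta K)) h x = ev (Theta (mult (dual A) G K)) h x" .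
qed simp

lemma DB_comult_in:
  assumes z: "z \<in> carrier DS"
  shows "comult DB z \<in> carrier (DS \<Otimes> DS)"
proof -
  have "L.dm (snd p) (\<lambda>f1 f2. H.dm (fst p) (\<lambda>p1 p2.
    tensor_lift HD LD (dc f2) (\<lambda>m y. tensor DS DS (F (mult (dual H) m p1) f1) (F p2 y)))) \<in> carrier (DS \<Otimes> DS)"
    if "p \<in> set (dreps z)" for p
    using dreps(1)[OF z that]
    by (intro tl_in tensor_in F_in H.dual_mult_in dc_in L.comult_dual_in H.comult_dual_in sp) auto
  then show ?thesis unfolding DB_comult
    by (intro linear_map_sum_list[OF is_space_tensor lin_id, THEN conjunct2])
qed

text \<open>Likewise, the right side contains \<open>\<phi>\<close> and \<open>f\<close> at the product of the generators of
  \<open>(x, h)\<close> and \<open>(y, k)\<close>.\<close>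

lemma ev_gen_comult:
  assumes p: "\<phi> \<in> carrier HD" "f \<in> carrier LD"
    and h: "h \<in> carrier H" "k \<in> carrier H" and x: "x \<in> carrier L" "y \<in> carrier L"
  shows "L.dm f (\<lambda>f1 f2. H.dm \<phi> (\<lambda>p1 p2. tensor_lift HD LD (dc f2) (\<lambda>m z.
      ev (F (mult (dual H) m p1) f1) h x * ev (F p2 z) k y))) =
    sm H (proj h) (\<lambda>a b. \<phi> (proj (b \<cdot> proj k)) * f (x \<star> u \<star> act a (y \<star> u) \<star> u))"
proof -
  note [lin] = linear_map_comp[OF dual_form[OF p(1)]] linear_map_comp[OF dual_form[OF p(2)]]
  have i: "x \<star> u \<in> carrier L" "y \<star> u \<in> carrier L" "proj h \<in> carrier H" "proj k \<in> carrier H" using x h by simp_all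
  let ?x = "x \<star> u" and ?y = "y \<star> u" and ?k = "proj k"
  have "L.dm f (\<lambda>f1 f2. H.dm \<phi> (\<lambda>p1 p2. tensor_lift HD LD (dc f2) (\<lambda>m z.
      ev (F (mult (dual H) m p1) f1) h x * ev (F p2 z) k y))) =
    L.dm f (\<lambda>f1 f2. H.dm \<phi> (\<lambda>p1 p2. tensor_lift HD LD (dc f2) (\<lambda>m z.
      sm H (proj h) (\<lambda>a b. m a * z ?y * (p1 b * p2 ?k * f1 ?x)))))"
  proof (intro L.dm_cong H.dm_cong tl_cong p is_space_dual_space dc_in; assumption?)
    fix f1 f2 p1 p2 m z assume m: "f1 \<in> carrier LD" "p1 \<in> carrier HD" "p2 \<in> carrier HD" "m \<in> carrier HD" "z \<in> carrier LD"
    have "ev (F (mult (dual H) m p1) f1) h x * ev (F p2 z) k y = sm H (proj h) (\<lambda>a b. m a * p1 b) * f1 ?x * (p2 ?k * z ?y)"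
      using m h x by (simp add: ev_F H.dual_mult_in H.dual_mult_apply)
    also have "\<dots> = sm H (proj h) (\<lambda>a b. m a * z ?y * (p1 b * p2 ?k * f1 ?x))"
      by (simp only: tl_times_right[symmetric], simp only: ac_simps)
    finally show "ev (F (mult (dual H) m p1) f1) h x * ev (F p2 z) k y = sm H (proj h) (\<lambda>a b. m a * z ?y * (p1 b * p2 ?k * f1 ?x))" .
  qed
  also have "\<dots> = L.dm f (\<lambda>f1 f2. H.dm \<phi> (\<lambda>p1 p2. sm H (proj h) (\<lambda>a b. tensor_lift HD LD (dc f2) (\<lambda>m z.
      m a * z ?y * (p1 b * p2 ?k * f1 ?x)))))"
    by (intro L.dm_cong H.dm_cong p tl_swap)
  also have "\<dots> = L.dm f (\<lambda>f1 f2. sm H (proj h) (\<lambda>a b. H.dm \<phi> (\<lambda>p1 p2. tensor_lift HD LD (dc f2) (\<lambda>m z.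
      m a * z ?y * (p1 b * p2 ?k * f1 ?x)))))"
    by (intro L.dm_cong p tl_swap)
  also have "\<dots> = sm H (proj h) (\<lambda>a b. L.dm f (\<lambda>f1 f2. H.dm \<phi> (\<lambda>p1 p2. tensor_lift HD LD (dc f2) (\<lambda>m z.
      m a * z ?y * (p1 b * p2 ?k * f1 ?x)))))"
    by (rule tl_swap)
  also have "\<dots> = sm H (proj h) (\<lambda>a b. L.dm f (\<lambda>f1 f2. H.dm \<phi> (\<lambda>p1 p2. p1 b * p2 ?k * (f1 ?x * f2 (act a ?y)))))"
  proof (intro H.sm_cong L.dm_cong H.dm_cong p i)
    fix a b f1 f2 p1 p2 assume m: "a \<in> carrier H" "f2 \<in> carrier LD"
    have "tensor_lift HD LD (dc f2) (\<lambda>m z. m a * z ?y * (p1 b * p2 ?k * f1 ?x)) = f2 (act a ?y) * (p1 b * p2 ?k * f1 ?x)"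
      unfolding tl_times_right by (simp add: dc_eval m x)
    then show "tensor_lift HD LD (dc f2) (\<lambda>m z. m a * z ?y * (p1 b * p2 ?k * f1 ?x)) = p1 b * p2 ?k * (f1 ?x * f2 (act a ?y))"
      by (simp add: ac_simps)
  qed
  also have "\<dots> = sm H (proj h) (\<lambda>a b. \<phi> (b \<cdot> ?k) * f (?x \<star> act a ?y))"
    unfolding tl_times_right tl_times_left
    by (intro H.sm_cong i) (simp add: L.dm_eval H.dm_eval p h x tl_times_left)
  also have "\<dots> = sm H (proj h) (\<lambda>a b. \<phi> (proj b \<cdot> ?k) * f (?x \<star> act a ?y))"
  proof -
    have "sm H (proj h) (\<lambda>a b. \<phi> (proj b \<cdot> ?k) * f (?x \<star> act a ?y)) =
      sm H h (\<lambda>a b. \<phi> (proj (proj b) \<cdot> ?k) * f (?x \<star> act a ?y))"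
      by (rule proj_comult(2)[OF h(1)]) (assumption | rule lin i)+
    also have "\<dots> = sm H h (\<lambda>a b. \<phi> (proj b \<cdot> ?k) * f (?x \<star> act a ?y))"
      by (intro H.sm_cong h) (simp add: proj_proj)
    also have "\<dots> = sm H (proj h) (\<lambda>a b. \<phi> (b \<cdot> ?k) * f (?x \<star> act a ?y))"
      by (rule proj_comult(2)[OF h(1), symmetric]) (assumption | rule lin i)+
    finally show ?thesis ..
  qed
  also have "\<dots> = sm H (proj h) (\<lambda>a b. \<phi> (proj (proj b \<cdot> ?k)) * f (?x \<star> act a ?y \<star> u))"
  proof (intro H.sm_cong i)
    fix a b assume ab: "a \<in> carrier H" "b \<in> carrier H"
    have "?x \<star> act a ?y \<star> u = ?x \<star> act a ?y"
      using ab x u_central[of "act a ?y"] by (simp add: L.mult_assoc)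
    then show "\<phi> (proj b \<cdot> ?k) * f (?x \<star> act a ?y) = \<phi> (proj (proj b \<cdot> ?k)) * f (?x \<star> act a ?y \<star> u)"
      using ab h by (simp add: proj_mult proj_proj)
  qed
  also have "\<dots> = sm H (proj h) (\<lambda>a b. \<phi> (proj (b \<cdot> ?k)) * f (?x \<star> act a ?y \<star> u))"
  proof -
    have "sm H (proj h) (\<lambda>a b. \<phi> (proj (proj b \<cdot> ?k)) * f (?x \<star> act a ?y \<star> u)) =
      sm H h (\<lambda>a b. \<phi> (proj (proj (proj b) \<cdot> ?k)) * f (?x \<star> act a ?y \<star> u))"
      by (rule proj_comult(2)[OF h(1)]) (assumption | rule lin i)+
    also have "\<dots> = sm H h (\<lambda>a b. \<phi> (proj (proj b \<cdot> ?k)) * f (?x \<star> act a ?y \<star> u))"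
      by (intro H.sm_cong h) (simp add: proj_proj)
    also have "\<dots> = sm H (proj h) (\<lambda>a b. \<phi> (proj (b \<cdot> ?k)) * f (?x \<star> act a ?y \<star> u))"
      by (rule proj_comult(2)[OF h(1), symmetric]) (assumption | rule lin i)+
    finally show ?thesis .
  qed
  finally show ?thesis .
qed

text \<open>The coordinates needed to compare tensors over the dual smash product by \<open>tensor_eq_by_coordinates\<close>:
  evaluations at pairs of basis vectors.\<close>

lemma DS_expand:
  assumes z: "z \<in> carrier DS"
  shows "z = (\<Sum>i\<in>some_basis L \<times> some_basis H. scale DS (ev z (snd i) (fst i)) (F (coord H (snd i)) (coord L (fst i))))"
proof -
  from z bij_Theta obtain G where G: "G \<in> carrier AD" "z = Theta G" by (auto simp: bij_betw_def)
  have b: "c \<in> carrier L" if "c \<in> some_basis L" for c using L.basis(2) that by blast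
  have "z = (\<Sum>c\<in>some_basis L. \<Sum>b\<in>some_basis H. scale DS (ev z b c) (F (coord H b) (coord L c)))"
    unfolding G(2) by (subst (1) Theta_def) (intro sum.cong refl, simp add: ev_Theta G(1) b basis_H)
  then show ?thesis by (simp add: sum.cartesian_product split_def)
qed

text \<open>Evaluated at two pairs, both sides are the value of \<open>G\<close> at the product of the corresponding generators.\<close>

lemma Theta_comult:
  assumes G: "G \<in> carrier AD"
  shows "comult DB (Theta G) = sm (dual A) G (\<lambda>a b. tensor DS DS (Theta a) (Theta b))"
  unfolding A.dm_sm
proof (rule tensor_eq_by_coordinates[where I = "some_basis L \<times> some_basis H" and J = "some_basis L \<times> some_basis H"
      and e = "\<lambda>i z. ev z (snd i) (fst i)" and f = "\<lambda>i z. ev z (snd i) (fst i)" and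
      v = "\<lambda>i. F (coord H (snd i)) (coord L (fst i))" and w = "\<lambda>i. F (coord H (snd i)) (coord L (fst i))",
      OF is_space_DS is_space_DS DS_expand _ DS_expand])
  show "comult DB (Theta G) \<in> carrier (DS \<Otimes> DS)" by (intro DB_comult_in Theta_in)
  show in2: "A.dm G (\<lambda>a b. tensor DS DS (Theta a) (Theta b)) \<in> carrier (DS \<Otimes> DS)"
    by (assumption | rule lin sp G)+
  fix i j assume "i \<in> some_basis L \<times> some_basis H" "j \<in> some_basis L \<times> some_basis H"
  then obtain x h y k where i: "i = (x, h)" "j = (y, k)"
    and x: "x \<in> carrier L" "y \<in> carrier L" and h: "h \<in> carrier H" "k \<in> carrier H"
    using L.basis(2) basis_H by blast
  let ?\<gamma> = "\<lambda>a b. ev a h x * ev b k y"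
  have b: "bilinear_map DS DS ground_space ?\<gamma>" by (assumption | rule lin)+
  note [lin] = linear_map_comp[OF AD_form[OF G]]
  have xy: "x \<star> u \<in> carrier L" "y \<star> u \<in> carrier L" "proj h \<in> carrier H" "proj k \<in> carrier H" using x h by simp_all
  have T: "Theta G \<in> carrier DS" by simp
  have "tensor_lift DS DS (comult DB (Theta G)) ?\<gamma> = comult DB (Theta G) ?\<gamma>"
    by (rule tl_tensor_eval[OF is_space_DS DB_comult_in[OF T] b, symmetric])
  also have "\<dots> = (\<Sum>p\<leftarrow>dreps (Theta G). L.dm (snd p) (\<lambda>f1 f2. H.dm (fst p) (\<lambda>p1 p2.
    tensor_lift HD LD (dc f2) (\<lambda>m z. ev (F (mult (dual H) m p1) f1) h x * ev (F p2 z) k y))))"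
    unfolding DB_comult sum_list_apply tl_apply tensor_apply[OF b] ..
  also have "\<dots> = (\<Sum>p\<leftarrow>dreps (Theta G). sm H (proj h) (\<lambda>a b. fst p (proj (b \<cdot> proj k)) *
      snd p (x \<star> u \<star> act a (y \<star> u) \<star> u)))"
    using dreps(1)[OF T] by (intro arg_cong[where f = sum_list] map_cong refl ev_gen_comult x h) auto
  also have "\<dots> = sm H (proj h) (\<lambda>a b. ev (Theta G) (b \<cdot> proj k) (x \<star> u \<star> act a (y \<star> u)))"
    unfolding tl_sum_list[symmetric] by (intro H.sm_cong xy) (simp add: ev_dreps[OF T] x h)
  also have "\<dots> = sm H (proj h) (\<lambda>a b. G (E (x \<star> u \<star> act a (y \<star> u)) (b \<cdot> proj k)))"
    by (intro H.sm_cong xy) (simp add: ev_Theta G x h)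
  also have "\<dots> = G (mu (E (x \<star> u) (proj h)) (E (y \<star> u) (proj k)))"
    by (rule form_mu[symmetric]) (rule xy AD_form G)+
  also have "\<dots> = G (mult A (E x h) (E y k))" using x h by simp
  also have "\<dots> = A.dm G (\<lambda>a b. a (E x h) * b (E y k))"
    by (rule A.dm_eval[symmetric]) (use G x h in simp_all)
  also have "\<dots> = A.dm G (\<lambda>a b. ?\<gamma> (Theta a) (Theta b))"
    by (intro A.dm_cong G) (simp add: ev_Theta x h)
  also have "\<dots> = A.dm G (\<lambda>a b. tensor DS DS (Theta a) (Theta b)) ?\<gamma>"
    unfolding tl_apply tensor_apply[OF b] ..
  also have "\<dots> = tensor_lift DS DS (A.dm G (\<lambda>a b. tensor DS DS (Theta a) (Theta b))) ?\<gamma>"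
    by (rule tl_tensor_eval[OF is_space_DS in2 b])
  finally show "tensor_lift DS DS (comult DB (Theta G)) (\<lambda>a b. ev a (snd i) (fst i) * ev b (snd j) (fst j)) =
      tensor_lift DS DS (A.dm G (\<lambda>a b. tensor DS DS (Theta a) (Theta b))) (\<lambda>a b. ev a (snd i) (fst i) * ev b (snd j) (fst j))"
    by (simp add: i)
qed (rule F_in H.basis L.basis | assumption)+

lemma Theta_one: "one_el DB = Theta \<one>\<^bsub>dual A\<^esub>"
proof (rule DS_eqI)
  show "one_el DB \<in> carrier DS" unfolding dual_smash_bialg_sel by (rule lin)+
  fix h x assume hx: "h \<in> carrier H" "x \<in> carrier L"
  have "counit H (proj h) = lam h"
    using H.counit_right[OF hx(1) linear_lam] by (simp add: form_proj hx H.linear_counit mult.commute)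
  then show "ev (one_el DB) h x = ev (Theta \<one>\<^bsub>dual A\<^esub>) h x"
    using hx A.dual_one_in by (simp add: ev_F H.dual_one_in L.dual_one_in ev_Theta Eps_E L.counit_mult)
qed simp

lemma Theta_counit:
  assumes G: "G \<in> carrier AD"
  shows "counit DB (Theta G) = counit (dual A) G"
proof -
  have T: "Theta G \<in> carrier DS" by simp
  have "counit DB (Theta G) = (\<Sum>p\<leftarrow>dreps (Theta G). fst p (proj \<one>) * snd p (\<one>\<^sub>L \<star> u))"
    unfolding DB_counit
  proof (intro arg_cong[where f = sum_list] map_cong refl)
    fix p assume "p \<in> set (dreps (Theta G))"
    then have p: "form L (snd p)" using dreps(1)[OF T] dual_form by blast
    show "fst p \<one> * da (restrict0 H (counit H)) (snd p) \<one> = fst p (proj \<one>) * snd p (\<one>\<^sub>L \<star> u)"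
      using rho_counit_left[OF H.one_in p] by (simp add: da_apply cong: rs_cong)
  qed
  also have "\<dots> = ev (Theta G) \<one> \<one>\<^sub>L" by (rule ev_dreps[OF T, symmetric]) simp_all
  finally show ?thesis by (simp add: ev_Theta G)
qed

text \<open>The antipode of the dual smash product is an arbitrary one of the bialgebra.  One exists, since that
  of the dual is transported, and by uniqueness it is the transported one, so \<open>Theta\<close> preserves antipodes.\<close>

theorem dual_smash_iso: "dual A \<simeq>\<^sub>H dual_smash H L act \<rho>"
proof -
  interpret DA: hopf_alg "dual A" by unfold_locales (rule A.dual_is_hopf)
  let ?Y = "dual_smash H L act \<rho>"
  let ?T = "\<lambda>b. Theta (antipode (dual A) (inv_into (carrier (dual A)) Theta b))"
  have sel: "carrier ?Y = carrier DB" "scale ?Y = scale DB" "mult ?Y = mult DB" "one_el ?Y = one_el DB"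
    "comult ?Y = comult DB" "counit ?Y = counit DB" "antipode ?Y = (SOME S. is_antipode DB S)"
    by (simp_all add: dual_smash_def Let_def bialg.defs hopf.defs)
  have Y: "is_space ?Y" using is_space_DS by (simp add: is_space_def sel DS_sel(2))
  have l: "linear_map (dual A) ?Y Theta"
    using linear_Theta by (simp add: linear_map_def sel DS_sel(2))
  have bij: "bij_betw Theta (carrier (dual A)) (carrier ?Y)"
    using bij_Theta by (simp add: sel)
  have t: "tensor ?Y ?Y = tensor DS DS"
    by (rule tensor_cong_space) (simp_all add: sel DS_sel(2))
  have mult: "mult ?Y (Theta a) (Theta b) = Theta (mult (dual A) a b)"
    if "a \<in> carrier (dual A)" "b \<in> carrier (dual A)" for a b
    using that by (simp add: sel Theta_mult)
  have one: "\<one>\<^bsub>?Y\<^esub> = Theta \<one>\<^bsub>dual A\<^esub>" unfolding sel by (rule Theta_one)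
  have comult: "comult ?Y (Theta a) = sm (dual A) a (\<lambda>a1 a2. tensor ?Y ?Y (Theta a1) (Theta a2))"
    if "a \<in> carrier (dual A)" for a
    unfolding sel t by (rule Theta_comult) (use that in simp)
  have counit: "counit ?Y (Theta a) = counit (dual A) a" if "a \<in> carrier (dual A)" for a
    unfolding sel by (rule Theta_counit) (use that in simp)
  note tr = DA.transport[OF Y l bij mult one comult counit]
  have cong: "is_antipode DB S \<longleftrightarrow> is_antipode ?Y S" for S
    by (rule is_antipode_cong) (simp_all add: sel)
  have "is_antipode DB (SOME S. is_antipode DB S)"
    by (rule someI[where x = ?T]) (unfold cong, rule tr(2))
  then have anti: "is_antipode ?Y (antipode ?Y)" by (simp only: sel(7) cong)
  have hopf: "is_hopf_algebra ?Y" using tr(1) anti by (simp add: is_hopf_algebra_def)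
  interpret Y: hopf_alg ?Y by unfold_locales (rule hopf)
  have "Theta (antipode (dual A) a) = antipode ?Y (Theta a)" if a: "a \<in> carrier (dual A)" for a
  proof -
    have "Theta a \<in> carrier ?Y" using linear_map_in[OF l a] .
    from Y.antipode_unique[OF tr(2) this] show ?thesis
      using bij a by (simp add: bij_betw_def inv_into_f_f del: dual_sel)
  qed
  then have "hopf_iso (dual A) ?Y Theta"
    unfolding hopf_iso_def sm_sw using l bij mult one comult counit by metis
  with A.dual_is_hopf hopf show ?thesis by (auto simp: hopf_isomorphic_def)
qed

end

theorem theorem4p14:
  fixes H :: "('k::field, 'h::ab_group_add) hopf"
    and L :: "('k, 'l::ab_group_add) hopf"
    and act :: "'h \<Rightarrow> 'l \<Rightarrow> 'l"
    and \<rho> :: "'h \<Rightarrow> ('k, 'h, 'l) tensor"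
  assumes "is_hopf_algebra H" and "finite_dimensional H"
    and "is_hopf_algebra L" and "finite_dimensional L"
    and "partial_matched_pair H L act \<rho>"
    and "quasi_abelian H L act \<rho>"
    and "\<And>h. h \<in> carrier H \<Longrightarrow>
      tensor_lift H L (\<rho> h) (\<lambda>h0 h1. act h0 \<one>\<^bsub>L\<^esub> \<otimes>\<^bsub>L,L\<^esub> antipode L h1) =
      tensor_lift H L (\<rho> \<one>\<^bsub>H\<^esub>) (\<lambda>u0 u1.
        scale L (counit H u0 * counit L (act h \<one>\<^bsub>L\<^esub>)) \<one>\<^bsub>L\<^esub> \<otimes>\<^bsub>L,L\<^esub> u1)"
    and "\<And>h g. h \<in> carrier H \<Longrightarrow> g \<in> carrier H \<Longrightarrow>
      tensor_lift H L (\<rho> h) (\<lambda>h0 h1. scale L (counit H h0) (act (antipode H g) h1)) =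
      tensor_lift H L (\<rho> \<one>\<^bsub>H\<^esub>) (\<lambda>u0 u1.
        scale L (counit L (act g \<one>\<^bsub>L\<^esub>) * counit H h * counit H u0) u1)"
  shows "dual (smash H L act \<rho>) \<simeq>\<^sub>H dual_smash H L act \<rho>"
proof -
  interpret matched_pair H L act \<rho>
    by unfold_locales (rule assms; assumption)+
  show ?thesis by (rule dual_smash_iso)
qed

end
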